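(* Let $K$ be an algebraically closed field of characteristic zero and let $C$ be a singular reduced plane algebroid curve over $K$. Then $\mu(C)=(d(C)m(C)-1)(m(C)-1)$ if and only if $C$ is an Eggers singularity.
   Context: An algebroid curve $C:\{f=0\}$ is the ideal of $K[[x,y]]$ generated by a nonzero power series $f$ without constant term; its multiplicity is $m(C)=\mathrm{ord}\, f$, and $C$ is singular if $m(C)>1$, smooth if $m(C)=1$. $C$ is reduced if $f$ has no multiple factors; $C$ is a branch if $f$ is irreducible. The branches of a reduced curve $C:\{f=0\}$ are the curves defined by the irreducible factors of $f$; $r(C)$ is their number. For $C:\{f=0\}$, $D:\{g=0\}$ put $(C,D)_0=\dim_K K[[x,y]]/(f,g)$ (possibly $+\infty$). For branches $C,D$ put $d(C,D)=\frac{(C,D)_0}{m(C)m(D)}$; for reduced curves $C,D$ with branches $C_i,D_j$ put $d(C,D)=\inf_{i,j}\{d(C_i,D_j)\}$. The contact exponent of a reduced curve $C$ is $d(C):=\sup\{d(C,W): W \text{ a smooth branch}\}$. Milnor number: for a reduced curve $C:\{f=0\}$ let $\mathcal{O}_C=K[[x,y]]/(f)$, let $\overline{\mathcal{O}}_C$ be its integral closure (in its total ring of fractions), let $\mathcal{C}$ be the conductor of $\overline{\mathcal{O}}_C$ in $\mathcal{O}_C$, and $c(C)=\dim_K\overline{\mathcal{O}}_C/\mathcal{C}$. Then $\mu(C):=c(C)-r(C)+1$. (In characteristic zero, $\mu(C)=\dim_K K[[x,y]]/(\partial f/\partial x,\partial f/\partial y)$.) Polar invariants: a generic polar $P(C)$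 of $C:\{f=0\}$ is the curve $\{a\,\partial f/\partial x+b\,\partial f/\partial y=0\}$ for generic $(a:b)\in\mathbb{P}^1(K)$; it is reduced of multiplicity $m(C)-1$. Let $P(C)=\bigcup_{j=1}^s D_j$ be its decomposition into branches. The set of polar invariants of $C$ is $\mathcal{Q}(C)=\left\{\frac{(C,D_j)_0}{m(D_j)}: j\in\{1,\ldots,s\}\right\}$; it does not depend on the choice of generic polar (polar invariants are equisingularity invariants of $C$). $C$ is an Eggers singularity if $\mathcal{Q}(C)$ has exactly one element. *)

theory Defs
  imports
    "HOL-Algebra.Algebra"
    "HOL-Algebra.Algebraic_Closure_Type"
    "HOL-Computational_Algebra.Computational_Algebra"
    "HOL-Library.Extended_Real"
begin

text \<open>
  Throughout, $K[[x,y]]$ is the type \<open>'k fps fps\<close>: the coefficient of $x^i y^j$ in \<open>f\<close> is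
  \<open>f $ i $ j\<close>. A curve is given by an equation \<open>f\<close>, and \<open>f\<close>, \<open>g\<close> define the same curve iff they
  generate the same ideal.
\<close>

section \<open>Total ring of fractions, integral closure, conductor\<close>

definition nonzerodivisors :: "('a, 'b) ring_scheme \<Rightarrow> 'a set" where
  "nonzerodivisors R =
     {s \<in> carrier R. \<forall>a\<in>carrier R. a \<otimes>\<^bsub>R\<^esub> s = \<zero>\<^bsub>R\<^esub> \<longrightarrow> a = \<zero>\<^bsub>R\<^esub>}"

text \<open>The class of the pair \<open>(a, s)\<close>. As only non-zero-divisors occur as denominators,
  no auxiliary factor is needed in the equivalence of fractions.\<close>

definition fraction :: "('a, 'b) ring_scheme \<Rightarrow> 'a \<Rightarrow> 'a \<Rightarrow> ('a \<times> 'a) set" where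
  "fraction R a s =
     {(b, t). b \<in> carrier R \<and> t \<in> nonzerodivisors R \<and> a \<otimes>\<^bsub>R\<^esub> t = b \<otimes>\<^bsub>R\<^esub> s}"

definition total_fraction_ring :: "('a, 'b) ring_scheme \<Rightarrow> ('a \<times> 'a) set ring" where
  "total_fraction_ring R =
     \<lparr>carrier = {fraction R a s | a s. a \<in> carrier R \<and> s \<in> nonzerodivisors R},
      monoid.mult = (\<lambda>U V. \<Union>(a, s)\<in>U. \<Union>(b, t)\<in>V. fraction R (a \<otimes>\<^bsub>R\<^esub> b) (s \<otimes>\<^bsub>R\<^esub> t)),
      one = fraction R \<one>\<^bsub>R\<^esub> \<one>\<^bsub>R\<^esub>,
      ring.zero = fraction R \<zero>\<^bsub>R\<^esub> \<one>\<^bsub>R\<^esub>,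
      add = (\<lambda>U V. \<Union>(a, s)\<in>U. \<Union>(b, t)\<in>V.
               fraction R (a \<otimes>\<^bsub>R\<^esub> t \<oplus>\<^bsub>R\<^esub> b \<otimes>\<^bsub>R\<^esub> s) (s \<otimes>\<^bsub>R\<^esub> t))\<rparr>"

definition to_fraction :: "('a, 'b) ring_scheme \<Rightarrow> 'a \<Rightarrow> ('a \<times> 'a) set" where
  "to_fraction R a = fraction R a \<one>\<^bsub>R\<^esub>"

text \<open>Polynomials are lists of coefficients with the leading coefficient first, so \<open>hd p = \<one>\<close>
  says that \<open>p\<close> is monic.\<close>

definition integral_closure_in :: "('a, 'b) ring_scheme \<Rightarrow> 'a set \<Rightarrow> 'a set" where
  "integral_closure_in R A =
     {x \<in> carrier R. \<exists>p. polynomial\<^bsub>R\<^esub> A p \<and> p \<noteq> [] \<and> hd p = \<one>\<^bsub>R\<^esub> \<and> ring.eval R p x = \<zero>\<^bsub>R\<^esub>}"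

definition conductor_in :: "('a, 'b) ring_scheme \<Rightarrow> 'a set \<Rightarrow> 'a set \<Rightarrow> 'a set" where
  "conductor_in R B A = {a \<in> B. \<forall>b\<in>B. a \<otimes>\<^bsub>R\<^esub> b \<in> A}"

text \<open>The dimension of \<open>R/I\<close> over (the image of) the field \<open>k \<subseteq> R\<close>.\<close>

definition quotient_dim :: "('a, 'b) ring_scheme \<Rightarrow> 'a set \<Rightarrow> 'a set \<Rightarrow> enat" where
  "quotient_dim R k I =
     (let Q = R Quot I; k' = (\<lambda>c. I +>\<^bsub>R\<^esub> c) ` k
      in if ring.finite_dimension Q k' (carrier Q) then enat (ring.dim Q k' (carrier Q)) else \<infinity>)"


section \<open>Plane algebroid curves\<close>

abbreviation power_series_ring :: "'k::Fields.field fps fps ring" where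
  "power_series_ring \<equiv> ring_of_type_algebra"

definition constants :: "'k::Fields.field fps fps set" where
  "constants = range (\<lambda>c. fps_const (fps_const c))"

definition algebroid_curve :: "'k::Fields.field fps fps \<Rightarrow> bool" where
  "algebroid_curve f \<longleftrightarrow> f \<noteq> 0 \<and> f $ 0 $ 0 = 0"

definition multiplicity_of :: "'k::Fields.field fps fps \<Rightarrow> nat" where
  "multiplicity_of f = (LEAST n. \<exists>i j. i + j = n \<and> f $ i $ j \<noteq> 0)"

definition singular_curve :: "'k::Fields.field fps fps \<Rightarrow> bool" where
  "singular_curve f \<longleftrightarrow> algebroid_curve f \<and> multiplicity_of f > 1"

definition smooth_curve :: "'k::Fields.field fps fps \<Rightarrow> bool" where
  "smooth_curve f \<longleftrightarrow> algebroid_curve f \<and> multiplicity_of f = 1"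

definition reduced_curve :: "'k::Fields.field fps fps \<Rightarrow> bool" where
  "reduced_curve f \<longleftrightarrow> algebroid_curve f \<and> squarefree f"

definition is_branch :: "'k::Fields.field fps fps \<Rightarrow> bool" where
  "is_branch f \<longleftrightarrow> algebroid_curve f \<and> comm_semiring_1_class.irreducible f"

text \<open>All equations of all branches of \<open>f\<close>; each branch has many equations, differing by units.\<close>

definition branches :: "'k::Fields.field fps fps \<Rightarrow> 'k fps fps set" where
  "branches f = {g. is_branch g \<and> g dvd f}"

definition num_branches :: "'k::Fields.field fps fps \<Rightarrow> nat" where
  "num_branches f = card ((\<lambda>g. PIdl\<^bsub>power_series_ring\<^esub> g) ` branches f)"

definition intersection_number :: "'k::Fields.field fps fps \<Rightarrow> 'k fps fps \<Rightarrow> enat" where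
  "intersection_number f g =
     quotient_dim power_series_ring constants (Idl\<^bsub>power_series_ring\<^esub> {f, g})"


section \<open>Contact exponent\<close>

definition branch_contact :: "'k::Fields.field fps fps \<Rightarrow> 'k fps fps \<Rightarrow> ereal" where
  "branch_contact f g =
     ereal_of_enat (intersection_number f g) / ereal (real (multiplicity_of f * multiplicity_of g))"

definition contact :: "'k::Fields.field fps fps \<Rightarrow> 'k fps fps \<Rightarrow> ereal" where
  "contact f g = (INF f'\<in>branches f. INF g'\<in>branches g. branch_contact f' g')"

definition contact_exponent :: "'k::Fields.field fps fps \<Rightarrow> ereal" where
  "contact_exponent f = (SUP w\<in>{w. is_branch w \<and> smooth_curve w}. contact f w)"


section \<open>Milnor number\<close>

definition local_ring :: "'k::Fields.field fps fps \<Rightarrow> 'k fps fps set ring" where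
  "local_ring f = power_series_ring Quot (PIdl\<^bsub>power_series_ring\<^esub> f)"

definition conductor_dim :: "'k::Fields.field fps fps \<Rightarrow> enat" where
  "conductor_dim f =
     (let R = power_series_ring;
          OC = local_ring f;
          Q = total_fraction_ring OC;
          A = to_fraction OC ` carrier OC;
          B = integral_closure_in Q A;
          k = (\<lambda>c. to_fraction OC (PIdl\<^bsub>R\<^esub> f +>\<^bsub>R\<^esub> c)) ` constants
      in quotient_dim (Q\<lparr>carrier := B\<rparr>) k (conductor_in Q B A))"

definition milnor_number :: "'k::Fields.field fps fps \<Rightarrow> ereal" where
  "milnor_number f = ereal_of_enat (conductor_dim f) - ereal (real (num_branches f)) + 1"


section \<open>Polar invariants\<close>

definition partial_x :: "'k::Fields.field fps fps \<Rightarrow> 'k fps fps" where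
  "partial_x f = fps_deriv f"

definition partial_y :: "'k::Fields.field fps fps \<Rightarrow> 'k fps fps" where
  "partial_y f = Abs_fps (\<lambda>i. fps_deriv (f $ i))"

definition polar :: "'k::Fields.field fps fps \<Rightarrow> 'k \<Rightarrow> 'k \<Rightarrow> 'k fps fps" where
  "polar f a b =
     fps_const (fps_const a) * partial_x f + fps_const (fps_const b) * partial_y f"

text \<open>\<open>P a b\<close> for generic \<open>(a:b)\<close> in the projective line: a non-empty Zariski open subset of the
  projective line is the complement of a finite set. Points are represented as lines through the
  origin.\<close>

definition generically :: "('k::Fields.field \<Rightarrow> 'k \<Rightarrow> bool) \<Rightarrow> bool" where
  "generically P \<longleftrightarrow>
     finite {range (\<lambda>t. (t * a, t * b)) | a b. (a, b) \<noteq> (0, 0) \<and> \<not> P a b}"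

definition polar_invariants :: "'k::Fields.field fps fps \<Rightarrow> 'k \<Rightarrow> 'k \<Rightarrow> ereal set" where
  "polar_invariants f a b =
     (\<lambda>g. ereal_of_enat (intersection_number f g) / ereal (real (multiplicity_of g)))
       ` branches (polar f a b)"

text \<open>For reduced \<open>f\<close> over an algebraically closed field of characteristic zero the set of polar
  invariants is the same for all generic \<open>(a:b)\<close>, so this says that this common set has exactly one
  element.\<close>

definition eggers_singularity :: "'k::Fields.field fps fps \<Rightarrow> bool" where
  "eggers_singularity f \<longleftrightarrow> generically (\<lambda>a b. \<exists>q. polar_invariants f a b = {q})"

end

theory Submission
  imports Defs "HOL-Library.Function_Algebras"
begin

text \<open>Choose a direction \<open>(a : 1)\<close> that is not tangent to \<open>C\<close>. After the shear \<open>x \<mapsto> x + a y\<close> the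
  equation \<open>F\<close> is regular in \<open>y\<close> of order \<open>m = m(C)\<close> and the polar is \<open>\<partial>F/\<partial>y\<close>, regular of order \<open>m - 1\<close>.
  By Weierstrass and Puiseux both split over \<open>K[[t]]\<close>, \<open>x = t\<^sup>N\<close>; the group generated by
  \<open>t \<mapsto> \<zeta> t\<close> permutes the roots, and its orbits are the branches.

  Put \<open>D = \<Sum> ord F\<^sub>y(\<alpha>)\<close>, summed over the roots \<open>\<alpha>\<close> of \<open>F\<close>. Lagrange interpolation
  identifies the conductor with \<open>F\<^sub>y\<close> times the inverse different of the normalization (Dedekind),
  so \<open>N (\<mu> + m - 1) = D\<close>, and \<open>D\<close> is also the sum of \<open>ord F(z)\<close> over the roots \<open>z\<close> of the polar. Let
  \<open>\<theta>\<close> be the minimal order of a difference of two roots of \<open>F\<close>. The contact exponent is \<open>\<theta>/N\<close>, attained by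
  the mean of the roots (Tschirnhausen transformation). Every root \<open>z\<close> of the polar satisfies
  \<open>ord F(z) \<ge> m \<theta>\<close>, and equality occurs: the polynomial formed by the coefficients of \<open>t\<^sup>\<theta>\<close>
  in the roots has a critical point that is not one of its zeros. Hence all polar quotients agree iff
  \<open>D = (m - 1) m \<theta>\<close>, which is the formula for \<open>\<mu>\<close>.\<close>

text \<open>All invariants are brought into one ring K[[t]], with N common to the curve and its
  polar. An orbit is as long as its branch has multiplicity, so dividing by the multiplicity turns
  orders along any branch into orders in t over N. The definitions, however, speak of dimensions of
  quotient rings and of a total ring of fractions. They are reached by evaluation at the roots: the
  local ring embeds into a product of copies of K[[t]], its normalization consists of the
  equivariant families of series, and dimensions are lengths of chains of subspaces. The different
  enters from two sides. A \<sigma>-invariant series without constant term is divisible by t^N,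
  which bounds the conductor from below; a trace multiplies an invariant leading term by the orbit
  length, nonzero in characteristic zero, which bounds it from above. The two formulas for D count
  the orders of \<alpha> - z over the same pairs, as in the symmetry of the resultant. The
  equivalence is proved for each direction (a : 1) off the tangent cone separately. Its Milnor side
  does not mention a, so genericity becomes a matter of counting lines.\<close>

section \<open>Codimension by chains of lines\<close>

locale codim_space = vector_space
begin

definition line_ext :: "'b set \<Rightarrow> 'b \<Rightarrow> 'b set" where
  "line_ext E v = {e + scale c v | e c. e \<in> E}"

text \<open>\<open>codim I n E\<close> says \<open>dim E/I = n\<close>, witnessed by a chain of one-dimensional extensions.\<close>

inductive codim :: "'b set \<Rightarrow> nat \<Rightarrow> 'b set \<Rightarrow> bool" for I where
  codim_refl: "codim I 0 I"
| codim_step: "codim I n E \<Longrightarrow> v \<notin> E \<Longrightarrow> codim I (Suc n) (line_ext E v)"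

lemma line_extI: "e \<in> E \<Longrightarrow> u = e + scale c v \<Longrightarrow> u \<in> line_ext E v"
  by (auto simp: line_ext_def)

lemma line_extE: "u \<in> line_ext E v \<Longrightarrow> (\<And>e c. e \<in> E \<Longrightarrow> u = e + scale c v \<Longrightarrow> P) \<Longrightarrow> P"
  by (auto simp: line_ext_def)

lemma subset_line_ext: "E \<subseteq> line_ext E v"
  by (auto intro!: line_extI[where c = 0])

lemma mem_line_ext: "subspace E \<Longrightarrow> v \<in> line_ext E v"
  by (auto intro!: line_extI[where c = 1 and e = 0] simp: subspace_0)

lemma subspace_line_ext:
  assumes "subspace E" shows "subspace (line_ext E v)"
proof (rule subspaceI)
  show "0 \<in> line_ext E v"
    using subspace_0[OF assms] subset_line_ext by auto
next
  fix x y assume "x \<in> line_ext E v" "y \<in> line_ext E v"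
  then obtain e c e' c' where "e \<in> E" "e' \<in> E" "x = e + scale c v" "y = e' + scale c' v"
    by (meson line_extE)
  then show "x + y \<in> line_ext E v"
    by (intro line_extI[of "e + e'" _ _ "c + c'"])
       (auto simp: subspace_add[OF assms] algebra_simps)
next
  fix k x assume "x \<in> line_ext E v"
  then obtain e c where "e \<in> E" "x = e + scale c v" by (meson line_extE)
  then show "scale k x \<in> line_ext E v"
    by (intro line_extI[of "scale k e" _ _ "k * c"])
       (auto simp: subspace_scale[OF assms] algebra_simps)
qed

lemma line_ext_least:
  assumes "subspace F" "E \<subseteq> F" "v \<in> F" shows "line_ext E v \<subseteq> F"
  using assms by (auto simp: line_ext_def intro!: subspace_add subspace_scale)

lemma subspace_codim: "codim I n E \<Longrightarrow> subspace I \<Longrightarrow> subspace E"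
  by (induction rule: codim.induct) (auto intro: subspace_line_ext)

lemma codim_subset: "codim I n E \<Longrightarrow> I \<subseteq> E"
  by (induction rule: codim.induct) (use subset_line_ext in blast)+

lemma codim_trans:
  assumes "codim E k F" "codim I n E" shows "codim I (n + k) F"
  using assms by (induction rule: codim.induct) (auto intro: codim_step)

lemma codim_1: "v \<notin> E \<Longrightarrow> codim E 1 (line_ext E v)"
  using codim_step[OF codim_refl] by auto

text \<open>Exchange property: w has a nonzero coefficient at v because it lies outside E, so v can
  be solved for.\<close>

lemma line_ext_absorb:
  assumes "subspace E" "w \<in> line_ext E v" "w \<notin> E"
  shows "line_ext E w = line_ext E v"
proof -
  from assms(2) obtain e c where e: "e \<in> E" "w = e + scale c v" by (meson line_extE)
  then have c: "c \<noteq> 0" using assms(3) by auto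
  have "v = scale (- inverse c) e + scale (inverse c) w"
    using c e by (simp add: algebra_simps)
  then have "v \<in> line_ext E w"
    using e(1) by (intro line_extI[of "scale (- inverse c) e"]) (intro subspace_scale assms(1))
  then show ?thesis
    using assms e
    by (intro equalityI line_ext_least subspace_line_ext subset_line_ext) auto
qed

lemma line_ext_commute: "line_ext (line_ext E v) w = line_ext (line_ext E w) v"
proof -
  have "line_ext (line_ext E v) w \<subseteq> line_ext (line_ext E w) v" for v w
  proof
    fix u assume "u \<in> line_ext (line_ext E v) w"
    then obtain e c d where "e \<in> E" "u = (e + scale c v) + scale d w"
      by (auto simp: line_ext_def)
    then show "u \<in> line_ext (line_ext E w) v"
      by (intro line_extI[of "e + scale d w" _ _ c] line_extI[of e _ _ d]) (auto simp: algebra_simps)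
  qed
  then show ?thesis by blast
qed

text \<open>Since e avoids even the top space F, adding it to every member of the chain keeps each
  step proper.\<close>

lemma codim_add_vector:
  assumes "codim A j F" "subspace A" "e \<notin> F"
  shows "codim (line_ext A e) j (line_ext F e)"
  using assms
proof (induction rule: codim.induct)
  case codim_refl
  then show ?case by (intro codim.codim_refl)
next
  case (codim_step n E v)
  have E: "subspace E" using codim_step subspace_codim by blast
  have e: "e \<notin> E" using codim_step.prems subset_line_ext by blast
  have "v \<notin> line_ext E e"
  proof
    assume "v \<in> line_ext E e"
    then have "line_ext E v = line_ext E e"
      using line_ext_absorb[OF E] codim_step by blast
    then show False using mem_line_ext[OF E, of e] codim_step.prems by auto
  qed
  then have "codim (line_ext A e) (Suc n) (line_ext (line_ext E e) v)"
    using codim_step e by (intro codim.codim_step) auto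
  then show ?case by (simp add: line_ext_commute)
qed

text \<open>The chain from I to F is intersected with E. At each step the intersection either stays,
  and the step counts for the part above E, or grows by one line. This passes finite codimension on
  to any subspace in between.\<close>

lemma codim_split:
  assumes "codim I n F" "subspace I" "subspace E" "I \<subseteq> E" "E \<subseteq> F"
  shows "\<exists>k\<le>n. codim I k E \<and> codim E (n - k) F"
  using assms
proof (induction arbitrary: E rule: codim.induct)
  case codim_refl
  then show ?case by (auto intro: codim.codim_refl)
next
  case (codim_step n F v E)
  have F: "subspace F" using codim_step subspace_codim by blast
  have "I \<subseteq> F" using codim_step codim_subset by blast
  with codim_step.IH[of "E \<inter> F"] codim_step.prems F
  obtain k where k: "k \<le> n" "codim I k (E \<inter> F)" "codim (E \<inter> F) (n - k) F"
    by (auto intro: subspace_inter)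
  show ?case
  proof (cases "E \<subseteq> F")
    case True
    then have "E \<inter> F = E" by auto
    with k have "codim I k E" "codim E (Suc (n - k)) (line_ext F v)"
      using codim_step.hyps by (auto intro: codim.codim_step)
    with k(1) show ?thesis by (intro exI[of _ k]) (auto simp: Suc_diff_le)
  next
    case False
    then obtain e where e: "e \<in> E" "e \<notin> F" by auto
    then have Fe: "line_ext F e = line_ext F v"
      using line_ext_absorb[OF F] codim_step.prems by blast
    \<comment> \<open>Modular law: as e is in E, the F-part of any element of E lies in E as
      well.\<close>
    have "line_ext (E \<inter> F) e = E"
    proof (intro equalityI line_ext_least)
      show "E \<subseteq> line_ext (E \<inter> F) e"
      proof
        fix u assume u: "u \<in> E"
        then have "u \<in> line_ext F e" using Fe codim_step.prems by auto
        then obtain g c where g: "g \<in> F" "u = g + scale c e" by (meson line_extE)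
        then have "g = u - scale c e" by simp
        then have "g \<in> E" using u e codim_step.prems by (auto intro: subspace_diff subspace_scale)
        then show "u \<in> line_ext (E \<inter> F) e" using g by (auto intro: line_extI)
      qed
    qed (use codim_step e in auto)
    moreover have "codim (line_ext (E \<inter> F) e) (n - k) (line_ext F e)"
      using k e F codim_step.prems by (intro codim_add_vector) (auto intro: subspace_inter)
    moreover have "codim I (Suc k) (line_ext (E \<inter> F) e)"
      using k e by (intro codim.codim_step) auto
    ultimately show ?thesis using k(1) Fe by (intro exI[of _ "Suc k"]) auto
  qed
qed

lemma codim_self: assumes "codim I n I" "subspace I" shows "n = 0"
proof (cases n)
  case (Suc k)
  with assms obtain E v where "codim I k E" "v \<notin> E" "I = line_ext E v"
    by (auto elim: codim.cases)
  moreover have "I \<subseteq> E" "subspace E" using calculation codim_subset assms subspace_codim by auto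
  ultimately show ?thesis using mem_line_ext by blast
qed auto

lemma codim_line_ext:
  assumes "codim F k (line_ext F v)" "subspace F" "v \<notin> F" shows "k = 1"
proof (cases k)
  case 0
  then show ?thesis using assms mem_line_ext by (auto elim: codim.cases)
next
  case (Suc j)
  with assms obtain E u where E: "codim F j E" "u \<notin> E" "line_ext F v = line_ext E u"
    by (auto elim: codim.cases)
  show ?thesis
  proof (cases "E = F")
    case True
    then show ?thesis using codim_self E Suc assms by auto
  next
    case False
    then obtain w where w: "w \<in> E" "w \<notin> F" using codim_subset[OF E(1)] by auto
    have "E \<subseteq> line_ext F v" using E subset_line_ext by auto
    then have "line_ext F w = line_ext F v" using line_ext_absorb assms w by blast
    moreover have "line_ext F w \<subseteq> E"
      using E assms w by (intro line_ext_least codim_subset) (auto intro: subspace_codim)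
    ultimately have "u \<in> E"
      using E mem_line_ext[of E u] subspace_codim[OF E(1) assms(2)] by auto
    then show ?thesis using E by auto
  qed
qed

text \<open>The second chain is cut at the last but one member of the first; the piece above has
  length 1 by \<open>codim_line_ext\<close>, the piece below is settled by induction.\<close>

lemma codim_unique:
  assumes "codim I n F" "codim I k F" "subspace I" shows "n = k"
  using assms
proof (induction arbitrary: k rule: codim.induct)
  case codim_refl
  then show ?case using codim_self by auto
next
  case (codim_step n F v k)
  have F: "subspace F" "I \<subseteq> F" using codim_step subspace_codim codim_subset by auto
  obtain j where j: "j \<le> k" "codim I j F" "codim F (k - j) (line_ext F v)"
    using codim_split[OF codim_step.prems F] subset_line_ext by blast
  then have "n = j" "k - j = 1"
    using codim_step F codim_line_ext by auto
  with j show ?case by auto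
qed

lemma codim_image:
  assumes "codim I n E" "inj g" "\<And>u v. g (u + v) = g u + g v" "\<And>c v. g (scale c v) = scale c (g v)"
  shows "codim (g ` I) n (g ` E)"
  using assms(1)
proof (induction rule: codim.induct)
  case codim_refl
  then show ?case by (rule codim.codim_refl)
next
  case (codim_step n E v)
  have "g ` line_ext E v = line_ext (g ` E) (g v)"
  proof (intro equalityI subsetI)
    fix u assume "u \<in> line_ext (g ` E) (g v)"
    then obtain e c where e: "e \<in> E" "u = g e + scale c (g v)" by (auto simp: line_ext_def)
    then have "u = g (e + scale c v)" by (simp add: assms)
    then show "u \<in> g ` line_ext E v" using e by (auto intro: line_extI)
  next
    fix u assume "u \<in> g ` line_ext E v"
    then show "u \<in> line_ext (g ` E) (g v)"
      by (auto simp: assms elim!: line_extE intro!: line_extI)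
  qed
  moreover have "g v \<notin> g ` E" using codim_step assms(2) by (simp add: inj_image_mem_iff)
  ultimately show ?case using codim_step by (auto intro: codim.codim_step)
qed

text \<open>The dual vectors make the functionals independent: each new functional reduces the
  common kernel by exactly the line of its dual vector. The filtration by order and the conductor
  are both measured this way.\<close>

lemma codim_functionals:
  assumes "finite J" "subspace F"
    and add: "\<And>j u v. j \<in> J \<Longrightarrow> u \<in> F \<Longrightarrow> v \<in> F \<Longrightarrow> l j (u + v) = l j u + l j v"
    and scl: "\<And>j c v. j \<in> J \<Longrightarrow> v \<in> F \<Longrightarrow> l j (scale c v) = c * l j v"
    and dual: "\<And>j. j \<in> J \<Longrightarrow> \<exists>e\<in>F. l j e = 1 \<and> (\<forall>i\<in>J-{j}. l i e = 0)"
  shows "codim {v\<in>F. \<forall>j\<in>J. l j v = 0} (card J) F"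
  using assms
proof (induction J)
  case empty
  then show ?case by (simp add: codim_refl)
next
  case (insert j J)
  let ?I = "{v\<in>F. \<forall>i\<in>J. l i v = 0}" and ?I' = "{v\<in>F. \<forall>i\<in>insert j J. l i v = 0}"
  have F: "subspace F" by fact
  have IH: "codim ?I (card J) F"
  proof (rule insert.IH[OF F])
    fix i assume "i \<in> J"
    then show "\<exists>e\<in>F. l i e = 1 \<and> (\<forall>i'\<in>J-{i}. l i' e = 0)"
      using insert.prems(4)[of i] by auto
  qed (use insert.prems in auto)
  obtain e where e: "e \<in> F" "l j e = 1" "\<forall>i\<in>J. l i e = 0"
    using insert.prems(4)[of j] insert.hyps by auto
  have "?I = line_ext ?I' e"
  proof (intro equalityI subsetI)
    fix u assume u: "u \<in> ?I"
    have m: "scale (- l j u) e \<in> F" by (intro subspace_scale F e)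
    then have "u + scale (- l j u) e \<in> ?I'"
      using u e insert.prems(2)[of _ u "scale (- l j u) e"] insert.prems(3)[of _ e "- l j u"]
        subspace_add[OF F _ m, of u] by (auto simp del: scale_minus_left)
    then show "u \<in> line_ext ?I' e"
      by (rule line_extI[of _ _ _ "l j u"]) (simp add: algebra_simps)
  next
    fix u assume "u \<in> line_ext ?I' e"
    then obtain w c where w: "w \<in> ?I'" "u = w + scale c e" by (meson line_extE)
    have "scale c e \<in> F" using e F by (auto intro: subspace_scale)
    then show "u \<in> ?I"
      using w e insert.prems(2)[of _ w "scale c e"] insert.prems(3)[of _ e c] F
      by (auto intro: subspace_add)
  qed
  moreover have "codim ?I' 1 (line_ext ?I' e)" using e by (intro codim_1) auto
  ultimately have "codim ?I' 1 ?I" by (simp only:)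
  from codim_trans[OF IH this] show ?case using insert.hyps by simp
qed

text \<open>\<Theta> only has to identify R/I with its image modulo W. A chain of lines from W to
  the image then lifts to a chain of line extensions in the quotient ring, which is how the
  algebraic dimension counts. The field inside R enters through its parametrization
  \<kappa>.\<close>

lemma quotient_dim_eq_codim:
  fixes R :: "('r, 'm) ring_scheme" (structure) and \<Theta> :: "'r \<Rightarrow> 'b" and \<kappa> :: "'a \<Rightarrow> 'r"
  assumes R: "ring R" and I: "ideal I R" and one: "\<one> \<notin> I" and k: "subfield (range \<kappa>) R"
    and add: "\<And>x y. x \<in> carrier R \<Longrightarrow> y \<in> carrier R \<Longrightarrow> \<Theta> (x \<oplus> y) = \<Theta> x + \<Theta> y"
    and scl: "\<And>x c. x \<in> carrier R \<Longrightarrow> \<Theta> (\<kappa> c \<otimes> x) = scale c (\<Theta> x)"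
    and W: "subspace W" "I = {x\<in>carrier R. \<Theta> x \<in> W}"
    and dim: "codim W n (\<Theta> ` carrier R)"
  shows "quotient_dim R (range \<kappa>) I = enat n"
proof -
  interpret R: ring R by fact
  interpret I: ideal I R by fact
  let ?Q = "R Quot I" and ?p = "\<lambda>x. I +> x"
  interpret h: ring_hom_ring R ?Q ?p by (rule I.rcos_ring_hom_ring)
  let ?k = "?p ` range \<kappa>"
  have kc: "\<kappa> c \<in> carrier R" for c using subfieldE(3)[OF k] by auto
  have zero: "\<zero>\<^bsub>?Q\<^esub> = I" unfolding FactRing_def by (simp only: ring.simps)
  have "\<one>\<^bsub>?Q\<^esub> \<noteq> \<zero>\<^bsub>?Q\<^esub>"
  proof
    assume "\<one>\<^bsub>?Q\<^esub> = \<zero>\<^bsub>?Q\<^esub>"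
    then have "I +> \<one> = I" unfolding FactRing_def by (simp only: ring.simps monoid.simps)
    then show False using one I.a_rcos_self[of \<one>] by auto
  qed
  then have sub: "subfield ?k ?Q" by (rule h.img_is_subfield(2)[OF k])
  have \<Theta>0: "\<Theta> \<zero> = 0" using add[of \<zero> \<zero>] by simp
  have \<Theta>neg: "\<Theta> (\<ominus> x) = - \<Theta> x" if "x \<in> carrier R" for x
    using add[of x "\<ominus> x"] that \<Theta>0 by (simp add: R.r_neg eq_neg_iff_add_eq_0 add.commute)
  have eqI: "?p x = ?p y \<longleftrightarrow> \<Theta> x - \<Theta> y \<in> W" if "x \<in> carrier R" "y \<in> carrier R" for x y
  proof -
    have "?p x = ?p y \<longleftrightarrow> x \<ominus> y \<in> I"
      using that R.quotient_eq_iff_same_a_r_cos[OF I] by auto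
    also have "\<dots> \<longleftrightarrow> \<Theta> x - \<Theta> y \<in> W"
    proof -
      have "\<Theta> (x \<ominus> y) = \<Theta> x - \<Theta> y"
        unfolding a_minus_def using that by (subst add) (simp_all add: \<Theta>neg)
      then show ?thesis using that by (subst W(2)) simp
    qed
    finally show ?thesis .
  qed
  have main: "E \<subseteq> \<Theta> ` carrier R \<Longrightarrow> h.S.dimension j ?k (?p ` {x\<in>carrier R. \<Theta> x \<in> E})"
    if "codim W j E" for j E
    using that
  proof (induction rule: codim.induct)
    case codim_refl
    have "?p ` {x\<in>carrier R. \<Theta> x \<in> W} = {\<zero>\<^bsub>?Q\<^esub>}"
    proof -
      have "?p ` I = (\<lambda>_. I) ` I" by (intro image_cong I.a_rcos_const) auto
      also have "\<dots> = {I}" by (rule image_constant[OF I.zero_closed])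
      finally show ?thesis unfolding zero W(2)[symmetric] .
    qed
    then show ?case by simp
  next
    case (codim_step n E v)
    have E: "subspace E" "W \<subseteq> E" using subspace_codim[OF codim_step.hyps(1) W(1)] codim_subset[OF codim_step.hyps(1)] by auto
    have Ev: "E \<subseteq> line_ext E v" "v \<in> line_ext E v"
      using subset_line_ext mem_line_ext E by auto
    have "v \<in> \<Theta> ` carrier R" using Ev(2) codim_step.prems by (rule rev_subsetD)
    then obtain r where r: "r \<in> carrier R" "v = \<Theta> r" by auto
    let ?E = "?p ` {x\<in>carrier R. \<Theta> x \<in> E}"
    have rE: "?p r \<notin> ?E"
    proof
      assume "?p r \<in> ?E"
      then obtain x where x: "x \<in> carrier R" "\<Theta> x \<in> E" "?p r = ?p x" by auto
      then have "\<Theta> r - \<Theta> x \<in> W" using eqI[OF r(1) x(1)] by simp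
      then have "\<Theta> r - \<Theta> x + \<Theta> x \<in> E" using E x by (intro subspace_add) auto
      then show False using codim_step r by simp
    qed
    have "h.S.line_extension ?k (?p r) ?E = ?p ` {x\<in>carrier R. \<Theta> x \<in> line_ext E v}"
    proof (intro equalityI subsetI)
      fix u assume "u \<in> h.S.line_extension ?k (?p r) ?E"
      then obtain c x where x: "x \<in> carrier R" "\<Theta> x \<in> E"
        "u = ?p (\<kappa> c) \<otimes>\<^bsub>?Q\<^esub> ?p r \<oplus>\<^bsub>?Q\<^esub> ?p x"
        unfolding h.S.line_extension_mem_iff by auto
      then have u: "u = ?p (\<kappa> c \<otimes> r \<oplus> x)" using r kc by simp
      have "\<Theta> (\<kappa> c \<otimes> r \<oplus> x) \<in> line_ext E v"
        using x r kc by (intro line_extI[of "\<Theta> x" _ _ c]) (auto simp: add scl add.commute)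
      then have "\<kappa> c \<otimes> r \<oplus> x \<in> {x\<in>carrier R. \<Theta> x \<in> line_ext E v}" using x(1) r(1) kc by simp
      then show "u \<in> ?p ` {x\<in>carrier R. \<Theta> x \<in> line_ext E v}" unfolding u by (rule imageI)
    next
      fix u assume "u \<in> ?p ` {x\<in>carrier R. \<Theta> x \<in> line_ext E v}"
      then obtain y where y: "y \<in> carrier R" "\<Theta> y \<in> line_ext E v" "u = ?p y" by auto
      then obtain e c where e: "e \<in> E" "\<Theta> y = e + scale c v" by (meson line_extE)
      moreover have "E \<subseteq> \<Theta> ` carrier R" using Ev(1) codim_step.prems by (rule subset_trans)
      ultimately obtain x where x: "x \<in> carrier R" "e = \<Theta> x" by auto
      have "u = ?p (\<kappa> c \<otimes> r \<oplus> x)"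
        unfolding y(3) using y x r kc e W(1) by (subst eqI) (auto simp: add scl subspace_0)
      then have "u = ?p (\<kappa> c) \<otimes>\<^bsub>?Q\<^esub> ?p r \<oplus>\<^bsub>?Q\<^esub> ?p x" using x r kc by simp
      then show "u \<in> h.S.line_extension ?k (?p r) ?E"
        unfolding h.S.line_extension_mem_iff using x e(1)
        by (intro bexI[of _ "?p (\<kappa> c)"] bexI[of _ "?p x"] imageI) simp_all
    qed
    moreover have "h.S.dimension (Suc n) ?k (h.S.line_extension ?k (?p r) ?E)"
      using codim_step.IH codim_step.prems Ev rE r by (intro h.S.dimension.Suc_dim) auto
    ultimately show ?case by simp
  qed
  have "{x\<in>carrier R. \<Theta> x \<in> \<Theta> ` carrier R} = carrier R" by auto
  moreover have "?p ` carrier R = carrier ?Q"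
    unfolding FactRing_def ring.simps partial_object.simps A_RCOSETS_def' by blast
  ultimately have "h.S.dimension n ?k (carrier ?Q)" using main[OF dim subset_refl] by simp
  note d = h.S.finite_dimensionI[OF this] h.S.dimI[OF sub this, unfolded over_def]
  show ?thesis unfolding quotient_dim_def Let_def using d by (simp only: if_True)
qed

end

section \<open>Ring homomorphisms\<close>

text \<open>Homomorphisms as plain functions between types: substitutions, evaluations, reductions
  and the Galois action all qualify, compose, and share the rules \<open>rhomD\<close>.\<close>

definition is_rhom :: "('a::comm_ring_1 \<Rightarrow> 'b::comm_ring_1) \<Rightarrow> bool" where
  "is_rhom h \<longleftrightarrow> (\<forall>a b. h (a + b) = h a + h b) \<and> (\<forall>a b. h (a * b) = h a * h b) \<and> h 1 = 1"

lemma rhomD: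
  assumes "is_rhom h"
  shows rhom_add: "h (a + b) = h a + h b" and rhom_mult: "h (a * b) = h a * h b" and rhom_1: "h 1 = 1"
    and rhom_0: "h 0 = 0" and rhom_minus: "h (- a) = - h a" and rhom_diff: "h (a - b) = h a - h b"
    and rhom_power: "h (a ^ n) = h a ^ n"
proof -
  show add: "h (a + b) = h a + h b" and mult: "h (a * b) = h a * h b" and one: "h 1 = 1" for a b
    using assms by (auto simp: is_rhom_def)
  show z: "h 0 = 0" using add[of 0 0] by simp
  show m: "h (- a) = - h a" for a using add[of a "- a"] z by (simp add: eq_neg_iff_add_eq_0 add.commute)
  show "h (a - b) = h a - h b" using add[of a "- b"] m by simp
  show "h (a ^ n) = h a ^ n" by (induction n) (auto simp: one mult)
qed

lemma rhom_sum: "is_rhom h \<Longrightarrow> h (sum f A) = (\<Sum>x\<in>A. h (f x))"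
  by (induction A rule: infinite_finite_induct) (auto simp: rhomD)

lemma rhom_prod: "is_rhom h \<Longrightarrow> h (prod f A) = (\<Prod>x\<in>A. h (f x))"
  by (induction A rule: infinite_finite_induct) (auto simp: rhomD)

lemma rhom_comp: "is_rhom g \<Longrightarrow> is_rhom h \<Longrightarrow> is_rhom (\<lambda>x. g (h x))"
  by (simp add: is_rhom_def)

lemma rhom_id: "is_rhom (\<lambda>x. x)" by (simp add: is_rhom_def)

lemma rhom_nth0: "is_rhom (\<lambda>f::'a::comm_ring_1 fps. f $ 0)" by (simp add: is_rhom_def)

lemma rhom_fps_const: "is_rhom (fps_const :: 'a::comm_ring_1 \<Rightarrow> _)" by (simp add: is_rhom_def)

lemma rhom_fps_map:
  assumes h: "is_rhom h" shows "is_rhom (\<lambda>f. Abs_fps (\<lambda>i. h (f $ i)))"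
  unfolding is_rhom_def
  by (auto simp: fps_eq_iff fps_mult_nth rhomD[OF h] rhom_sum[OF h])

lemma rhom_compose: "(p::'a::idom fps) $ 0 = 0 \<Longrightarrow> is_rhom (\<lambda>f. f oo p)"
  by (simp add: is_rhom_def fps_compose_add_distrib fps_compose_mult_distrib)

section \<open>Order filtration and substitution\<close>

abbreviation varX :: "'a::comm_ring_1 fps fps" where "varX \<equiv> fps_X"
abbreviation varY :: "'a::comm_ring_1 fps fps" where "varY \<equiv> fps_const fps_X"
abbreviation cst :: "'a::comm_ring_1 \<Rightarrow> 'a fps fps" where "cst c \<equiv> fps_const (fps_const c)"

text \<open>The inclusion of K[[x]], the outer variable; the inclusion of K[[y]] is
  \<open>fps_const\<close>.\<close>

definition embx :: "'a::comm_ring_1 fps \<Rightarrow> 'a fps fps" where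
  "embx a = Abs_fps (\<lambda>i. fps_const (a $ i))"

lemma rhom_embx: "is_rhom (embx :: 'a::comm_ring_1 fps \<Rightarrow> _)"
  unfolding embx_def by (rule rhom_fps_map[OF rhom_fps_const])

text \<open>The filtration by powers of the maximal ideal (x, y), as a predicate so that the zero
  series needs no order of its own.\<close>

definition ord_ge :: "nat \<Rightarrow> 'a::comm_ring_1 fps fps \<Rightarrow> bool" where
  "ord_ge n h \<longleftrightarrow> (\<forall>i j. i + j < n \<longrightarrow> h $ i $ j = 0)"

lemma ord_ge_0 [simp]: "ord_ge 0 h" by (simp add: ord_ge_def)
lemma ord_ge_zero [simp]: "ord_ge n 0" by (simp add: ord_ge_def)
lemma ord_ge_mono: "ord_ge n h \<Longrightarrow> m \<le> n \<Longrightarrow> ord_ge m h" by (simp add: ord_ge_def)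
lemma ord_ge_add: "ord_ge n f \<Longrightarrow> ord_ge n g \<Longrightarrow> ord_ge n (f + g)" by (simp add: ord_ge_def)
lemma ord_ge_minus: "ord_ge n f \<Longrightarrow> ord_ge n (- f)" by (simp add: ord_ge_def)
lemma ord_ge_sum: "(\<And>x. x \<in> A \<Longrightarrow> ord_ge n (f x)) \<Longrightarrow> ord_ge n (sum f A)"
  by (induction A rule: infinite_finite_induct) (auto intro: ord_ge_add)

lemma fps2_mult_nth:
  "(f * g) $ i $ j = (\<Sum>p\<le>i. \<Sum>q\<le>j. f $ p $ q * g $ (i - p) $ (j - q))"
  by (simp add: fps_mult_nth fps_sum_nth atLeast0AtMost)

lemma ord_ge_mult:
  assumes "ord_ge a f" "ord_ge b g" shows "ord_ge (a + b) (f * g)"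
  unfolding ord_ge_def
proof (intro allI impI)
  fix i j assume ij: "i + j < a + b"
  have "f $ p $ q * g $ (i - p) $ (j - q) = 0" if "p \<le> i" "q \<le> j" for p q
  proof (cases "p + q < a")
    case True
    then show ?thesis using assms by (simp add: ord_ge_def)
  next
    case False
    then have "(i - p) + (j - q) < b" using that ij by linarith
    then show ?thesis using assms by (simp add: ord_ge_def)
  qed
  then show "(f * g) $ i $ j = 0" by (simp add: fps2_mult_nth)
qed

lemma ord_ge_power: "ord_ge 1 f \<Longrightarrow> ord_ge n (f ^ n)"
  by (induction n) (use ord_ge_mult[of 1] in auto)

lemma ord_ge_multl: "ord_ge n f \<Longrightarrow> ord_ge n (f * g)"
  using ord_ge_mult[of n f 0 g] by simp
lemma ord_ge_multr: "ord_ge n f \<Longrightarrow> ord_ge n (g * f)"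
  using ord_ge_mult[of 0 g n f] by simp

lemma ord_ge_cong_mult:
  assumes "ord_ge n (u - v)" "ord_ge n (u' - v')" shows "ord_ge n (u * u' - v * v')"
proof -
  have "u * u' - v * v' = (u - v) * u' + v * (u' - v')" by (simp add: algebra_simps)
  then show ?thesis using assms by (simp add: ord_ge_add ord_ge_multl ord_ge_multr)
qed

lemma ord_ge_cong_trans: "ord_ge n (u - v) \<Longrightarrow> ord_ge n (v - w) \<Longrightarrow> ord_ge n (u - w)"
  using ord_ge_add[of n "u - v" "v - w"] by simp

lemma ord_ge_cong_sym: "ord_ge n (u - v) \<Longrightarrow> ord_ge n (v - u)"
  using ord_ge_minus[of n "u - v"] by simp

lemma ord_ge_all_0: "(\<And>n. ord_ge n h) \<Longrightarrow> h = 0"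
  by (simp add: ord_ge_def fps_eq_iff) (meson lessI)

lemma ord_ge_1_iff: "ord_ge (Suc 0) h \<longleftrightarrow> h $ 0 $ 0 = 0"
  by (auto simp: ord_ge_def)

text \<open>\<open>sub P w = \<Sum>k. w\<^sub>k P\<^sup>k\<close> for \<open>P\<close> of positive order; as \<open>P\<^sup>k\<close> has order at
  least \<open>k\<close>, the truncated sum is exact.\<close>

definition sub :: "'a::comm_ring_1 fps fps \<Rightarrow> 'a fps fps fps \<Rightarrow> 'a fps fps" where
  "sub P w = Abs_fps (\<lambda>i. Abs_fps (\<lambda>j. (\<Sum>k\<le>i + j. P ^ k * w $ k) $ i $ j))"

lemma sub_nth:
  assumes "ord_ge 1 P" "i + j \<le> n"
  shows "sub P w $ i $ j = (\<Sum>k\<le>n. P ^ k * w $ k) $ i $ j"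
proof -
  have "(P ^ k * w $ k) $ i $ j = 0" if "k \<in> {..n} - {..i+j}" for k
    using ord_ge_multl[OF ord_ge_power[OF assms(1), of k], of "w $ k"] that
    by (auto simp: ord_ge_def)
  then have "(\<Sum>k\<le>i+j. (P ^ k * w $ k) $ i $ j) = (\<Sum>k\<le>n. (P ^ k * w $ k) $ i $ j)"
    using assms by (intro sum.mono_neutral_left) auto
  then show ?thesis by (simp add: sub_def fps_sum_nth)
qed

lemma sub_cong:
  assumes "ord_ge 1 P" shows "ord_ge (Suc n) (sub P w - (\<Sum>k\<le>n. P ^ k * w $ k))"
  using sub_nth[OF assms, of _ _ n w] by (auto simp: ord_ge_def)

text \<open>Modulo order n + 1 both sides are finite sums over pairs (i, j). The pairs by which they
  differ have i + j > n, and there P ^ (i + j) has order above n.\<close>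

lemma sub_mult:
  assumes P: "ord_ge 1 P" shows "sub P (w * v) = sub P w * sub P v"
proof -
  have "ord_ge (Suc n) (sub P (w * v) - sub P w * sub P v)" for n
  proof -
    let ?g = "\<lambda>i j. P ^ (i + j) * (w $ i * v $ j)"
    have 1: "(\<Sum>k\<le>n. P ^ k * (w * v) $ k) = (\<Sum>(i,j)\<in>{(i,j). i + j \<le> n}. ?g i j)"
    proof -
      have "(\<Sum>k\<le>n. P ^ k * (w * v) $ k) = (\<Sum>k\<le>n. \<Sum>i\<le>k. ?g i (k - i))"
        by (simp add: fps_mult_nth atLeast0AtMost sum_distrib_left)
      then show ?thesis by (simp add: sum.triangle_reindex_eq)
    qed
    have 2: "(\<Sum>k\<le>n. P ^ k * w $ k) * (\<Sum>k\<le>n. P ^ k * v $ k) = (\<Sum>(i,j)\<in>{..n}\<times>{..n}. ?g i j)"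
      unfolding sum_product sum.cartesian_product
      by (intro sum.cong refl) (auto simp: power_add mult_ac)
    have fin: "finite {(i,j). i + j \<le> n}"
      by (rule finite_subset[of _ "{..n}\<times>{..n}"]) auto
    have "(\<Sum>(i,j)\<in>{..n}\<times>{..n}. ?g i j) - (\<Sum>(i,j)\<in>{(i,j). i + j \<le> n}. ?g i j)
        = (\<Sum>(i,j)\<in>{..n}\<times>{..n} - {(i,j). i + j \<le> n}. ?g i j)"
      by (subst sum_diff) auto
    moreover have "ord_ge (Suc n) \<dots>"
      by (intro ord_ge_sum)
         (auto intro!: ord_ge_multl ord_ge_mono[OF ord_ge_power[OF P]])
    ultimately have 3: "ord_ge (Suc n) ((\<Sum>k\<le>n. P ^ k * w $ k) * (\<Sum>k\<le>n. P ^ k * v $ k) - (\<Sum>k\<le>n. P ^ k * (w * v) $ k))"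
      unfolding 1 2 by simp
    show ?thesis
      by (rule ord_ge_cong_trans[OF sub_cong[OF P]])
         (rule ord_ge_cong_sym, rule ord_ge_cong_trans[OF ord_ge_cong_mult[OF sub_cong[OF P] sub_cong[OF P]] 3])
  qed
  then have "ord_ge n (sub P (w * v) - sub P w * sub P v)" for n
    using ord_ge_mono[of "Suc n" _ n] by auto
  from ord_ge_all_0[OF this] show ?thesis by simp
qed

lemma rhom_sub: "ord_ge 1 P \<Longrightarrow> is_rhom (sub P)"
proof -
  assume P: "ord_ge 1 P"
  have "sub P 1 = 1"
  proof (intro fps_ext)
    fix i j
    have "(\<Sum>k\<le>i+j. P ^ k * 1 $ k) = (\<Sum>k\<le>i+j. if k = 0 then 1 else 0)"
      by (intro sum.cong) auto
    then show "sub P 1 $ i $ j = 1 $ i $ j" by (simp add: sub_def)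
  qed
  moreover have "sub P (w + v) = sub P w + sub P v" for w v
    by (auto simp: sub_def fps_eq_iff fps_sum_nth algebra_simps sum.distrib)
  ultimately show ?thesis using sub_mult[OF P] by (simp add: is_rhom_def)
qed

lemma sub_const: "ord_ge 1 P \<Longrightarrow> sub P (fps_const c) = c"
proof (intro fps_ext)
  fix i j
  have "(\<Sum>k\<le>i+j. P ^ k * fps_const c $ k) = (\<Sum>k\<le>i+j. if k = 0 then c else 0)"
    by (intro sum.cong) auto
  then show "sub P (fps_const c) $ i $ j = c $ i $ j" by (simp add: sub_def)
qed

lemma sub_X: assumes "ord_ge 1 P" shows "sub P fps_X = P"
proof (intro fps_ext)
  fix i j :: nat
  have "(\<Sum>k\<le>Suc (i+j). P ^ k * fps_X $ k) = (\<Sum>k\<le>Suc (i+j). if k = 1 then P else 0)"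
    by (intro sum.cong) (auto simp: fps_X_def)
  then show "sub P fps_X $ i $ j = P $ i $ j"
    using sub_nth[OF assms, of i j "Suc (i + j)" fps_X] by simp
qed

lemma ord_ge_sub:
  assumes "ord_ge 1 P" "\<And>k. ord_ge (n - k) (w $ k)" shows "ord_ge n (sub P w)"
proof (cases n)
  case (Suc m)
  have "ord_ge n (P ^ k * w $ k)" for k
    using ord_ge_mult[OF ord_ge_power[OF assms(1), of k] assms(2)[of k]] by (rule ord_ge_mono) auto
  then have "ord_ge (Suc m) (sub P w - 0)"
    using Suc by (intro ord_ge_cong_trans[OF sub_cong[OF assms(1)]]) (auto intro: ord_ge_sum)
  then show ?thesis using Suc by simp
qed auto

text \<open>\<open>bisub P Q h = h(P, Q)\<close>, and \<open>ev p q h = h(p(t), q(t))\<close> below; both are meaningful only for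
  arguments without constant term.\<close>

definition bisub :: "'a::comm_ring_1 fps fps \<Rightarrow> 'a fps fps \<Rightarrow> 'a fps fps \<Rightarrow> 'a fps fps" where
  "bisub P Q h = sub P (Abs_fps (\<lambda>i. sub Q (Abs_fps (\<lambda>j. cst (h $ i $ j)))))"

context
  fixes P Q :: "'a::comm_ring_1 fps fps"
  assumes P: "ord_ge 1 P" and Q: "ord_ge 1 Q"
begin

lemma rhom_bisub: "is_rhom (bisub P Q)"
proof -
  have "is_rhom (\<lambda>b. sub Q (Abs_fps (\<lambda>j. cst (b $ j))))"
    by (intro rhom_comp[OF rhom_sub[OF Q]] rhom_fps_map[OF rhom_comp[OF rhom_fps_const rhom_fps_const]])
  from rhom_comp[OF rhom_sub[OF P] rhom_fps_map[OF this]] show ?thesis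
    by (simp add: bisub_def[abs_def])
qed

lemma bisub_const: "bisub P Q (fps_const b) = sub Q (Abs_fps (\<lambda>j. cst (b $ j)))"
proof -
  have "Abs_fps (\<lambda>i. sub Q (Abs_fps (\<lambda>j. cst (fps_const b $ i $ j)))) =
    fps_const (sub Q (Abs_fps (\<lambda>j. cst (b $ j))))"
    using rhom_0[OF rhom_sub[OF Q]] by (auto simp: fps_eq_iff simp flip: fps_zero_def)
  then show ?thesis by (simp add: bisub_def sub_const[OF P])
qed

lemma bisub_cst: "bisub P Q (cst c) = cst c"
proof -
  have "Abs_fps (\<lambda>j. cst (fps_const c $ j)) = fps_const (cst c)"
    by (auto simp: fps_eq_iff)
  then show ?thesis by (simp add: bisub_const sub_const[OF Q])
qed

lemma bisub_varY: "bisub P Q varY = Q"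
proof -
  have "Abs_fps (\<lambda>j. cst ((fps_X :: 'a fps) $ j)) = fps_X"
    by (auto simp: fps_eq_iff fps_X_def)
  then show ?thesis by (simp add: bisub_const sub_X[OF Q])
qed

lemma bisub_varX: "bisub P Q varX = P"
proof -
  have "Abs_fps (\<lambda>i. sub Q (Abs_fps (\<lambda>j. cst (fps_X $ i $ j)))) = fps_X"
  proof (rule fps_ext)
    fix i
    have "Abs_fps (\<lambda>j. cst ((1::'a fps) $ j)) = 1" "Abs_fps (\<lambda>j. cst ((0::'a fps) $ j)) = 0"
      by (auto simp: fps_eq_iff)
    then show "Abs_fps (\<lambda>i. sub Q (Abs_fps (\<lambda>j. cst (fps_X $ i $ j)))) $ i = fps_X $ i"
      using rhom_0[OF rhom_sub[OF Q]] rhom_1[OF rhom_sub[OF Q]] by (simp add: fps_X_def del: fps_one_nth fps_zero_nth)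
  qed
  then show ?thesis by (simp add: bisub_def sub_X[OF P])
qed

lemma ord_ge_bisub:
  assumes "ord_ge n h" shows "ord_ge n (bisub P Q h)"
  unfolding bisub_def
proof (rule ord_ge_sub[OF P])
  fix i
  show "ord_ge (n - i) (Abs_fps (\<lambda>i. sub Q (Abs_fps (\<lambda>j. cst (h $ i $ j)))) $ i)"
    unfolding fps_nth_Abs_fps
  proof (rule ord_ge_sub[OF Q])
    fix j
    show "ord_ge (n - i - j) (Abs_fps (\<lambda>j. cst (h $ i $ j)) $ j)"
      using assms by (cases "n \<le> i + j") (auto simp: ord_ge_def)
  qed
qed

end

lemma bisub_embx:
  assumes P: "ord_ge 1 P" and Q: "ord_ge 1 Q"
  shows "bisub P Q (embx a) = sub P (Abs_fps (\<lambda>i. cst (a $ i)))"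
proof -
  have "sub Q (Abs_fps (\<lambda>j. cst (fps_const c $ j))) = cst c" for c
    using bisub_cst[OF P Q, of c] bisub_const[OF P Q, of "fps_const c"] by simp
  then show ?thesis by (simp add: bisub_def embx_def)
qed

lemma sub_fps_const:
  assumes "p $ 0 = 0"
  shows "sub (fps_const p) (Abs_fps (\<lambda>i. cst (a $ i))) = fps_const (a oo p)"
proof (intro fps_ext)
  fix i j
  have "sub (fps_const p) (Abs_fps (\<lambda>i. cst (a $ i))) $ i $ j
     = (\<Sum>k\<le>i+j. fps_const (p ^ k * fps_const (a $ k)) $ i $ j)"
    by (simp add: sub_def fps_sum_nth)
  also have "\<dots> = fps_const (a oo p) $ i $ j"
    by (cases "i = 0") (auto simp: fps_compose_nth atLeast0AtMost mult.commute)
  finally show "sub (fps_const p) (Abs_fps (\<lambda>i. cst (a $ i))) $ i $ j = fps_const (a oo p) $ i $ j" .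
qed

text \<open>The inner variable plays the part of t: p and q are inserted as constants with respect
  to the outer variable, so the result sits at outer index 0.\<close>

definition ev :: "'a::comm_ring_1 fps \<Rightarrow> 'a fps \<Rightarrow> 'a fps fps \<Rightarrow> 'a fps" where
  "ev p q h = bisub (fps_const p) (fps_const q) h $ 0"

context
  fixes p q :: "'a::comm_ring_1 fps"
  assumes p: "p $ 0 = 0" and q: "q $ 0 = 0"
begin

lemma ord_ge_pq: "ord_ge 1 (fps_const p)" "ord_ge 1 (fps_const q)"
  using p q by (auto simp: ord_ge_1_iff)

lemma rhom_ev: "is_rhom (ev p q)"
  unfolding ev_def[abs_def] by (rule rhom_comp[OF rhom_nth0 rhom_bisub[OF ord_ge_pq]])

lemma ev_cst: "ev p q (cst c) = fps_const c" by (simp add: ev_def bisub_cst[OF ord_ge_pq])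
lemma ev_varX: "ev p q varX = p" by (simp add: ev_def bisub_varX[OF ord_ge_pq])
lemma ev_varY: "ev p q varY = q" by (simp add: ev_def bisub_varY[OF ord_ge_pq])
lemma ev_fps_const: "ev p q (fps_const b) = b oo q"
  by (simp add: ev_def bisub_const[OF ord_ge_pq] sub_fps_const[OF q])
lemma ev_embx: "ev p q (embx a) = a oo p"
  by (simp add: ev_def bisub_embx[OF ord_ge_pq] sub_fps_const[OF p])

end

section \<open>Density of polynomials\<close>

text \<open>S stands for a property shared by all polynomials in x and y. Splitting off constant
  terms n times in each variable leaves a remainder in the ideal (x^n, y^n).\<close>

lemma poly_dense:
  fixes h :: "'a::comm_ring_1 fps fps"
  assumes add: "\<And>a b. S a \<Longrightarrow> S b \<Longrightarrow> S (a + b)" and mult: "\<And>a b. S a \<Longrightarrow> S b \<Longrightarrow> S (a * b)"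
    and c: "\<And>c. S (cst c)" and X: "S varX" and Y: "S varY"
  shows "\<exists>p h1 h2. S p \<and> h = p + varX ^ n * h1 + varY ^ n * h2"
proof -
  have S0: "S 0" using c[of 0] by simp
  have dec: "f = fps_const (f $ 0) + fps_X * fps_shift 1 f" for f :: "'b::comm_ring_1 fps"
    by (auto simp: fps_eq_iff fps_X_mult_nth)
  have 1: "\<exists>p b'. S p \<and> fps_const b = p + varY ^ m * fps_const b'" for b :: "'a fps" and m
  proof (induction m arbitrary: b)
    case 0
    show ?case using S0 by (intro exI[of _ 0] exI[of _ b]) auto
  next
    case (Suc m)
    obtain p b' where p: "S p" "fps_const (fps_shift 1 b) = p + varY ^ m * fps_const b'"
      using Suc by blast
    have "fps_const b = fps_const (fps_const (b $ 0) + fps_X * fps_shift 1 b)"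
      using dec[of b] by simp
    also have "\<dots> = cst (b $ 0) + varY * fps_const (fps_shift 1 b)"
      by simp
    also have "\<dots> = (cst (b $ 0) + varY * p) + varY ^ Suc m * fps_const b'"
      unfolding p(2) by (simp only: power_Suc ring_distribs mult.assoc add.assoc)
    finally show ?case using p by (intro exI conjI) (auto intro: add mult c Y)
  qed
  have "\<exists>p h1 h2. S p \<and> h = p + varX ^ m * h1 + varY ^ n * h2" for m
  proof (induction m arbitrary: h)
    case 0
    show ?case using S0 by (intro exI[of _ 0] exI[of _ h]) auto
  next
    case (Suc m)
    obtain p h1 h2 where p: "S p" "fps_shift 1 h = p + varX ^ m * h1 + varY ^ n * h2"
      using Suc by blast
    obtain r b where r: "S r" "fps_const (h $ 0) = r + varY ^ n * fps_const b"
      using 1 by blast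
    have "h = (r + varX * p) + varX ^ Suc m * h1 + varY ^ n * (fps_const b + varX * h2)"
      by (subst dec, unfold p(2) r(2)) (simp only: power_Suc ring_distribs mult_ac add_ac)
    then show ?case using p r by (intro exI conjI) (auto intro: add mult X)
  qed
  then show ?thesis .
qed

text \<open>Both maps agree on polynomials, and they send the remainder in (x^n, y^n) to order at
  least n because the images of x and y have positive order. No continuity has to be
  assumed.\<close>

lemma hom_unique:
  fixes H1 H2 :: "'a::comm_ring_1 fps fps \<Rightarrow> 'a fps fps"
  assumes H: "is_rhom H1" "is_rhom H2" and c: "\<And>c. H1 (cst c) = H2 (cst c)"
    and X: "H1 varX = H2 varX" "ord_ge 1 (H1 varX)" and Y: "H1 varY = H2 varY" "ord_ge 1 (H1 varY)"
  shows "H1 h = H2 h"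
proof -
  have "ord_ge n (H1 h - H2 h)" for n
  proof -
    obtain p h1 h2 where p: "H1 p = H2 p" "h = p + varX ^ n * h1 + varY ^ n * h2"
      using poly_dense[of "\<lambda>p. H1 p = H2 p" h n] by (auto simp: H[THEN rhom_add] H[THEN rhom_mult] c X Y)
    have "H1 h - H2 h = H1 varX ^ n * (H1 h1 - H2 h1) + H1 varY ^ n * (H1 h2 - H2 h2)"
      unfolding p(2) H[THEN rhom_add] H[THEN rhom_mult] H[THEN rhom_power]
      using X Y p(1) by (simp add: algebra_simps)
    then show ?thesis
      using X Y by (auto intro!: ord_ge_add ord_ge_multl ord_ge_power)
  qed
  from ord_ge_all_0[OF this] show ?thesis by simp
qed

text \<open>D obeys the Leibniz rule along T. It kills polynomials, and on a multiple of x^n or y^n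
  it keeps the factor T x ^ n or T y ^ n, so D h has arbitrarily high order. This is how the chain
  rule is checked on generators.\<close>

lemma derivation_unique:
  fixes D T :: "'a::comm_ring_1 fps fps \<Rightarrow> 'a fps fps"
  assumes T: "is_rhom T" "ord_ge 1 (T varX)" "ord_ge 1 (T varY)"
    and add: "\<And>a b. D (a + b) = D a + D b" and mult: "\<And>a b. D (a * b) = D a * T b + T a * D b"
    and 0: "\<And>c. D (cst c) = 0" "D varX = 0" "D varY = 0"
  shows "D h = 0"
proof -
  have D1: "D 1 = 0" using 0(1)[of 1] by simp
  have pow: "D (a ^ n) = 0" if "D a = 0" for a n
    by (induction n) (simp_all add: D1 mult that)
  have "ord_ge n (D h)" for n
  proof -
    obtain p h1 h2 where p: "D p = 0" "h = p + varX ^ n * h1 + varY ^ n * h2"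
      using poly_dense[of "\<lambda>p. D p = 0" h n] by (auto simp: add mult 0)
    have "D h = T varX ^ n * D h1 + T varY ^ n * D h2"
      unfolding p(2) add mult using p(1) pow 0 by (simp add: rhom_power[OF T(1)] del: fps_const_power)
    then show ?thesis
      using T by (auto intro!: ord_ge_add ord_ge_multl ord_ge_power)
  qed
  from ord_ge_all_0[OF this] show ?thesis by simp
qed

section \<open>Shears and partial derivatives\<close>

definition shear :: "'a::comm_ring_1 \<Rightarrow> 'a fps fps \<Rightarrow> 'a fps fps" where
  "shear a = bisub (varX + cst a * varY) varY"

lemma ord_ge_shear_args: "ord_ge 1 (varX + cst a * varY)" "ord_ge 1 (varY :: 'a::comm_ring_1 fps fps)"
  by (auto simp: ord_ge_1_iff)

lemmas rhom_shear = rhom_bisub[OF ord_ge_shear_args, folded shear_def]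
lemmas shear_varX = bisub_varX[OF ord_ge_shear_args, folded shear_def]
lemmas shear_varY = bisub_varY[OF ord_ge_shear_args, folded shear_def]
lemmas shear_cst = bisub_cst[OF ord_ge_shear_args, folded shear_def]
lemmas ord_ge_shear = ord_ge_bisub[OF ord_ge_shear_args, folded shear_def]

lemma shear_shear: "shear (- a) (shear a h) = h"
proof (rule hom_unique[of "\<lambda>h. shear (- a) (shear a h)" "\<lambda>h. h"])
  show "is_rhom (\<lambda>h. shear (- a) (shear a h))" by (rule rhom_comp[OF rhom_shear rhom_shear])
  show "is_rhom (\<lambda>h. h)" by (rule rhom_id)
  show x: "shear (- a) (shear a varX) = varX"
  proof -
    have "shear (- a) (shear a varX) = varX + (cst (- a) + cst a) * varY"
      unfolding shear_varX rhom_add[OF rhom_shear] rhom_mult[OF rhom_shear] shear_cst shear_varY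
      by (simp only: distrib_right add.assoc)
    also have "cst (- a) + cst a = 0" by simp
    finally show ?thesis by simp
  qed
  show y: "shear (- a) (shear a varY) = varY" by (simp add: shear_varY)
  show "ord_ge 1 (shear (- a) (shear a varX))" "ord_ge 1 (shear (- a) (shear a varY))"
    unfolding x y by (auto simp: ord_ge_1_iff)
qed (simp add: shear_cst)

lemma shear_shear': "shear a (shear (- a) h) = h"
  using shear_shear[of "- a"] by simp

lemma bij_shear: "bij (shear a)"
  by (rule bijI') (metis shear_shear, metis shear_shear')

lemma ord_ge_shear_iff: "ord_ge n (shear a h) \<longleftrightarrow> ord_ge n h"
  using ord_ge_shear[of n h a] ord_ge_shear[of n "shear a h" "- a"] by (auto simp: shear_shear)

text \<open>Setting x = 0 after the shear gives f(a y, y). For n the multiplicity this coefficient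
  is the leading form at (a, 1), which vanishes exactly at the tangent directions.\<close>

lemma shear_nth_0:
  "shear a h $ 0 $ n = (\<Sum>k\<le>n. a ^ k * h $ k $ (n - k))"
proof -
  have Y: "sub varY (Abs_fps (\<lambda>j. cst (b $ j))) = fps_const b" for b :: "'a fps"
    using sub_fps_const[of fps_X b] by simp
  have P: "(varX + cst a * varY) ^ k $ 0 = (fps_const a * fps_X) ^ k" for k
    using rhom_power[OF rhom_nth0, of "varX + cst a * varY" k] by simp
  have "shear a h $ 0 $ n = (\<Sum>k\<le>n. ((varX + cst a * varY) ^ k * fps_const (h $ k)) $ 0 $ n)"
    unfolding shear_def bisub_def Y unfolding sub_def by (simp add: fps_sum_nth)
  also have "\<dots> = (\<Sum>k\<le>n. ((fps_const a * fps_X) ^ k * h $ k) $ n)"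
    by (simp add: P del: fps_const_mult)
  also have "\<dots> = (\<Sum>k\<le>n. a ^ k * h $ k $ (n - k))"
    by (intro sum.cong refl) (simp add: power_mult_distrib fps_const_power mult.assoc fps_X_power_mult_nth)
  finally show ?thesis .
qed

lemma partial_x_simps:
  "partial_x (f + g) = partial_x f + partial_x g" "partial_x (f * g) = partial_x f * g + f * partial_x g"
  "partial_x (cst c) = 0" "partial_x varX = 1" "partial_x varY = 0"
  by (simp_all add: partial_x_def)

lemma partial_y_simps:
  "partial_y (f + g) = partial_y f + partial_y g" "partial_y (f * g) = partial_y f * g + f * partial_y g"
  "partial_y (cst c) = 0" "partial_y varX = 0" "partial_y varY = 1"
proof -
  show "partial_y (f * g) = partial_y f * g + f * partial_y g"
    by (rule fps_ext) (simp add: partial_y_def fps_mult_nth fps_deriv_sum sum.distrib)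
  show "partial_y (cst c) = 0" "partial_y varX = 0" "partial_y varY = 1"
    by (rule fps_ext, simp add: partial_y_def fps_X_nth)+
qed (simp add: partial_y_def fps_eq_iff[of _ "_ :: _ fps fps"])

text \<open>Chain rule: the polar in direction (a : 1) becomes the y-derivative of the sheared
  equation. The difference of the two sides is a derivation along the shear that kills all
  generators.\<close>

lemma partial_y_shear:
  "partial_y (shear a f) = shear a (cst a * partial_x f + partial_y f)"
proof -
  define D where "D h = partial_y (shear a h) - shear a (cst a * partial_x h + partial_y h)" for h
  note T = rhom_add[OF rhom_shear] rhom_mult[OF rhom_shear] shear_cst shear_varX shear_varY
  have "D f = 0"
  proof (rule derivation_unique[where D = D and T = "shear a"])
    show "ord_ge 1 (shear a varX)" "ord_ge 1 (shear a varY)"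
      by (auto simp: T ord_ge_1_iff)
    show "D (x + y) = D x + D y" for x y
      by (simp add: D_def T partial_x_simps partial_y_simps algebra_simps del: fps_const_mult)
    show "D (x * y) = D x * shear a y + shear a x * D y" for x y
      by (simp add: D_def T partial_x_simps partial_y_simps algebra_simps del: fps_const_mult)
  qed (auto simp: D_def T partial_x_simps partial_y_simps rhom_0[OF rhom_shear] rhom_1[OF rhom_shear] rhom_shear simp del: fps_const_mult)
  then show ?thesis by (simp add: D_def)
qed

section \<open>Polynomials over rings of power series\<close>

lemma rhom_map_poly:
  assumes h: "is_rhom h" shows "is_rhom (map_poly h)"
  unfolding is_rhom_def
  by (auto simp: poly_eq_iff coeff_map_poly rhom_0[OF h] rhom_add[OF h] rhom_mult[OF h] rhom_1[OF h]
      rhom_sum[OF h] coeff_mult coeff_1)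

lemma map_poly_linear: "is_rhom h \<Longrightarrow> map_poly h [:a, 1:] = [:h a, 1:]"
  by (simp add: map_poly_pCons rhomD)

lemma degree_map_poly_le: "h 0 = 0 \<Longrightarrow> degree (map_poly h p) \<le> degree p"
  by (intro degree_le) (auto simp: coeff_map_poly coeff_eq_0)

lemma poly_altdef_le:
  fixes p :: "'a::comm_ring_1 poly"
  assumes "degree p \<le> n" shows "poly p x = (\<Sum>i\<le>n. coeff p i * x ^ i)"
  unfolding poly_altdef using assms by (intro sum.mono_neutral_left) (auto simp: coeff_eq_0)

lemma monic_map_poly:
  assumes h: "is_rhom h" and p: "lead_coeff p = 1"
  shows "degree (map_poly h p) = degree p" "lead_coeff (map_poly h p) = 1"
proof -
  have "coeff (map_poly h p) (degree p) = 1"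
    using p by (simp add: coeff_map_poly rhomD[OF h])
  moreover have "degree (map_poly h p) \<le> degree p" by (rule degree_map_poly_le) (rule rhom_0[OF h])
  ultimately show "degree (map_poly h p) = degree p"
    by (metis le_antisym le_degree zero_neq_one)
  then show "lead_coeff (map_poly h p) = 1"
    using p by (simp add: coeff_map_poly rhomD[OF h])
qed

text \<open>A polynomial in y over K[[x]] read as a power series. The indices swap because x is the
  outer variable of the series but the inner one of the polynomial.\<close>

definition conv :: "'a::comm_ring_1 fps poly \<Rightarrow> 'a fps fps" where
  "conv p = Abs_fps (\<lambda>i. Abs_fps (\<lambda>j. coeff p j $ i))"

lemma conv_nth [simp]: "conv p $ i $ j = coeff p j $ i"
  by (simp add: conv_def)

lemma rhom_conv: "is_rhom (conv :: 'a::comm_ring_1 fps poly \<Rightarrow> _)"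
proof -
  have "conv (p * q) = conv p * conv q" for p q :: "'a fps poly"
  proof (intro fps_ext)
    fix i j
    have "conv (p * q) $ i $ j = (\<Sum>b\<le>j. \<Sum>a\<le>i. coeff p b $ a * coeff q (j - b) $ (i - a))"
      by (simp add: coeff_mult fps_sum_nth fps_mult_nth atLeast0AtMost)
    also have "\<dots> = (conv p * conv q) $ i $ j"
      by (subst sum.swap) (simp add: fps2_mult_nth)
    finally show "conv (p * q) $ i $ j = (conv p * conv q) $ i $ j" .
  qed
  then show ?thesis by (auto simp: is_rhom_def fps_eq_iff coeff_1)
qed

lemma conv_pCons: "conv (pCons a p) = embx a + varY * conv p"
proof (intro fps_ext)
  fix i j show "conv (pCons a p) $ i $ j = (embx a + varY * conv p) $ i $ j"
    by (cases j) (auto simp: coeff_pCons embx_def)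
qed

lemma ev_conv:
  assumes "p $ 0 = 0" "q $ 0 = 0"
  shows "ev p q (conv w) = poly (map_poly (\<lambda>a. a oo p) w) q"
proof (induction w)
  case 0
  then show ?case by (simp add: rhom_0[OF rhom_conv] rhom_0[OF rhom_ev[OF assms]])
next
  case (pCons a w)
  then show ?case
    by (simp add: conv_pCons map_poly_pCons rhom_add[OF rhom_ev[OF assms]] rhom_mult[OF rhom_ev[OF assms]]
        ev_embx[OF assms] ev_varY[OF assms])
qed

lemma conv_eq_0_iff: "conv p = 0 \<longleftrightarrow> p = 0"
  by (auto simp: fps_eq_iff poly_eq_iff)

lemma fps_unit_iff:
  fixes u :: "'a::field fps fps"
  shows "u dvd 1 \<longleftrightarrow> u $ 0 $ 0 \<noteq> 0"
proof
  assume "u dvd 1"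
  then obtain v where "1 = u * v" by (auto simp: dvd_def)
  from arg_cong[OF this, of "\<lambda>f. f $ 0 $ 0"] show "u $ 0 $ 0 \<noteq> 0" by auto
next
  assume "u $ 0 $ 0 \<noteq> 0"
  then have "u $ 0 * inverse (u $ 0) = 1" by (simp add: inverse_mult_eq_1')
  from fps_right_inverse[OF this] show "u dvd 1" by (metis dvd_triv_left)
qed

section \<open>Weierstrass division and preparation\<close>

text \<open>The coefficient at x^k of the Weierstrass quotient of h by F: what the earlier
  coefficients leave of \<open>h $ k\<close> is divided by y^m, and V is meant to be the inverse of
  the unit factor of \<open>F $ 0\<close>.\<close>

fun wq :: "'a::field fps fps \<Rightarrow> nat \<Rightarrow> 'a fps \<Rightarrow> 'a fps fps \<Rightarrow> nat \<Rightarrow> 'a fps" where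
  "wq F m V h k = fps_shift m (h $ k - (\<Sum>j<k. wq F m V h j * F $ (k - j))) * V"

declare wq.simps [simp del]

text \<open>As \<open>F $ 0\<close> is y^m times a unit, the equation can be solved exactly, one
  power of x after the other.\<close>

lemma weierstrass_division:
  fixes F h :: "'a::field fps fps"
  assumes F: "F $ 0 \<noteq> 0" and m: "m = subdegree (F $ 0)"
  shows "\<exists>q r. h = q * F + conv r \<and> (\<forall>j\<ge>m. coeff r j = 0)"
proof -
  define U where "U = fps_shift m (F $ 0)"
  have F0: "F $ 0 = U * fps_X ^ m" unfolding U_def m by (rule subdegree_decompose)
  have "U $ 0 \<noteq> 0" using F by (simp add: U_def m)
  then have U: "inverse U * U = 1" by (simp add: inverse_mult_eq_1)
  let ?q = "wq F m (inverse U) h"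
  \<comment> \<open>What is left of h at x^k: the part from y^m on is absorbed by the quotient, the
    part below becomes the remainder.\<close>
  define e where "e k = h $ k - (\<Sum>j<k. ?q j * F $ (k - j))" for k
  define r where "r = (\<Sum>j<m. monom (Abs_fps (\<lambda>k. e k $ j)) j)"
  have coeff_r: "coeff r j = (if j < m then Abs_fps (\<lambda>k. e k $ j) else 0)" for j
    by (simp add: r_def coeff_sum)
  have q: "?q k = fps_shift m (e k) * inverse U" for k
    unfolding e_def by (rule wq.simps)
  have "h = Abs_fps ?q * F + conv r"
  proof (rule fps_ext)
    fix k
    have "(Abs_fps ?q * F) $ k = (\<Sum>j<k. ?q j * F $ (k - j)) + ?q k * F $ 0"
      by (simp add: fps_mult_nth atLeast0AtMost lessThan_Suc_atMost[symmetric])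
    also have "?q k * F $ 0 = fps_shift m (e k) * fps_X ^ m"
      unfolding q F0 using U by (simp add: mult.assoc mult.left_commute mult.commute[of U])
    also have "(\<Sum>j<k. ?q j * F $ (k - j)) = h $ k - e k" by (simp add: e_def)
    finally have 1: "(Abs_fps ?q * F) $ k = h $ k - e k + fps_shift m (e k) * fps_X ^ m" .
    have "conv r $ k = e k - fps_shift m (e k) * fps_X ^ m"
      by (rule fps_ext) (auto simp: coeff_r fps_X_power_mult_right_nth)
    then show "h $ k = (Abs_fps ?q * F + conv r) $ k" using 1 by simp
  qed
  then show ?thesis using coeff_r by (intro exI[of _ "Abs_fps ?q"] exI[of _ r]) auto
qed

text \<open>At the first power of x where q does not vanish, the product with \<open>F $ 0\<close>
  has y-order at least m, while the remainder has y-degree below m; they cannot cancel.\<close>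

lemma weierstrass_unique:
  fixes F q :: "'a::field fps fps"
  assumes F: "F $ 0 \<noteq> 0" and m: "m = subdegree (F $ 0)"
    and eq: "q * F + conv r = 0" and r: "\<And>j. j \<ge> m \<Longrightarrow> coeff r j = 0"
  shows "q = 0 \<and> r = 0"
proof -
  have main: "q $ k = 0 \<and> conv r $ k = 0" for k
  proof (induction k rule: less_induct)
    case (less k)
    have "(q * F) $ k = (\<Sum>j\<le>k. q $ j * F $ (k - j))" by (simp add: fps_mult_nth atLeast0AtMost)
    also have "\<dots> = (\<Sum>j\<in>{k}. q $ j * F $ (k - j))"
      using less by (intro sum.mono_neutral_right) auto
    finally have qF: "(q * F) $ k = q $ k * F $ 0" by simp
    have sum0: "q $ k * F $ 0 + conv r $ k = 0" using arg_cong[OF eq, of "\<lambda>f. f $ k"] qF by simp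
    have "q $ k = 0"
    proof (rule ccontr)
      assume nz: "q $ k \<noteq> 0"
      define s where "s = subdegree (q $ k * F $ 0)"
      have "s \<ge> m" using nz F by (simp add: s_def m)
      then have "conv r $ k $ s = 0" using r by simp
      moreover have "(q $ k * F $ 0) $ s \<noteq> 0"
        unfolding s_def using nz F by (intro nth_subdegree_nonzero) auto
      ultimately show False using arg_cong[OF sum0, of "\<lambda>f. f $ s"] by simp
    qed
    then show ?case using sum0 by simp
  qed
  then have "q = 0" "conv r = 0" by (auto simp: fps_eq_iff)
  then show ?thesis by (simp add: conv_eq_0_iff)
qed

definition wpoly :: "'a::field fps poly \<Rightarrow> bool" where
  "wpoly W \<longleftrightarrow> lead_coeff W = 1 \<and> (\<forall>j<degree W. coeff W j $ 0 = 0)"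

lemma wpoly_conv_0: assumes "wpoly W" shows "conv W $ 0 = fps_X ^ degree W"
proof (rule fps_ext)
  fix j
  show "conv W $ 0 $ j = (fps_X ^ degree W) $ j"
    using assms by (cases j "degree W" rule: linorder_cases) (auto simp: wpoly_def coeff_eq_0)
qed

text \<open>Divide y^m by F. At x = 0 the remainder must vanish since \<open>F $ 0\<close> has order
  m, so the quotient q is a unit and y^m - r = q F is the required polynomial.\<close>

lemma weierstrass_preparation:
  fixes F :: "'a::field fps fps"
  assumes F: "F $ 0 \<noteq> 0"
  shows "\<exists>U W. U $ 0 $ 0 \<noteq> 0 \<and> F = U * conv W \<and> wpoly W \<and> degree W = subdegree (F $ 0)"
proof -
  let ?m = "subdegree (F $ 0)"
  obtain q r where qr: "varY ^ ?m = q * F + conv r" "\<And>j. j \<ge> ?m \<Longrightarrow> coeff r j = 0"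
    using weierstrass_division[OF F refl] by blast
  have e0: "fps_X ^ ?m = q $ 0 * F $ 0 + conv r $ 0"
    using arg_cong[OF qr(1), of "\<lambda>f. f $ 0"] by (simp add: rhom_power[OF rhom_nth0])
  have r0: "coeff r j $ 0 = 0" if "j < ?m" for j
  proof -
    have "(q $ 0 * F $ 0) $ j = 0"
      using that by (intro fps_mult_nth_outside_subdegrees(2)) auto
    then show ?thesis using arg_cong[OF e0, of "\<lambda>f. f $ j"] that by simp
  qed
  then have "conv r $ 0 = 0" using qr(2) by (intro fps_ext) (metis conv_nth fps_zero_nth not_le)
  then have e: "fps_X ^ ?m = q $ 0 * F $ 0" using e0 by simp
  then have "q $ 0 \<noteq> 0" by auto
  then have "subdegree (q $ 0) + ?m = ?m" using F arg_cong[OF e, of subdegree] by simp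
  then have "q $ 0 $ 0 \<noteq> 0" using \<open>q $ 0 \<noteq> 0\<close> by (simp add: subdegree_eq_0_iff)
  then have "q dvd 1" by (simp add: fps_unit_iff)
  then obtain U where U: "1 = q * U" by (auto simp: dvd_def)
  define W where "W = monom 1 ?m - r"
  have "conv (monom 1 ?m :: 'a fps poly) = varY ^ ?m"
  proof -
    have "conv [:0, 1:: 'a fps:] = varY"
      by (simp add: conv_pCons rhomD[OF rhom_conv] rhomD[OF rhom_embx])
    then show ?thesis
      using rhom_power[OF rhom_conv, of "[:0, 1::'a fps:]" ?m]
      by (simp only: monom_altdef smult_1_left)
  qed
  then have "conv W = q * F" using qr(1) by (simp add: W_def rhomD[OF rhom_conv])
  then have "U * conv W = (q * U) * F" by (simp only: mult_ac)
  then have "U * conv W = F" by (simp only: U[symmetric] mult_1_left)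
  moreover have cW: "coeff W ?m = 1" "\<And>j. j > ?m \<Longrightarrow> coeff W j = 0"
    using qr(2) by (auto simp: W_def)
  have dW: "degree W = ?m"
    using cW by (metis degree_le le_antisym le_degree zero_neq_one)
  moreover have "wpoly W"
    using cW dW r0 by (auto simp: wpoly_def W_def)
  moreover have "U $ 0 $ 0 \<noteq> 0"
    using U fps_unit_iff[of U] by (metis dvd_triv_right)
  ultimately show ?thesis by metis
qed

lemma monic_division:
  fixes f g :: "'a::idom poly"
  assumes "lead_coeff g = 1"
  shows "\<exists>q r. f = g * q + r \<and> (r = 0 \<or> degree r < degree g)"
proof -
  have "g \<noteq> 0" using assms by auto
  obtain q r where "pseudo_divmod f g = (q, r)" by force
  from pseudo_divmod[OF \<open>g \<noteq> 0\<close> this] assms show ?thesis by auto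
qed

text \<open>Polynomial division by W is also a Weierstrass division, so by uniqueness divisibility
  among power series is already divisibility among polynomials.\<close>

lemma wpoly_dvd_conv:
  fixes W p :: "'a::field fps poly"
  assumes W: "wpoly W" and p: "conv p = q * conv W"
  shows "\<exists>g. p = W * g"
proof -
  obtain g r where gr: "p = W * g + r" "r = 0 \<or> degree r < degree W"
    using monic_division[of W p] W by (auto simp: wpoly_def)
  have F: "conv W $ 0 \<noteq> 0" and m: "degree W = subdegree (conv W $ 0)"
    by (simp_all add: wpoly_conv_0[OF W] fps_X_power_subdegree)
  have "(conv g - q) * conv W + conv r = 0"
    using arg_cong[OF gr(1), of conv] p by (simp add: rhomD[OF rhom_conv] algebra_simps)
  then have "r = 0"
    using weierstrass_unique[OF F m] gr(2) by (metis coeff_0 coeff_eq_0 order.strict_trans2)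
  then show ?thesis using gr by auto
qed

section \<open>Puiseux roots\<close>

abbreviation xpow :: "nat \<Rightarrow> 'a::comm_ring_1 fps \<Rightarrow> 'a fps" where
  "xpow n a \<equiv> a oo fps_X ^ n"

lemma rhom_xpow: "n > 0 \<Longrightarrow> is_rhom (xpow n :: 'a::idom fps \<Rightarrow> _)"
  by (rule rhom_compose) simp

lemma xpow_X: "n > 0 \<Longrightarrow> xpow n (fps_X ^ k) = (fps_X ^ (n * k) :: 'a::idom fps)"
  by (simp add: fps_X_power_compose power_mult)

lemma xpow_xpow: "n > 0 \<Longrightarrow> m > 0 \<Longrightarrow> xpow n (xpow m a) = xpow (n * m) (a :: 'a::idom fps)"
  using fps_compose_assoc[of "fps_X ^ n" "fps_X ^ m :: 'a fps" a] by (simp add: xpow_X)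

lemma xpow_nth: "n > 0 \<Longrightarrow> xpow n (a::'a::idom fps) $ k = (if n dvd k then a $ (k div n) else 0)"
proof -
  assume n: "n > 0"
  have "xpow n a $ k = (\<Sum>i=0..k. a $ i * (if k = n * i then 1 else 0))"
    by (simp add: fps_compose_nth flip: power_mult)
  also have "\<dots> = (\<Sum>i=0..k. if i = k div n then (if n dvd k then a $ i else 0) else 0)"
    using n by (intro sum.cong) auto
  also have "\<dots> = (if n dvd k then a $ (k div n) else 0)" by (simp add: div_le_dividend)
  finally show ?thesis .
qed

lemma inj_xpow: "n > 0 \<Longrightarrow> inj (xpow n :: 'a::idom fps \<Rightarrow> _)"
proof (rule injI)
  fix a b :: "'a fps" assume n: "n > 0" and e: "xpow n a = xpow n b"
  show "a = b"
  proof (rule fps_ext)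
    fix k show "a $ k = b $ k" using arg_cong[OF e, of "\<lambda>f. f $ (n * k)"] n by (simp add: xpow_nth)
  qed
qed

lemma subdegree_xpow: "n > 0 \<Longrightarrow> subdegree (xpow n (a::'a::idom fps)) = n * subdegree a"
  by (simp add: fps_X_power_subdegree)

lemma xpow_nth_0: "n > 0 \<Longrightarrow> xpow n (a::'a::idom fps) $ 0 = a $ 0"
  by (simp add: xpow_nth)

text \<open>The second coefficient is what the Tschirnhausen shift annihilates; it later shows that
  a reduction is not an n-th power of a linear polynomial.\<close>

lemma pcompose_shift_coeffs:
  fixes p :: "'a::idom poly"
  assumes "degree p \<le> n"
  shows "coeff (p \<circ>\<^sub>p [:b, 1:]) n = coeff p n"
    and "n > 0 \<Longrightarrow> coeff (p \<circ>\<^sub>p [:b, 1:]) (n - 1) = coeff p (n - 1) + of_nat n * b * coeff p n"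
proof -
  have "coeff (p \<circ>\<^sub>p [:b, 1:]) n = coeff p n \<and>
    (n > 0 \<longrightarrow> coeff (p \<circ>\<^sub>p [:b, 1:]) (n - 1) = coeff p (n - 1) + of_nat n * b * coeff p n)"
    using assms
  proof (induction p arbitrary: n)
    case 0
    then show ?case by simp
  next
    case (pCons a p)
    show ?case
    proof (cases n)
      case 0
      then have "p = 0" using pCons.prems by (auto split: if_splits)
      then show ?thesis using 0 by (simp add: pcompose_pCons)
    next
      case (Suc m)
      then have d: "degree p \<le> m" using pCons.prems by (auto split: if_splits)
      note IH = pCons.IH[OF d]
      have hi: "coeff (p \<circ>\<^sub>p [:b, 1:]) n = 0"
        using d Suc degree_pcompose_le[of p "[:b,1:]"] by (intro coeff_eq_0) (auto simp: degree_pCons_eq_if)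
      have c: "coeff (pCons a p \<circ>\<^sub>p [:b, 1:]) k = coeff [:a:] k + (b * coeff (p \<circ>\<^sub>p [:b, 1:]) k
           + (case k of 0 \<Rightarrow> 0 | Suc j \<Rightarrow> coeff (p \<circ>\<^sub>p [:b, 1:]) j))" for k
        by (simp add: pcompose_pCons coeff_pCons split: nat.split)
      have 0: "coeff p n = 0" using d Suc by (intro coeff_eq_0) auto
      show ?thesis
        using IH Suc hi 0 unfolding c by (cases m) (auto simp: algebra_simps coeff_pCons)
    qed
  qed
  then show "coeff (p \<circ>\<^sub>p [:b, 1:]) n = coeff p n"
    and "n > 0 \<Longrightarrow> coeff (p \<circ>\<^sub>p [:b, 1:]) (n - 1) = coeff p (n - 1) + of_nat n * b * coeff p n"
    by auto
qed

lemma monic_pcompose_shift: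
  fixes p :: "'a::idom poly"
  assumes "lead_coeff p = 1"
  shows "degree (p \<circ>\<^sub>p [:b, 1:]) = degree p" "lead_coeff (p \<circ>\<^sub>p [:b, 1:]) = 1"
  using assms pcompose_shift_coeffs(1)[OF order_refl, of p b] by (simp_all add: degree_pcompose)

lemma map_poly_pcompose_shift:
  assumes h: "is_rhom h"
  shows "map_poly h (p \<circ>\<^sub>p [:b, 1:]) = map_poly h p \<circ>\<^sub>p [:h b, 1:]"
proof (induction p)
  case (pCons a p)
  have "map_poly h (pCons a p \<circ>\<^sub>p [:b, 1:]) = [:h a:] + [:h b, 1:] * map_poly h (p \<circ>\<^sub>p [:b, 1:])"
    unfolding pcompose_pCons rhom_add[OF rhom_map_poly[OF h]] rhom_mult[OF rhom_map_poly[OF h]]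
    by (simp only: map_poly_linear[OF h]) (simp add: map_poly_pCons rhom_0[OF h])
  then show ?case using pCons by (simp add: map_poly_pCons rhom_0[OF h] pcompose_pCons)
qed auto

section \<open>The Newton-Puiseux algorithm\<close>

definition has_puiseux_root :: "'a::field fps poly \<Rightarrow> bool" where
  "has_puiseux_root p \<longleftrightarrow> (\<exists>N>0. \<exists>\<alpha>. poly (map_poly (xpow N) p) \<alpha> = 0)"

lemma has_puiseux_root_shift:
  assumes "has_puiseux_root (p \<circ>\<^sub>p [:b, 1:])" shows "has_puiseux_root (p :: 'a::field fps poly)"
proof -
  obtain N \<alpha> where N: "N > 0" "poly (map_poly (xpow N) (p \<circ>\<^sub>p [:b, 1:])) \<alpha> = 0"
    using assms by (auto simp: has_puiseux_root_def)
  note h = rhom_xpow[OF N(1)]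
  have "map_poly (xpow N) (p \<circ>\<^sub>p [:b, 1:]) = map_poly (xpow N) p \<circ>\<^sub>p [:xpow N b, 1:]"
    by (rule map_poly_pcompose_shift[OF h])
  then have "poly (map_poly (xpow N) p) (xpow N b + \<alpha>) = 0"
    using N(2) by (simp add: poly_pcompose)
  then show ?thesis using N(1) by (auto simp: has_puiseux_root_def)
qed

lemma has_puiseux_root_mult:
  assumes "has_puiseux_root p" shows "has_puiseux_root (p * q :: 'a::field fps poly)"
proof -
  obtain N \<alpha> where N: "N > 0" "poly (map_poly (xpow N) p) \<alpha> = 0"
    using assms by (auto simp: has_puiseux_root_def)
  then have "poly (map_poly (xpow N) (p * q)) \<alpha> = 0"
    by (simp add: rhom_mult[OF rhom_map_poly[OF rhom_xpow]])
  then show ?thesis using N(1) by (auto simp: has_puiseux_root_def)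
qed

text \<open>The substitution \<open>x = t\<^sup>d\<close>, \<open>y = t\<^sup>e Y\<close> followed by division by \<open>t\<^sup>(\<^sup>n\<^sup>e\<^sup>)\<close>.\<close>

lemma has_puiseux_root_rescale:
  fixes p p' :: "'a::field fps poly"
  assumes d: "d > 0" and n: "degree p \<le> n" "degree p' \<le> n"
    and c: "\<And>j. j \<le> n \<Longrightarrow> xpow d (coeff p j) = fps_X ^ (e * (n - j)) * coeff p' j"
    and root: "has_puiseux_root p'"
  shows "has_puiseux_root p"
proof -
  obtain N \<beta> where N: "N > 0" "poly (map_poly (xpow N) p') \<beta> = 0"
    using root by (auto simp: has_puiseux_root_def)
  note h = rhom_xpow[OF N(1), where 'a = 'a]
  have pp: "poly (map_poly (xpow k) q) z = (\<Sum>j\<le>n. xpow k (coeff q j) * z ^ j)"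
    if "degree q \<le> n" "k > 0" for q :: "'a fps poly" and z k
  proof -
    have "degree (map_poly (xpow k) q) \<le> n"
      using degree_map_poly_le[of "xpow k" q] that by simp
    then show ?thesis
      using that by (simp add: poly_altdef_le coeff_map_poly)
  qed
  have "poly (map_poly (xpow (N * d)) p) (fps_X ^ (N * e) * \<beta>)
      = (\<Sum>j\<le>n. xpow N (xpow d (coeff p j)) * (fps_X ^ (N * e) * \<beta>) ^ j)"
    using N d n by (simp add: pp xpow_xpow)
  also have "\<dots> = (\<Sum>j\<le>n. fps_X ^ (N * e * n) * (xpow N (coeff p' j) * \<beta> ^ j))"
  proof (intro sum.cong refl)
    fix j assume "j \<in> {..n}"
    then have j: "j \<le> n" by simp
    have "N * e * n = N * (e * (n - j)) + N * e * j" using j by (simp add: algebra_simps diff_mult_distrib2)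
    then show "xpow N (xpow d (coeff p j)) * (fps_X ^ (N * e) * \<beta>) ^ j = fps_X ^ (N * e * n) * (xpow N (coeff p' j) * \<beta> ^ j)"
      unfolding c[OF j] rhom_mult[OF h] xpow_X[OF N(1)]
      by (simp only: power_add power_mult power_mult_distrib mult_ac)
  qed
  also have "\<dots> = 0"
    using N n by (simp add: pp flip: sum_distrib_left)
  finally show ?thesis using N d by (auto simp: has_puiseux_root_def intro!: exI[of _ "N * d"])
qed


text \<open>Let c be a root of the reduction at x = 0. Full multiplicity n would force n c = 0
  through the vanishing second coefficient, hence c = 0, against the nonzero coefficient i. So c has
  multiplicity k with 0 < k < n, and Weierstrass preparation around c splits off a factor of degree
  k, in the role of Hensel's lemma.\<close>

lemma puiseux_root_step:
  fixes p :: "'a::{alg_closed_field,field_char_0} fps poly"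
  assumes p: "lead_coeff p = 1" "coeff p (degree p - 1) = 0" "i < degree p" "coeff p i $ 0 \<noteq> 0"
    and IH: "\<And>q :: 'a fps poly. lead_coeff q = 1 \<Longrightarrow> 0 < degree q \<Longrightarrow> degree q < degree p \<Longrightarrow> has_puiseux_root q"
  shows "has_puiseux_root p"
proof -
  let ?n = "degree p"
  define pb where "pb = map_poly (\<lambda>c. c $ 0) p"
  have h: "is_rhom (\<lambda>c::'a fps. c $ 0)" by (rule rhom_nth0)
  have pb: "degree pb = ?n" "lead_coeff pb = 1"
    unfolding pb_def using monic_map_poly[OF h p(1)] by auto
  obtain c where c: "poly pb c = 0" using alg_closed_imp_poly_has_root[of pb] pb p(3) by auto
  define p3 where "p3 = p \<circ>\<^sub>p [:fps_const c, 1:]"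
  have p3: "degree p3 = ?n" "lead_coeff p3 = 1"
    unfolding p3_def using monic_pcompose_shift[OF p(1)] by auto
  have red: "map_poly (\<lambda>c. c $ 0) p3 = pb \<circ>\<^sub>p [:c, 1:]"
    unfolding p3_def pb_def using map_poly_pcompose_shift[OF h] by simp
  have F0: "conv p3 $ 0 $ 0 = 0"
  proof -
    have "conv p3 $ 0 $ 0 = coeff (pb \<circ>\<^sub>p [:c, 1:]) 0"
      using arg_cong[OF red, of "\<lambda>q. coeff q 0"] by (simp add: coeff_map_poly)
    also have "\<dots> = poly (pb \<circ>\<^sub>p [:c, 1:]) 0" by (simp add: poly_0_coeff_0)
    also have "\<dots> = 0" using c by (simp add: poly_pcompose)
    finally show ?thesis .
  qed
  have Fn: "conv p3 $ 0 $ ?n \<noteq> 0" using p3 by simp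
  then have F: "conv p3 $ 0 \<noteq> 0" by (metis fps_zero_nth)
  define k where "k = subdegree (conv p3 $ 0)"
  have "k \<le> ?n" unfolding k_def using Fn by (rule subdegree_leI)
  moreover have "k \<noteq> ?n"
  proof
    assume k: "k = ?n"
    have z: "coeff p3 j $ 0 = 0" if "j < ?n" for j
      using nth_less_subdegree_zero[of j "conv p3 $ 0"] that k by (simp add: k_def)
    have "coeff p3 (?n - 1) = of_nat ?n * fps_const c"
      unfolding p3_def using pcompose_shift_coeffs(2)[of p ?n "fps_const c"] p by simp
    then have "of_nat ?n * c = 0" using z[of "?n - 1"] p(3) by (simp add: fps_of_nat[symmetric])
    then have "c = 0" using p(3) by simp
    then have "p3 = p" by (simp add: p3_def)
    then show False using z p by auto
  qed
  ultimately have "k < ?n" by simp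
  moreover have "k > 0" using F0 F by (simp add: k_def subdegree_eq_0_iff zero_less_iff_neq_zero)
  moreover obtain U W where UW: "conv p3 = U * conv W" "wpoly W" "degree W = k"
    using weierstrass_preparation[OF F] k_def by auto
  ultimately have "has_puiseux_root W" using IH[of W] by (auto simp: wpoly_def)
  moreover obtain g where "p3 = W * g" using wpoly_dvd_conv[OF UW(2,1)] by blast
  ultimately have "has_puiseux_root p3" by (simp add: has_puiseux_root_mult)
  then show ?thesis unfolding p3_def by (rule has_puiseux_root_shift)
qed

text \<open>Tschirnhausen shift, then a rescaling along the flattest edge of the Newton polygon at
  (n, 0). The result has integral coefficients and a reduction that is not a pure power, so
  \<open>puiseux_root_step\<close> lowers the degree.\<close>

lemma puiseux_root:
  fixes p :: "'a::{alg_closed_field,field_char_0} fps poly"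
  assumes "lead_coeff p = 1" "degree p > 0"
  shows "has_puiseux_root p"
  using assms
proof (induction "degree p" arbitrary: p rule: less_induct)
  case (less p)
  define n where "n = degree p"
  have n: "n > 0" using less.prems by (simp add: n_def)
  \<comment> \<open>The shift that removes the second coefficient; division by n needs
    characteristic zero.\<close>
  define b where "b = - (fps_const (1 / of_nat n) * coeff p (n - 1))"
  define p1 where "p1 = p \<circ>\<^sub>p [:b, 1:]"
  have p1: "degree p1 = n" "lead_coeff p1 = 1"
    unfolding p1_def n_def using monic_pcompose_shift[OF less.prems(1)] by auto
  have "of_nat n * b = - (fps_const (of_nat n * (1 / of_nat n)) * coeff p (n - 1))"
    by (simp only: b_def fps_of_nat[symmetric] mult_minus_right mult.assoc[symmetric] fps_const_mult)
  also have "\<dots> = - coeff p (n - 1)" using n by simp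
  finally have nb: "of_nat n * b = - coeff p (n - 1)" .
  have t: "coeff p1 (n - 1) = 0"
    unfolding p1_def using pcompose_shift_coeffs(2)[of p n b] nb less.prems n by (simp add: n_def)
  have "has_puiseux_root p1"
  proof (cases "\<exists>j<n. coeff p1 j \<noteq> 0")
    case False
    then have "poly (map_poly (xpow 1) p1) 0 = 0"
      using n by (simp add: poly_0_coeff_0 coeff_map_poly)
    then show ?thesis unfolding has_puiseux_root_def by (intro exI[of _ 1]) auto
  next
    case True
    define J where "J = {j. j < n \<and> coeff p1 j \<noteq> 0}"
    define slope where "slope j = real (subdegree (coeff p1 j)) / real (n - j)" for j
    have "finite J" "J \<noteq> {}" using True by (auto simp: J_def)
    then obtain j0 where j0: "j0 \<in> J" "\<And>j. j \<in> J \<Longrightarrow> slope j0 \<le> slope j"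
      using ex_min_if_finite[of "slope ` J"] by (auto simp: not_less)
    \<comment> \<open>Minimal slope e / d: after x = t^d, y = t^e Y all coefficients stay integral,
      and the one at j0 becomes a unit.\<close>
    define e d where "e = subdegree (coeff p1 j0)" and "d = n - j0"
    have d: "d > 0" using j0 by (auto simp: d_def J_def)
    have sl: "e * (n - j) \<le> d * subdegree (coeff p1 j)" if "j \<in> J" for j
    proof -
      have nj: "n - j > 0" using that by (auto simp: J_def)
      have "real e / real d \<le> real (subdegree (coeff p1 j)) / real (n - j)"
        using j0(2)[OF that] by (simp add: slope_def e_def d_def)
      then have "real e * real (n - j) \<le> real d * real (subdegree (coeff p1 j))"
        using d nj by (simp add: field_simps del: of_nat_diff)
      then show ?thesis by (simp only: of_nat_mult[symmetric] of_nat_le_iff)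
    qed
    define c' where "c' j = fps_shift (e * (n - j)) (xpow d (coeff p1 j))" for j
    have c': "xpow d (coeff p1 j) = fps_X ^ (e * (n - j)) * c' j" if "j \<le> n" for j
    proof (cases "coeff p1 j = 0")
      case False
      have "e * (n - j) \<le> subdegree (xpow d (coeff p1 j))"
        using sl[of j] that False d by (cases "j = n") (auto simp: subdegree_xpow J_def mult.commute)
      from fps_shift_times_fps_X_power[OF this] show ?thesis
        unfolding c'_def by (metis mult.commute)
    qed (simp add: c'_def)
    define p' where "p' = (\<Sum>j\<le>n. monom (c' j) j)"
    have cp': "coeff p' j = (if j \<le> n then c' j else 0)" for j
      by (simp add: p'_def coeff_sum)
    have "c' n = 1" using p1 by (simp add: c'_def)
    then have dp': "degree p' = n" using cp'
      by (metis degree_le le_antisym le_degree not_le order.refl zero_neq_one)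
    have "has_puiseux_root p'"
    proof (rule puiseux_root_step[where i = j0])
      show "lead_coeff p' = 1" using dp' cp' \<open>c' n = 1\<close> by simp
      show "coeff p' (degree p' - 1) = 0" using t by (simp add: dp' cp' c'_def)
      show "j0 < degree p'" using j0 by (simp add: dp' J_def)
      have "subdegree (xpow d (coeff p1 j0)) = e * (n - j0)"
        using d by (simp add: subdegree_xpow e_def d_def)
      moreover have "xpow d (coeff p1 j0) \<noteq> 0"
        using j0 inj_xpow[OF d] rhom_0[OF rhom_xpow[OF d]] by (metis (mono_tags, lifting) J_def inj_eq mem_Collect_eq)
      ultimately have "c' j0 $ 0 \<noteq> 0" unfolding c'_def
        by (metis add_0 fps_shift_nth nth_subdegree_nonzero)
      then show "coeff p' j0 $ 0 \<noteq> 0" using j0 by (simp add: cp' J_def)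
      show "has_puiseux_root q" if "lead_coeff q = 1" "0 < degree q" "degree q < degree p'" for q :: "'a fps poly"
        using less.hyps[of q] that dp' n_def by auto
    qed
    then show ?thesis
      using has_puiseux_root_rescale[OF d, of p1 n p' e] p1 dp' c' cp' by simp
  qed
  then show ?case unfolding p1_def by (rule has_puiseux_root_shift)
qed

lemma monic_mult_left:
  fixes p q :: "'a::idom poly"
  assumes "lead_coeff (p * q) = 1" "lead_coeff p = 1"
  shows "lead_coeff q = 1" "degree (p * q) = degree p + degree q"
proof -
  show "lead_coeff q = 1" using assms by (simp add: lead_coeff_mult)
  then show "degree (p * q) = degree p + degree q" using assms by (intro degree_mult_eq) auto
qed

text \<open>Each further root may need a further ramification, whence the product of exponents. A
  list is used because repeated roots are still possible here.\<close>

theorem puiseux_split: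
  fixes p :: "'a::{alg_closed_field,field_char_0} fps poly"
  assumes "lead_coeff p = 1"
  shows "\<exists>N>0. \<exists>as. map_poly (xpow N) p = (\<Prod>a\<leftarrow>as. [:- a, 1:])"
  using assms
proof (induction "degree p" arbitrary: p)
  case 0
  then have "p = 1" by (metis degree_eq_zeroE lead_coeff_pCons(2) one_pCons pCons_eq_0_iff)
  then show ?case by (intro exI[of _ 1] conjI exI[of _ "[]"]) (auto simp: rhom_1[OF rhom_map_poly[OF rhom_xpow]])
next
  case (Suc n)
  obtain N \<alpha> where N: "N > 0" "poly (map_poly (xpow N) p) \<alpha> = 0"
    using puiseux_root[of p] Suc by (auto simp: has_puiseux_root_def)
  then obtain q where q: "map_poly (xpow N) p = [:- \<alpha>, 1:] * q"
    unfolding poly_eq_0_iff_dvd by auto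
  have l: "lead_coeff (map_poly (xpow N) p) = 1" "degree (map_poly (xpow N) p) = Suc n"
    using monic_map_poly[OF rhom_xpow[OF N(1)] Suc.prems] Suc.hyps by auto
  have lq: "lead_coeff q = 1" and dq: "n = degree q"
    using monic_mult_left[of "[:- \<alpha>, 1:]" q] l q by auto
  obtain M as where M: "M > 0" "map_poly (xpow M) q = (\<Prod>a\<leftarrow>as. [:- a, 1:])"
    using Suc.hyps(1)[OF dq lq] by auto
  note h = rhom_xpow[OF M(1)]
  have "map_poly (xpow (M * N)) p = map_poly (xpow M) (map_poly (xpow N) p)"
    using M N by (subst map_poly_map_poly) (auto simp: xpow_xpow o_def)
  also have "\<dots> = [:- xpow M \<alpha>, 1:] * map_poly (xpow M) q"
    by (simp only: q rhom_mult[OF rhom_map_poly[OF h]] map_poly_linear[OF h] rhom_minus[OF h])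
  also have "\<dots> = (\<Prod>a\<leftarrow>xpow M \<alpha> # as. [:- a, 1:])" by (simp only: M list.map prod_list.Cons)
  finally have "map_poly (xpow (M * N)) p = (\<Prod>a\<leftarrow>xpow M \<alpha> # as. [:- a, 1:])" .
  moreover have "M * N > 0" using M N by simp
  ultimately show ?case by blast
qed

section \<open>Roots of unity and the Galois action\<close>

text \<open>Induction on N = p M. If p divides M, a p-th root of a primitive M-th root serves.
  Otherwise p and M are coprime and a root of 1 + X + ... + X^(p-1) is multiplied in; it differs
  from 1 because p is nonzero in K.\<close>

lemma primitive_root_of_unity_exists:
  assumes "N > 0" shows "\<exists>\<zeta>::'a::{alg_closed_field,field_char_0}. \<forall>k. \<zeta> ^ k = 1 \<longleftrightarrow> N dvd k"
  using assms
proof (induction N rule: less_induct)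
  case (less N)
  show ?case
  proof (cases "N = 1")
    case True
    then show ?thesis by (intro exI[of _ 1]) auto
  next
    case False
    then obtain p where p: "Factorial_Ring.prime p" "p dvd N" using prime_factor_nat by blast
    then obtain M where M: "N = p * M" by (auto simp: dvd_def)
    have p0: "p > 1" using p prime_gt_1_nat by auto
    have "M < N" "M > 0" using M less.prems p0 by auto
    then obtain \<zeta> :: 'a where \<zeta>: "\<And>k. \<zeta> ^ k = 1 \<longleftrightarrow> M dvd k" using less.IH by blast
    show ?thesis
    proof (cases "p dvd M")
      case True
      obtain \<eta> where \<eta>: "\<eta> ^ p = \<zeta>" using nth_root_exists[of p \<zeta>] p0 by auto
      have \<eta>': "\<eta> ^ (p * k) = \<zeta> ^ k" for k by (simp add: power_mult \<eta>)
      have "\<eta> ^ k = 1 \<longleftrightarrow> N dvd k" for k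
      proof
        assume k: "\<eta> ^ k = 1"
        then have "\<zeta> ^ k = 1" using \<eta>'[of k] by (simp add: mult.commute power_mult)
        then have "p dvd k" using \<zeta> True by (meson dvd_trans)
        then obtain k' where "k = p * k'" by (auto simp: dvd_def)
        then show "N dvd k" using k \<eta>' \<zeta> M by auto
      next
        assume "N dvd k"
        then obtain j where "k = p * (M * j)" using M by (auto simp: dvd_def mult.assoc)
        then have "\<eta> ^ k = \<zeta> ^ (M * j)" using \<eta>' by simp
        then show "\<eta> ^ k = 1" using \<zeta> by auto
      qed
      then show ?thesis by blast
    next
      case False
      then have cop: "coprime p M" using p prime_imp_coprime by blast
      define q where "q = (\<Sum>i<p. monom (1::'a) i)"
      have "coeff q (p - 1) = 1" using p0 by (simp add: q_def coeff_sum)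
      then have "degree q > 0" using p0 le_degree[of q "p - 1"] by auto
      then obtain \<omega> where "poly q \<omega> = 0" using alg_closed_imp_poly_has_root by blast
      then have sum0: "(\<Sum>i<p. \<omega> ^ i) = 0" by (simp add: q_def poly_sum poly_monom)
      then have \<omega>p: "\<omega> ^ p = 1" using power_diff_1_eq[of \<omega> p] by simp
      have \<omega>1: "\<omega> \<noteq> 1" using sum0 p0 by auto
      have \<omega>k: "p dvd k" if "\<omega> ^ k = 1" for k
      proof (rule ccontr)
        assume nd: "\<not> p dvd k"
        then have "gcd k p = 1" using p prime_imp_coprime by (metis coprime_iff_gcd_eq_1 gcd.commute)
        moreover have "k \<noteq> 0" using nd by (metis dvd_0_right)
        ultimately obtain x y where "k * x = p * y + 1" using bezout_nat[of k p] by auto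
        then have "(\<omega> ^ k) ^ x = (\<omega> ^ p) ^ y * \<omega>" by (metis power_add power_mult power_one_right)
        then show False using that \<omega>p \<omega>1 by simp
      qed
      have "(\<omega> * \<zeta>) ^ k = 1 \<longleftrightarrow> N dvd k" for k
      proof
        assume k: "(\<omega> * \<zeta>) ^ k = 1"
        have "((\<omega> * \<zeta>) ^ k) ^ p = (\<omega> ^ p) ^ k * \<zeta> ^ (p * k)"
          by (simp add: power_mult_distrib mult.commute flip: power_mult)
        then have "\<zeta> ^ (p * k) = 1" using k \<omega>p by simp
        then have Mk: "M dvd k" using \<zeta> cop by (metis coprime_commute coprime_dvd_mult_right_iff)
        then have "\<omega> ^ k = 1" using k \<zeta>[of k] by (simp add: power_mult_distrib)
        then show "N dvd k" using \<omega>k Mk cop M divides_mult by blast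
      next
        assume "N dvd k"
        then obtain j where j: "k = p * M * j" using M by (auto simp: dvd_def)
        have "\<omega> ^ k = (\<omega> ^ p) ^ (M * j)" unfolding j by (simp add: power_mult)
        moreover have "\<zeta> ^ k = 1" using \<zeta> j by simp
        ultimately show "(\<omega> * \<zeta>) ^ k = 1" using \<omega>p by (simp add: power_mult_distrib)
      qed
      then show ?thesis by blast
    qed
  qed
qed

text \<open>\<open>\<sigma>\<close> is \<open>t \<mapsto> \<zeta> t\<close> for a primitive \<open>N\<close>-th root of unity \<open>\<zeta>\<close>, \<open>E \<alpha> h = h(t\<^sup>N, \<alpha>(t))\<close>, and \<open>unx\<close>
  undoes \<open>x = t\<^sup>N\<close> on series fixed by \<open>\<sigma>\<close>.\<close>

locale galois =
  fixes N :: nat and \<zeta> :: "'k::{alg_closed_field,field_char_0}"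
  assumes N: "N > 0" and \<zeta>: "\<And>k. \<zeta> ^ k = 1 \<longleftrightarrow> N dvd k"
begin

definition \<sigma> :: "'k fps \<Rightarrow> 'k fps" where "\<sigma> h = Abs_fps (\<lambda>k. \<zeta> ^ k * h $ k)"

abbreviation E :: "'k fps \<Rightarrow> 'k fps fps \<Rightarrow> 'k fps" where "E \<alpha> \<equiv> ev (fps_X ^ N) \<alpha>"

lemma \<sigma>_nth [simp]: "\<sigma> h $ k = \<zeta> ^ k * h $ k" by (simp add: \<sigma>_def)

lemma rhom_\<sigma>: "is_rhom \<sigma>"
proof -
  have "\<sigma> (a * b) = \<sigma> a * \<sigma> b" for a b
  proof (rule fps_ext)
    fix k
    have "(\<Sum>i=0..k. \<zeta> ^ k * (a $ i * b $ (k - i))) = (\<Sum>i=0..k. \<zeta> ^ i * a $ i * (\<zeta> ^ (k - i) * b $ (k - i)))"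
      by (intro sum.cong refl) (simp add: mult_ac flip: power_add)
    then show "\<sigma> (a * b) $ k = (\<sigma> a * \<sigma> b) $ k" by (simp add: fps_mult_nth sum_distrib_left)
  qed
  then show ?thesis by (auto simp: is_rhom_def fps_eq_iff algebra_simps)
qed

lemma \<sigma>_funpow_nth: "(\<sigma> ^^ i) h $ k = \<zeta> ^ (i * k) * h $ k"
  by (induction i) (auto simp: power_add mult_ac)

lemma \<sigma>_funpow_fixed: "(\<sigma> ^^ i) h = h \<longleftrightarrow> (\<forall>k. h $ k \<noteq> 0 \<longrightarrow> N dvd i * k)"
  by (auto simp: fps_eq_iff \<sigma>_funpow_nth \<zeta>)

lemma \<sigma>_fixed: "\<sigma> h = h \<longleftrightarrow> (\<forall>k. h $ k \<noteq> 0 \<longrightarrow> N dvd k)"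
  using \<sigma>_funpow_fixed[of 1 h] by simp

lemma \<sigma>_funpow_N: "(\<sigma> ^^ N) h = h"
  by (simp add: \<sigma>_funpow_fixed)

lemma inj_\<sigma>: "inj \<sigma>"
proof (rule injI)
  fix a b assume "\<sigma> a = \<sigma> b"
  moreover have "\<sigma> ^^ N = (\<sigma> ^^ (N - 1)) \<circ> \<sigma>" using N by (metis Suc_diff_1 funpow_Suc_right)
  ultimately show "a = b" by (metis \<sigma>_funpow_N comp_apply)
qed

lemma \<sigma>_eq_0_iff [simp]: "\<sigma> h = 0 \<longleftrightarrow> h = 0"
  using inj_\<sigma> rhom_0[OF rhom_\<sigma>] by (metis injD)

lemma \<sigma>_const [simp]: "\<sigma> (fps_const c) = fps_const c"
  by (auto simp: fps_eq_iff)

lemma \<sigma>_X_N: "\<sigma> (fps_X ^ N) = fps_X ^ N"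
  by (auto simp: \<sigma>_fixed)

lemma subdegree_\<sigma>: "subdegree (\<sigma> h) = subdegree h"
proof (cases "h = 0")
  case False
  have "\<zeta> \<noteq> 0" using \<zeta>[of N] N by (auto simp: power_0_left)
  then show ?thesis using False by (intro subdegreeI) auto
qed (simp add: rhom_0[OF rhom_\<sigma>])

definition unx :: "'k fps \<Rightarrow> 'k fps" where "unx a = Abs_fps (\<lambda>k. a $ (N * k))"

lemma unx_0 [simp]: "unx 0 = 0" by (simp add: unx_def fps_eq_iff)

lemma xpow_unx: "\<sigma> a = a \<Longrightarrow> xpow N (unx a) = a"
proof (rule fps_ext)
  fix k assume "\<sigma> a = a"
  then show "xpow N (unx a) $ k = a $ k" by (cases "N dvd k") (auto simp: xpow_nth N unx_def \<sigma>_fixed)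
qed

text \<open>Galois descent: a series fixed by \<sigma> involves only powers of t^N = x.\<close>

lemma descend:
  assumes "map_poly \<sigma> p = p"
  shows "map_poly (xpow N) (map_poly unx p) = p"
proof (rule poly_eqI)
  fix n
  have "\<sigma> (coeff p n) = coeff p n"
    using arg_cong[OF assms, of "\<lambda>q. coeff q n"] by (simp add: coeff_map_poly rhom_0[OF rhom_\<sigma>])
  then show "coeff (map_poly (xpow N) (map_poly unx p)) n = coeff p n"
    by (simp add: coeff_map_poly xpow_unx)
qed

lemma XN0: "(fps_X ^ N :: 'k fps) $ 0 = 0" using N by simp

lemmas rhom_E = rhom_ev[OF XN0]
lemmas E_conv = ev_conv[OF XN0]

text \<open>\<sigma> fixes t^N, so both sides are homomorphisms with equal values on constants, x
  and y. The wrapping in \<open>fps_const\<close> only adapts the type to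
  \<open>hom_unique\<close>.\<close>

lemma \<sigma>_E: assumes "\<alpha> $ 0 = 0" shows "\<sigma> (E \<alpha> h) = E (\<sigma> \<alpha>) h"
proof -
  have \<sigma>\<alpha>: "\<sigma> \<alpha> $ 0 = 0" using assms by simp
  have "fps_const (\<sigma> (E \<alpha> h)) = fps_const (E (\<sigma> \<alpha>) h)"
  proof (rule hom_unique[where ?H1.0 = "\<lambda>h. fps_const (\<sigma> (E \<alpha> h))" and ?H2.0 = "\<lambda>h. fps_const (E (\<sigma> \<alpha>) h)"])
    show "is_rhom (\<lambda>h. fps_const (\<sigma> (E \<alpha> h)))"
      by (rule rhom_comp[OF rhom_fps_const rhom_comp[OF rhom_\<sigma> rhom_E[OF assms]]])
    show "is_rhom (\<lambda>h. fps_const (E (\<sigma> \<alpha>) h))"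
      by (rule rhom_comp[OF rhom_fps_const rhom_E[OF \<sigma>\<alpha>]])
  qed (use N assms in \<open>auto simp: ev_cst[OF XN0] ev_varX[OF XN0] ev_varY[OF XN0] \<sigma>_X_N ord_ge_1_iff rhom_0[OF rhom_\<sigma>]\<close>)
  from arg_cong[OF this, of "\<lambda>f. f $ 0"] show ?thesis by simp
qed

subsection \<open>Stable sets of series\<close>

text \<open>The sets of roots of curves over K[[x]]: finite, closed under the Galois action, and
  passing through the origin.\<close>

definition stable :: "'k fps set \<Rightarrow> bool" where
  "stable A \<longleftrightarrow> finite A \<and> \<sigma> ` A \<subseteq> A \<and> (\<forall>\<alpha>\<in>A. \<alpha> $ 0 = 0)"

lemma stable_image: "stable A \<Longrightarrow> \<sigma> ` A = A"
  unfolding stable_def by (meson endo_inj_surj inj_\<sigma> inj_on_subset subset_UNIV)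

lemma stable_bij: "stable A \<Longrightarrow> bij_betw \<sigma> A A"
  using stable_image inj_\<sigma> by (metis bij_betw_def inj_on_subset subset_UNIV)

definition gpoly :: "'k fps set \<Rightarrow> 'k fps poly" where
  "gpoly A = (\<Prod>\<beta>\<in>A. [:- \<beta>, 1:])"

text \<open>The same polynomial with its coefficients rewritten as series in x, which makes sense
  for stable A. For a single orbit it is the equation of a branch.\<close>

definition dpoly :: "'k fps set \<Rightarrow> 'k fps poly" where
  "dpoly A = map_poly unx (gpoly A)"

lemma map_\<sigma>_linear: "map_poly \<sigma> [:- \<beta>, 1:] = [:- \<sigma> \<beta>, 1:]"
  by (simp add: map_poly_linear[OF rhom_\<sigma>] rhom_minus[OF rhom_\<sigma>])

lemma map_\<sigma>_gpoly: assumes "stable A" shows "map_poly \<sigma> (gpoly A) = gpoly A"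
proof -
  have "map_poly \<sigma> (gpoly A) = (\<Prod>\<beta>\<in>A. [:- \<sigma> \<beta>, 1:])"
    unfolding gpoly_def rhom_prod[OF rhom_map_poly[OF rhom_\<sigma>]] map_\<sigma>_linear ..
  also have "\<dots> = gpoly A"
    unfolding gpoly_def by (rule prod.reindex_bij_betw[OF stable_bij[OF assms]])
  finally show ?thesis .
qed

lemma map_xpow_dpoly: "stable A \<Longrightarrow> map_poly (xpow N) (dpoly A) = gpoly A"
  unfolding dpoly_def by (rule descend[OF map_\<sigma>_gpoly])

lemma gpoly_monic: "finite A \<Longrightarrow> lead_coeff (gpoly A) = 1 \<and> degree (gpoly A) = card A"
proof -
  assume "finite A"
  then have "degree (gpoly A) = card A" by (simp add: gpoly_def degree_prod_eq_sum_degree)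
  moreover have "lead_coeff (gpoly A) = (\<Prod>\<beta>\<in>A. lead_coeff [:- \<beta>, 1:])"
    by (simp only: gpoly_def lead_coeff_prod)
  ultimately show ?thesis by simp
qed

lemma poly_gpoly: "finite A \<Longrightarrow> poly (gpoly A) z = (\<Prod>\<beta>\<in>A. z - \<beta>)"
  by (simp add: gpoly_def poly_prod)

lemma degree_map_xpow: "degree (map_poly (xpow N) w) = degree (w :: 'k fps poly)"
proof -
  have "xpow N c = 0 \<longleftrightarrow> c = 0" for c :: "'k fps"
    using inj_xpow[OF N, where 'a = 'k] rhom_0[OF rhom_xpow[OF N]] by (metis injD)
  then show ?thesis by (intro degree_map_poly) auto
qed

lemma dpoly_wpoly: assumes "stable A" shows "wpoly (dpoly A)" "degree (dpoly A) = card A"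
proof -
  have fin: "finite A" using assms by (simp add: stable_def)
  show d: "degree (dpoly A) = card A"
    using degree_map_xpow[of "dpoly A"] gpoly_monic[OF fin] map_xpow_dpoly[OF assms] by simp
  have c: "coeff (dpoly A) j $ 0 = coeff (gpoly A) j $ 0" for j
    using arg_cong[OF map_xpow_dpoly[OF assms], of "\<lambda>q. coeff q j $ 0"]
    by (simp add: coeff_map_poly xpow_nth_0 N)
  have "map_poly (\<lambda>c. c $ 0) (gpoly A) = (\<Prod>\<beta>\<in>A. [:0, 1:])"
    unfolding gpoly_def rhom_prod[OF rhom_map_poly[OF rhom_nth0]] map_poly_linear[OF rhom_nth0]
    using assms by (intro prod.cong) (auto simp: stable_def)
  also have "\<dots> = monom 1 (card A)" by (simp add: monom_altdef)
  finally have "coeff (map_poly (\<lambda>c. c $ 0) (gpoly A)) j = coeff (monom 1 (card A)) j" for j by simp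
  then have "coeff (gpoly A) j $ 0 = (if j = card A then 1 else 0)" for j by (simp add: coeff_map_poly)
  moreover have "coeff (dpoly A) (card A) = 1"
  proof -
    have "coeff (gpoly A) (card A) = 1" using gpoly_monic[OF fin] by auto
    moreover have "unx 1 = 1" using N by (auto simp: unx_def fps_eq_iff)
    ultimately show ?thesis by (simp add: dpoly_def coeff_map_poly)
  qed
  ultimately show "wpoly (dpoly A)" using d c by (auto simp: wpoly_def)
qed

lemma E_dpoly: "stable A \<Longrightarrow> z $ 0 = 0 \<Longrightarrow> E z (conv (dpoly A)) = (\<Prod>\<beta>\<in>A. z - \<beta>)"
  by (simp add: E_conv map_xpow_dpoly poly_gpoly stable_def)

lemma poly_zero_on_card:
  fixes p :: "'k fps poly"
  assumes "finite A" "\<And>z. z \<in> A \<Longrightarrow> poly p z = 0" "p \<noteq> 0 \<Longrightarrow> degree p < card A"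
  shows "p = 0"
proof (rule ccontr)
  assume nz: "p \<noteq> 0"
  have "card A \<le> card {z. poly p z = 0}"
    using assms(2) poly_roots_finite[OF nz] by (intro card_mono) auto
  also have "\<dots> \<le> degree p" by (rule card_poly_roots_bound[OF nz])
  finally show False using assms(3) nz by simp
qed

text \<open>The Weierstrass remainder of h has degree below \<open>card A\<close> but vanishes on
  all of A, so it is zero. Divisibility thus turns into vanishing at the roots.\<close>

lemma kernel_stable:
  assumes A: "stable A"
  shows "(\<forall>\<beta>\<in>A. E \<beta> h = 0) \<longleftrightarrow> conv (dpoly A) dvd h"
proof
  have fin: "finite A" and z: "\<And>\<beta>. \<beta> \<in> A \<Longrightarrow> \<beta> $ 0 = 0" using A by (auto simp: stable_def)
  have E0: "E \<beta> (conv (dpoly A)) = 0" if "\<beta> \<in> A" for \<beta>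
    using E_dpoly[OF A z[OF that]] fin that by auto
  {
    assume 0: "\<forall>\<beta>\<in>A. E \<beta> h = 0"
    note W = dpoly_wpoly[OF A]
    have F: "conv (dpoly A) $ 0 \<noteq> 0" and m: "card A = subdegree (conv (dpoly A) $ 0)"
      using W by (simp_all add: wpoly_conv_0 fps_X_power_subdegree)
    obtain q r where qr: "h = q * conv (dpoly A) + conv r" "\<And>j. j \<ge> card A \<Longrightarrow> coeff r j = 0"
      using weierstrass_division[OF F m] by blast
    have "map_poly (xpow N) r = 0"
    proof (rule poly_zero_on_card[OF fin])
      fix \<beta> assume b: "\<beta> \<in> A"
      have "E \<beta> (conv r) = 0"
      proof -
        have "E \<beta> h = E \<beta> q * E \<beta> (conv (dpoly A)) + E \<beta> (conv r)"
          unfolding qr(1) rhom_add[OF rhom_E[OF z[OF b]]] rhom_mult[OF rhom_E[OF z[OF b]]] ..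
        then show ?thesis using 0 b E0[OF b] by simp
      qed
      then show "poly (map_poly (xpow N) r) \<beta> = 0" by (simp add: E_conv[OF z[OF b]])
    next
      assume nz: "map_poly (xpow N) r \<noteq> 0"
      then have "r \<noteq> 0" by auto
      then have "degree r < card A" using qr(2) by (meson leading_coeff_neq_0 not_le)
      then show "degree (map_poly (xpow N) r) < card A" by (simp add: degree_map_xpow)
    qed
    then have "coeff (map_poly (xpow N) r) j = 0" for j by simp
    then have "xpow N (coeff r j) = xpow N 0" for j by (simp add: coeff_map_poly)
    then have "coeff r j = 0" for j using inj_xpow[OF N] by (metis injD)
    then have "r = 0" by (simp add: poly_eq_iff)
    then show "conv (dpoly A) dvd h" using qr(1) by (simp add: rhom_0[OF rhom_conv])
  }
  assume "conv (dpoly A) dvd h"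
  then show "\<forall>\<beta>\<in>A. E \<beta> h = 0"
    using E0 z by (auto simp: dvd_def rhom_mult[OF rhom_E])
qed

subsection \<open>Interpolation\<close>

text \<open>The value at \<open>\<alpha> \<in> A\<close> of the derivative of \<open>gpoly A\<close>.\<close>

definition Dif :: "'k fps set \<Rightarrow> 'k fps \<Rightarrow> 'k fps" where
  "Dif A \<alpha> = (\<Prod>\<beta>\<in>A - {\<alpha>}. \<alpha> - \<beta>)"

lemma Dif_nonzero: "finite A \<Longrightarrow> Dif A \<alpha> \<noteq> 0" by (auto simp: Dif_def)

lemma stable_remove_bij:
  assumes "stable A" "\<alpha> \<in> A" shows "bij_betw \<sigma> (A - {\<alpha>}) (A - {\<sigma> \<alpha>})"
  unfolding bij_betw_def
proof
  show "inj_on \<sigma> (A - {\<alpha>})" using inj_\<sigma> by (rule inj_on_subset) auto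
  show "\<sigma> ` (A - {\<alpha>}) = A - {\<sigma> \<alpha>}"
    using stable_image[OF assms(1)] image_set_diff[OF inj_\<sigma>, of A "{\<alpha>}"] by simp
qed

lemma \<sigma>_Dif: assumes "stable A" "\<alpha> \<in> A" shows "Dif A (\<sigma> \<alpha>) = \<sigma> (Dif A \<alpha>)"
proof -
  have "\<sigma> (Dif A \<alpha>) = (\<Prod>\<beta>\<in>A - {\<alpha>}. \<sigma> \<alpha> - \<sigma> \<beta>)"
    unfolding Dif_def rhom_prod[OF rhom_\<sigma>] rhom_diff[OF rhom_\<sigma>] ..
  also have "\<dots> = Dif A (\<sigma> \<alpha>)"
    unfolding Dif_def by (rule prod.reindex_bij_betw[OF stable_remove_bij[OF assms]])
  finally show ?thesis ..
qed

text \<open>Lagrange interpolation without denominators: the value at \<alpha> is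
  \<open>v \<alpha> * Dif A \<alpha>\<close>. Its top coefficient, the sum of v, is the trace used
  against the conductor.\<close>

definition lag :: "'k fps set \<Rightarrow> ('k fps \<Rightarrow> 'k fps) \<Rightarrow> 'k fps poly" where
  "lag A v = (\<Sum>\<alpha>\<in>A. smult (v \<alpha>) (gpoly (A - {\<alpha>})))"

lemma poly_lag: assumes "finite A" "\<alpha> \<in> A" shows "poly (lag A v) \<alpha> = v \<alpha> * Dif A \<alpha>"
proof -
  have "poly (lag A v) \<alpha> = (\<Sum>\<gamma>\<in>A. v \<gamma> * (\<Prod>\<beta>\<in>A - {\<gamma>}. \<alpha> - \<beta>))"
    using assms by (simp add: lag_def poly_sum poly_gpoly)
  also have "\<dots> = (\<Sum>\<gamma>\<in>{\<alpha>}. v \<gamma> * (\<Prod>\<beta>\<in>A - {\<gamma>}. \<alpha> - \<beta>))"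
    using assms by (intro sum.mono_neutral_right) auto
  finally show ?thesis by (simp add: Dif_def)
qed

lemma lag_coeffs:
  assumes "finite A" shows "coeff (lag A v) (card A - 1) = sum v A" "j \<ge> card A \<Longrightarrow> coeff (lag A v) j = 0"
proof -
  have "coeff (lag A v) (card A - 1) = (\<Sum>\<alpha>\<in>A. v \<alpha> * coeff (gpoly (A - {\<alpha>})) (card A - 1))"
    by (simp add: lag_def coeff_sum)
  also have "\<dots> = (\<Sum>\<alpha>\<in>A. v \<alpha>)"
  proof (intro sum.cong refl)
    fix \<alpha> assume "\<alpha> \<in> A"
    then have "coeff (gpoly (A - {\<alpha>})) (card A - 1) = 1"
      using assms gpoly_monic[of "A - {\<alpha>}"] by (metis card_Diff_singleton finite_Diff)
    then show "v \<alpha> * coeff (gpoly (A - {\<alpha>})) (card A - 1) = v \<alpha>" by simp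
  qed
  finally show "coeff (lag A v) (card A - 1) = sum v A" .
  assume j: "j \<ge> card A"
  have "coeff (gpoly (A - {\<alpha>})) j = 0" if "\<alpha> \<in> A" for \<alpha>
  proof -
    have "card (A - {\<alpha>}) < card A" using assms that by (rule card_Diff1_less)
    moreover have "degree (gpoly (A - {\<alpha>})) = card (A - {\<alpha>})" using gpoly_monic assms by simp
    ultimately show ?thesis using j by (intro coeff_eq_0) linarith
  qed
  then show "coeff (lag A v) j = 0" by (simp add: lag_def coeff_sum)
qed

lemma map_\<sigma>_lag:
  assumes A: "stable A" and v: "\<And>\<alpha>. \<alpha> \<in> A \<Longrightarrow> v (\<sigma> \<alpha>) = \<sigma> (v \<alpha>)"
  shows "map_poly \<sigma> (lag A v) = lag A v"
proof -
  have g: "map_poly \<sigma> (gpoly (A - {\<alpha>})) = gpoly (A - {\<sigma> \<alpha>})" if "\<alpha> \<in> A" for \<alpha>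
    unfolding gpoly_def rhom_prod[OF rhom_map_poly[OF rhom_\<sigma>]] map_\<sigma>_linear
    by (rule prod.reindex_bij_betw[OF stable_remove_bij[OF A that]])
  have s: "map_poly \<sigma> (smult c p) = smult (\<sigma> c) (map_poly \<sigma> p)" for c p
    by (auto simp: poly_eq_iff coeff_map_poly rhomD[OF rhom_\<sigma>])
  have "map_poly \<sigma> (lag A v) = (\<Sum>\<alpha>\<in>A. smult (v (\<sigma> \<alpha>)) (gpoly (A - {\<sigma> \<alpha>})))"
    unfolding lag_def rhom_sum[OF rhom_map_poly[OF rhom_\<sigma>]] s by (intro sum.cong refl) (simp add: g v)
  also have "\<dots> = lag A v"
    unfolding lag_def by (rule sum.reindex_bij_betw[OF stable_bij[OF A]])
  finally show ?thesis .
qed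

text \<open>The strict bound by N, instead of 0, is what invariance buys. Under it v = t^N u / Dif
  has positive order, so the coefficients of \<open>lag A v\<close> are invariant series without
  constant term, hence divisible by t^N. Cancelling t^N gives an interpolating polynomial over
  K[[x]].\<close>

lemma interpolation:
  assumes A: "stable A" and u: "\<And>\<alpha>. \<alpha> \<in> A \<Longrightarrow> u (\<sigma> \<alpha>) = \<sigma> (u \<alpha>)"
    and ord: "\<And>\<alpha>. \<alpha> \<in> A \<Longrightarrow> u \<alpha> = 0 \<or> subdegree (Dif A \<alpha>) < N + subdegree (u \<alpha>)"
  shows "\<exists>h. \<forall>\<alpha>\<in>A. E \<alpha> h = u \<alpha>"
proof -
  have fin: "finite A" and z: "\<And>\<beta>. \<beta> \<in> A \<Longrightarrow> \<beta> $ 0 = 0" using A by (auto simp: stable_def)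
  have "\<exists>w. fps_X ^ N * u \<alpha> = w * Dif A \<alpha> \<and> w $ 0 = 0" if a: "\<alpha> \<in> A" for \<alpha>
  proof (cases "u \<alpha> = 0")
    case True
    then show ?thesis by (intro exI[of _ 0]) auto
  next
    case False
    then have sd: "subdegree (fps_X ^ N * u \<alpha>) > subdegree (Dif A \<alpha>)"
      using ord[OF a] by (simp add: fps_X_power_subdegree)
    then have "Dif A \<alpha> dvd fps_X ^ N * u \<alpha>"
      using Dif_nonzero[OF fin] False by (subst fps_dvd_iff) auto
    then obtain w where w: "fps_X ^ N * u \<alpha> = w * Dif A \<alpha>" by (auto simp: dvd_def mult.commute)
    have "w \<noteq> 0" using w False by auto
    then have "subdegree w > 0"
      using sd Dif_nonzero[OF fin, of \<alpha>] unfolding w by simp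
    then have "w $ 0 = 0" by (rule nth_less_subdegree_zero)
    then show ?thesis using w by blast
  qed
  then obtain v where v: "\<And>\<alpha>. \<alpha> \<in> A \<Longrightarrow> fps_X ^ N * u \<alpha> = v \<alpha> * Dif A \<alpha>"
      and v0: "\<And>\<alpha>. \<alpha> \<in> A \<Longrightarrow> v \<alpha> $ 0 = 0" by metis
  have v\<sigma>: "v (\<sigma> \<alpha>) = \<sigma> (v \<alpha>)" if a: "\<alpha> \<in> A" for \<alpha>
  proof -
    have "\<sigma> \<alpha> \<in> A" using A a by (auto simp: stable_def)
    have "v (\<sigma> \<alpha>) * Dif A (\<sigma> \<alpha>) = \<sigma> (fps_X ^ N * u \<alpha>)"
      using v[OF \<open>\<sigma> \<alpha> \<in> A\<close>] u[OF a] by (simp only: rhom_mult[OF rhom_\<sigma>] \<sigma>_X_N)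
    also have "\<dots> = \<sigma> (v \<alpha>) * Dif A (\<sigma> \<alpha>)"
      unfolding v[OF a] \<sigma>_Dif[OF A a] rhom_mult[OF rhom_\<sigma>] ..
    finally show ?thesis using Dif_nonzero[OF fin] by simp
  qed
  have fix1: "\<sigma> (coeff (lag A v) j) = coeff (lag A v) j" for j
    using arg_cong[OF map_\<sigma>_lag[of A v], of "\<lambda>q. coeff q j"] A v\<sigma> by (simp add: coeff_map_poly rhom_0[OF rhom_\<sigma>])
  have c0: "coeff (lag A v) j $ 0 = 0" for j
    using v0 by (simp add: lag_def coeff_sum fps_sum_nth)
  \<comment> \<open>The exponents of an invariant series are multiples of N, so a vanishing constant
    term already yields the factor t^N.\<close>
  have c: "coeff (lag A v) j = fps_X ^ N * fps_shift N (coeff (lag A v) j)" for j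
  proof (rule fps_ext)
    fix k
    show "coeff (lag A v) j $ k = (fps_X ^ N * fps_shift N (coeff (lag A v) j)) $ k"
    proof (cases "k < N")
      case True
      then have "\<not> N dvd k \<or> k = 0" using nat_dvd_not_less by blast
      then have "coeff (lag A v) j $ k = 0" using fix1[of j] c0[of j] unfolding \<sigma>_fixed by blast
      then show ?thesis using True by (simp add: fps_X_power_mult_nth)
    qed (simp add: fps_X_power_mult_nth)
  qed
  define H where "H = map_poly (fps_shift N) (lag A v)"
  have XH: "lag A v = smult (fps_X ^ N) H"
    by (rule poly_eqI) (simp add: H_def coeff_map_poly flip: c)
  have "map_poly \<sigma> H = H"
  proof (rule poly_eqI)
    fix j
    have "fps_X ^ N * \<sigma> (coeff H j) = fps_X ^ N * coeff H j"
      using fix1[of j] unfolding XH coeff_smult rhom_mult[OF rhom_\<sigma>] \<sigma>_X_N .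
    then show "coeff (map_poly \<sigma> H) j = coeff H j" by (simp add: coeff_map_poly rhom_0[OF rhom_\<sigma>])
  qed
  from descend[OF this] have H: "map_poly (xpow N) (map_poly unx H) = H" .
  have "E \<alpha> (conv (map_poly unx H)) = u \<alpha>" if a: "\<alpha> \<in> A" for \<alpha>
  proof -
    have "fps_X ^ N * poly H \<alpha> = fps_X ^ N * u \<alpha>"
      using poly_lag[OF fin a, of v] v[OF a] by (simp add: XH)
    then show ?thesis by (simp add: E_conv[OF z[OF a]] H)
  qed
  then show ?thesis by blast
qed

text \<open>Euler's formula: the trace of h(\<alpha>) / Dif A \<alpha> is the top coefficient of the
  Weierstrass remainder of h, hence has no pole. Here v is t^M times the summand.\<close>

lemma lagrange_sum:
  assumes A: "stable A" "A \<noteq> {}" and v: "\<And>\<alpha>. \<alpha> \<in> A \<Longrightarrow> fps_X ^ M * E \<alpha> h = v \<alpha> * Dif A \<alpha>"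
  shows "fps_X ^ M dvd sum v A"
proof -
  have fin: "finite A" and z: "\<And>\<beta>. \<beta> \<in> A \<Longrightarrow> \<beta> $ 0 = 0" using A by (auto simp: stable_def)
  note W = dpoly_wpoly[OF A(1)]
  have F: "conv (dpoly A) $ 0 \<noteq> 0" and m: "card A = subdegree (conv (dpoly A) $ 0)"
    using W by (simp_all add: wpoly_conv_0 fps_X_power_subdegree)
  obtain q r where qr: "h = q * conv (dpoly A) + conv r" "\<And>j. j \<ge> card A \<Longrightarrow> coeff r j = 0"
    using weierstrass_division[OF F m] by blast
  define H where "H = map_poly (xpow N) r"
  have Hj: "coeff H j = 0" if "j \<ge> card A" for j using qr(2) that by (simp add: H_def coeff_map_poly)
  have "smult (fps_X ^ M) H - lag A v = 0"
  proof (rule poly_zero_on_card[OF fin])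
    fix \<beta> assume b: "\<beta> \<in> A"
    have "E \<beta> (conv (dpoly A)) = 0" using kernel_stable[OF A(1), of "conv (dpoly A)"] b by simp
    moreover have "E \<beta> h = E \<beta> q * E \<beta> (conv (dpoly A)) + E \<beta> (conv r)"
      unfolding qr(1) rhom_add[OF rhom_E[OF z[OF b]]] rhom_mult[OF rhom_E[OF z[OF b]]] ..
    ultimately have "E \<beta> h = poly H \<beta>" by (simp add: E_conv[OF z[OF b]] H_def)
    then show "poly (smult (fps_X ^ M) H - lag A v) \<beta> = 0"
      using v[OF b] poly_lag[OF fin b] by simp
  next
    assume nz: "smult (fps_X ^ M) H - lag A v \<noteq> 0"
    have "coeff (smult (fps_X ^ M) H - lag A v) j = 0" if "j \<ge> card A" for j
      using Hj that lag_coeffs(2)[OF fin] by simp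
    then show "degree (smult (fps_X ^ M) H - lag A v) < card A"
      using nz by (meson leading_coeff_neq_0 not_le)
  qed
  then have "smult (fps_X ^ M) H = lag A v" by simp
  from arg_cong[OF this, of "\<lambda>q. coeff q (card A - 1)"]
  have "fps_X ^ M * coeff H (card A - 1) = sum v A" by (simp only: coeff_smult lag_coeffs(1)[OF fin])
  then show ?thesis by (metis dvd_triv_left)
qed

subsection \<open>Orbits\<close>

definition per :: "'k fps \<Rightarrow> nat" where "per \<alpha> = (LEAST n. n > 0 \<and> (\<sigma> ^^ n) \<alpha> = \<alpha>)"

definition orb :: "'k fps \<Rightarrow> 'k fps set" where "orb \<alpha> = range (\<lambda>i. (\<sigma> ^^ i) \<alpha>)"

lemma per: "per \<alpha> > 0" "(\<sigma> ^^ per \<alpha>) \<alpha> = \<alpha>"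
  using LeastI[of "\<lambda>n. n > 0 \<and> (\<sigma> ^^ n) \<alpha> = \<alpha>" N] N \<sigma>_funpow_N by (auto simp: per_def)

lemma per_dvd: "(\<sigma> ^^ i) \<alpha> = \<alpha> \<longleftrightarrow> per \<alpha> dvd i"
proof
  assume "(\<sigma> ^^ i) \<alpha> = \<alpha>"
  then have "(\<sigma> ^^ (i mod per \<alpha>)) \<alpha> = \<alpha>" using funpow_mod_eq[OF per(2)] by simp
  moreover have "i mod per \<alpha> < per \<alpha>" using per by simp
  ultimately have "i mod per \<alpha> = 0"
    using not_less_Least[of "i mod per \<alpha>" "\<lambda>n. n > 0 \<and> (\<sigma> ^^ n) \<alpha> = \<alpha>"] by (auto simp: per_def)
  then show "per \<alpha> dvd i" by auto
next
  assume "per \<alpha> dvd i"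
  then show "(\<sigma> ^^ i) \<alpha> = \<alpha>" using funpow_mod_eq[OF per(2)[of \<alpha>], of i] by simp
qed

lemma per_dvd_N: "per \<alpha> dvd N" using per_dvd \<sigma>_funpow_N by blast

lemma \<sigma>_funpow_eq: "(\<sigma> ^^ i) \<alpha> = (\<sigma> ^^ j) \<alpha> \<longleftrightarrow> i mod per \<alpha> = j mod per \<alpha>"
proof -
  have "(\<sigma> ^^ i) \<alpha> = (\<sigma> ^^ (i + k)) \<alpha> \<longleftrightarrow> per \<alpha> dvd k" for i k
  proof -
    have "inj (\<sigma> ^^ i)" using inj_\<sigma> by (induction i) (auto simp: inj_compose)
    then have "(\<sigma> ^^ i) \<alpha> = (\<sigma> ^^ i) ((\<sigma> ^^ k) \<alpha>) \<longleftrightarrow> \<alpha> = (\<sigma> ^^ k) \<alpha>" by (rule inj_eq)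
    then show ?thesis unfolding funpow_add comp_apply per_dvd[of k \<alpha>, symmetric] by metis
  qed
  moreover have "i mod p = (i + k) mod p \<longleftrightarrow> p dvd k" for i k p :: nat
    by (metis add_diff_cancel_left' le_add1 mod_eq_dvd_iff_nat)
  ultimately show ?thesis by (metis le_add_diff_inverse linear)
qed

lemma orb_eq: "orb \<alpha> = (\<lambda>i. (\<sigma> ^^ i) \<alpha>) ` {..<per \<alpha>}"
proof -
  have "(\<sigma> ^^ i) \<alpha> \<in> (\<lambda>i. (\<sigma> ^^ i) \<alpha>) ` {..<per \<alpha>}" for i
    using per(1)[of \<alpha>] \<sigma>_funpow_eq[of i \<alpha> "i mod per \<alpha>"] by (intro image_eqI[of _ _ "i mod per \<alpha>"]) auto
  then show ?thesis by (auto simp: orb_def)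
qed

lemma inj_on_orb: "inj_on (\<lambda>i. (\<sigma> ^^ i) \<alpha>) {..<per \<alpha>}"
  by (auto simp: inj_on_def \<sigma>_funpow_eq)

lemma card_orb: "card (orb \<alpha>) = per \<alpha>"
  unfolding orb_eq by (simp add: card_image inj_on_orb)

lemma finite_orb: "finite (orb \<alpha>)" by (simp add: orb_eq)

lemma orb_self: "\<alpha> \<in> orb \<alpha>" unfolding orb_def by (rule range_eqI[of _ _ 0]) simp

lemma \<sigma>_orb: "\<beta> \<in> orb \<alpha> \<Longrightarrow> \<sigma> \<beta> \<in> orb \<alpha>"
  unfolding orb_def using range_eqI[of _ "\<lambda>i. (\<sigma> ^^ i) \<alpha>" "Suc _"] by auto

lemma \<sigma>_funpow_mem: "(\<sigma> ^^ i) \<alpha> \<in> orb \<alpha>" by (simp add: orb_def)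

lemma stable_orb: "\<alpha> $ 0 = 0 \<Longrightarrow> stable (orb \<alpha>)"
  unfolding stable_def using finite_orb \<sigma>_orb by (auto simp: orb_def \<sigma>_funpow_nth)

lemma funpow_stable: "stable A \<Longrightarrow> \<alpha> \<in> A \<Longrightarrow> (\<sigma> ^^ i) \<alpha> \<in> A"
  by (induction i) (auto simp: stable_def)

lemma orb_subset: "stable A \<Longrightarrow> \<alpha> \<in> A \<Longrightarrow> orb \<alpha> \<subseteq> A"
  using funpow_stable by (auto simp: orb_def)

lemma orb_eqI: assumes "\<beta> \<in> orb \<alpha>" shows "orb \<beta> = orb \<alpha>"
proof -
  obtain i where i: "\<beta> = (\<sigma> ^^ i) \<alpha>" using assms by (auto simp: orb_def)
  have "(\<sigma> ^^ j) \<beta> = (\<sigma> ^^ (j + i)) \<alpha>" for j by (simp add: i funpow_add)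
  then have "orb \<beta> \<subseteq> orb \<alpha>" by (auto simp: orb_def)
  moreover have "\<alpha> \<in> orb \<beta>"
  proof -
    have "i \<le> per \<alpha> * i" using mult_le_mono1[of 1 "per \<alpha>" i] per(1)[of \<alpha>] by simp
    then have "(\<sigma> ^^ (per \<alpha> * i - i)) \<beta> = (\<sigma> ^^ (per \<alpha> * i)) \<alpha>"
      unfolding i by (metis comp_apply funpow_add le_add_diff_inverse2)
    also have "\<dots> = \<alpha>" by (simp add: per_dvd)
    finally show ?thesis using \<sigma>_funpow_mem by metis
  qed
  then have "orb \<alpha> \<subseteq> orb \<beta>"
    by (auto simp: orb_def) (metis funpow_add comp_apply rangeI)
  ultimately show ?thesis by blast
qed

lemma orb_disjoint: "orb \<alpha> \<inter> orb \<beta> = {} \<or> orb \<alpha> = orb \<beta>"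
  using orb_eqI by blast

lemma per_orb: "\<beta> \<in> orb \<alpha> \<Longrightarrow> per \<beta> = per \<alpha>"
  using orb_eqI card_orb by metis

text \<open>The branch of \<alpha> is parametrized by s = t^(ram \<alpha>), so orders in t are
  \<open>ram \<alpha>\<close> times orders along the branch.\<close>

definition ram :: "'k fps \<Rightarrow> nat" where "ram \<alpha> = N div per \<alpha>"

lemma ram: "N = per \<alpha> * ram \<alpha>" "ram \<alpha> > 0"
  using per_dvd_N[of \<alpha>] N by (auto simp: ram_def dvd_div_eq_0_iff intro: Nat.gr0I)

lemma fixed_ram: "(\<sigma> ^^ per \<alpha>) h = h \<longleftrightarrow> (\<forall>k. h $ k \<noteq> 0 \<longrightarrow> ram \<alpha> dvd k)"
proof -
  have "N dvd per \<alpha> * k \<longleftrightarrow> ram \<alpha> dvd k" for k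
    by (subst ram(1)[of \<alpha>]) (use per(1)[of \<alpha>] in simp)
  then show ?thesis by (simp add: \<sigma>_funpow_fixed)
qed

lemma equivariant_funpow:
  assumes "stable A" "\<And>\<alpha>. \<alpha> \<in> A \<Longrightarrow> u (\<sigma> \<alpha>) = \<sigma> (u \<alpha>)" "\<alpha> \<in> A"
  shows "u ((\<sigma> ^^ i) \<alpha>) = (\<sigma> ^^ i) (u \<alpha>)"
  by (induction i) (auto simp: assms funpow_stable)

text \<open>Two indices of the same point of the orbit differ by a multiple of
  \<open>per \<alpha>\<close>, and h is fixed by the corresponding power of \<sigma>; so the value
  transported along the orbit does not depend on the choice in \<open>idx\<close>.\<close>

lemma equivariant_extend:
  assumes "(\<sigma> ^^ per \<alpha>) h = h"
  shows "\<exists>u. u \<alpha> = h \<and> (\<forall>\<beta>\<in>orb \<alpha>. u (\<sigma> \<beta>) = \<sigma> (u \<beta>)) \<and> (\<forall>\<beta>. \<beta> \<notin> orb \<alpha> \<longrightarrow> u \<beta> = 0)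
    \<and> (\<forall>i. u ((\<sigma> ^^ i) \<alpha>) = (\<sigma> ^^ i) h)"
proof -
  define idx where "idx \<beta> = (SOME i. \<beta> = (\<sigma> ^^ i) \<alpha>)" for \<beta>
  define u where "u \<beta> = (if \<beta> \<in> orb \<alpha> then (\<sigma> ^^ idx \<beta>) h else 0)" for \<beta>
  have idx: "\<beta> = (\<sigma> ^^ idx \<beta>) \<alpha>" if "\<beta> \<in> orb \<alpha>" for \<beta>
    unfolding idx_def using that by (intro someI_ex[of "\<lambda>i. \<beta> = (\<sigma> ^^ i) \<alpha>"]) (auto simp: orb_def)
  have hmod: "(\<sigma> ^^ (i mod per \<alpha>)) h = (\<sigma> ^^ i) h" for i
    using funpow_mod_eq[OF assms] by simp
  have u: "u ((\<sigma> ^^ i) \<alpha>) = (\<sigma> ^^ i) h" for i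
  proof -
    have "idx ((\<sigma> ^^ i) \<alpha>) mod per \<alpha> = i mod per \<alpha>"
      by (rule \<sigma>_funpow_eq[THEN iffD1, symmetric]) (rule idx[OF \<sigma>_funpow_mem])
    then have "(\<sigma> ^^ idx ((\<sigma> ^^ i) \<alpha>)) h = (\<sigma> ^^ i) h" using hmod by metis
    then show ?thesis by (simp add: u_def \<sigma>_funpow_mem)
  qed
  have "u (\<sigma> \<beta>) = \<sigma> (u \<beta>)" if b: "\<beta> \<in> orb \<alpha>" for \<beta>
  proof -
    obtain i where i: "\<beta> = (\<sigma> ^^ i) \<alpha>" using b by (auto simp: orb_def)
    show ?thesis using u[of "Suc i"] u[of i] unfolding i by simp
  qed
  moreover have "u \<alpha> = h" using u[of 0] by simp
  ultimately show ?thesis using u by (intro exI[of _ u]) (auto simp: u_def)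
qed

end

section \<open>Intersection numbers\<close>

interpretation fpsV: codim_space "\<lambda>c v. fps_const c * (v :: 'a::field fps)"
  by unfold_locales (auto simp: algebra_simps simp flip: fps_const_add fps_const_mult)

lemma psr_simps [simp]:
  "carrier (ring_of_type_algebra :: 'a::comm_ring_1 ring) = UNIV"
  "x \<otimes>\<^bsub>ring_of_type_algebra\<^esub> y = x * (y :: 'a)" "x \<oplus>\<^bsub>ring_of_type_algebra\<^esub> y = x + (y :: 'a)"
  "\<one>\<^bsub>ring_of_type_algebra\<^esub> = (1 :: 'a)" "\<zero>\<^bsub>ring_of_type_algebra\<^esub> = (0 :: 'a)"
  by (simp_all add: ring_of_type_algebra_def)

lemma psr_cring: "cring (power_series_ring :: 'k::Fields.field fps fps ring)"
  by (rule cring_from_type_algebra)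

lemma psr_ring: "ring (power_series_ring :: 'k::Fields.field fps fps ring)"
  by (rule ring_from_type_algebra)

lemma subfield_constants: "subfield (range cst) (power_series_ring :: 'k::Fields.field fps fps ring)"
proof -
  have f: "field (ring_of_type_algebra :: 'k ring)" by (rule field_from_type_algebra)
  interpret K: field "ring_of_type_algebra :: 'k ring" by (rule f)
  interpret S: ring "power_series_ring :: 'k fps fps ring" by (rule psr_ring)
  have h: "ring_hom_ring (ring_of_type_algebra :: 'k ring) (power_series_ring :: 'k fps fps ring) cst"
    by (intro ring_hom_ringI K.ring_axioms S.ring_axioms) (auto simp: simp flip: fps_const_add fps_const_mult)
  from ring_hom_ring.img_is_subfield(2)[OF h K.carrier_is_subfield] show ?thesis by simp
qed

lemma ideal_psrI:
  assumes "0 \<in> I" "\<And>a b. a \<in> I \<Longrightarrow> b \<in> I \<Longrightarrow> a + b \<in> I" "\<And>a b. a \<in> I \<Longrightarrow> b * a \<in> I"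
  shows "ideal I (power_series_ring :: 'k::Fields.field fps fps ring)"
proof -
  interpret S: cring "power_series_ring :: 'k fps fps ring" by (rule psr_cring)
  have neg: "- a \<in> I" if "a \<in> I" for a using assms(3)[OF that, of "- 1"] by simp
  have minus: "\<ominus>\<^bsub>power_series_ring\<^esub> a = - a" for a :: "'k fps fps"
    by (rule S.minus_equality) auto
  have "inv\<^bsub>add_monoid power_series_ring\<^esub> a = - a" for a :: "'k fps fps"
    using minus[of a] by (simp add: a_inv_def)
  then show ?thesis
    using assms neg
    by (intro idealI S.ring_axioms subgroup.intro) (auto simp: mult.commute)
qed

context galois begin

lemma subdegree_\<sigma>_funpow: "subdegree ((\<sigma> ^^ i) h) = subdegree h"
  by (induction i) (auto simp: subdegree_\<sigma>)

lemma rhom_\<sigma>_funpow: "is_rhom (\<sigma> ^^ i)"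
proof (induction i)
  case (Suc i)
  show ?case using rhom_comp[OF rhom_\<sigma> Suc] by (simp add: comp_def)
qed (simp add: is_rhom_def)

lemma \<sigma>_funpow_E: "\<alpha> $ 0 = 0 \<Longrightarrow> (\<sigma> ^^ i) (E \<alpha> h) = E ((\<sigma> ^^ i) \<alpha>) h"
  by (induction i) (auto simp: \<sigma>_E \<sigma>_funpow_nth)

lemma \<sigma>_funpow_Dif:
  "stable A \<Longrightarrow> \<alpha> \<in> A \<Longrightarrow> Dif A ((\<sigma> ^^ i) \<alpha>) = (\<sigma> ^^ i) (Dif A \<alpha>)"
  by (induction i) (auto simp: \<sigma>_Dif funpow_stable)

section \<open>The local ring of a branch inside its normalization\<close>

text \<open>The normalization of the branch of \<alpha>: by \<open>Bring_iff\<close> it is K[[s]]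
  with s = t^(ram \<alpha>). The local ring of the branch is
  \<open>range (E \<alpha>)\<close>.\<close>

definition Bring :: "'k fps \<Rightarrow> 'k fps set" where "Bring \<alpha> = {h. (\<sigma> ^^ per \<alpha>) h = h}"

lemma Bring_iff: "h \<in> Bring \<alpha> \<longleftrightarrow> (\<forall>k. h $ k \<noteq> 0 \<longrightarrow> ram \<alpha> dvd k)"
  by (simp add: Bring_def fixed_ram)

lemma Bring_iff': "h \<in> Bring \<alpha> \<longleftrightarrow> (\<forall>k. \<not> ram \<alpha> dvd k \<longrightarrow> h $ k = 0)"
  by (auto simp: Bring_iff)

lemma subspace_Bring: "fpsV.subspace (Bring \<alpha>)"
  by (intro fpsV.subspaceI) (auto simp: Bring_iff')

lemma E_in_Bring: "\<alpha> $ 0 = 0 \<Longrightarrow> E \<alpha> h \<in> Bring \<alpha>"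
  by (simp add: Bring_def \<sigma>_funpow_E per)

lemma ram_dvd_subdegree: "h \<in> Bring \<alpha> \<Longrightarrow> ram \<alpha> dvd subdegree h"
  by (cases "h = 0") (auto simp: Bring_iff)

text \<open>Interpolation on the orbit of \<alpha>, applied to the equivariant extension of h. The
  order condition at \<alpha> suffices because \<sigma> preserves orders.\<close>

lemma orb_image:
  assumes \<alpha>: "\<alpha> $ 0 = 0" and h: "h \<in> Bring \<alpha>" and ord: "subdegree (Dif (orb \<alpha>) \<alpha>) < N + subdegree h"
  shows "h \<in> range (E \<alpha>)"
proof -
  obtain u where u: "u \<alpha> = h" "\<And>\<beta>. \<beta> \<in> orb \<alpha> \<Longrightarrow> u (\<sigma> \<beta>) = \<sigma> (u \<beta>)" "\<And>i. u ((\<sigma> ^^ i) \<alpha>) = (\<sigma> ^^ i) h"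
    using equivariant_extend[of \<alpha> h] h unfolding Bring_def by blast
  have "subdegree (Dif (orb \<alpha>) \<beta>) < N + subdegree (u \<beta>)" if b: "\<beta> \<in> orb \<alpha>" for \<beta>
  proof -
    obtain i where i: "\<beta> = (\<sigma> ^^ i) \<alpha>" using b unfolding orb_def by blast
    show ?thesis
      unfolding i u(3) \<sigma>_funpow_Dif[OF stable_orb[OF \<alpha>] orb_self] subdegree_\<sigma>_funpow by (rule ord)
  qed
  then obtain g where "\<forall>\<beta>\<in>orb \<alpha>. E \<beta> g = u \<beta>"
    using interpolation[OF stable_orb[OF \<alpha>], of u] u(2) by blast
  then have "E \<alpha> g = h" using u(1) orb_self by auto
  then show ?thesis by blast
qed

definition Fil :: "'k fps \<Rightarrow> nat \<Rightarrow> 'k fps set" where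
  "Fil \<alpha> k = {h \<in> Bring \<alpha>. \<forall>j\<in>{..<k}. h $ (j * ram \<alpha>) = 0}"

lemma codim_Fil: "fpsV.codim (Fil \<alpha> k) k (Bring \<alpha>)"
proof -
  have "fpsV.codim {h \<in> Bring \<alpha>. \<forall>j\<in>{..<k}. h $ (j * ram \<alpha>) = 0} (card {..<k}) (Bring \<alpha>)"
  proof (rule fpsV.codim_functionals)
    fix j assume "j \<in> {..<k}"
    show "\<exists>e\<in>Bring \<alpha>. e $ (j * ram \<alpha>) = 1 \<and> (\<forall>i\<in>{..<k} - {j}. e $ (i * ram \<alpha>) = 0)"
      by (intro bexI[of _ "fps_X ^ (j * ram \<alpha>)"]) (use ram(2)[of \<alpha>] in \<open>auto simp: Bring_iff\<close>)
  qed (auto simp: subspace_Bring)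
  then show ?thesis by (simp add: Fil_def)
qed

lemma subspace_Fil: "fpsV.subspace (Fil \<alpha> k)"
  by (intro fpsV.subspaceI) (auto simp: Fil_def Bring_iff')

lemma Fil_iff: "h \<in> Fil \<alpha> k \<longleftrightarrow> h \<in> Bring \<alpha> \<and> (h = 0 \<or> k * ram \<alpha> \<le> subdegree h)"
proof -
  have "(\<forall>j<k. h $ (j * ram \<alpha>) = 0) \<longleftrightarrow> (h = 0 \<or> k * ram \<alpha> \<le> subdegree h)" if h: "h \<in> Bring \<alpha>"
  proof
    assume 0: "\<forall>j<k. h $ (j * ram \<alpha>) = 0"
    have "h $ i = 0" if "i < k * ram \<alpha>" for i
    proof (rule ccontr)
      assume nz: "h $ i \<noteq> 0"
      then obtain j where "i = j * ram \<alpha>" using h by (auto simp: Bring_iff dvd_def mult.commute)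
      then show False using nz 0 that by simp
    qed
    then show "h = 0 \<or> k * ram \<alpha> \<le> subdegree h" using subdegree_geI by blast
  next
    assume d: "h = 0 \<or> k * ram \<alpha> \<le> subdegree h"
    have "j * ram \<alpha> < k * ram \<alpha>" if "j < k" for j using that ram(2) by simp
    with d show "\<forall>j<k. h $ (j * ram \<alpha>) = 0"
      using nth_less_subdegree_zero by (metis fps_zero_nth order.strict_trans2)
  qed
  then show ?thesis by (auto simp: Fil_def)
qed

lemma subspace_range_E: "\<alpha> $ 0 = 0 \<Longrightarrow> fpsV.subspace (range (E \<alpha>))"
proof (intro fpsV.subspaceI)
  assume a: "\<alpha> $ 0 = 0"
  note h = rhom_E[OF a]
  show "0 \<in> range (E \<alpha>)" using rhom_0[OF h] by (metis rangeI)
  show "x + y \<in> range (E \<alpha>)" if "x \<in> range (E \<alpha>)" "y \<in> range (E \<alpha>)" for x y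
    using that rhom_add[OF h] by (auto simp: image_iff) metis
  show "fps_const c * x \<in> range (E \<alpha>)" if x: "x \<in> range (E \<alpha>)" for c x
  proof -
    obtain y where "x = E \<alpha> y" using x by blast
    then have "fps_const c * x = E \<alpha> (cst c * y)" by (simp only: rhom_mult[OF h] ev_cst[OF XN0 a])
    then show ?thesis by blast
  qed
qed

text \<open>Finiteness of the delta invariant: by \<open>orb_image\<close> the local ring contains
  all elements of the normalization of sufficiently high order.\<close>

lemma finite_codim_E:
  assumes \<alpha>: "\<alpha> $ 0 = 0" shows "\<exists>d. fpsV.codim (range (E \<alpha>)) d (Bring \<alpha>)"
proof -
  define k where "k = subdegree (Dif (orb \<alpha>) \<alpha>)"
  have "Fil \<alpha> k \<subseteq> range (E \<alpha>)"
  proof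
    fix h assume h: "h \<in> Fil \<alpha> k"
    show "h \<in> range (E \<alpha>)"
    proof (cases "h = 0")
      case False
      then have "k * ram \<alpha> \<le> subdegree h" "h \<in> Bring \<alpha>" using h by (auto simp: Fil_iff)
      moreover have "k \<le> k * ram \<alpha>" using ram(2)[of \<alpha>] by simp
      ultimately have "k < N + subdegree h" "h \<in> Bring \<alpha>" using N by linarith+
      then show ?thesis by (intro orb_image[OF \<alpha>]) (simp_all add: k_def[symmetric])
    qed (use subspace_range_E[OF \<alpha>] fpsV.subspace_0 in blast)
  qed
  moreover have "range (E \<alpha>) \<subseteq> Bring \<alpha>" using E_in_Bring[OF \<alpha>] by auto
  ultimately show ?thesis
    using fpsV.codim_split[OF codim_Fil subspace_Fil subspace_range_E[OF \<alpha>]] by blast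
qed

text \<open>Let A be the local ring, B the normalization, \<eta> the value of f. Multiplication by
  \<eta> carries B/A to \<eta> B/\<eta> A, so comparing the chains through A and through \<eta> B
  gives dim A/\<eta> A = dim B/\<eta> B, the order of \<eta> along the branch.\<close>

lemma codim_mult_E:
  assumes \<alpha>: "\<alpha> $ 0 = 0" and f: "E \<alpha> f \<noteq> 0"
  shows "fpsV.codim ((\<lambda>x. E \<alpha> f * x) ` range (E \<alpha>)) (subdegree (E \<alpha> f) div ram \<alpha>) (range (E \<alpha>))"
proof -
  let ?\<eta> = "E \<alpha> f" and ?A = "range (E \<alpha>)"
  obtain s where s: "subdegree ?\<eta> = ram \<alpha> * s"
    using ram_dvd_subdegree[OF E_in_Bring[OF \<alpha>, of f]] by (auto simp: dvd_def)
  obtain d where d: "fpsV.codim ?A d (Bring \<alpha>)" using finite_codim_E[OF \<alpha>] by blast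
  have img: "(\<lambda>x. ?\<eta> * x) ` Bring \<alpha> = Fil \<alpha> s"
  proof (intro equalityI subsetI)
    fix h assume "h \<in> (\<lambda>x. ?\<eta> * x) ` Bring \<alpha>"
    then obtain x where x: "x \<in> Bring \<alpha>" "h = ?\<eta> * x" by auto
    then have "h \<in> Bring \<alpha>"
      using E_in_Bring[OF \<alpha>, of f] by (simp add: Bring_def rhom_mult[OF rhom_\<sigma>_funpow])
    then show "h \<in> Fil \<alpha> s" using x f by (cases "x = 0") (auto simp: Fil_iff s mult.commute)
  next
    fix h assume h: "h \<in> Fil \<alpha> s"
    have "?\<eta> dvd h"
    proof (cases "h = 0")
      case False
      then show ?thesis using h f by (subst fps_dvd_iff) (auto simp: Fil_iff s mult.commute)
    qed auto
    then obtain w where w: "h = ?\<eta> * w" by (auto simp: dvd_def)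
    have "?\<eta> * (\<sigma> ^^ per \<alpha>) w = ?\<eta> * w"
      using h E_in_Bring[OF \<alpha>, of f] unfolding Fil_iff Bring_def w by (simp add: rhom_mult[OF rhom_\<sigma>_funpow])
    then have "w \<in> Bring \<alpha>" using f by (simp add: Bring_def)
    then show "h \<in> (\<lambda>x. ?\<eta> * x) ` Bring \<alpha>" using w by blast
  qed
  have "inj (\<lambda>x. ?\<eta> * x)" using f by (auto simp: inj_def)
  then have "fpsV.codim ((\<lambda>x. ?\<eta> * x) ` ?A) d (Fil \<alpha> s)"
    unfolding img[symmetric] by (intro fpsV.codim_image[OF d]) (auto simp: algebra_simps)
  from fpsV.codim_trans[OF codim_Fil this]
  have tot: "fpsV.codim ((\<lambda>x. ?\<eta> * x) ` ?A) (d + s) (Bring \<alpha>)" .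
  have sub: "fpsV.subspace ((\<lambda>x. ?\<eta> * x) ` ?A)"
  proof (intro fpsV.subspaceI)
    note S = subspace_range_E[OF \<alpha>]
    show "0 \<in> (\<lambda>x. ?\<eta> * x) ` ?A" by (rule image_eqI[OF _ fpsV.subspace_0[OF S]]) simp
    show "x + y \<in> (\<lambda>x. ?\<eta> * x) ` ?A" if "x \<in> (\<lambda>x. ?\<eta> * x) ` ?A" "y \<in> (\<lambda>x. ?\<eta> * x) ` ?A" for x y
    proof -
      obtain a b where "a \<in> ?A" "b \<in> ?A" "x = ?\<eta> * a" "y = ?\<eta> * b" using \<open>x \<in> _\<close> \<open>y \<in> _\<close> by blast
      then show ?thesis using fpsV.subspace_add[OF S]
        by (intro image_eqI[of _ _ "a + b"]) (auto simp: algebra_simps)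
    qed
    show "fps_const c * x \<in> (\<lambda>x. ?\<eta> * x) ` ?A" if x: "x \<in> (\<lambda>x. ?\<eta> * x) ` ?A" for c x
    proof -
      obtain a where "a \<in> ?A" "x = ?\<eta> * a" using x by blast
      then show ?thesis using fpsV.subspace_scale[OF S]
        by (intro image_eqI[of _ _ "fps_const c * a"]) (auto simp: algebra_simps)
    qed
  qed
  have "(\<lambda>x. ?\<eta> * x) ` ?A \<subseteq> ?A"
  proof
    fix h assume "h \<in> (\<lambda>x. ?\<eta> * x) ` ?A"
    then obtain g where "h = E \<alpha> (f * g)" by (auto simp: rhom_mult[OF rhom_E[OF \<alpha>]])
    then show "h \<in> ?A" by blast
  qed
  moreover have "?A \<subseteq> Bring \<alpha>" using E_in_Bring[OF \<alpha>] by auto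
  ultimately obtain k where k: "k \<le> d + s" "fpsV.codim ((\<lambda>x. ?\<eta> * x) ` ?A) k ?A"
    "fpsV.codim ?A (d + s - k) (Bring \<alpha>)"
    using fpsV.codim_split[OF tot sub subspace_range_E[OF \<alpha>]] by blast
  have "d + s - k = d" using fpsV.codim_unique[OF k(3) d subspace_range_E[OF \<alpha>]] .
  then have "k = s" using k(1) by simp
  then show ?thesis using k(2) s ram(2)[of \<alpha>] by simp
qed

text \<open>Dividing out g first is the same as applying \<Theta>, whose kernel is (g); what remains
  is the local ring modulo \<Theta> f. Only the image of \<Theta> is tied to
  \<open>E \<alpha>\<close>, which leaves room for a change of coordinates.\<close>

theorem intersection_number_eq:
  assumes \<alpha>: "\<alpha> $ 0 = 0" and \<Theta>: "is_rhom \<Theta>" "\<And>c. \<Theta> (cst c) = fps_const c" "range \<Theta> = range (E \<alpha>)"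
    and ker: "\<And>h. \<Theta> h = 0 \<longleftrightarrow> g dvd h" and nz: "\<Theta> f \<noteq> 0" and f0: "f $ 0 $ 0 = 0" "g $ 0 $ 0 = 0"
  shows "intersection_number f g = enat (subdegree (\<Theta> f) div ram \<alpha>)"
proof -
  interpret S: cring "power_series_ring :: 'k fps fps ring" by (rule psr_cring)
  let ?R = "power_series_ring :: 'k fps fps ring"
  define I where "I = Idl\<^bsub>?R\<^esub> {f, g}"
  define W where "W = (\<lambda>x. \<Theta> f * x) ` range \<Theta>"
  obtain f' where f': "\<Theta> f = E \<alpha> f'" using \<Theta>(3) by (metis rangeE rangeI)
  have codim: "fpsV.codim W (subdegree (\<Theta> f) div ram \<alpha>) (range \<Theta>)"
    unfolding W_def \<Theta>(3) f' using codim_mult_E[OF \<alpha>] nz f' by simp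
  have SR: "fpsV.subspace (range \<Theta>)" unfolding \<Theta>(3) by (rule subspace_range_E[OF \<alpha>])
  have W_iff: "w \<in> W \<longleftrightarrow> (\<exists>r. w = \<Theta> (f * r))" for w
    by (auto simp: W_def rhom_mult[OF \<Theta>(1)])
  have idI: "ideal I ?R" unfolding I_def by (rule S.genideal_ideal) simp
  have fg: "{f, g} \<subseteq> I" unfolding I_def by (rule S.genideal_self) simp
  have I: "I = {h. \<Theta> h \<in> W}"
  proof
    have "ideal {h. \<Theta> h \<in> W} ?R"
    proof (rule ideal_psrI)
      show "0 \<in> {h. \<Theta> h \<in> W}" by (auto simp: W_iff intro!: exI[of _ 0])
      show "a + b \<in> {h. \<Theta> h \<in> W}" if ab: "a \<in> {h. \<Theta> h \<in> W}" "b \<in> {h. \<Theta> h \<in> W}" for a b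
      proof -
        obtain r s where "\<Theta> a = \<Theta> (f * r)" "\<Theta> b = \<Theta> (f * s)" using ab by (auto simp: W_iff)
        then have "\<Theta> (a + b) = \<Theta> (f * (r + s))" by (simp add: distrib_left rhom_add[OF \<Theta>(1)])
        then show ?thesis by (auto simp: W_iff)
      qed
      show "b * a \<in> {h. \<Theta> h \<in> W}" if ab: "a \<in> {h. \<Theta> h \<in> W}" for a b
      proof -
        obtain r where "\<Theta> a = \<Theta> (f * r)" using ab by (auto simp: W_iff)
        then have "\<Theta> (b * a) = \<Theta> (f * (b * r))" by (simp add: mult_ac rhom_mult[OF \<Theta>(1)])
        then show ?thesis by (auto simp: W_iff)
      qed
    qed
    moreover have "\<Theta> f = \<Theta> (f * 1)" "\<Theta> g = \<Theta> (f * 0)"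
      using ker[of g] rhom_0[OF \<Theta>(1)] by auto
    then have "{f, g} \<subseteq> {h. \<Theta> h \<in> W}" unfolding W_iff by blast
    ultimately show "I \<subseteq> {h. \<Theta> h \<in> W}" unfolding I_def by (rule S.genideal_minimal)
    show "{h. \<Theta> h \<in> W} \<subseteq> I"
    proof
      fix h assume "h \<in> {h. \<Theta> h \<in> W}"
      then obtain r where r: "\<Theta> h = \<Theta> (f * r)" by (auto simp: W_iff)
      then have "\<Theta> (h - f * r) = 0" by (simp add: rhom_diff[OF \<Theta>(1)])
      then obtain s where "h - f * r = g * s" using ker by (auto simp: dvd_def)
      then have h: "h = f * r + g * s" by (simp add: algebra_simps)
      have "f * r \<in> I" "g * s \<in> I"
        using ideal.I_r_closed[OF idI, of f r] ideal.I_r_closed[OF idI, of g s] fg by auto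
      then show "h \<in> I"
        using additive_subgroup.a_closed[OF ideal.axioms(1)[OF idI]] h by fastforce
    qed
  qed
  have one: "\<one>\<^bsub>?R\<^esub> \<notin> I"
  proof -
    have "ideal {h. h $ 0 $ 0 = 0} ?R" by (rule ideal_psrI) auto
    then have "I \<subseteq> {h. h $ 0 $ 0 = 0}" unfolding I_def by (rule S.genideal_minimal) (use f0 in auto)
    then show ?thesis by auto
  qed
  have W: "fpsV.subspace W"
  proof (intro fpsV.subspaceI)
    show "0 \<in> W" using rhom_0[OF \<Theta>(1)] by (auto simp: W_iff intro!: exI[of _ 0])
    show "x + y \<in> W" if "x \<in> W" "y \<in> W" for x y
      using that unfolding W_iff by (metis distrib_left rhom_add[OF \<Theta>(1)])
    show "fps_const c * x \<in> W" if "x \<in> W" for c x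
      using that unfolding W_iff by (metis \<Theta>(2) mult.left_commute rhom_mult[OF \<Theta>(1)])
  qed
  have "quotient_dim ?R (range cst) I = enat (subdegree (\<Theta> f) div ram \<alpha>)"
  proof (rule fpsV.quotient_dim_eq_codim[where \<Theta> = \<Theta> and W = W])
    show "ring ?R" by (rule psr_ring)
    show "subfield (range cst) ?R" by (rule subfield_constants)
    show "fpsV.codim W (subdegree (\<Theta> f) div ram \<alpha>) (\<Theta> ` carrier ?R)" using codim by simp
  qed (use idI one W I in \<open>simp_all add: rhom_add[OF \<Theta>(1)] rhom_mult[OF \<Theta>(1)] \<Theta>(2)\<close>)
  then show ?thesis by (simp add: intersection_number_def constants_def I_def)
qed

end

section \<open>The total ring of fractions of a parametrized curve\<close>

text \<open>Ring identities are pulled back along the jointly injective maps \<phi> i, which spares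
  checking them on classes of fractions.\<close>

lemma cring_jointly_injective:
  fixes Q :: "('q, 'm) ring_scheme" (structure) and \<phi> :: "'i \<Rightarrow> 'q \<Rightarrow> 'f::comm_ring_1"
  assumes cl: "\<And>x y. x \<in> carrier Q \<Longrightarrow> y \<in> carrier Q \<Longrightarrow> x \<otimes> y \<in> carrier Q"
      "\<And>x y. x \<in> carrier Q \<Longrightarrow> y \<in> carrier Q \<Longrightarrow> x \<oplus> y \<in> carrier Q"
      "\<one> \<in> carrier Q" "\<zero> \<in> carrier Q"
    and neg: "\<And>x. x \<in> carrier Q \<Longrightarrow> \<exists>y\<in>carrier Q. \<forall>i\<in>S. \<phi> i y = - \<phi> i x"
    and hom: "\<And>i x y. i \<in> S \<Longrightarrow> x \<in> carrier Q \<Longrightarrow> y \<in> carrier Q \<Longrightarrow> \<phi> i (x \<otimes> y) = \<phi> i x * \<phi> i y"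
      "\<And>i x y. i \<in> S \<Longrightarrow> x \<in> carrier Q \<Longrightarrow> y \<in> carrier Q \<Longrightarrow> \<phi> i (x \<oplus> y) = \<phi> i x + \<phi> i y"
      "\<And>i. i \<in> S \<Longrightarrow> \<phi> i \<one> = 1" "\<And>i. i \<in> S \<Longrightarrow> \<phi> i \<zero> = 0"
    and inj: "\<And>x y. x \<in> carrier Q \<Longrightarrow> y \<in> carrier Q \<Longrightarrow> (\<And>i. i \<in> S \<Longrightarrow> \<phi> i x = \<phi> i y) \<Longrightarrow> x = y"
  shows "cring Q"
proof (intro cringI abelian_groupI comm_monoidI)
  fix x assume x: "x \<in> carrier Q"
  obtain y where y: "y \<in> carrier Q" "\<forall>i\<in>S. \<phi> i y = - \<phi> i x" using neg[OF x] by blast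
  have "y \<oplus> x = \<zero>" by (rule inj) (use x y cl hom in auto)
  then show "\<exists>y\<in>carrier Q. y \<oplus> x = \<zero>" using y by blast
qed (auto intro!: inj simp: cl hom algebra_simps)

text \<open>The curve seen through its roots S in the coordinates T. By \<open>ker\<close> its local
  ring embeds into a product of copies of K[[t]]; \<open>big\<close> expresses that the curve is
  singular and keeps the conductor a proper ideal.\<close>

locale curve = galois N \<zeta> for N and \<zeta> :: "'k::{alg_closed_field,field_char_0}" +
  fixes S :: "'k fps set" and T :: "'k fps fps \<Rightarrow> 'k fps fps" and f :: "'k fps fps"
  assumes stable_S: "stable S" and S_nonempty: "S \<noteq> {}"
    and rhom_T: "is_rhom T" and bij_T: "bij T" and T_cst: "\<And>c. T (cst c) = cst c"
    and ker: "\<And>h. f dvd h \<longleftrightarrow> (\<forall>\<alpha>\<in>S. E \<alpha> (T h) = 0)"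
    and big: "\<And>\<alpha>. \<alpha> \<in> S \<Longrightarrow> N \<le> subdegree (Dif S \<alpha>)"
begin

definition th :: "'k fps \<Rightarrow> 'k fps fps \<Rightarrow> 'k fps" where "th \<alpha> h = E \<alpha> (T h)"

lemma S0: "\<alpha> \<in> S \<Longrightarrow> \<alpha> $ 0 = 0" and finite_S: "finite S" and \<sigma>_S: "\<alpha> \<in> S \<Longrightarrow> \<sigma> \<alpha> \<in> S"
  using stable_S by (auto simp: stable_def)

lemma rhom_th: "\<alpha> \<in> S \<Longrightarrow> is_rhom (th \<alpha>)"
  unfolding th_def[abs_def] by (rule rhom_comp[OF rhom_E[OF S0] rhom_T])

lemmas th_simps = rhomD[OF rhom_th]

lemma th_cst: "\<alpha> \<in> S \<Longrightarrow> th \<alpha> (cst c) = fps_const c"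
  by (simp add: th_def T_cst ev_cst[OF XN0 S0])

lemma th_\<sigma>: "\<alpha> \<in> S \<Longrightarrow> th (\<sigma> \<alpha>) h = \<sigma> (th \<alpha> h)"
  by (simp add: th_def \<sigma>_E S0)

lemma T_surj: "\<exists>h. T h = g" using bij_T by (metis bij_pointE)

lemma f_dvd_iff: "f dvd a - b \<longleftrightarrow> (\<forall>\<alpha>\<in>S. th \<alpha> a = th \<alpha> b)"
  unfolding ker by (auto simp: th_def rhom_diff[OF rhom_T] rhom_diff[OF rhom_E[OF S0]])

lemma th_interpolation:
  assumes "\<And>\<alpha>. \<alpha> \<in> S \<Longrightarrow> u (\<sigma> \<alpha>) = \<sigma> (u \<alpha>)"
    and "\<And>\<alpha>. \<alpha> \<in> S \<Longrightarrow> u \<alpha> = 0 \<or> subdegree (Dif S \<alpha>) < N + subdegree (u \<alpha>)"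
  shows "\<exists>h. \<forall>\<alpha>\<in>S. th \<alpha> h = u \<alpha>"
proof -
  obtain g where g: "\<forall>\<alpha>\<in>S. E \<alpha> g = u \<alpha>" using interpolation[OF stable_S assms] by blast
  obtain h where "T h = g" using T_surj by blast
  then show ?thesis using g by (auto simp: th_def)
qed

abbreviation "psr \<equiv> power_series_ring :: 'k fps fps ring"
abbreviation "OC \<equiv> local_ring f"
definition "cl h = PIdl\<^bsub>psr\<^esub> f +>\<^bsub>psr\<^esub> h"
definition "nz s \<longleftrightarrow> (\<forall>\<alpha>\<in>S. th \<alpha> s \<noteq> 0)"

lemma PIdl_f: "PIdl\<^bsub>psr\<^esub> f = {h. f dvd h}"
  by (auto simp: cgenideal_def dvd_def mult.commute)

lemma ideal_f: "ideal (PIdl\<^bsub>psr\<^esub> f) psr"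
  by (rule cring.cgenideal_ideal[OF psr_cring]) simp

lemma cl_eq: "cl a = cl b \<longleftrightarrow> (\<forall>\<alpha>\<in>S. th \<alpha> a = th \<alpha> b)"
proof -
  interpret S: cring psr by (rule psr_cring)
  have "\<ominus>\<^bsub>psr\<^esub> b = - b" by (rule S.minus_equality) auto
  then have "a \<ominus>\<^bsub>psr\<^esub> b = a - b" by (simp add: a_minus_def)
  then show ?thesis
    using S.quotient_eq_iff_same_a_r_cos[OF ideal_f, of a b] unfolding cl_def PIdl_f
    by (simp add: f_dvd_iff)
qed

lemma carrier_OC: "carrier OC = range cl"
  unfolding local_ring_def FactRing_def ring.simps partial_object.simps A_RCOSETS_def' cl_def by auto

lemma cl_carrier: "cl a \<in> carrier OC" unfolding carrier_OC by (rule rangeI)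

lemma cl_hom: "cl a \<otimes>\<^bsub>OC\<^esub> cl b = cl (a * b)" "cl a \<oplus>\<^bsub>OC\<^esub> cl b = cl (a + b)"
  "\<one>\<^bsub>OC\<^esub> = cl 1" "\<zero>\<^bsub>OC\<^esub> = cl 0"
proof -
  interpret h: ring_hom_ring psr "psr Quot (PIdl\<^bsub>psr\<^esub> f)" "\<lambda>x. PIdl\<^bsub>psr\<^esub> f +>\<^bsub>psr\<^esub> x"
    by (rule ideal.rcos_ring_hom_ring[OF ideal_f])
  show "cl a \<otimes>\<^bsub>OC\<^esub> cl b = cl (a * b)" using h.hom_mult[of a b] by (simp add: cl_def local_ring_def)
  show "cl a \<oplus>\<^bsub>OC\<^esub> cl b = cl (a + b)" using h.hom_add[of a b] by (simp add: cl_def local_ring_def)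
  show "\<one>\<^bsub>OC\<^esub> = cl 1" using h.hom_one by (simp add: cl_def local_ring_def)
  show "\<zero>\<^bsub>OC\<^esub> = cl 0" using h.hom_zero by (simp add: cl_def local_ring_def)
qed

text \<open>If s vanishes at \<alpha> it vanishes on the whole orbit, and the equation with the
  remaining roots kills s without being zero at \<alpha>.\<close>

lemma nzd: "cl s \<in> nonzerodivisors OC \<longleftrightarrow> nz s"
proof
  assume s: "cl s \<in> nonzerodivisors OC"
  show "nz s" unfolding nz_def
  proof
    fix \<alpha> assume \<alpha>: "\<alpha> \<in> S"
    show "th \<alpha> s \<noteq> 0"
    proof
      assume 0: "th \<alpha> s = 0"
      have orb0: "th \<beta> s = 0" if b: "\<beta> \<in> orb \<alpha>" for \<beta>
      proof -
        obtain i where "\<beta> = (\<sigma> ^^ i) \<alpha>" using b unfolding orb_def by blast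
        then show ?thesis using 0 \<sigma>_funpow_E[OF S0[OF \<alpha>], of i "T s"] rhom_0[OF rhom_\<sigma>_funpow]
          by (simp add: th_def)
      qed
      let ?A = "S - orb \<alpha>"
      have "\<sigma> \<beta> \<notin> orb \<alpha>" if "\<beta> \<in> ?A" for \<beta>
      proof
        assume "\<sigma> \<beta> \<in> orb \<alpha>"
        moreover have "\<sigma> \<beta> \<in> orb \<beta>" using \<sigma>_orb orb_self by blast
        ultimately have "orb \<beta> = orb \<alpha>" using orb_eqI by metis
        then show False using that orb_self by blast
      qed
      then have stA: "stable ?A"
        using stable_S by (auto simp: stable_def)
      obtain a where a: "T a = conv (dpoly ?A)" using T_surj by blast
      have tha: "th \<beta> a = (\<Prod>\<gamma>\<in>?A. \<beta> - \<gamma>)" if "\<beta> \<in> S" for \<beta>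
        unfolding th_def a by (rule E_dpoly[OF stA S0[OF that]])
      have "cl a \<otimes>\<^bsub>OC\<^esub> cl s = \<zero>\<^bsub>OC\<^esub>"
        unfolding cl_hom cl_eq
      proof
        fix \<beta> assume b: "\<beta> \<in> S"
        show "th \<beta> (a * s) = th \<beta> 0"
        proof (cases "\<beta> \<in> orb \<alpha>")
          case False
          then have "th \<beta> a = 0" using tha[OF b] b finite_S by auto
          then show ?thesis by (simp add: th_simps b)
        qed (simp add: th_simps b orb0)
      qed
      then have "cl a = \<zero>\<^bsub>OC\<^esub>" using s by (auto simp: nonzerodivisors_def carrier_OC)
      then have "th \<alpha> a = 0" using \<alpha> by (simp add: cl_hom cl_eq th_simps)
      then have "\<alpha> \<in> ?A" using tha[OF \<alpha>] finite_S by auto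
      then show False using orb_self by blast
    qed
  qed
next
  assume s: "nz s"
  have "x = \<zero>\<^bsub>OC\<^esub>" if x: "x \<in> carrier OC" "x \<otimes>\<^bsub>OC\<^esub> cl s = \<zero>\<^bsub>OC\<^esub>" for x
  proof -
    obtain a where a: "x = cl a" using x by (auto simp: carrier_OC)
    then have "\<forall>\<alpha>\<in>S. th \<alpha> (a * s) = th \<alpha> 0" using x by (simp add: cl_hom cl_eq)
    then have "\<forall>\<alpha>\<in>S. th \<alpha> a = th \<alpha> 0" using s by (auto simp: th_simps nz_def)
    then show ?thesis by (simp add: a cl_hom cl_eq)
  qed
  then show "cl s \<in> nonzerodivisors OC" by (auto simp: nonzerodivisors_def carrier_OC)
qed

definition "fr a s = fraction OC (cl a) (cl s)"

lemma fr_eq: "fr a s = {(cl b, cl t) | b t. nz t \<and> (\<forall>\<alpha>\<in>S. th \<alpha> a * th \<alpha> t = th \<alpha> b * th \<alpha> s)}"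
proof (intro Set.set_eqI iffI)
  fix p assume "p \<in> fr a s"
  then obtain x y where p: "p = (x, y)" "x \<in> carrier OC" "y \<in> nonzerodivisors OC"
    "cl a \<otimes>\<^bsub>OC\<^esub> y = x \<otimes>\<^bsub>OC\<^esub> cl s" by (auto simp: fr_def fraction_def)
  obtain b t where bt: "x = cl b" "y = cl t"
    using p(2,3) unfolding nonzerodivisors_def carrier_OC by auto
  show "p \<in> {(cl b, cl t) | b t. nz t \<and> (\<forall>\<alpha>\<in>S. th \<alpha> a * th \<alpha> t = th \<alpha> b * th \<alpha> s)}"
    using p bt by (auto simp: nzd cl_hom cl_eq th_simps)
next
  fix p assume "p \<in> {(cl b, cl t) | b t. nz t \<and> (\<forall>\<alpha>\<in>S. th \<alpha> a * th \<alpha> t = th \<alpha> b * th \<alpha> s)}"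
  then obtain b t where "p = (cl b, cl t)" "nz t" "\<forall>\<alpha>\<in>S. th \<alpha> a * th \<alpha> t = th \<alpha> b * th \<alpha> s" by blast
  then show "p \<in> fr a s"
    by (simp add: fr_def fraction_def nzd cl_hom cl_eq th_simps cl_carrier)
qed

lemma nz_mult: "nz s \<Longrightarrow> nz t \<Longrightarrow> nz (s * t)"
  by (simp add: nz_def th_simps)

lemma nz_1: "nz 1" by (simp add: nz_def th_simps)

lemma fr_self: "nz s \<Longrightarrow> (cl a, cl s) \<in> fr a s"
  unfolding fr_eq by blast

lemma fr_cong:
  assumes "nz s" "nz t"
  shows "fr a s = fr b t \<longleftrightarrow> (\<forall>\<alpha>\<in>S. th \<alpha> a * th \<alpha> t = th \<alpha> b * th \<alpha> s)"
proof
  assume "fr a s = fr b t"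
  then have "(cl b, cl t) \<in> fr a s" using fr_self assms by simp
  then obtain b' t' where "cl b = cl b'" "cl t = cl t'" "\<forall>\<alpha>\<in>S. th \<alpha> a * th \<alpha> t' = th \<alpha> b' * th \<alpha> s"
    unfolding fr_eq by blast
  then show "\<forall>\<alpha>\<in>S. th \<alpha> a * th \<alpha> t = th \<alpha> b * th \<alpha> s" by (simp add: cl_eq)
next
  assume e: "\<forall>\<alpha>\<in>S. th \<alpha> a * th \<alpha> t = th \<alpha> b * th \<alpha> s"
  have "(th \<alpha> a * th \<alpha> u = th \<alpha> c * th \<alpha> s) \<longleftrightarrow> (th \<alpha> b * th \<alpha> u = th \<alpha> c * th \<alpha> t)" if \<alpha>: "\<alpha> \<in> S" for \<alpha> u c
  proof -
    have n: "th \<alpha> s \<noteq> 0" "th \<alpha> t \<noteq> 0" using assms \<alpha> by (auto simp: nz_def)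
    have "th \<alpha> a * th \<alpha> u = th \<alpha> c * th \<alpha> s \<longleftrightarrow> (th \<alpha> a * th \<alpha> u) * th \<alpha> t = (th \<alpha> c * th \<alpha> s) * th \<alpha> t"
      using n by simp
    also have "(th \<alpha> a * th \<alpha> u) * th \<alpha> t = (th \<alpha> a * th \<alpha> t) * th \<alpha> u" by (simp only: mult_ac)
    also have "\<dots> = (th \<alpha> b * th \<alpha> u) * th \<alpha> s" using e \<alpha> by (simp only: mult_ac)
    also have "(th \<alpha> c * th \<alpha> s) * th \<alpha> t = (th \<alpha> c * th \<alpha> t) * th \<alpha> s" by (simp only: mult_ac)
    finally show ?thesis using n by simp
  qed
  then have "(\<forall>\<alpha>\<in>S. th \<alpha> a * th \<alpha> u = th \<alpha> c * th \<alpha> s) \<longleftrightarrow> (\<forall>\<alpha>\<in>S. th \<alpha> b * th \<alpha> u = th \<alpha> c * th \<alpha> t)" for u c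
    by (intro ball_cong refl)
  then show "fr a s = fr b t" unfolding fr_eq by (simp only:)
qed

definition "Q = total_fraction_ring OC"

lemma carrier_Q: "carrier Q = {fr a s | a s. nz s}"
proof -
  have "carrier Q = {fraction OC x y | x y. x \<in> carrier OC \<and> y \<in> nonzerodivisors OC}"
    by (simp add: Q_def total_fraction_ring_def)
  also have "\<dots> = {fr a s | a s. nz s}"
  proof (intro Set.set_eqI iffI)
    fix U assume "U \<in> {fraction OC x y | x y. x \<in> carrier OC \<and> y \<in> nonzerodivisors OC}"
    then obtain x y where xy: "U = fraction OC x y" "x \<in> carrier OC" "y \<in> nonzerodivisors OC" by blast
    then obtain a s where "x = cl a" "y = cl s" unfolding nonzerodivisors_def carrier_OC by auto
    then show "U \<in> {fr a s | a s. nz s}" using xy nzd unfolding fr_def by blast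
  next
    fix U assume "U \<in> {fr a s | a s. nz s}"
    then obtain a s where "U = fr a s" "nz s" by blast
    then show "U \<in> {fraction OC x y | x y. x \<in> carrier OC \<and> y \<in> nonzerodivisors OC}"
      using nzd carrier_OC unfolding fr_def by blast
  qed
  finally show ?thesis .
qed

text \<open>The operations on fractions are unions over representatives; once the outcome is
  independent of these, the union is that one class.\<close>

lemma UN_const2:
  assumes "U \<noteq> {}" "V \<noteq> {}" "\<And>p q. p \<in> U \<Longrightarrow> q \<in> V \<Longrightarrow> F p q = c"
  shows "(\<Union>p\<in>U. \<Union>q\<in>V. F p q) = c"
  using assms by auto

lemma Q_mult:
  assumes s: "nz s" and t: "nz t" shows "fr a s \<otimes>\<^bsub>Q\<^esub> fr b t = fr (a * b) (s * t)"
proof -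
  have "fr a s \<otimes>\<^bsub>Q\<^esub> fr b t = (\<Union>p\<in>fr a s. \<Union>q\<in>fr b t. fraction OC (fst p \<otimes>\<^bsub>OC\<^esub> fst q) (snd p \<otimes>\<^bsub>OC\<^esub> snd q))"
    by (simp add: Q_def total_fraction_ring_def case_prod_unfold)
  also have "\<dots> = fr (a * b) (s * t)"
  proof (rule UN_const2)
    fix p q assume "p \<in> fr a s" "q \<in> fr b t"
    then obtain a' s' b' t' where *: "p = (cl a', cl s')" "nz s'" "\<And>\<alpha>. \<alpha>\<in>S \<Longrightarrow> th \<alpha> a * th \<alpha> s' = th \<alpha> a' * th \<alpha> s"
      "q = (cl b', cl t')" "nz t'" "\<And>\<alpha>. \<alpha>\<in>S \<Longrightarrow> th \<alpha> b * th \<alpha> t' = th \<alpha> b' * th \<alpha> t"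
      unfolding fr_eq by blast
    have "(th \<alpha> a' * th \<alpha> b') * (th \<alpha> s * th \<alpha> t) = (th \<alpha> a * th \<alpha> b) * (th \<alpha> s' * th \<alpha> t')" if \<alpha>: "\<alpha> \<in> S" for \<alpha>
    proof -
      have "(th \<alpha> a' * th \<alpha> b') * (th \<alpha> s * th \<alpha> t) = (th \<alpha> a' * th \<alpha> s) * (th \<alpha> b' * th \<alpha> t)"
        by (simp only: mult_ac)
      also have "\<dots> = (th \<alpha> a * th \<alpha> s') * (th \<alpha> b * th \<alpha> t')"
        using *(3,6)[OF \<alpha>] by simp
      finally show ?thesis by (simp only: mult_ac)
    qed
    then have "fr (a' * b') (s' * t') = fr (a * b) (s * t)"
      using * s t by (subst fr_cong) (auto simp: nz_mult th_simps)
    then show "fraction OC (fst p \<otimes>\<^bsub>OC\<^esub> fst q) (snd p \<otimes>\<^bsub>OC\<^esub> snd q) = fr (a * b) (s * t)"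
      by (simp add: * cl_hom fr_def)
  qed (use fr_self s t in blast)+
  finally show ?thesis .
qed

lemma Q_add:
  assumes s: "nz s" and t: "nz t" shows "fr a s \<oplus>\<^bsub>Q\<^esub> fr b t = fr (a * t + b * s) (s * t)"
proof -
  have "fr a s \<oplus>\<^bsub>Q\<^esub> fr b t = (\<Union>p\<in>fr a s. \<Union>q\<in>fr b t.
      fraction OC (fst p \<otimes>\<^bsub>OC\<^esub> snd q \<oplus>\<^bsub>OC\<^esub> fst q \<otimes>\<^bsub>OC\<^esub> snd p) (snd p \<otimes>\<^bsub>OC\<^esub> snd q))"
    by (simp add: Q_def total_fraction_ring_def case_prod_unfold)
  also have "\<dots> = fr (a * t + b * s) (s * t)"
  proof (rule UN_const2)
    fix p q assume "p \<in> fr a s" "q \<in> fr b t"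
    then obtain a' s' b' t' where *: "p = (cl a', cl s')" "nz s'" "\<And>\<alpha>. \<alpha>\<in>S \<Longrightarrow> th \<alpha> a * th \<alpha> s' = th \<alpha> a' * th \<alpha> s"
      "q = (cl b', cl t')" "nz t'" "\<And>\<alpha>. \<alpha>\<in>S \<Longrightarrow> th \<alpha> b * th \<alpha> t' = th \<alpha> b' * th \<alpha> t"
      unfolding fr_eq by blast
    have "(th \<alpha> a' * th \<alpha> t' + th \<alpha> b' * th \<alpha> s') * (th \<alpha> s * th \<alpha> t)
        = (th \<alpha> a * th \<alpha> t + th \<alpha> b * th \<alpha> s) * (th \<alpha> s' * th \<alpha> t')" if \<alpha>: "\<alpha> \<in> S" for \<alpha>
    proof -
      have "(th \<alpha> a' * th \<alpha> t' + th \<alpha> b' * th \<alpha> s') * (th \<alpha> s * th \<alpha> t)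
          = (th \<alpha> a' * th \<alpha> s) * (th \<alpha> t * th \<alpha> t') + (th \<alpha> b' * th \<alpha> t) * (th \<alpha> s * th \<alpha> s')"
        by (simp only: distrib_right distrib_left mult_ac)
      also have "\<dots> = (th \<alpha> a * th \<alpha> s') * (th \<alpha> t * th \<alpha> t') + (th \<alpha> b * th \<alpha> t') * (th \<alpha> s * th \<alpha> s')"
        using *(3,6)[OF \<alpha>] by simp
      finally show ?thesis by (simp only: distrib_right distrib_left mult_ac)
    qed
    then have "fr (a' * t' + b' * s') (s' * t') = fr (a * t + b * s) (s * t)"
      using * s t by (subst fr_cong) (auto simp: nz_mult th_simps)
    then show "fraction OC (fst p \<otimes>\<^bsub>OC\<^esub> snd q \<oplus>\<^bsub>OC\<^esub> fst q \<otimes>\<^bsub>OC\<^esub> snd p) (snd p \<otimes>\<^bsub>OC\<^esub> snd q) = fr (a * t + b * s) (s * t)"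
      by (simp add: * cl_hom fr_def)
  qed (use fr_self s t in blast)+
  finally show ?thesis .
qed

lemma Q_one: "\<one>\<^bsub>Q\<^esub> = fr 1 1" and Q_zero: "\<zero>\<^bsub>Q\<^esub> = fr 0 1"
  by (simp_all add: Q_def total_fraction_ring_def fr_def cl_hom)

lemma to_fraction_eq: "to_fraction OC (cl a) = fr a 1"
  by (simp add: to_fraction_def fr_def cl_hom)

section \<open>Values of fractions as Laurent series\<close>

text \<open>The value of a fraction at the root \<alpha>, in K((t)) because denominators may vanish
  at t = 0. By \<open>\<phi>_fr\<close> the chosen representative does not matter.\<close>

definition \<phi> :: "'k fps \<Rightarrow> ('k fps fps set \<times> 'k fps fps set) set \<Rightarrow> 'k fls" where
  "\<phi> \<alpha> U = (let (a, s) = (SOME (a, s). nz s \<and> U = fr a s) in fps_to_fls (th \<alpha> a) / fps_to_fls (th \<alpha> s))"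

lemma \<phi>_fr:
  assumes "nz s" "\<alpha> \<in> S" shows "\<phi> \<alpha> (fr a s) = fps_to_fls (th \<alpha> a) / fps_to_fls (th \<alpha> s)"
proof -
  obtain b t where bt: "(SOME (b, t). nz t \<and> fr a s = fr b t) = (b, t)" by (rule prod.exhaust)
  have "(\<lambda>(b, t). nz t \<and> fr a s = fr b t) (SOME (b, t). nz t \<and> fr a s = fr b t)"
    by (rule someI[where x = "(a, s)"]) (use assms in simp)
  then have t: "nz t" "fr a s = fr b t" unfolding bt by auto
  then have "th \<alpha> a * th \<alpha> t = th \<alpha> b * th \<alpha> s" using fr_cong[OF assms(1) t(1)] assms(2) by blast
  then have "fps_to_fls (th \<alpha> a) * fps_to_fls (th \<alpha> t) = fps_to_fls (th \<alpha> b) * fps_to_fls (th \<alpha> s)"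
    by (simp flip: fls_times_fps_to_fls)
  moreover have "fps_to_fls (th \<alpha> s) \<noteq> 0" "fps_to_fls (th \<alpha> t) \<noteq> 0"
    using assms t by (auto simp: nz_def)
  ultimately have "fps_to_fls (th \<alpha> b) / fps_to_fls (th \<alpha> t) = fps_to_fls (th \<alpha> a) / fps_to_fls (th \<alpha> s)"
    by (simp add: frac_eq_eq)
  then show ?thesis unfolding \<phi>_def bt by simp
qed

lemma \<phi>_mult: "\<alpha> \<in> S \<Longrightarrow> x \<in> carrier Q \<Longrightarrow> y \<in> carrier Q \<Longrightarrow> \<phi> \<alpha> (x \<otimes>\<^bsub>Q\<^esub> y) = \<phi> \<alpha> x * \<phi> \<alpha> y"
  by (auto simp: carrier_Q Q_mult \<phi>_fr nz_mult th_simps fls_times_fps_to_fls)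

lemma \<phi>_add:
  assumes \<alpha>: "\<alpha> \<in> S" and xy: "x \<in> carrier Q" "y \<in> carrier Q"
  shows "\<phi> \<alpha> (x \<oplus>\<^bsub>Q\<^esub> y) = \<phi> \<alpha> x + \<phi> \<alpha> y"
proof -
  obtain a s b t where *: "x = fr a s" "nz s" "y = fr b t" "nz t" using xy by (auto simp: carrier_Q)
  have n: "fps_to_fls (th \<alpha> s) \<noteq> 0" "fps_to_fls (th \<alpha> t) \<noteq> 0" using * \<alpha> by (auto simp: nz_def)
  show ?thesis
    using * \<alpha> by (simp add: Q_add \<phi>_fr nz_mult th_simps fls_times_fps_to_fls add_frac_eq[OF n])
qed

lemma \<phi>_one: "\<alpha> \<in> S \<Longrightarrow> \<phi> \<alpha> \<one>\<^bsub>Q\<^esub> = 1" and \<phi>_zero: "\<alpha> \<in> S \<Longrightarrow> \<phi> \<alpha> \<zero>\<^bsub>Q\<^esub> = 0"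
  by (simp_all add: Q_one Q_zero \<phi>_fr nz_1 th_simps)

lemma \<phi>_inj:
  assumes xy: "x \<in> carrier Q" "y \<in> carrier Q" and e: "\<And>\<alpha>. \<alpha> \<in> S \<Longrightarrow> \<phi> \<alpha> x = \<phi> \<alpha> y" shows "x = y"
proof -
  obtain a s b t where *: "x = fr a s" "nz s" "y = fr b t" "nz t" using xy by (auto simp: carrier_Q)
  have "th \<alpha> a * th \<alpha> t = th \<alpha> b * th \<alpha> s" if \<alpha>: "\<alpha> \<in> S" for \<alpha>
  proof -
    have n: "fps_to_fls (th \<alpha> s) \<noteq> 0" "fps_to_fls (th \<alpha> t) \<noteq> 0" using * \<alpha> by (auto simp: nz_def)
    have "fps_to_fls (th \<alpha> a) * fps_to_fls (th \<alpha> t) = fps_to_fls (th \<alpha> b) * fps_to_fls (th \<alpha> s)"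
      using e[OF \<alpha>] n \<alpha> * by (simp add: \<phi>_fr frac_eq_eq)
    then show ?thesis by (simp flip: fls_times_fps_to_fls)
  qed
  then show ?thesis using * fr_cong by blast
qed

lemma Q_cring: "cring Q"
proof (rule cring_jointly_injective[where \<phi> = \<phi> and S = S])
  fix x assume "x \<in> carrier Q"
  then obtain a s where *: "x = fr a s" "nz s" by (auto simp: carrier_Q)
  show "\<exists>y\<in>carrier Q. \<forall>\<alpha>\<in>S. \<phi> \<alpha> y = - \<phi> \<alpha> x"
    using * by (intro bexI[of _ "fr (- a) s"]) (auto simp: \<phi>_fr th_simps carrier_Q )
next
  fix x y assume "x \<in> carrier Q" "y \<in> carrier Q"
  then obtain a s b t where *: "x = fr a s" "nz s" "y = fr b t" "nz t" by (auto simp: carrier_Q)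
  then show "x \<otimes>\<^bsub>Q\<^esub> y \<in> carrier Q" "x \<oplus>\<^bsub>Q\<^esub> y \<in> carrier Q"
    unfolding carrier_Q using nz_mult[OF *(2,4)] by (simp only: * Q_mult Q_add, blast)+
next
  show "\<one>\<^bsub>Q\<^esub> \<in> carrier Q" "\<zero>\<^bsub>Q\<^esub> \<in> carrier Q"
    unfolding carrier_Q Q_one Q_zero using nz_1 by blast+
qed (simp_all add: \<phi>_mult \<phi>_add \<phi>_one \<phi>_zero \<phi>_inj)

end

section \<open>Integral closure and conductor\<close>

context curve begin

definition "Aset = range (\<lambda>a. fr a 1)"

text \<open>The fractions without a pole at any root, later recognized as the integral closure in
  \<open>integral_closure_eq\<close>.\<close>

definition "Bset = {u \<in> carrier Q. \<forall>\<alpha>\<in>S. \<phi> \<alpha> u \<in> range fps_to_fls}"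

text \<open>The value 0 outside S makes the image of \<open>bet\<close> a subspace of a function
  space on which it is injective as a coordinate map, see \<open>Bset_eqI\<close>.\<close>

definition bet :: "('k fps fps set \<times> 'k fps fps set) set \<Rightarrow> 'k fps \<Rightarrow> 'k fps" where
  "bet u \<alpha> = (if \<alpha> \<in> S then fls_regpart (\<phi> \<alpha> u) else 0)"

lemma bet: "u \<in> Bset \<Longrightarrow> \<alpha> \<in> S \<Longrightarrow> \<phi> \<alpha> u = fps_to_fls (bet u \<alpha>)"
  by (auto simp: Bset_def bet_def)

lemma bet_outside: "\<alpha> \<notin> S \<Longrightarrow> bet u \<alpha> = 0" by (simp add: bet_def)

lemma Bset_carrier: "u \<in> Bset \<Longrightarrow> u \<in> carrier Q" by (simp add: Bset_def)

lemma image_Aset: "to_fraction OC ` carrier OC = Aset"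
  unfolding carrier_OC Aset_def image_image to_fraction_eq ..

lemma fr1_Bset: "fr a 1 \<in> Bset" and bet_fr1: "\<alpha> \<in> S \<Longrightarrow> bet (fr a 1) \<alpha> = th \<alpha> a"
proof -
  have \<phi>1: "\<phi> \<alpha> (fr a 1) = fps_to_fls (th \<alpha> a)" if "\<alpha> \<in> S" for \<alpha>
    using that by (simp add: \<phi>_fr nz_1 th_simps)
  then show "fr a 1 \<in> Bset" using nz_1 unfolding Bset_def carrier_Q by auto
  show "\<alpha> \<in> S \<Longrightarrow> bet (fr a 1) \<alpha> = th \<alpha> a" using \<phi>1 by (simp add: bet_def)
qed

lemma Bset_eqI: "u \<in> Bset \<Longrightarrow> v \<in> Bset \<Longrightarrow> (\<And>\<alpha>. \<alpha> \<in> S \<Longrightarrow> bet u \<alpha> = bet v \<alpha>) \<Longrightarrow> u = v"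
  by (rule \<phi>_inj) (auto simp: Bset_carrier bet)

lemma Aset_iff: assumes "u \<in> Bset" shows "u \<in> Aset \<longleftrightarrow> (\<exists>a. \<forall>\<alpha>\<in>S. bet u \<alpha> = th \<alpha> a)"
proof
  assume "u \<in> Aset"
  then show "\<exists>a. \<forall>\<alpha>\<in>S. bet u \<alpha> = th \<alpha> a" using bet_fr1 unfolding Aset_def by blast
next
  assume "\<exists>a. \<forall>\<alpha>\<in>S. bet u \<alpha> = th \<alpha> a"
  then obtain a where "\<forall>\<alpha>\<in>S. bet u \<alpha> = th \<alpha> a" by blast
  then have "u = fr a 1" by (intro Bset_eqI assms fr1_Bset) (simp add: bet_fr1)
  then show "u \<in> Aset" by (simp add: Aset_def)
qed

lemma Bset_ops:
  assumes "u \<in> Bset" "v \<in> Bset"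
  shows "u \<otimes>\<^bsub>Q\<^esub> v \<in> Bset" "\<alpha> \<in> S \<Longrightarrow> bet (u \<otimes>\<^bsub>Q\<^esub> v) \<alpha> = bet u \<alpha> * bet v \<alpha>"
    "u \<oplus>\<^bsub>Q\<^esub> v \<in> Bset" "\<alpha> \<in> S \<Longrightarrow> bet (u \<oplus>\<^bsub>Q\<^esub> v) \<alpha> = bet u \<alpha> + bet v \<alpha>"
proof -
  interpret Q: cring Q by (rule Q_cring)
  have m: "\<phi> \<alpha> (u \<otimes>\<^bsub>Q\<^esub> v) = fps_to_fls (bet u \<alpha> * bet v \<alpha>)" if "\<alpha> \<in> S" for \<alpha>
    using assms that by (simp add: \<phi>_mult Bset_carrier bet fls_times_fps_to_fls)
  have a: "\<phi> \<alpha> (u \<oplus>\<^bsub>Q\<^esub> v) = fps_to_fls (bet u \<alpha> + bet v \<alpha>)" if "\<alpha> \<in> S" for \<alpha>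
    using assms that by (simp add: \<phi>_add Bset_carrier bet)
  show "u \<otimes>\<^bsub>Q\<^esub> v \<in> Bset" "u \<oplus>\<^bsub>Q\<^esub> v \<in> Bset"
    using m a assms by (auto simp: Bset_def simp del: fps_to_fls_plus)
  show "\<alpha> \<in> S \<Longrightarrow> bet (u \<otimes>\<^bsub>Q\<^esub> v) \<alpha> = bet u \<alpha> * bet v \<alpha>" "\<alpha> \<in> S \<Longrightarrow> bet (u \<oplus>\<^bsub>Q\<^esub> v) \<alpha> = bet u \<alpha> + bet v \<alpha>"
    using m a by (simp_all add: bet_def)
qed

lemma bet_\<sigma>: assumes u: "u \<in> Bset" and \<alpha>: "\<alpha> \<in> S" shows "bet u (\<sigma> \<alpha>) = \<sigma> (bet u \<alpha>)"
proof -
  obtain a s where as: "u = fr a s" "nz s" using Bset_carrier[OF u] by (auto simp: carrier_Q)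
  have e: "bet u \<beta> * th \<beta> s = th \<beta> a" if b: "\<beta> \<in> S" for \<beta>
  proof -
    have "fps_to_fls (th \<beta> s) \<noteq> 0" using as b by (auto simp: nz_def)
    then have "fps_to_fls (bet u \<beta>) * fps_to_fls (th \<beta> s) = fps_to_fls (th \<beta> a)"
      using bet[OF u b] as b by (simp add: \<phi>_fr field_simps)
    then show ?thesis by (simp flip: fls_times_fps_to_fls)
  qed
  have "bet u (\<sigma> \<alpha>) * th (\<sigma> \<alpha>) s = \<sigma> (bet u \<alpha>) * th (\<sigma> \<alpha>) s"
    unfolding e[OF \<sigma>_S[OF \<alpha>]] unfolding th_\<sigma>[OF \<alpha>] e[OF \<alpha>, symmetric] rhom_mult[OF rhom_\<sigma>] ..
  then show ?thesis using as \<sigma>_S[OF \<alpha>] by (simp add: nz_def)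
qed

definition "Ddeg \<alpha> = subdegree (Dif S \<alpha>)"
definition "Dtot = (\<Sum>\<alpha>\<in>S. Ddeg \<alpha>)"

lemma Ddeg_le: "\<alpha> \<in> S \<Longrightarrow> Ddeg \<alpha> \<le> Dtot"
  unfolding Dtot_def using finite_S by (intro member_le_sum) auto

lemma varX_power: "\<exists>h. \<forall>\<alpha>\<in>S. th \<alpha> h = fps_X ^ (N * M)"
proof -
  obtain h where "T h = varX ^ M" using T_surj by blast
  then show ?thesis
    by (intro exI[of _ h]) (simp add: th_def rhom_power[OF rhom_E[OF S0]] ev_varX[OF XN0 S0] power_mult)
qed

text \<open>A high power of x acts as common denominator: v times t^(N * Dtot) meets the order
  condition of the interpolation, and a fraction with denominator t^(N * Dtot) restores v.\<close>

lemma bet_surj: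
  assumes v: "\<And>\<alpha>. \<alpha> \<in> S \<Longrightarrow> v (\<sigma> \<alpha>) = \<sigma> (v \<alpha>)"
  shows "\<exists>u\<in>Bset. \<forall>\<alpha>\<in>S. bet u \<alpha> = v \<alpha>"
proof -
  obtain s where s: "\<forall>\<alpha>\<in>S. th \<alpha> s = fps_X ^ (N * Dtot)" using varX_power by blast
  have "\<exists>a. \<forall>\<alpha>\<in>S. th \<alpha> a = v \<alpha> * fps_X ^ (N * Dtot)"
  proof (rule th_interpolation)
    fix \<alpha> assume \<alpha>: "\<alpha> \<in> S"
    have "\<sigma> (fps_X ^ (N * Dtot)) = fps_X ^ (N * Dtot)"
      by (auto simp: \<sigma>_fixed)
    then show "v (\<sigma> \<alpha>) * fps_X ^ (N * Dtot) = \<sigma> (v \<alpha> * fps_X ^ (N * Dtot))"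
      by (simp add: v[OF \<alpha>] rhom_mult[OF rhom_\<sigma>])
    have "Ddeg \<alpha> \<le> N * Dtot" using Ddeg_le[OF \<alpha>] N by (metis le_trans mult_le_mono1 nat_mult_1 Suc_leI One_nat_def)
    then show "v \<alpha> * fps_X ^ (N * Dtot) = 0 \<or> subdegree (Dif S \<alpha>) < N + subdegree (v \<alpha> * fps_X ^ (N * Dtot))"
      using N by (cases "v \<alpha> = 0") (auto simp: Ddeg_def fps_X_power_subdegree)
  qed
  then obtain a where a: "\<forall>\<alpha>\<in>S. th \<alpha> a = v \<alpha> * fps_X ^ (N * Dtot)" by blast
  have nzs: "nz s" using s by (simp add: nz_def)
  have \<phi>: "\<phi> \<alpha> (fr a s) = fps_to_fls (v \<alpha>)" if "\<alpha> \<in> S" for \<alpha>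
    using that s a by (simp add: \<phi>_fr nzs fls_times_fps_to_fls)
  then have "fr a s \<in> Bset" using nzs unfolding Bset_def carrier_Q by auto
  moreover have "\<forall>\<alpha>\<in>S. bet (fr a s) \<alpha> = v \<alpha>" using \<phi> by (simp add: bet_def)
  ultimately show ?thesis by blast
qed

text \<open>k is the pole order of z, obtained as the least power of t that clears the pole;
  minimality makes the constant term of w nonzero.\<close>

lemma fls_split:
  fixes z :: "'k fls"
  assumes "z \<notin> range fps_to_fls"
  obtains k w where "k > 0" "fps_to_fls (fps_X ^ k) * z = fps_to_fls w" "w $ 0 \<noteq> 0"
proof -
  have X0: "fps_to_fls (fps_X ^ n :: 'k fps) \<noteq> 0" for n by simp
  have "\<exists>k w. fps_to_fls (fps_X ^ k) * z = fps_to_fls w"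
  proof -
    have "int (nat (- fls_subdegree z)) \<ge> - fls_subdegree z" by simp
    from fls_as_fps'[OF this] obtain w where w: "z = fls_shift (int (nat (- fls_subdegree z))) (fps_to_fls w)"
      by blast
    have "fps_to_fls (fps_X ^ nat (- fls_subdegree z)) * z = fps_to_fls w"
      by (subst (2) w) (simp add: fps_to_fls_power fls_X_power_times_conv_shift)
    then show ?thesis by blast
  qed
  then obtain k where k: "\<exists>w. fps_to_fls (fps_X ^ k) * z = fps_to_fls w"
    and least: "\<And>j. j < k \<Longrightarrow> \<not> (\<exists>w. fps_to_fls (fps_X ^ j) * z = fps_to_fls w)"
    using exists_least_iff[of "\<lambda>k. \<exists>w. fps_to_fls (fps_X ^ k) * z = fps_to_fls w"] by auto
  obtain w where w: "fps_to_fls (fps_X ^ k) * z = fps_to_fls w" using k by blast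
  have "k > 0" using w assms by (cases k) auto
  moreover have "w $ 0 \<noteq> 0"
  proof
    assume "w $ 0 = 0"
    then have "w = fps_X * fps_shift 1 w" by (auto simp: fps_eq_iff fps_X_mult_nth)
    moreover obtain j where j: "k = Suc j" using \<open>k > 0\<close> gr0_implies_Suc by blast
    ultimately have "fps_to_fls fps_X * (fps_to_fls (fps_X ^ j) * z) = fps_to_fls fps_X * fps_to_fls (fps_shift 1 w)"
      using w by (simp only: power_Suc fls_times_fps_to_fls mult.assoc) (metis fls_times_fps_to_fls)
    then have "fps_to_fls (fps_X ^ j) * z = fps_to_fls (fps_shift 1 w)" by simp
    then show False using least[of j] j by blast
  qed
  ultimately show ?thesis using w that by blast
qed

text \<open>K[[t]] is integrally closed: if u has a pole of order k at \<alpha>, then in a monic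
  equation of degree n the term u^n has a pole of order k n, while the others together have one of
  order at most k (n - 1).\<close>

lemma integral_imp_Bset:
  assumes u: "u \<in> carrier Q" and p: "set p \<subseteq> Aset" "p \<noteq> []" "hd p = \<one>\<^bsub>Q\<^esub>" and ev: "ring.eval Q p u = \<zero>\<^bsub>Q\<^esub>"
  shows "u \<in> Bset"
proof (rule ccontr)
  interpret Q: cring Q by (rule Q_cring)
  assume "u \<notin> Bset"
  then obtain \<alpha> where \<alpha>: "\<alpha> \<in> S" "\<phi> \<alpha> u \<notin> range fps_to_fls" using u by (auto simp: Bset_def)
  define xp where "xp k = fps_to_fls (fps_X ^ k :: 'k fps)" for k
  have xp_add: "xp (i + j) = xp i * xp j" for i j by (simp add: xp_def power_add fls_times_fps_to_fls)
  obtain k w where kw: "k > 0" "xp k * \<phi> \<alpha> u = fps_to_fls w" "w $ 0 \<noteq> 0"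
    using fls_split[OF \<alpha>(2)] unfolding xp_def by metis
  have pow: "u [^]\<^bsub>Q\<^esub> (n::nat) \<in> carrier Q \<and> xp (k * n) * \<phi> \<alpha> (u [^]\<^bsub>Q\<^esub> n) = fps_to_fls (w ^ n)" for n
  proof (induction n)
    case 0
    then show ?case by (simp add: xp_def \<phi>_one \<alpha>)
  next
    case (Suc n)
    have "xp (k * Suc n) * \<phi> \<alpha> (u [^]\<^bsub>Q\<^esub> Suc n) = (xp k * \<phi> \<alpha> u) * (xp (k * n) * \<phi> \<alpha> (u [^]\<^bsub>Q\<^esub> n))"
      using u Suc \<alpha> by (simp add: xp_add \<phi>_mult mult_ac)
    then show ?case using Suc kw u by (simp add: fls_times_fps_to_fls)
  qed
  have main: "Q.eval q u \<in> carrier Q \<and> (\<exists>h. xp (k * length q) * \<phi> \<alpha> (Q.eval q u) = xp k * fps_to_fls h)"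
    if "set q \<subseteq> Aset" for q
    using that
  proof (induction q)
    case Nil
    then show ?case by (auto simp: \<phi>_zero \<alpha> intro!: exI[of _ 0])
  next
    case (Cons a q)
    obtain h where h: "xp (k * length q) * \<phi> \<alpha> (Q.eval q u) = xp k * fps_to_fls h" "Q.eval q u \<in> carrier Q"
      using Cons by auto
    have a: "a \<in> Bset" using Cons.prems fr1_Bset by (auto simp: Aset_def)
    let ?n = "length q"
    have ev: "Q.eval (a # q) u = a \<otimes>\<^bsub>Q\<^esub> u [^]\<^bsub>Q\<^esub> ?n \<oplus>\<^bsub>Q\<^esub> Q.eval q u" by simp
    have "xp (k * length (a # q)) * \<phi> \<alpha> (Q.eval (a # q) u)
      = xp k * (\<phi> \<alpha> a * (xp (k * ?n) * \<phi> \<alpha> (u [^]\<^bsub>Q\<^esub> ?n)) + xp (k * ?n) * \<phi> \<alpha> (Q.eval q u))"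
      unfolding ev using \<alpha> h pow[of ?n] Bset_carrier[OF a]
      by (simp add: \<phi>_add \<phi>_mult xp_add algebra_simps)
    also have "\<dots> = xp k * fps_to_fls (bet a \<alpha> * w ^ ?n + fps_X ^ k * h)"
    proof -
      have hk: "xp k * fps_to_fls h = fps_to_fls (fps_X ^ k * h)" by (simp add: xp_def fls_times_fps_to_fls)
      show ?thesis
        by (simp only: conjunct2[OF pow] h(1) hk bet[OF a \<alpha>(1)] fls_times_fps_to_fls fps_to_fls_plus)
    qed
    finally have "\<exists>h. xp (k * length (a # q)) * \<phi> \<alpha> (Q.eval (a # q) u) = xp k * fps_to_fls h" by (rule exI)
    moreover have "Q.eval (a # q) u \<in> carrier Q"
      unfolding ev using h pow[of ?n] Bset_carrier[OF a] by simp
    ultimately show ?case by blast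
  qed
  obtain q where q: "p = \<one>\<^bsub>Q\<^esub> # q" using p by (cases p) auto
  have sq: "set q \<subseteq> Aset" using p q by auto
  obtain h where h: "xp (k * length q) * \<phi> \<alpha> (Q.eval q u) = xp k * fps_to_fls h" "Q.eval q u \<in> carrier Q"
    using main[OF sq] by blast
  have "\<phi> \<alpha> (u [^]\<^bsub>Q\<^esub> length q) + \<phi> \<alpha> (Q.eval q u) = 0"
    using ev h(2) pow[of "length q"] \<alpha> unfolding q by (simp flip: \<phi>_add add: \<phi>_zero)
  then have "xp (k * length q) * \<phi> \<alpha> (u [^]\<^bsub>Q\<^esub> length q) + xp (k * length q) * \<phi> \<alpha> (Q.eval q u) = 0"
    by (simp flip: distrib_left)
  then have "fps_to_fls (w ^ length q) + xp k * fps_to_fls h = 0"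
    using pow[of "length q"] h by simp
  then have "fps_to_fls (w ^ length q + fps_X ^ k * h) = 0"
    by (simp add: xp_def fls_times_fps_to_fls)
  then have "w ^ length q + fps_X ^ k * h = 0" by (simp only: fps_to_fls_eq_0_iff)
  then have "(w ^ length q + fps_X ^ k * h) $ 0 = 0" by simp
  moreover have "0 ^ k = (0::'k)" using kw(1) by simp
  ultimately have "(w $ 0) ^ length q = 0" by (simp add: fps_power_zeroth)
  then show False using kw(3) by simp
qed

text \<open>Translates between list polynomials with leading coefficient first, evaluated in Q, and
  polynomials evaluated at a root.\<close>

lemma eval_frs:
  assumes b: "b \<in> Bset" and \<alpha>: "\<alpha> \<in> S"
  shows "ring.eval Q (map (\<lambda>h. fr h 1) (rev (coeffs P))) b \<in> carrier Q \<and>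
    \<phi> \<alpha> (ring.eval Q (map (\<lambda>h. fr h 1) (rev (coeffs P))) b) = fps_to_fls (poly (map_poly (th \<alpha>) P) (bet b \<alpha>))"
proof (induction P)
  interpret Q: cring Q by (rule Q_cring)
  case 0
  then show ?case by (simp add: \<phi>_zero \<alpha>)
next
  interpret Q: cring Q by (rule Q_cring)
  case (pCons h P)
  let ?l = "map (\<lambda>h. fr h 1) (rev (coeffs P))"
  have l: "map (\<lambda>h. fr h 1) (rev (coeffs (pCons h P))) = ?l @ [fr h 1]"
    using pCons.hyps by (cases "P = 0") (auto simp: cCons_def)
  have c: "fr h 1 \<in> carrier Q" for h using fr1_Bset Bset_carrier by blast
  have ev: "Q.eval (?l @ [fr h 1]) b = Q.eval ?l b \<otimes>\<^bsub>Q\<^esub> b \<oplus>\<^bsub>Q\<^esub> fr h 1"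
    using c Bset_carrier[OF b] by (intro Q.eval_append_aux) auto
  show ?case
    unfolding l ev using pCons.IH c Bset_carrier[OF b] \<alpha>
    by (simp add: \<phi>_add \<phi>_mult bet[OF b \<alpha>] \<phi>_fr nz_1 th_simps map_poly_pCons fls_times_fps_to_fls add.commute mult.commute)
qed

text \<open>Let C be the set of constant terms of b at the roots. The product of the b - c over C
  vanishes at t = 0 for every root, so a power of it with exponent above \<open>Dtot\<close> is in
  the local ring, say equal to a. Then b is a zero of the monic polynomial formed by that power of
  the product of the Y - c, minus a.\<close>

lemma Bset_imp_integral:
  assumes b: "b \<in> Bset"
  shows "\<exists>p. set p \<subseteq> Aset \<and> p \<noteq> [] \<and> hd p = \<one>\<^bsub>Q\<^esub> \<and> ring.eval Q p b = \<zero>\<^bsub>Q\<^esub>"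
proof -
  interpret Q: cring Q by (rule Q_cring)
  define C where "C = (\<lambda>\<alpha>. bet b \<alpha> $ 0) ` S"
  have finC: "finite C" "C \<noteq> {}" using finite_S S_nonempty by (auto simp: C_def)
  define M where "M = Suc Dtot"
  define u where "u \<alpha> = (\<Prod>c\<in>C. bet b \<alpha> - fps_const c) ^ M" for \<alpha>
  have "\<exists>a. \<forall>\<alpha>\<in>S. th \<alpha> a = u \<alpha>"
  proof (rule th_interpolation)
    fix \<alpha> assume \<alpha>: "\<alpha> \<in> S"
    show "u (\<sigma> \<alpha>) = \<sigma> (u \<alpha>)"
      by (simp add: u_def rhom_power[OF rhom_\<sigma>] rhom_prod[OF rhom_\<sigma>] rhom_diff[OF rhom_\<sigma>] bet_\<sigma>[OF b \<alpha>])
    define v where "v = (\<Prod>c\<in>C. bet b \<alpha> - fps_const c)"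
    have "v $ 0 = (\<Prod>c\<in>C. bet b \<alpha> $ 0 - c)"
      unfolding v_def rhom_prod[OF rhom_nth0] by simp
    also have "\<dots> = 0" using \<alpha> finC by (auto simp: C_def)
    finally have v0: "v $ 0 = 0" .
    show "u \<alpha> = 0 \<or> subdegree (Dif S \<alpha>) < N + subdegree (u \<alpha>)"
    proof (cases "v = 0")
      case False
      then have "subdegree v > 0" using v0 by (simp add: subdegree_eq_0_iff zero_less_iff_neq_zero)
      then have "M * 1 \<le> M * subdegree v" by (intro mult_le_mono2) simp
      also have "M * subdegree v = subdegree (u \<alpha>)" by (simp add: u_def v_def[symmetric])
      finally show ?thesis using Ddeg_le[OF \<alpha>] by (simp add: M_def Ddeg_def)
    qed (simp add: u_def v_def[symmetric] M_def)
  qed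
  then obtain a where a: "\<forall>\<alpha>\<in>S. th \<alpha> a = u \<alpha>" by blast
  define P0 where "P0 = (\<Prod>c\<in>C. [:- cst c, 1:]) ^ M"
  define P where "P = P0 - [:a:]"
  have d0: "degree P0 = card C * M" "lead_coeff P0 = 1"
  proof -
    have "degree (\<Prod>c\<in>C. [:- cst c, 1:]) = card C" by (simp add: degree_prod_eq_sum_degree)
    moreover have "lead_coeff (\<Prod>c\<in>C. [:- cst c, 1:]) = (\<Prod>c\<in>C. lead_coeff [:- cst c, 1:])" by (rule lead_coeff_prod)
    ultimately have l: "lead_coeff (\<Prod>c\<in>C. [:- cst c, 1:]) = 1" by simp
    then have "(\<Prod>c\<in>C. [:- cst c, 1:]) \<noteq> 0" by (metis leading_coeff_0_iff zero_neq_one)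
    then show "degree P0 = card C * M"
      unfolding P0_def using \<open>degree (\<Prod>c\<in>C. [:- cst c, 1:]) = card C\<close> by (simp add: degree_power_eq)
    show "lead_coeff P0 = 1" unfolding P0_def lead_coeff_power l by simp
  qed
  have pos: "card C * M > 0" using finC by (auto simp: M_def card_gt_0_iff)
  have "degree P = degree P0" unfolding P_def diff_conv_add_uminus
    using pos d0 by (intro degree_add_eq_left) simp
  then have P: "lead_coeff P = 1" "P \<noteq> 0" using d0 pos by (auto simp: P_def coeff_pCons split: nat.split)
  let ?p = "map (\<lambda>h. fr h 1) (rev (coeffs P))"
  have "hd (rev (coeffs P)) = 1" using P by (simp add: hd_rev last_coeffs_eq_coeff_degree)
  then have hd: "hd ?p = \<one>\<^bsub>Q\<^esub>" using P by (simp add: hd_map Q_one)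
  have "ring.eval Q ?p b = \<zero>\<^bsub>Q\<^esub>"
  proof (rule \<phi>_inj)
    obtain \<alpha>0 where "\<alpha>0 \<in> S" using S_nonempty by blast
    then show "ring.eval Q ?p b \<in> carrier Q" using eval_frs[OF b] by blast
    fix \<alpha> assume \<alpha>: "\<alpha> \<in> S"
    have "poly (map_poly (th \<alpha>) P) (bet b \<alpha>) = 0"
    proof -
      note h = rhom_map_poly[OF rhom_th[OF \<alpha>]]
      have "map_poly (th \<alpha>) P = (\<Prod>c\<in>C. [:- fps_const c, 1:]) ^ M - [:th \<alpha> a:]"
        unfolding P_def P0_def rhom_diff[OF h] rhom_power[OF h] rhom_prod[OF h] map_poly_linear[OF rhom_th[OF \<alpha>]]
        using \<alpha> by (simp add: th_simps th_cst map_poly_pCons del: fps_const_neg)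
      then show ?thesis using a \<alpha> by (simp add: poly_prod u_def del: fps_const_neg)
    qed
    then show "\<phi> \<alpha> (ring.eval Q ?p b) = \<phi> \<alpha> \<zero>\<^bsub>Q\<^esub>" using eval_frs[OF b \<alpha>, of P] \<alpha> by (simp add: \<phi>_zero)
  qed simp
  moreover have "set ?p \<subseteq> Aset" by (auto simp: Aset_def)
  moreover have "?p \<noteq> []" using P by simp
  ultimately show ?thesis using hd by blast
qed

lemma integral_closure_eq: "integral_closure_in Q Aset = Bset"
proof -
  obtain \<alpha> where \<alpha>: "\<alpha> \<in> S" using S_nonempty by blast
  have ne: "\<one>\<^bsub>Q\<^esub> \<noteq> \<zero>\<^bsub>Q\<^esub>" using \<phi>_one[OF \<alpha>] \<phi>_zero[OF \<alpha>] by auto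
  show ?thesis
  proof (intro equalityI subsetI)
    fix u assume "u \<in> integral_closure_in Q Aset"
    then show "u \<in> Bset" using integral_imp_Bset
      by (auto simp: integral_closure_in_def polynomial_def)
  next
    fix u assume u: "u \<in> Bset"
    from Bset_imp_integral[OF this] obtain p where
      p: "set p \<subseteq> Aset" "p \<noteq> []" "hd p = \<one>\<^bsub>Q\<^esub>" "ring.eval Q p u = \<zero>\<^bsub>Q\<^esub>" by blast
    then have "polynomial\<^bsub>Q\<^esub> Aset p" using ne by (simp add: polynomial_def)
    then show "u \<in> integral_closure_in Q Aset"
      using p Bset_carrier[OF u] unfolding integral_closure_in_def by blast
  qed
qed

end

interpretation funV: codim_space "\<lambda>c v \<alpha>. fps_const c * (v \<alpha> :: 'a::field fps)"
  by unfold_locales (auto simp: fun_eq_iff algebra_simps simp flip: fps_const_add fps_const_mult)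

context curve begin

lemma ram_dvd_Ddeg: assumes "\<alpha> \<in> S" shows "ram \<alpha> dvd Ddeg \<alpha>"
proof -
  have "Dif S \<alpha> \<in> Bring \<alpha>"
    unfolding Bring_def using \<sigma>_funpow_Dif[OF stable_S assms, of "per \<alpha>"] by (simp add: per)
  then show ?thesis unfolding Ddeg_def by (rule ram_dvd_subdegree)
qed

lemma \<sigma>_notin_orb: "\<beta> \<notin> orb \<alpha> \<Longrightarrow> \<sigma> \<beta> \<notin> orb \<alpha>"
proof
  assume "\<beta> \<notin> orb \<alpha>" "\<sigma> \<beta> \<in> orb \<alpha>"
  moreover have "\<sigma> \<beta> \<in> orb \<beta>" using \<sigma>_orb orb_self by blast
  ultimately have "orb \<beta> = orb \<alpha>" using orb_eqI by metis
  then show False using \<open>\<beta> \<notin> orb \<alpha>\<close> orb_self by blast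
qed

section \<open>The conductor by interpolation and traces\<close>

text \<open>The normalization in concrete form, by \<open>bet_image\<close>. On one root of each
  orbit the value is an arbitrary element of \<open>Bring\<close>; equivariance determines the
  rest.\<close>

definition "Fspace = {v. (\<forall>\<alpha>\<in>S. v (\<sigma> \<alpha>) = \<sigma> (v \<alpha>)) \<and> (\<forall>\<alpha>. \<alpha> \<notin> S \<longrightarrow> v \<alpha> = 0)}"

lemma Fspace_Bring: "v \<in> Fspace \<Longrightarrow> \<alpha> \<in> S \<Longrightarrow> v \<alpha> \<in> Bring \<alpha>"
  using equivariant_funpow[OF stable_S, of v \<alpha> "per \<alpha>"] by (auto simp: Fspace_def Bring_def per)

lemma bet_Fspace: "u \<in> Bset \<Longrightarrow> bet u \<in> Fspace"
  by (auto simp: Fspace_def bet_\<sigma> bet_outside)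

lemma bet_image: "bet ` Bset = Fspace"
proof (intro equalityI subsetI)
  fix v assume v: "v \<in> Fspace"
  then obtain u where u: "u \<in> Bset" "\<forall>\<alpha>\<in>S. bet u \<alpha> = v \<alpha>"
    using bet_surj[of v] by (auto simp: Fspace_def)
  have "bet u = v"
  proof
    fix \<alpha> show "bet u \<alpha> = v \<alpha>" using u v by (cases "\<alpha> \<in> S") (auto simp: bet_outside Fspace_def)
  qed
  then show "v \<in> bet ` Bset" using u by blast
qed (use bet_Fspace in blast)

lemma subspace_Fspace: "funV.subspace Fspace"
  by (intro funV.subspaceI) (auto simp: Fspace_def rhomD[OF rhom_\<sigma>])

lemma extend_Fspace:
  assumes \<alpha>: "\<alpha> \<in> S" and h: "h \<in> Bring \<alpha>"
  shows "\<exists>v\<in>Fspace. v \<alpha> = h \<and> (\<forall>\<beta>. \<beta> \<notin> orb \<alpha> \<longrightarrow> v \<beta> = 0)"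
proof -
  obtain u where u: "u \<alpha> = h" "\<forall>\<beta>\<in>orb \<alpha>. u (\<sigma> \<beta>) = \<sigma> (u \<beta>)" "\<forall>\<beta>. \<beta> \<notin> orb \<alpha> \<longrightarrow> u \<beta> = 0"
    using equivariant_extend[of \<alpha> h] h unfolding Bring_def by blast
  have "u (\<sigma> \<beta>) = \<sigma> (u \<beta>)" for \<beta>
    using u \<sigma>_notin_orb[of \<beta> \<alpha>] by (cases "\<beta> \<in> orb \<alpha>") auto
  moreover have "orb \<alpha> \<subseteq> S" by (rule orb_subset[OF stable_S \<alpha>])
  ultimately show ?thesis using u by (intro bexI[of _ u]) (auto simp: Fspace_def)
qed

definition "Cset = conductor_in Q Bset Aset"

text \<open>\<open>N - ram \<alpha>\<close> is the exponent of the different of the branch of \<open>\<alpha>\<close> over \<open>K[[x]]\<close>, measured in \<open>t\<close>.\<close>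

definition in_cond :: "('k fps \<Rightarrow> 'k fps) \<Rightarrow> bool" where "in_cond v \<longleftrightarrow> (\<forall>\<alpha>\<in>S. v \<alpha> = 0 \<or> Ddeg \<alpha> \<le> subdegree (v \<alpha>) + (N - ram \<alpha>))"

text \<open>As N - ram \<alpha> is less than N, products with arbitrary elements of the
  normalization still satisfy the strict order condition of the interpolation.\<close>

lemma in_cond_Cset:
  assumes u: "u \<in> Bset" and c: "in_cond (bet u)" shows "u \<in> Cset"
proof -
  have "u \<otimes>\<^bsub>Q\<^esub> b \<in> Aset" if b: "b \<in> Bset" for b
  proof -
    have "\<exists>a. \<forall>\<alpha>\<in>S. th \<alpha> a = bet u \<alpha> * bet b \<alpha>"
    proof (rule th_interpolation)
      fix \<alpha> assume \<alpha>: "\<alpha> \<in> S"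
      show "bet u (\<sigma> \<alpha>) * bet b (\<sigma> \<alpha>) = \<sigma> (bet u \<alpha> * bet b \<alpha>)"
        by (simp add: bet_\<sigma> u b \<alpha> rhom_mult[OF rhom_\<sigma>])
      show "bet u \<alpha> * bet b \<alpha> = 0 \<or> subdegree (Dif S \<alpha>) < N + subdegree (bet u \<alpha> * bet b \<alpha>)"
      proof (cases "bet u \<alpha> * bet b \<alpha> = 0")
        case False
        then have "Ddeg \<alpha> \<le> subdegree (bet u \<alpha>) + (N - ram \<alpha>)" using c \<alpha> by (auto simp: in_cond_def)
        moreover have "subdegree (bet u \<alpha> * bet b \<alpha>) = subdegree (bet u \<alpha>) + subdegree (bet b \<alpha>)"
          using False by simp
        moreover have "N - ram \<alpha> < N" using ram(2)[of \<alpha>] N by simp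
        ultimately show ?thesis unfolding Ddeg_def by linarith
      qed auto
    qed
    then obtain a where "\<forall>\<alpha>\<in>S. th \<alpha> a = bet u \<alpha> * bet b \<alpha>" by blast
    then have "\<forall>\<alpha>\<in>S. bet (u \<otimes>\<^bsub>Q\<^esub> b) \<alpha> = th \<alpha> a" by (simp add: Bset_ops(2)[OF u b])
    then show ?thesis using Aset_iff[OF Bset_ops(1)[OF u b]] by blast
  qed
  then show ?thesis using u by (simp add: Cset_def conductor_in_def)
qed

text \<open>If the order of u at \<alpha> is too small, u is multiplied by an element of the
  normalization supported on the orbit of \<alpha>, chosen such that the quotient by
  \<open>Dif\<close> starts with a negative power of t^N. Taking the trace multiplies that term by
  the length of the orbit, so the trace has a pole, which \<open>lagrange_sum\<close>
  forbids.\<close>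

lemma Cset_in_cond:
  assumes "u \<in> Cset" shows "in_cond (bet u)"
proof (rule ccontr)
  have u: "u \<in> Bset" and uA: "\<And>b. b \<in> Bset \<Longrightarrow> u \<otimes>\<^bsub>Q\<^esub> b \<in> Aset"
    using assms by (auto simp: Cset_def conductor_in_def)
  assume "\<not> in_cond (bet u)"
  then obtain \<alpha> where \<alpha>: "\<alpha> \<in> S" "bet u \<alpha> \<noteq> 0" "subdegree (bet u \<alpha>) + (N - ram \<alpha>) < Ddeg \<alpha>"
    by (auto simp: in_cond_def not_le)
  define r p where "r = ram \<alpha>" and "p = per \<alpha>"
  have rp: "N = p * r" "r > 0" "p > 0" using ram[of \<alpha>] per[of \<alpha>] by (auto simp: r_def p_def)
  obtain d where d: "Ddeg \<alpha> = r * d" using ram_dvd_Ddeg[OF \<alpha>(1)] by (auto simp: r_def dvd_def)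
  obtain s where s: "subdegree (bet u \<alpha>) = r * s"
    using ram_dvd_subdegree[OF Fspace_Bring[OF bet_Fspace[OF u] \<alpha>(1)]] by (auto simp: r_def dvd_def)
  have Nr: "N - r = r * (p - 1)" using rp(1) by (simp add: diff_mult_distrib2 mult.commute)
  have "r * (s + (p - 1)) < r * d"
    using \<alpha>(3) unfolding r_def[symmetric] Nr d s by (simp only: distrib_left)
  then have "s + (p - 1) < d" by simp
  then have ps: "s + p \<le> d" using rp by simp
  \<comment> \<open>In units of r, u has order s and \<open>Dif\<close> has order d. Raising the
    order of u by j makes the gap a multiple p q of p, hence N q in terms of t; q is at least 1, so
    a pole remains.\<close>
  define j q where "j = (d - s) mod p" and "q = (d - s) div p"
  have q1: "q \<ge> 1" using ps rp by (simp add: q_def div_greater_zero_iff Suc_le_eq)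
  have dsj: "d = s + j + p * q" using ps by (simp add: j_def q_def)
  have qd: "q \<le> d" using dsj rp(3) by (metis le_add2 le_trans mult_le_mono1 nat_mult_1 Suc_leI One_nat_def)
  have "fps_X ^ (j * r) \<in> Bring \<alpha>" by (auto simp: Bring_iff r_def)
  then obtain w where w: "w \<in> Fspace" "w \<alpha> = fps_X ^ (j * r)" "\<forall>\<beta>. \<beta> \<notin> orb \<alpha> \<longrightarrow> w \<beta> = 0"
    using extend_Fspace[OF \<alpha>(1)] by blast
  then obtain b where b: "b \<in> Bset" "w = bet b" using bet_image by blast
  obtain a where a: "\<And>\<beta>. \<beta> \<in> S \<Longrightarrow> th \<beta> a = bet u \<beta> * w \<beta>"
    using uA[OF b(1)] Aset_iff[OF Bset_ops(1)[OF u b(1)]] Bset_ops(2)[OF u b(1)] b(2) by metis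
  \<comment> \<open>The factor t^(N * M) clears the denominators \<open>Dif S \<beta>\<close> at all
    roots.\<close>
  define M where "M = Dtot"
  have DN: "Ddeg \<beta> \<le> N * M" if "\<beta> \<in> S" for \<beta>
    using Ddeg_le[OF that] N unfolding M_def by (metis le_trans mult_le_mono1 nat_mult_1 Suc_leI One_nat_def)
  have "\<exists>v. fps_X ^ (N * M) * th \<beta> a = v * Dif S \<beta>" if b: "\<beta> \<in> S" for \<beta>
  proof (cases "th \<beta> a = 0")
    case False
    then have "Dif S \<beta> dvd fps_X ^ (N * M) * th \<beta> a"
      using DN[OF b] Dif_nonzero[OF finite_S] by (subst fps_dvd_iff) (auto simp: fps_X_power_subdegree Ddeg_def)
    then show ?thesis by (auto simp: dvd_def mult.commute)
  qed (auto intro!: exI[of _ 0])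
  then obtain v where v: "\<And>\<beta>. \<beta> \<in> S \<Longrightarrow> fps_X ^ (N * M) * th \<beta> a = v \<beta> * Dif S \<beta>" by metis
  have "fps_X ^ (N * M) dvd sum v S"
    by (rule lagrange_sum[OF stable_S S_nonempty, where h = "T a"]) (use v in \<open>simp add: th_def\<close>)
  moreover have v0: "v \<beta> = 0" if "\<beta> \<in> S - orb \<alpha>" for \<beta>
    using v[of \<beta>] a[of \<beta>] w(3) that Dif_nonzero[OF finite_S, of \<beta>] by simp
  then have "sum v S = sum v (orb \<alpha>)"
    using orb_subset[OF stable_S \<alpha>(1)] finite_S by (intro sum.mono_neutral_right) auto
  moreover have v\<sigma>: "v (\<sigma> \<beta>) = \<sigma> (v \<beta>)" if b: "\<beta> \<in> S" for \<beta>
  proof -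
    have X: "\<sigma> (fps_X ^ (N * M)) = fps_X ^ (N * M)" by (auto simp: \<sigma>_fixed)
    have "v (\<sigma> \<beta>) * Dif S (\<sigma> \<beta>) = \<sigma> (fps_X ^ (N * M) * th \<beta> a)"
      using v[OF \<sigma>_S[OF b]] th_\<sigma>[OF b, of a] by (simp only: rhom_mult[OF rhom_\<sigma>] X)
    also have "\<dots> = \<sigma> (v \<beta>) * Dif S (\<sigma> \<beta>)"
      unfolding v[OF b] \<sigma>_Dif[OF stable_S b] rhom_mult[OF rhom_\<sigma>] ..
    finally show ?thesis using Dif_nonzero[OF finite_S] by simp
  qed
  have "v ((\<sigma> ^^ i) \<alpha>) = (\<sigma> ^^ i) (v \<alpha>)" for i
    by (rule equivariant_funpow[OF stable_S _ \<alpha>(1)]) (rule v\<sigma>)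
  then have "sum v (orb \<alpha>) = (\<Sum>i<p. (\<sigma> ^^ i) (v \<alpha>))"
    unfolding orb_eq by (subst sum.reindex[OF inj_on_orb]) (simp add: p_def)
  ultimately have dvd: "fps_X ^ (N * M) dvd (\<Sum>i<p. (\<sigma> ^^ i) (v \<alpha>))" by simp
  define e where "e = N * (M - q)"
  have qM: "q \<le> M"
  proof -
    have "d \<le> r * d" using rp by simp
    then show ?thesis using qd d Ddeg_le[OF \<alpha>(1)] unfolding M_def by linarith
  qed
  have eM: "e < N * M" using N q1 qM by (simp add: e_def)
  have va: "v \<alpha> \<noteq> 0" "subdegree (v \<alpha>) = e"
  proof -
    have eq: "fps_X ^ (N * M) * (bet u \<alpha> * fps_X ^ (j * r)) = v \<alpha> * Dif S \<alpha>"
      using v[OF \<alpha>(1)] a[OF \<alpha>(1)] w(2) by simp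
    show nz: "v \<alpha> \<noteq> 0" using eq \<alpha>(2) by auto
    have "N * M + (r * s + j * r) = subdegree (v \<alpha>) + r * d"
      using arg_cong[OF eq, of subdegree] \<alpha>(2) nz Dif_nonzero[OF finite_S, of \<alpha>] s d
      by (simp add: fps_X_power_subdegree Ddeg_def)
    moreover have "r * d = r * s + j * r + N * q" by (simp add: dsj rp(1) algebra_simps)
    moreover have "N * M = e + N * q" using qM by (simp add: e_def diff_mult_distrib2)
    ultimately show "subdegree (v \<alpha>) = e" by linarith
  qed
  \<comment> \<open>e is a multiple of N, so \<sigma> fixes the lowest term of v \<alpha> and its
    conjugates add up instead of cancelling.\<close>
  have "(\<Sum>i<p. (\<sigma> ^^ i) (v \<alpha>)) $ e = (\<Sum>i<p. \<zeta> ^ (i * e) * v \<alpha> $ e)"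
    by (simp add: fps_sum_nth \<sigma>_funpow_nth)
  also have "\<zeta> ^ (i * e) = 1" for i unfolding \<zeta> e_def by (intro dvd_mult dvd_triv_left)
  then have "(\<Sum>i<p. \<zeta> ^ (i * e) * v \<alpha> $ e) = of_nat p * v \<alpha> $ e" by simp
  finally have c: "(\<Sum>i<p. (\<sigma> ^^ i) (v \<alpha>)) $ e = of_nat p * v \<alpha> $ e" .
  have "v \<alpha> $ e \<noteq> 0" using va by auto
  then have "(\<Sum>i<p. (\<sigma> ^^ i) (v \<alpha>)) $ e \<noteq> 0" unfolding c using rp(3) by simp
  moreover obtain g where "(\<Sum>i<p. (\<sigma> ^^ i) (v \<alpha>)) = fps_X ^ (N * M) * g" using dvd by (auto simp: dvd_def)
  ultimately show False using eM by (simp add: fps_X_power_mult_nth)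
qed

lemma Cset_eq: "Cset = {u \<in> Bset. in_cond (bet u)}"
  using in_cond_Cset Cset_in_cond by (auto simp: Cset_def conductor_in_def)

abbreviation "QB \<equiv> Q\<lparr>carrier := Bset\<rparr>"

lemma QB_cring: "cring QB"
proof (rule cring_jointly_injective[where \<phi> = \<phi> and S = S])
  fix x assume "x \<in> carrier QB"
  then have x: "x \<in> Bset" by simp
  show "\<exists>y\<in>carrier QB. \<forall>\<alpha>\<in>S. \<phi> \<alpha> y = - \<phi> \<alpha> x"
  proof (rule bexI[of _ "fr (- 1) 1 \<otimes>\<^bsub>Q\<^esub> x"])
    show "\<forall>\<alpha>\<in>S. \<phi> \<alpha> (fr (- 1) 1 \<otimes>\<^bsub>Q\<^esub> x) = - \<phi> \<alpha> x"
      using x by (simp add: \<phi>_mult Bset_carrier fr1_Bset \<phi>_fr nz_1 th_simps)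
    show "fr (- 1) 1 \<otimes>\<^bsub>Q\<^esub> x \<in> carrier QB" using Bset_ops(1)[OF fr1_Bset x] by simp
  qed
qed (simp_all add: \<phi>_mult \<phi>_add \<phi>_one \<phi>_zero \<phi>_inj Bset_ops Bset_carrier, simp_all add: Q_one Q_zero fr1_Bset)

lemma bet_zero: "\<alpha> \<in> S \<Longrightarrow> bet \<zero>\<^bsub>Q\<^esub> \<alpha> = 0" and bet_one: "\<alpha> \<in> S \<Longrightarrow> bet \<one>\<^bsub>Q\<^esub> \<alpha> = 1"
  by (simp_all add: Q_zero Q_one bet_fr1 th_simps)

lemma in_cond_add:
  assumes "in_cond v" "in_cond w" shows "in_cond (\<lambda>\<alpha>. v \<alpha> + w \<alpha>)"
  unfolding in_cond_def
proof
  fix \<alpha> assume \<alpha>: "\<alpha> \<in> S"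
  have vw: "v \<alpha> = 0 \<or> Ddeg \<alpha> \<le> subdegree (v \<alpha>) + (N - ram \<alpha>)" "w \<alpha> = 0 \<or> Ddeg \<alpha> \<le> subdegree (w \<alpha>) + (N - ram \<alpha>)"
    using assms \<alpha> by (auto simp: in_cond_def)
  show "v \<alpha> + w \<alpha> = 0 \<or> Ddeg \<alpha> \<le> subdegree (v \<alpha> + w \<alpha>) + (N - ram \<alpha>)"
  proof (cases "v \<alpha> = 0 \<or> w \<alpha> = 0 \<or> v \<alpha> + w \<alpha> = 0")
    case False
    then have "min (subdegree (v \<alpha>)) (subdegree (w \<alpha>)) \<le> subdegree (v \<alpha> + w \<alpha>)"
      by (intro subdegree_add_ge') auto
    then show ?thesis using vw False by linarith
  qed (use vw in auto)
qed

lemma in_cond_mult: "in_cond v \<Longrightarrow> in_cond (\<lambda>\<alpha>. w \<alpha> * v \<alpha>)"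
  unfolding in_cond_def
proof
  fix \<alpha> assume v: "\<forall>\<alpha>\<in>S. v \<alpha> = 0 \<or> Ddeg \<alpha> \<le> subdegree (v \<alpha>) + (N - ram \<alpha>)" and \<alpha>: "\<alpha> \<in> S"
  show "w \<alpha> * v \<alpha> = 0 \<or> Ddeg \<alpha> \<le> subdegree (w \<alpha> * v \<alpha>) + (N - ram \<alpha>)"
    using v[rule_format, OF \<alpha>] by (cases "w \<alpha> * v \<alpha> = 0") auto
qed

lemma in_cond_cong: "(\<And>\<alpha>. \<alpha> \<in> S \<Longrightarrow> v \<alpha> = w \<alpha>) \<Longrightarrow> in_cond v \<Longrightarrow> in_cond w"
  by (auto simp: in_cond_def)

lemma Cset_ideal: "ideal Cset QB"
proof -
  interpret QB: cring QB by (rule QB_cring)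
  have mult: "x \<otimes>\<^bsub>Q\<^esub> u \<in> Cset" if "u \<in> Cset" "x \<in> Bset" for u x
    using that in_cond_mult[of "bet u" "bet x"] in_cond_cong[of "\<lambda>\<alpha>. bet x \<alpha> * bet u \<alpha>" "bet (x \<otimes>\<^bsub>Q\<^esub> u)"]
    by (auto simp: Cset_eq Bset_ops)
  show ?thesis
  proof (intro idealI QB.ring_axioms subgroup.intro)
    show "Cset \<subseteq> carrier (add_monoid QB)" by (auto simp: Cset_eq)
    show "x \<otimes>\<^bsub>add_monoid QB\<^esub> y \<in> Cset" if "x \<in> Cset" "y \<in> Cset" for x y
      using that in_cond_add[of "bet x" "bet y"] in_cond_cong[of "\<lambda>\<alpha>. bet x \<alpha> + bet y \<alpha>" "bet (x \<oplus>\<^bsub>Q\<^esub> y)"]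
      by (auto simp: Cset_eq Bset_ops)
    show "\<one>\<^bsub>add_monoid QB\<^esub> \<in> Cset"
      using QB.zero_closed by (auto simp: Cset_eq in_cond_def bet_zero)
    show "inv\<^bsub>add_monoid QB\<^esub> x \<in> Cset" if x: "x \<in> Cset" for x
    proof -
      have "x \<in> carrier QB" using x by (simp add: Cset_eq)
      then have "inv\<^bsub>add_monoid QB\<^esub> x = \<ominus>\<^bsub>QB\<^esub> \<one>\<^bsub>QB\<^esub> \<otimes>\<^bsub>QB\<^esub> x"
        using QB.l_minus[of "\<one>\<^bsub>QB\<^esub>" x] QB.one_closed QB.l_one[of x] unfolding a_inv_def by (simp only:)
      moreover have "\<ominus>\<^bsub>QB\<^esub> \<one>\<^bsub>QB\<^esub> \<in> Bset" using QB.a_inv_closed[OF QB.one_closed] by simp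
      ultimately show ?thesis using mult[OF x] by simp
    qed
    show "x \<otimes>\<^bsub>QB\<^esub> a \<in> Cset" if "a \<in> Cset" "x \<in> carrier QB" for a x using mult that by simp
    show "a \<otimes>\<^bsub>QB\<^esub> x \<in> Cset" if "a \<in> Cset" "x \<in> carrier QB" for a x
      using mult[of a x] that QB.m_comm[of a x] by (auto simp: Cset_eq)
  qed
qed

lemma one_notin_Cset: "\<one>\<^bsub>QB\<^esub> \<notin> Cset"
proof
  assume "\<one>\<^bsub>QB\<^esub> \<in> Cset"
  moreover obtain \<alpha> where \<alpha>: "\<alpha> \<in> S" using S_nonempty by blast
  ultimately have "Ddeg \<alpha> \<le> N - ram \<alpha>" by (auto simp: Cset_eq in_cond_def bet_one)
  moreover have "N \<le> Ddeg \<alpha>" using big[OF \<alpha>] by (simp add: Ddeg_def)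
  ultimately show False using ram(2)[of \<alpha>] N by simp
qed

lemma subfield_QB: "subfield (range (\<lambda>c. fr (cst c) 1)) QB"
proof -
  have f: "field (ring_of_type_algebra :: 'k ring)" by (rule field_from_type_algebra)
  interpret K: field "ring_of_type_algebra :: 'k ring" by (rule f)
  interpret QB: cring QB by (rule QB_cring)
  have hom: "ring_hom_ring (ring_of_type_algebra :: 'k ring) QB (\<lambda>c. fr (cst c) 1)"
    by (intro ring_hom_ringI K.ring_axioms QB.ring_axioms)
       (auto simp: fr1_Bset Q_mult Q_add Q_one nz_1 simp flip: fps_const_add fps_const_mult)
  have "\<one>\<^bsub>QB\<^esub> \<noteq> \<zero>\<^bsub>QB\<^esub>"
    using one_notin_Cset additive_subgroup.zero_closed[OF ideal.axioms(1)[OF Cset_ideal]] by auto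
  from ring_hom_ring.img_is_subfield(2)[OF hom K.carrier_is_subfield this] show ?thesis by simp
qed

text \<open>The conductor exponent in the parameter s of the branch: the order of \<open>Dif\<close>
  minus the different exponent \<open>per \<alpha>\<close> - 1 of a tame extension. Adding 1 before
  subtracting keeps natural subtraction exact under \<open>big\<close>.\<close>

definition "cexp \<alpha> = Ddeg \<alpha> div ram \<alpha> + 1 - per \<alpha>"

lemma in_cond_Fil:
  assumes v: "v \<in> Fspace" and \<alpha>: "\<alpha> \<in> S"
  shows "(v \<alpha> = 0 \<or> Ddeg \<alpha> \<le> subdegree (v \<alpha>) + (N - ram \<alpha>)) \<longleftrightarrow> (\<forall>j<cexp \<alpha>. v \<alpha> $ (j * ram \<alpha>) = 0)"
proof -
  have B: "v \<alpha> \<in> Bring \<alpha>" by (rule Fspace_Bring[OF v \<alpha>])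
  define r p where "r = ram \<alpha>" and "p = per \<alpha>"
  have rp: "N = p * r" "r > 0" "p > 0" using ram[of \<alpha>] per[of \<alpha>] by (auto simp: r_def p_def)
  obtain d where d: "Ddeg \<alpha> = r * d" using ram_dvd_Ddeg[OF \<alpha>(1)] by (auto simp: r_def dvd_def)
  obtain s where s: "subdegree (v \<alpha>) = r * s"
    using ram_dvd_subdegree[OF B] by (auto simp: r_def dvd_def)
  have "(Ddeg \<alpha> \<le> subdegree (v \<alpha>) + (N - ram \<alpha>)) \<longleftrightarrow> r * d \<le> r * (s + (p - 1))"
  proof -
    have Nr: "N - r = r * (p - 1)" using rp(1) by (simp add: diff_mult_distrib2 mult.commute)
    show ?thesis unfolding r_def[symmetric] Nr d s by (simp only: distrib_left)
  qed
  also have "\<dots> \<longleftrightarrow> d + 1 - p \<le> s" using rp by auto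
  also have "\<dots> \<longleftrightarrow> (d + 1 - p) * r \<le> s * r" using rp by simp
  also have "d + 1 - p = cexp \<alpha>"
    unfolding cexp_def d r_def[symmetric] p_def[symmetric] using rp(2) by simp
  finally have "(Ddeg \<alpha> \<le> subdegree (v \<alpha>) + (N - ram \<alpha>)) \<longleftrightarrow> cexp \<alpha> * ram \<alpha> \<le> subdegree (v \<alpha>)"
    unfolding s r_def by (simp only: mult.commute)
  then show ?thesis using Fil_iff[of "v \<alpha>" \<alpha> "cexp \<alpha>"] B by (auto simp: Fil_def)
qed

lemma orb_reps: "\<exists>P. P \<subseteq> S \<and> inj_on orb P \<and> orb ` P = orb ` S"
proof -
  have "orb ` S \<subseteq> orb ` S" by (rule order_refl)
  then obtain P where "P \<subseteq> S" "inj_on orb P" "orb ` S = orb ` P"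
    unfolding subset_image_inj by (elim exE conjE)
  then show ?thesis by (intro exI[of _ P]) simp
qed

lemma in_cond_reps:
  assumes v: "v \<in> Fspace" and P: "P \<subseteq> S" "orb ` P = orb ` S"
  shows "in_cond v \<longleftrightarrow> (\<forall>\<alpha>\<in>P. v \<alpha> = 0 \<or> Ddeg \<alpha> \<le> subdegree (v \<alpha>) + (N - ram \<alpha>))"
proof
  assume R: "\<forall>\<alpha>\<in>P. v \<alpha> = 0 \<or> Ddeg \<alpha> \<le> subdegree (v \<alpha>) + (N - ram \<alpha>)"
  show "in_cond v" unfolding in_cond_def
  proof
    fix \<beta> assume "\<beta> \<in> S"
    then have "orb \<beta> \<in> orb ` P" unfolding P(2) by (rule imageI)
    then obtain \<alpha> where \<alpha>: "\<alpha> \<in> P" "orb \<beta> = orb \<alpha>" by auto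
    then obtain i where i: "\<beta> = (\<sigma> ^^ i) \<alpha>" using orb_self[of \<beta>] unfolding orb_def by blast
    have S: "\<alpha> \<in> S" using \<alpha> P by auto
    have "v \<beta> = (\<sigma> ^^ i) (v \<alpha>)"
      unfolding i using v by (intro equivariant_funpow[OF stable_S _ S]) (auto simp: Fspace_def)
    moreover have "Ddeg \<beta> = Ddeg \<alpha>"
      unfolding Ddeg_def i \<sigma>_funpow_Dif[OF stable_S S] by (rule subdegree_\<sigma>_funpow)
    moreover have "ram \<beta> = ram \<alpha>" using per_orb[of \<beta> \<alpha>] i \<sigma>_funpow_mem by (simp add: ram_def)
    ultimately show "v \<beta> = 0 \<or> Ddeg \<beta> \<le> subdegree (v \<beta>) + (N - ram \<beta>)"
      using R \<alpha>(1) by (auto simp: subdegree_\<sigma>_funpow rhom_0[OF rhom_\<sigma>_funpow])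
  qed
qed (use P in \<open>auto simp: in_cond_def\<close>)

text \<open>On one root per branch, the coefficients of s^j with j < cexp \<alpha> are independent
  functionals on the normalization, and their common kernel is the conductor. A dual vector is the
  equivariant family extending a power of s by zero.\<close>

theorem conductor_dim_reps:
  assumes P: "P \<subseteq> S" "inj_on orb P" "orb ` P = orb ` S"
  shows "conductor_dim f = enat (\<Sum>\<alpha>\<in>P. cexp \<alpha>)"
proof -
  have finP: "finite P" using P finite_S finite_subset by blast
  define J where "J = Sigma P (\<lambda>\<alpha>. {..<cexp \<alpha>})"
  define l where "l = (\<lambda>(\<alpha>, j) v. (v \<alpha> :: 'k fps) $ (j * ram \<alpha>))"
  define W where "W = {v \<in> Fspace. \<forall>i\<in>J. l i v = 0}"
  have W: "v \<in> W \<longleftrightarrow> in_cond v" if "v \<in> Fspace" for v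
    using that in_cond_Fil[OF that] P(1) by (auto simp: W_def J_def l_def in_cond_reps[OF that P(1,3)])
  have "funV.codim W (card J) Fspace"
    unfolding W_def
  proof (rule funV.codim_functionals)
    show "finite J" using finP by (auto simp: J_def)
    show "funV.subspace Fspace" by (rule subspace_Fspace)
    fix i assume i: "i \<in> J"
    then obtain \<alpha> j where ij: "i = (\<alpha>, j)" "\<alpha> \<in> P" "j < cexp \<alpha>" by (auto simp: J_def)
    have "fps_X ^ (j * ram \<alpha>) \<in> Bring \<alpha>" by (auto simp: Bring_iff)
    then obtain v where v: "v \<in> Fspace" "v \<alpha> = fps_X ^ (j * ram \<alpha>)" "\<forall>\<beta>. \<beta> \<notin> orb \<alpha> \<longrightarrow> v \<beta> = 0"
      using extend_Fspace[of \<alpha>] ij(2) P(1) by blast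
    have "l i' v = 0" if i': "i' \<in> J - {i}" for i'
    proof -
      obtain \<beta> k where b: "i' = (\<beta>, k)" "\<beta> \<in> P" using i' by (auto simp: J_def)
      show ?thesis
      proof (cases "\<beta> = \<alpha>")
        case True
        then have "k \<noteq> j" using i' ij b by auto
        then show ?thesis using v(2) True b ram(2)[of \<alpha>] by (simp add: l_def)
      next
        case False
        then have "orb \<beta> \<noteq> orb \<alpha>" using inj_onD[OF P(2), of \<beta> \<alpha>] b(2) ij(2) by blast
        then have "\<beta> \<notin> orb \<alpha>" using orb_eqI by blast
        then show ?thesis using v(3) b by (simp add: l_def)
      qed
    qed
    then show "\<exists>e\<in>Fspace. l i e = 1 \<and> (\<forall>i'\<in>J - {i}. l i' e = 0)"
      using v ij by (intro bexI[of _ v]) (auto simp: l_def)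
  qed (auto simp: l_def)
  moreover have cJ: "card J = (\<Sum>\<alpha>\<in>P. cexp \<alpha>)" using finP by (simp add: J_def)
  ultimately have codim: "funV.codim W (\<Sum>\<alpha>\<in>P. cexp \<alpha>) (bet ` carrier QB)" by (simp add: bet_image)
  have "quotient_dim QB (range (\<lambda>c. fr (cst c) 1)) Cset = enat (\<Sum>\<alpha>\<in>P. cexp \<alpha>)"
  proof (rule funV.quotient_dim_eq_codim[where \<Theta> = bet and W = W])
    interpret QB: cring QB by (rule QB_cring)
    show "ring QB" by (rule QB.ring_axioms)
    show "ideal Cset QB" by (rule Cset_ideal)
    show "\<one>\<^bsub>QB\<^esub> \<notin> Cset" by (rule one_notin_Cset)
    show "subfield (range (\<lambda>c. fr (cst c) 1)) QB" by (rule subfield_QB)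
    show "bet (x \<oplus>\<^bsub>QB\<^esub> y) = bet x + bet y" if "x \<in> carrier QB" "y \<in> carrier QB" for x y
    proof
      fix \<alpha> show "bet (x \<oplus>\<^bsub>QB\<^esub> y) \<alpha> = (bet x + bet y) \<alpha>"
        using that by (cases "\<alpha> \<in> S") (auto simp: Bset_ops bet_outside)
    qed
    show "bet (fr (cst c) 1 \<otimes>\<^bsub>QB\<^esub> x) = (\<lambda>\<alpha>. fps_const c * bet x \<alpha>)" if "x \<in> carrier QB" for c x
    proof
      fix \<alpha> show "bet (fr (cst c) 1 \<otimes>\<^bsub>QB\<^esub> x) \<alpha> = fps_const c * bet x \<alpha>"
        using that by (cases "\<alpha> \<in> S") (auto simp: Bset_ops fr1_Bset bet_fr1 th_cst bet_outside)
    qed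
    show "funV.subspace W"
      unfolding W_def by (intro funV.subspaceI) (auto simp: Fspace_def rhomD[OF rhom_\<sigma>] l_def J_def)
    show "Cset = {x \<in> carrier QB. bet x \<in> W}"
      using W bet_Fspace by (auto simp: Cset_eq)
    show "funV.codim W (\<Sum>\<alpha>\<in>P. cexp \<alpha>) (bet ` carrier QB)" by (rule codim)
  qed
  moreover have "(\<lambda>c. to_fraction OC (PIdl\<^bsub>psr\<^esub> f +>\<^bsub>psr\<^esub> c)) ` constants = range (\<lambda>c. fr (cst c) 1)"
    unfolding constants_def image_image cl_def[symmetric] to_fraction_eq ..
  ultimately show ?thesis
    unfolding conductor_dim_def Let_def Q_def[symmetric] image_Aset integral_closure_eq
      Cset_def[symmetric] by simp
qed

text \<open>The exponents summed over the branches. The relation avoids subtraction and division;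
  with m roots and r orbits it reads N (c - r + m) = Dtot.\<close>

theorem conductor_dim_eq:
  "\<exists>c. conductor_dim f = enat c \<and> N * c + N * card S = Dtot + N * card (orb ` S)"
proof -
  obtain P where P: "P \<subseteq> S" "inj_on orb P" "orb ` P = orb ` S" using orb_reps by blast
  have finP: "finite P" using P finite_S finite_subset by blast
  have US: "S = (\<Union>\<alpha>\<in>P. orb \<alpha>)"
  proof (intro equalityI subsetI)
    fix \<beta> assume "\<beta> \<in> S"
    then have "orb \<beta> \<in> orb ` P" unfolding P(3) by (rule imageI)
    then obtain \<alpha> where "\<alpha> \<in> P" "orb \<beta> = orb \<alpha>" by auto
    then show "\<beta> \<in> (\<Union>\<alpha>\<in>P. orb \<alpha>)" using orb_self[of \<beta>] by auto
  qed (use orb_subset[OF stable_S] P in auto)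
  have disj: "\<forall>\<alpha>\<in>P. \<forall>\<beta>\<in>P. \<alpha> \<noteq> \<beta> \<longrightarrow> orb \<alpha> \<inter> orb \<beta> = {}"
    using orb_disjoint inj_onD[OF P(2)] by blast
  have cS: "card S = (\<Sum>\<alpha>\<in>P. per \<alpha>)"
    unfolding US using finP disj by (subst card_UN_disjoint) (auto simp: finite_orb card_orb)
  have Dt: "Dtot = (\<Sum>\<alpha>\<in>P. per \<alpha> * Ddeg \<alpha>)"
  proof -
    have "Dtot = (\<Sum>\<alpha>\<in>P. \<Sum>\<beta>\<in>orb \<alpha>. Ddeg \<beta>)"
      unfolding Dtot_def by (subst US, rule sum.UNION_disjoint) (use finP disj finite_orb in auto)
    also have "\<dots> = (\<Sum>\<alpha>\<in>P. \<Sum>\<beta>\<in>orb \<alpha>. Ddeg \<alpha>)"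
    proof (intro sum.cong refl)
      fix \<alpha> \<beta> assume "\<alpha> \<in> P" "\<beta> \<in> orb \<alpha>"
      then obtain i where "\<beta> = (\<sigma> ^^ i) \<alpha>" "\<alpha> \<in> S" using P(1) unfolding orb_def by blast
      then show "Ddeg \<beta> = Ddeg \<alpha>" by (simp add: Ddeg_def \<sigma>_funpow_Dif[OF stable_S] subdegree_\<sigma>_funpow)
    qed
    finally show ?thesis by (simp add: card_orb)
  qed
  have each: "N * cexp \<alpha> + N * per \<alpha> = per \<alpha> * Ddeg \<alpha> + N" if "\<alpha> \<in> P" for \<alpha>
  proof -
    have \<alpha>: "\<alpha> \<in> S" using that P by auto
    obtain d where d: "Ddeg \<alpha> = ram \<alpha> * d" using ram_dvd_Ddeg[OF \<alpha>] by (auto simp: dvd_def)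
    have "N \<le> Ddeg \<alpha>" using big[OF \<alpha>] by (simp add: Ddeg_def)
    then have "ram \<alpha> * per \<alpha> \<le> ram \<alpha> * d" using ram(1)[of \<alpha>] d by (simp add: mult.commute)
    then have pd: "per \<alpha> \<le> d" using ram(2)[of \<alpha>] by simp
    have "N * cexp \<alpha> + N * per \<alpha> = N * (cexp \<alpha> + per \<alpha>)" by (simp add: distrib_left)
    also have "cexp \<alpha> + per \<alpha> = d + 1" using pd ram(2)[of \<alpha>] by (simp add: cexp_def d)
    also have "N * (d + 1) = per \<alpha> * Ddeg \<alpha> + N" using ram(1)[of \<alpha>] by (simp add: d)
    finally show ?thesis .
  qed
  have "N * (\<Sum>\<alpha>\<in>P. cexp \<alpha>) + N * card S = (\<Sum>\<alpha>\<in>P. N * cexp \<alpha> + N * per \<alpha>)"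
    by (simp add: cS sum_distrib_left sum.distrib)
  also have "\<dots> = (\<Sum>\<alpha>\<in>P. per \<alpha> * Ddeg \<alpha> + N)" using each by simp
  also have "\<dots> = Dtot + N * card P" by (simp add: Dt sum.distrib)
  also have "card P = card (orb ` S)" using card_image[OF P(2)] P(3) by simp
  finally show ?thesis using conductor_dim_reps[OF P] by blast
qed

end

section \<open>Multiplicity and branches\<close>

lemma multiplicity_witness:
  assumes "f \<noteq> 0" shows "\<exists>i j. i + j = multiplicity_of f \<and> f $ i $ j \<noteq> 0"
proof -
  obtain i j where "f $ i $ j \<noteq> 0" using assms by (auto simp: fps_eq_iff)
  then have "\<exists>i' j'. i' + j' = i + j \<and> f $ i' $ j' \<noteq> 0" by blast
  then show ?thesis unfolding multiplicity_of_def by (rule LeastI)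
qed

lemma ord_ge_iff_multiplicity:
  assumes "f \<noteq> 0" shows "ord_ge n f \<longleftrightarrow> n \<le> multiplicity_of f"
proof
  assume "ord_ge n f"
  then show "n \<le> multiplicity_of f" using multiplicity_witness[OF assms] by (metis not_le ord_ge_def)
next
  assume n: "n \<le> multiplicity_of f"
  show "ord_ge n f" unfolding ord_ge_def
  proof (intro allI impI)
    fix i j :: nat assume "i + j < n"
    then have "i + j < multiplicity_of f" using n by simp
    then show "f $ i $ j = 0" using not_less_Least[of "i + j"] unfolding multiplicity_of_def by blast
  qed
qed

text \<open>The leading forms have a nonzero product: with i0 and i1 their least exponents of x,
  only one pair of terms contributes to the monomial with x-exponent i0 + i1.\<close>

lemma multiplicity_mult:
  assumes f: "f \<noteq> 0" and g: "g \<noteq> 0"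
  shows "multiplicity_of (f * g) = multiplicity_of f + multiplicity_of g"
proof -
  let ?m = "multiplicity_of f" and ?n = "multiplicity_of g"
  have fg: "f * g \<noteq> 0" using f g by simp
  have F: "ord_ge ?m f" and G: "ord_ge ?n g" using ord_ge_iff_multiplicity f g by blast+
  define i0 where "i0 = (LEAST i. i \<le> ?m \<and> f $ i $ (?m - i) \<noteq> 0)"
  define i1 where "i1 = (LEAST i. i \<le> ?n \<and> g $ i $ (?n - i) \<noteq> 0)"
  have "\<exists>i. i \<le> ?m \<and> f $ i $ (?m - i) \<noteq> 0"
    using multiplicity_witness[OF f] by (metis add_diff_cancel_left' le_add1)
  then have "i0 \<le> ?m \<and> f $ i0 $ (?m - i0) \<noteq> 0" unfolding i0_def by (rule LeastI_ex)
  then have i0: "i0 \<le> ?m" "f $ i0 $ (?m - i0) \<noteq> 0" by auto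
  have "\<exists>i. i \<le> ?n \<and> g $ i $ (?n - i) \<noteq> 0"
    using multiplicity_witness[OF g] by (metis add_diff_cancel_left' le_add1)
  then have "i1 \<le> ?n \<and> g $ i1 $ (?n - i1) \<noteq> 0" unfolding i1_def by (rule LeastI_ex)
  then have i1: "i1 \<le> ?n" "g $ i1 $ (?n - i1) \<noteq> 0" by auto
  let ?i = "i0 + i1" and ?j = "(?m - i0) + (?n - i1)"
  have z: "f $ p $ q * g $ (?i - p) $ (?j - q) = 0" if pq: "p \<le> ?i" "q \<le> ?j" "(p, q) \<noteq> (i0, ?m - i0)" for p q
  proof -
    consider "p + q < ?m" | "p + q > ?m" | "p + q = ?m" by linarith
    then show ?thesis
    proof cases
      case 1
      then show ?thesis using F by (simp add: ord_ge_def)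
    next
      case 2
      then have "(?i - p) + (?j - q) < ?n" using pq i0 i1 by linarith
      then show ?thesis using G by (simp add: ord_ge_def)
    next
      case 3
      then have q: "q = ?m - p" by simp
      have "p \<noteq> i0" using pq(3) q by auto
      then consider "p < i0" | "p > i0" by linarith
      then show ?thesis
      proof cases
        case 1
        then have "\<not> (p \<le> ?m \<and> f $ p $ (?m - p) \<noteq> 0)" unfolding i0_def by (rule not_less_Least)
        then show ?thesis using 3 q by simp
      next
        case 2
        then have lt: "?i - p < i1" and e: "?j - q = ?n - (?i - p)" using pq i0 i1 3 by linarith+
        from lt have "\<not> (?i - p \<le> ?n \<and> g $ (?i - p) $ (?n - (?i - p)) \<noteq> 0)"
          unfolding i1_def by (rule not_less_Least)
        moreover have "?i - p \<le> ?n" using lt i1 by linarith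
        ultimately have "g $ (?i - p) $ (?n - (?i - p)) = 0" by blast
        then show ?thesis unfolding e by (simp only: mult_zero_right)
      qed
    qed
  qed
  have "(f * g) $ ?i $ ?j = (\<Sum>(p, q)\<in>{..?i}\<times>{..?j}. f $ p $ q * g $ (?i - p) $ (?j - q))"
    by (simp add: fps2_mult_nth sum.cartesian_product)
  also have "\<dots> = (\<Sum>(p, q)\<in>{(i0, ?m - i0)}. f $ p $ q * g $ (?i - p) $ (?j - q))"
  proof (rule sum.mono_neutral_right)
    show "\<forall>x\<in>{..?i}\<times>{..?j} - {(i0, ?m - i0)}. (case x of (p, q) \<Rightarrow> f $ p $ q * g $ (?i - p) $ (?j - q)) = 0"
    proof
      fix x assume x: "x \<in> {..?i}\<times>{..?j} - {(i0, ?m - i0)}"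
      obtain p q where pq: "x = (p, q)" by (rule prod.exhaust)
      then have "f $ p $ q * g $ (?i - p) $ (?j - q) = 0" using x by (intro z) auto
      then show "(case x of (p, q) \<Rightarrow> f $ p $ q * g $ (?i - p) $ (?j - q)) = 0" by (simp only: pq prod.case)
    qed
  qed auto
  also have "\<dots> = f $ i0 $ (?m - i0) * g $ i1 $ (?n - i1)" by simp
  finally have "(f * g) $ ?i $ ?j \<noteq> 0" using i0 i1 by simp
  moreover have "?i + ?j < Suc (?m + ?n)" using i0 i1 by linarith
  ultimately have "\<not> ord_ge (Suc (?m + ?n)) (f * g)" unfolding ord_ge_def by blast
  then have "multiplicity_of (f * g) \<le> ?m + ?n" using ord_ge_iff_multiplicity[OF fg] by simp
  moreover have "?m + ?n \<le> multiplicity_of (f * g)"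
    using ord_ge_iff_multiplicity[OF fg] ord_ge_mult[OF F G] by simp
  ultimately show ?thesis by simp
qed

lemma multiplicity_0_iff: "f \<noteq> 0 \<Longrightarrow> multiplicity_of f = 0 \<longleftrightarrow> f $ 0 $ 0 \<noteq> 0"
  using ord_ge_iff_multiplicity[of f 1] by (simp add: ord_ge_1_iff) linarith

lemma multiplicity_unit: "(f :: 'a::field fps fps) dvd 1 \<Longrightarrow> multiplicity_of f = 0"
proof -
  assume "f dvd 1"
  then have "f $ 0 $ 0 \<noteq> 0" by (simp add: fps_unit_iff)
  moreover from this have "f \<noteq> 0" by auto
  ultimately show ?thesis using multiplicity_0_iff by blast
qed

text \<open>Multiplicities of factors add up to 1, so one of the factors has multiplicity 0 and is a
  unit.\<close>

lemma smooth_is_branch: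
  fixes w :: "'a::Fields.field fps fps"
  assumes "smooth_curve w" shows "is_branch w"
proof -
  have w: "w \<noteq> 0" "w $ 0 $ 0 = 0" "multiplicity_of w = 1"
    using assms by (auto simp: smooth_curve_def algebroid_curve_def)
  have "comm_semiring_1_class.irreducible w"
  proof (rule Factorial_Ring.irreducibleI)
    show "w \<noteq> 0" "\<not> w dvd 1" using w by (auto simp: fps_unit_iff)
    fix a b assume ab: "w = a * b"
    then have nz: "a \<noteq> 0" "b \<noteq> 0" using w by auto
    then have "multiplicity_of a + multiplicity_of b = 1" using w(3) ab multiplicity_mult by metis
    then have "multiplicity_of a = 0 \<or> multiplicity_of b = 0" by linarith
    then show "a dvd 1 \<or> b dvd 1"
      unfolding multiplicity_0_iff[OF nz(1)] multiplicity_0_iff[OF nz(2)] fps_unit_iff .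
  qed
  then show ?thesis using assms by (simp add: is_branch_def smooth_curve_def)
qed

lemma ord_ge_subdegree: "ord_ge n F \<Longrightarrow> F $ 0 \<noteq> 0 \<Longrightarrow> n \<le> subdegree (F $ 0)"
  by (rule subdegree_geI) (auto simp: ord_ge_def)

lemma multiplicity_le_subdegree: "F $ 0 \<noteq> 0 \<Longrightarrow> multiplicity_of F \<le> subdegree (F $ 0)"
proof -
  assume F: "F $ 0 \<noteq> 0"
  then have "F \<noteq> 0" by auto
  then show ?thesis using ord_ge_subdegree F ord_ge_iff_multiplicity by blast
qed

text \<open>Since p has no zero among the list, every linear factor divides q and can be cancelled
  there; at the end p divides 1.\<close>

lemma linear_factors_root:
  fixes p q :: "'a::idom poly"
  assumes "p * q = (\<Prod>a\<leftarrow>as. [:- a, 1:])" "\<And>a. a \<in> set as \<Longrightarrow> poly p a \<noteq> 0"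
  shows "degree p = 0"
  using assms
proof (induction as arbitrary: q)
  case Nil
  then have pq: "p * q = 1" by simp
  then have "p \<noteq> 0" "q \<noteq> 0" by auto
  then show ?case using degree_mult_eq[of p q] pq by simp
next
  case (Cons a as)
  have "poly (p * q) a = 0" unfolding Cons.prems(1) by simp
  then have "poly q a = 0" using Cons.prems(2)[of a] by simp
  then obtain q' where q': "q = [:- a, 1:] * q'" unfolding poly_eq_0_iff_dvd by auto
  have "[:- a, 1:] * (p * q') = [:- a, 1:] * (\<Prod>a\<leftarrow>as. [:- a, 1:])"
    using Cons.prems(1) unfolding q' by (simp only: list.map prod_list.Cons mult_ac)
  then have "p * q' = (\<Prod>a\<leftarrow>as. [:- a, 1:])" by (subst (asm) mult_cancel_left) simp
  then show ?case using Cons by auto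
qed

section \<open>Branches as orbits of roots\<close>

text \<open>What is required of a coordinate change: an automorphism fixing the constants and
  preserving the order filtration, hence multiplicities. The shear will be inserted for T.\<close>

locale coord = galois N \<zeta> for N and \<zeta> :: "'k::{alg_closed_field,field_char_0}" +
  fixes T :: "'k fps fps \<Rightarrow> 'k fps fps"
  assumes rhom_T: "is_rhom T" and bij_T: "bij T" and T_cst: "\<And>c. T (cst c) = cst c"
    and T_ord: "\<And>n h. ord_ge n (T h) \<longleftrightarrow> ord_ge n h"
begin

lemmas T_simps = rhomD[OF rhom_T]

lemma T_surj: "\<exists>h. T h = g" using bij_T by (metis bij_pointE)

lemma T_inj: "T a = T b \<longleftrightarrow> a = b" using bij_T by (meson bij_is_inj injD)

lemma T_eq_0: "T a = 0 \<longleftrightarrow> a = 0" using T_inj[of a 0] T_simps by simp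

lemma T_dvd: "T a dvd T b \<longleftrightarrow> a dvd b"
proof
  assume "T a dvd T b"
  then obtain c where "T b = T a * c" by (auto simp: dvd_def)
  moreover obtain c' where "T c' = c" using T_surj by blast
  ultimately have "T b = T (a * c')" by (simp add: T_simps)
  then show "a dvd b" by (simp add: T_inj)
qed (auto simp: dvd_def T_simps)

lemma T_unit: "T a dvd 1 \<longleftrightarrow> a dvd 1"
  using T_dvd[of a 1] by (simp add: T_simps)

lemma T_00: "T h $ 0 $ 0 = 0 \<longleftrightarrow> h $ 0 $ 0 = 0"
  using T_ord[of "Suc 0" h] by (simp add: ord_ge_1_iff)

lemma multiplicity_T: assumes "h \<noteq> 0" shows "multiplicity_of (T h) = multiplicity_of h"
proof -
  have "n \<le> multiplicity_of (T h) \<longleftrightarrow> n \<le> multiplicity_of h" for n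
    using T_ord[of n h] ord_ge_iff_multiplicity[OF assms] ord_ge_iff_multiplicity[of "T h"] T_eq_0 assms by simp
  then show ?thesis by (meson le_antisym order_refl)
qed

text \<open>The equation of the branch with the orbit of \<alpha> as its roots, pulled back to the
  original coordinates.\<close>

definition br :: "'k fps \<Rightarrow> 'k fps fps" where "br \<alpha> = (SOME h. T h = conv (dpoly (orb \<alpha>)))"

lemma T_br: "T (br \<alpha>) = conv (dpoly (orb \<alpha>))"
  unfolding br_def using T_surj by (rule someI_ex)

text \<open>Galois equivariance spreads vanishing at \<alpha> over its orbit, so the single
  evaluation at \<alpha> has kernel generated by \<open>br \<alpha>\<close>.\<close>

lemma br_dvd: assumes "\<alpha> $ 0 = 0" shows "br \<alpha> dvd h \<longleftrightarrow> E \<alpha> (T h) = 0"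
proof -
  have "br \<alpha> dvd h \<longleftrightarrow> (\<forall>\<beta>\<in>orb \<alpha>. E \<beta> (T h) = 0)"
    unfolding T_dvd[symmetric, of "br \<alpha>"] T_br kernel_stable[OF stable_orb[OF assms]] ..
  also have "\<dots> \<longleftrightarrow> E \<alpha> (T h) = 0"
  proof
    assume 0: "E \<alpha> (T h) = 0"
    show "\<forall>\<beta>\<in>orb \<alpha>. E \<beta> (T h) = 0"
    proof
      fix \<beta> assume "\<beta> \<in> orb \<alpha>"
      then obtain i where "\<beta> = (\<sigma> ^^ i) \<alpha>" unfolding orb_def by blast
      then show "E \<beta> (T h) = 0"
        using \<sigma>_funpow_E[OF assms, of i "T h"] 0 rhom_0[OF rhom_\<sigma>_funpow] by simp
    qed
  qed (use orb_self in blast)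
  finally show ?thesis .
qed

lemma br_0: assumes "\<alpha> $ 0 = 0" shows "T (br \<alpha>) $ 0 = fps_X ^ per \<alpha>" "br \<alpha> $ 0 $ 0 = 0" "br \<alpha> \<noteq> 0"
proof -
  note W = dpoly_wpoly[OF stable_orb[OF assms]]
  show 1: "T (br \<alpha>) $ 0 = fps_X ^ per \<alpha>" unfolding T_br using wpoly_conv_0[OF W(1)] W(2) by (simp add: card_orb)
  have "T (br \<alpha>) $ 0 $ 0 = 0" unfolding 1 using per(1)[of \<alpha>] by simp
  then show "br \<alpha> $ 0 $ 0 = 0" by (simp only: T_00)
  show "br \<alpha> \<noteq> 0" using 1 T_eq_0[of "br \<alpha>"] by auto
qed

lemma rhom_ET: "\<alpha> $ 0 = 0 \<Longrightarrow> is_rhom (\<lambda>h. E \<alpha> (T h))"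
  by (rule rhom_comp[OF rhom_E rhom_T])

text \<open>By \<open>br_dvd\<close> the ideal of \<open>br \<alpha>\<close> is the kernel of a
  homomorphism into the domain K[[t]], so \<open>br \<alpha>\<close> is prime.\<close>

lemma br_irreducible: assumes "\<alpha> $ 0 = 0" shows "comm_semiring_1_class.irreducible (br \<alpha>)"
proof (rule Factorial_Ring.irreducibleI)
  note b = br_0[OF assms]
  show "br \<alpha> \<noteq> 0" "\<not> br \<alpha> dvd 1" using b by (auto simp: fps_unit_iff)
  fix x y assume xy: "br \<alpha> = x * y"
  have "E \<alpha> (T (x * y)) = 0" using br_dvd[OF assms, of "x * y"] xy by simp
  then have "E \<alpha> (T x) = 0 \<or> E \<alpha> (T y) = 0" by (simp add: rhom_mult[OF rhom_ET[OF assms]])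
  then have "br \<alpha> dvd x \<or> br \<alpha> dvd y" by (simp add: br_dvd[OF assms])
  then show "x dvd 1 \<or> y dvd 1"
  proof
    assume "br \<alpha> dvd x"
    then obtain c where "x = x * y * c" unfolding xy by (auto simp: dvd_def)
    then have "1 = y * c" using b(3) xy by (metis mult.assoc mult_cancel_left1 mult_zero_left)
    then show ?thesis by (metis dvd_triv_left)
  next
    assume "br \<alpha> dvd y"
    then obtain c where c: "y = x * y * c" unfolding xy by (auto simp: dvd_def)
    then have "y * (x * c) = y * 1" by (simp add: mult_ac)
    then have "1 = x * c" using b(3) xy by (metis mult_cancel_left mult_zero_right)
    then show ?thesis by (metis dvd_triv_left)
  qed
qed

lemma branch_assoc:
  assumes "\<alpha> $ 0 = 0" "is_branch g" "br \<alpha> dvd g" shows "\<exists>u. u dvd 1 \<and> g = br \<alpha> * u"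
proof -
  obtain u where u: "g = br \<alpha> * u" using assms(3) by (auto simp: dvd_def)
  have "comm_semiring_1_class.irreducible g" using assms(2) by (simp add: is_branch_def)
  then have "br \<alpha> dvd 1 \<or> u dvd 1" using u Factorial_Ring.irreducibleD by blast
  then show ?thesis using u br_0[OF assms(1)] by (auto simp: fps_unit_iff)
qed

lemma dvd_mult_unit: "u dvd 1 \<Longrightarrow> b * u dvd x \<longleftrightarrow> b dvd (x :: 'a::comm_ring_1)"
  by (metis dvd_def dvd_mult_left mult.assoc mult.right_neutral mult_dvd_mono)

lemma branch_mult_unit: assumes "\<alpha> $ 0 = 0" "u dvd 1" shows "is_branch (br \<alpha> * u)"
proof -
  have u: "u $ 0 $ 0 \<noteq> 0" "u \<noteq> 0" using assms(2) fps_unit_iff by auto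
  have "comm_semiring_1_class.irreducible (br \<alpha> * u)"
  proof (rule Factorial_Ring.irreducibleI)
    obtain v where v: "1 = u * v" using assms(2) by (auto simp: dvd_def)
    show "br \<alpha> * u \<noteq> 0" "\<not> br \<alpha> * u dvd 1" using br_0[OF assms(1)] u by (auto simp: fps_unit_iff)
    fix x y assume "br \<alpha> * u = x * y"
    then have "br \<alpha> * (u * v) = x * (y * v)" by (simp only: mult.assoc[symmetric])
    then have "br \<alpha> = x * (y * v)" by (simp only: v[symmetric] mult_1_right)
    then have "x dvd 1 \<or> y * v dvd 1" using br_irreducible[OF assms(1)] Factorial_Ring.irreducibleD by blast
    then show "x dvd 1 \<or> y dvd 1" using dvd_mult_left by blast
  qed
  then show ?thesis using br_0[OF assms(1)] u by (simp add: is_branch_def algebroid_curve_def)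
qed

text \<open>The list carries the roots with repetition. The last condition, degree equal to
  multiplicity, says that the line x = 0 is not tangent to h.\<close>

definition splits :: "'k fps fps \<Rightarrow> 'k fps list \<Rightarrow> bool" where
  "splits h as \<longleftrightarrow> (\<exists>U W. U $ 0 $ 0 \<noteq> 0 \<and> T h = U * conv W \<and> wpoly W \<and>
     map_poly (xpow N) W = (\<Prod>a\<leftarrow>as. [:- a, 1:]) \<and> (\<forall>a\<in>set as. a $ 0 = 0) \<and> degree W = multiplicity_of h)"

lemma splits_E:
  assumes "splits h as" shows "\<exists>U. U $ 0 $ 0 \<noteq> 0 \<and> (\<forall>z. z $ 0 = 0 \<longrightarrow> E z (T h) = E z U * (\<Prod>a\<leftarrow>as. z - a))"
proof -
  obtain U W where UW: "U $ 0 $ 0 \<noteq> 0" "T h = U * conv W" "map_poly (xpow N) W = (\<Prod>a\<leftarrow>as. [:- a, 1:])"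
    using assms by (auto simp: splits_def)
  have "poly (\<Prod>a\<leftarrow>as. [:- a, 1:]) z = (\<Prod>a\<leftarrow>as. z - a)" for z
    by (induction as) (auto simp: algebra_simps)
  then show ?thesis
    using UW by (intro exI[of _ U]) (auto simp: rhom_mult[OF rhom_E] E_conv)
qed

lemma ev_nth_0: "z $ 0 = 0 \<Longrightarrow> E z h $ 0 = h $ 0 $ 0"
proof -
  assume z: "z $ 0 = 0"
  have "ord_ge (Suc 0) (bisub (fps_const (fps_X ^ N)) (fps_const z) (h - cst (h $ 0 $ 0)))"
    by (rule ord_ge_bisub[OF ord_ge_pq(1)[OF XN0 z] ord_ge_pq(2)[OF XN0 z]]) (simp add: ord_ge_1_iff)
  then have "E z (h - cst (h $ 0 $ 0)) $ 0 = 0" by (simp add: ev_def ord_ge_1_iff)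
  then show ?thesis by (simp add: rhom_diff[OF rhom_E[OF z]] ev_cst[OF XN0 z])
qed

lemma splits_root_iff: "splits h as \<Longrightarrow> z $ 0 = 0 \<Longrightarrow> E z (T h) = 0 \<longleftrightarrow> z \<in> set as"
proof -
  assume s: "splits h as" and z: "z $ 0 = 0"
  obtain U where U: "U $ 0 $ 0 \<noteq> 0" "E z (T h) = E z U * (\<Prod>a\<leftarrow>as. z - a)" using splits_E[OF s] z by blast
  have "E z U $ 0 \<noteq> 0" using U ev_nth_0[OF z] by simp
  then have "E z U \<noteq> 0" by auto
  then show ?thesis using U by (auto simp: prod_list_zero_iff)
qed

text \<open>A branch dividing h has, after Weierstrass preparation, a polynomial equation dividing
  W, hence one of the listed roots \<alpha>. Then \<open>br \<alpha>\<close> divides the irreducible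
  equation and differs from it by a unit.\<close>

lemma branches_splits:
  assumes s: "splits h as" and h: "h \<noteq> 0"
  shows "branches h = {br \<alpha> * u | \<alpha> u. \<alpha> \<in> set as \<and> u dvd 1}"
proof (intro Set.set_eqI iffI)
  have z: "\<alpha> $ 0 = 0" if "\<alpha> \<in> set as" for \<alpha> using s that by (auto simp: splits_def)
  {
    fix g assume "g \<in> {br \<alpha> * u | \<alpha> u. \<alpha> \<in> set as \<and> u dvd 1}"
    then obtain \<alpha> u where g: "g = br \<alpha> * u" "\<alpha> \<in> set as" "u dvd 1" by blast
    have "br \<alpha> dvd h" using br_dvd[OF z[OF g(2)]] splits_root_iff[OF s z[OF g(2)]] g(2) by blast
    then show "g \<in> branches h"
      using g branch_mult_unit[OF z[OF g(2)] g(3)] dvd_mult_unit[OF g(3)] by (simp add: branches_def)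
  }
  fix g assume "g \<in> branches h"
  then have g: "is_branch g" "g dvd h" by (auto simp: branches_def)
  obtain U W where UW: "U $ 0 $ 0 \<noteq> 0" "T h = U * conv W" "wpoly W" "map_poly (xpow N) W = (\<Prod>a\<leftarrow>as. [:- a, 1:])"
    using s by (auto simp: splits_def)
  have "U dvd 1" using UW(1) by (simp add: fps_unit_iff)
  moreover have "T g dvd T h" using g T_dvd by blast
  ultimately obtain V k where V: "1 = U * V" and k: "T h = T g * k" by (auto simp: dvd_def)
  have "conv W = (U * V) * conv W" unfolding V[symmetric] by simp
  also have "\<dots> = V * T h" unfolding UW(2) by (simp only: mult_ac)
  finally obtain q where q: "conv W = T g * q" unfolding k using mult.left_commute by metis
  have "conv W $ 0 \<noteq> 0" using wpoly_conv_0[OF UW(3)] by simp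
  then have Tg0: "T g $ 0 \<noteq> 0" using q by auto
  obtain U' W' where UW': "U' $ 0 $ 0 \<noteq> 0" "T g = U' * conv W'" "wpoly W'" "degree W' = subdegree (T g $ 0)"
    using weierstrass_preparation[OF Tg0] by blast
  have "g $ 0 $ 0 = 0" using g by (simp add: is_branch_def algebroid_curve_def)
  then have "T g $ 0 $ 0 = 0" by (simp only: T_00)
  then have "degree W' \<noteq> 0" using UW'(4) Tg0 by (simp add: subdegree_eq_0_iff)
  have "conv W = (U' * q) * conv W'" using q UW'(2) by (simp add: mult_ac)
  from wpoly_dvd_conv[OF UW'(3) this] obtain Q where "W = W' * Q" by blast
  then have "map_poly (xpow N) W' * map_poly (xpow N) Q = (\<Prod>a\<leftarrow>as. [:- a, 1:])"
    using UW(4) rhom_mult[OF rhom_map_poly[OF rhom_xpow[OF N]]] by metis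
  then obtain \<alpha> where \<alpha>: "\<alpha> \<in> set as" "poly (map_poly (xpow N) W') \<alpha> = 0"
    using linear_factors_root[of "map_poly (xpow N) W'"] \<open>degree W' \<noteq> 0\<close> degree_map_xpow[of W'] by metis
  have "E \<alpha> (T g) = 0"
    using \<alpha> z[OF \<alpha>(1)] by (simp add: UW'(2) rhom_mult[OF rhom_E] E_conv)
  then have "br \<alpha> dvd g" using br_dvd[OF z[OF \<alpha>(1)]] by blast
  then show "g \<in> {br \<alpha> * u | \<alpha> u. \<alpha> \<in> set as \<and> u dvd 1}"
    using branch_assoc[OF z[OF \<alpha>(1)] g(1)] \<alpha>(1) by blast
qed

text \<open>For any factor the multiplicity is at most the y-order at x = 0. Both are additive and
  they agree for h, so they agree for every factor.\<close>

lemma multiplicity_br: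
  assumes s: "splits h as" and h: "h \<noteq> 0" and \<alpha>: "\<alpha> \<in> set as" and u: "u dvd 1"
  shows "multiplicity_of (br \<alpha> * u) = per \<alpha>"
proof -
  have z: "\<alpha> $ 0 = 0" using s \<alpha> by (auto simp: splits_def)
  have u0: "u \<noteq> 0" using u by auto
  obtain U W where UW: "U $ 0 $ 0 \<noteq> 0" "T h = U * conv W" "wpoly W" "degree W = multiplicity_of h"
    using s by (auto simp: splits_def)
  have Th0: "T h $ 0 = U $ 0 * fps_X ^ multiplicity_of h" using UW wpoly_conv_0[OF UW(3)] by simp
  have "U $ 0 \<noteq> 0" using UW by auto
  have "br \<alpha> dvd h" using br_dvd[OF z] splits_root_iff[OF s z] \<alpha> by blast
  then obtain k where k: "h = br \<alpha> * k" by (auto simp: dvd_def)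
  have nz: "br \<alpha> \<noteq> 0" "k \<noteq> 0" using k h by auto
  have Tk: "T h $ 0 = T (br \<alpha>) $ 0 * T k $ 0" by (simp add: k T_simps)
  then have Tk0: "T k $ 0 \<noteq> 0" using Th0 \<open>U $ 0 \<noteq> 0\<close> by auto
  have "subdegree (T h $ 0) = multiplicity_of h"
    unfolding Th0 using \<open>U $ 0 \<noteq> 0\<close> UW(1) by (simp add: fps_X_power_subdegree)
  then have "multiplicity_of h = per \<alpha> + subdegree (T k $ 0)"
    using Tk Tk0 br_0(1)[OF z] by (simp add: fps_X_power_subdegree)
  moreover have "multiplicity_of h = multiplicity_of (br \<alpha>) + multiplicity_of k"
    unfolding k by (rule multiplicity_mult[OF nz])
  moreover have "multiplicity_of (br \<alpha>) \<le> per \<alpha>"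
    using multiplicity_le_subdegree[of "T (br \<alpha>)"] br_0(1)[OF z] multiplicity_T[OF nz(1)] by (simp add: fps_X_power_subdegree)
  moreover have "multiplicity_of k \<le> subdegree (T k $ 0)"
    using multiplicity_le_subdegree[of "T k"] Tk0 multiplicity_T[OF nz(2)] by simp
  ultimately have "multiplicity_of (br \<alpha>) = per \<alpha>" by linarith
  then show ?thesis using multiplicity_mult[OF nz(1) u0] multiplicity_unit[OF u] by simp
qed

text \<open>The order along the branch is the order in t over \<open>ram \<alpha>\<close>; dividing
  it further by \<open>per \<alpha>\<close> leaves N as denominator, whatever the branch.\<close>

lemma intersection_br:
  assumes z: "\<alpha> $ 0 = 0" and u: "u dvd 1" and x: "x $ 0 $ 0 = 0" "E \<alpha> (T x) \<noteq> 0"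
  shows "ereal_of_enat (intersection_number x (br \<alpha> * u)) / ereal (real (per \<alpha>)) = ereal (subdegree (E \<alpha> (T x)) / N)"
proof -
  have "intersection_number x (br \<alpha> * u) = enat (subdegree (E \<alpha> (T x)) div ram \<alpha>)"
  proof (rule intersection_number_eq[OF z rhom_ET[OF z]])
    show "E \<alpha> (T (cst c)) = fps_const c" for c by (simp add: T_cst ev_cst[OF XN0 z])
    show "range (\<lambda>h. E \<alpha> (T h)) = range (E \<alpha>)"
      using T_surj by (auto simp: image_iff) metis
    show "E \<alpha> (T h) = 0 \<longleftrightarrow> br \<alpha> * u dvd h" for h
      using br_dvd[OF z] dvd_mult_unit[OF u] by blast
  qed (use x br_0[OF z] in auto)
  moreover obtain k where k: "subdegree (E \<alpha> (T x)) = ram \<alpha> * k"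
    using ram_dvd_subdegree[OF E_in_Bring[OF z]] by (auto simp: dvd_def)
  moreover have "real N = real (per \<alpha>) * real (ram \<alpha>)" using ram(1)[of \<alpha>] by (metis of_nat_mult)
  ultimately show ?thesis using ram(2)[of \<alpha>] per(1)[of \<alpha>] by simp
qed

lemma intersection_number_commute: "intersection_number f g = intersection_number g f"
  by (simp add: intersection_number_def insert_commute)

text \<open>The ideal of a branch consists of the series vanishing on an orbit, and the orbit can be
  read off from it; passing to ideals removes the ambiguity of units.\<close>

lemma num_branches_splits:
  assumes s: "splits h as" and h: "h \<noteq> 0"
  shows "num_branches h = card (orb ` set as)"
proof -
  have z: "\<alpha> $ 0 = 0" if "\<alpha> \<in> set as" for \<alpha> using s that by (auto simp: splits_def)
  have P: "PIdl\<^bsub>power_series_ring\<^esub> g = {x. g dvd x}" for g :: "'k fps fps"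
    by (auto simp: cgenideal_def dvd_def mult.commute)
  define I where "I O' = {x. \<forall>\<beta>\<in>O'. E \<beta> (T x) = 0}" for O'
  have I: "{x. br \<alpha> * u dvd x} = I (orb \<alpha>)" if "\<alpha> \<in> set as" "u dvd 1" for \<alpha> u
    unfolding dvd_mult_unit[OF that(2)] unfolding T_dvd[symmetric, of "br \<alpha>"] T_br
      kernel_stable[OF stable_orb[OF z[OF that(1)]], symmetric] I_def ..
  have "(\<lambda>g. PIdl\<^bsub>power_series_ring\<^esub> g) ` branches h = I ` orb ` set as"
  proof (intro equalityI subsetI)
    fix J assume "J \<in> (\<lambda>g. PIdl\<^bsub>power_series_ring\<^esub> g) ` branches h"
    then obtain \<alpha> u where "\<alpha> \<in> set as" "u dvd 1" "J = {x. br \<alpha> * u dvd x}"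
      unfolding branches_splits[OF s h] P by blast
    then show "J \<in> I ` orb ` set as" using I by blast
  next
    fix J assume "J \<in> I ` orb ` set as"
    then obtain \<alpha> where \<alpha>: "\<alpha> \<in> set as" "J = I (orb \<alpha>)" by blast
    then have "J = {x. br \<alpha> * 1 dvd x}" using I[of \<alpha> 1] by simp
    moreover have "br \<alpha> * 1 \<in> branches h" unfolding branches_splits[OF s h] using \<alpha>(1) by (intro CollectI exI[of _ \<alpha>] exI[of _ 1]) simp
    ultimately show "J \<in> (\<lambda>g. PIdl\<^bsub>power_series_ring\<^esub> g) ` branches h" unfolding P by blast
  qed
  moreover have "inj_on I (orb ` set as)"
  proof (rule inj_onI)
    fix O1 O2 assume "O1 \<in> orb ` set as" "O2 \<in> orb ` set as" and eq: "I O1 = I O2"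
    then obtain \<alpha> \<beta> where ab: "\<alpha> \<in> set as" "\<beta> \<in> set as" "O1 = orb \<alpha>" "O2 = orb \<beta>" by blast
    have "br \<alpha> \<in> I (orb \<alpha>)" using I[OF ab(1), of 1] by auto
    then have "br \<alpha> \<in> I (orb \<beta>)" using eq ab by simp
    then have "E \<beta> (T (br \<alpha>)) = 0" using orb_self unfolding I_def by blast
    then have "(\<Prod>\<gamma>\<in>orb \<alpha>. \<beta> - \<gamma>) = 0"
      unfolding T_br using E_dpoly[OF stable_orb[OF z[OF ab(1)]] z[OF ab(2)]] by simp
    then have "\<beta> \<in> orb \<alpha>" using finite_orb by auto
    then show "O1 = O2" using orb_eqI ab by metis
  qed
  ultimately show ?thesis unfolding num_branches_def by (simp add: card_image)
qed

end

section \<open>Polars and the first Newton slope\<close>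

text \<open>Let p be the product of the X - a \<alpha>. The polynomial q below is p' freed of the
  repeated factors of p: its degree is one less than the number of distinct values, hence positive,
  and it does not vanish at any of them.\<close>

lemma critical_point_off_roots:
  fixes a :: "'i \<Rightarrow> 'k::{alg_closed_field,field_char_0}"
  assumes S: "finite S" and ne: "\<alpha>0 \<in> S" "\<beta>0 \<in> S" "a \<alpha>0 \<noteq> a \<beta>0"
  shows "\<exists>\<zeta>. (\<forall>\<alpha>\<in>S. \<zeta> \<noteq> a \<alpha>) \<and> (\<Sum>\<alpha>\<in>S. \<Prod>\<beta>\<in>S - {\<alpha>}. \<zeta> - a \<beta>) = 0"
proof -
  define P where "P = a ` S"
  define n where "n c = card {\<alpha> \<in> S. a \<alpha> = c}" for c
  have P: "finite P" "a \<alpha>0 \<in> P" "a \<beta>0 \<in> P" using S ne by (auto simp: P_def)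
  have n0: "n c > 0" if "c \<in> P" for c using that S by (auto simp: n_def P_def card_gt_0_iff)
  have "card {a \<alpha>0, a \<beta>0} \<le> card P" using P by (intro card_mono) auto
  then have k: "card P \<ge> 2" using ne by simp
  define g where "g c = (\<Prod>b\<in>P - {c}. [:- b, 1:])" for c
  define q where "q = (\<Sum>c\<in>P. Polynomial.smult (of_nat (n c)) (g c))"
  have dg: "degree (g c) = card P - 1" "lead_coeff (g c) = 1" if "c \<in> P" for c
  proof -
    show "degree (g c) = card P - 1" unfolding g_def using that P by (simp add: degree_prod_eq_sum_degree card_Diff_singleton)
    have "lead_coeff (g c) = (\<Prod>b\<in>P - {c}. lead_coeff [:- b, 1:])" unfolding g_def by (rule lead_coeff_prod)
    then show "lead_coeff (g c) = 1" by simp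
  qed
  have "coeff q (card P - 1) = (\<Sum>c\<in>P. of_nat (n c) * coeff (g c) (card P - 1))" by (simp add: q_def coeff_sum)
  also have "\<dots> = (\<Sum>c\<in>P. of_nat (n c))" using dg by (intro sum.cong refl) (metis mult_1_right)
  also have "\<dots> = of_nat (\<Sum>c\<in>P. n c)" by simp
  finally have "coeff q (card P - 1) = of_nat (\<Sum>c\<in>P. n c)" .
  moreover have "(\<Sum>c\<in>P. n c) \<noteq> 0" using P n0[of "a \<alpha>0"] by (auto simp: sum_eq_0_iff)
  ultimately have "coeff q (card P - 1) \<noteq> 0" by (metis of_nat_eq_0_iff)
  then have "degree q > 0" using k le_degree[of q "card P - 1"] by simp
  then obtain \<zeta> where \<zeta>: "poly q \<zeta> = 0" using alg_closed_imp_poly_has_root by blast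
  have pq: "poly q z = (\<Sum>c\<in>P. of_nat (n c) * (\<Prod>b\<in>P - {c}. z - b))" for z
    by (simp add: q_def g_def poly_sum poly_prod)
  have "\<zeta> \<notin> P"
  proof
    assume zP: "\<zeta> \<in> P"
    have "poly q \<zeta> = (\<Sum>c\<in>{\<zeta>}. of_nat (n c) * (\<Prod>b\<in>P - {c}. \<zeta> - b))"
      unfolding pq using P zP by (intro sum.mono_neutral_right) auto
    then have "of_nat (n \<zeta>) * (\<Prod>b\<in>P - {\<zeta>}. \<zeta> - b) = 0" using \<zeta> by simp
    then show False using n0[OF zP] P by auto
  qed
  then have off: "\<zeta> \<noteq> a \<alpha>" if "\<alpha> \<in> S" for \<alpha> using that by (auto simp: P_def)
  have frac: "(\<Prod>b\<in>A - {c}. h b) = (\<Prod>b\<in>A. h b) * inverse (h c)"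
    if "finite A" "c \<in> A" "h c \<noteq> 0" for A :: "'j set" and c and h :: "'j \<Rightarrow> 'k"
    using that by (simp add: prod.remove[of A c h] field_simps)
  \<comment> \<open>Through the logarithmic derivative, the sum of the 1 / (X - a \<alpha>), the
    zero of q becomes a zero of p'.\<close>
  have "(\<Prod>b\<in>P. \<zeta> - b) * (\<Sum>c\<in>P. of_nat (n c) * inverse (\<zeta> - c)) = poly q \<zeta>"
    unfolding pq sum_distrib_left
  proof (intro sum.cong refl)
    fix c assume c: "c \<in> P"
    have "(\<Prod>b\<in>P - {c}. \<zeta> - b) = (\<Prod>b\<in>P. \<zeta> - b) * inverse (\<zeta> - c)"
      using P c \<open>\<zeta> \<notin> P\<close> by (intro frac) auto
    then show "(\<Prod>b\<in>P. \<zeta> - b) * (of_nat (n c) * inverse (\<zeta> - c)) = of_nat (n c) * (\<Prod>b\<in>P - {c}. \<zeta> - b)"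
      by (simp only: mult_ac)
  qed
  moreover have "(\<Prod>b\<in>P. \<zeta> - b) \<noteq> 0" using P \<open>\<zeta> \<notin> P\<close> by auto
  ultimately have s0: "(\<Sum>c\<in>P. of_nat (n c) * inverse (\<zeta> - c)) = 0" using \<zeta> by simp
  have "(\<Sum>\<alpha>\<in>S. inverse (\<zeta> - a \<alpha>)) = (\<Sum>c\<in>P. \<Sum>\<alpha>\<in>{\<alpha>\<in>S. a \<alpha> = c}. inverse (\<zeta> - a \<alpha>))"
    unfolding P_def by (rule sum.image_gen[OF S])
  also have "\<dots> = (\<Sum>c\<in>P. of_nat (n c) * inverse (\<zeta> - c))"
    by (intro sum.cong refl) (simp add: n_def)
  finally have s1: "(\<Sum>\<alpha>\<in>S. inverse (\<zeta> - a \<alpha>)) = 0" using s0 by simp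
  have "(\<Sum>\<alpha>\<in>S. \<Prod>\<beta>\<in>S - {\<alpha>}. \<zeta> - a \<beta>) = (\<Sum>\<alpha>\<in>S. (\<Prod>\<beta>\<in>S. \<zeta> - a \<beta>) * inverse (\<zeta> - a \<alpha>))"
  proof (intro sum.cong refl)
    fix \<alpha> assume "\<alpha> \<in> S"
    then show "(\<Prod>\<beta>\<in>S - {\<alpha>}. \<zeta> - a \<beta>) = (\<Prod>\<beta>\<in>S. \<zeta> - a \<beta>) * inverse (\<zeta> - a \<alpha>)"
      using S off by (intro frac) auto
  qed
  also have "\<dots> = 0" using s1 by (simp flip: sum_distrib_left)
  finally show ?thesis using off by blast
qed

lemma X_power_dvd_iff: "fps_X ^ n dvd (h :: 'a::field fps) \<longleftrightarrow> h = 0 \<or> n \<le> subdegree h"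
proof (cases "h = 0")
  case False
  then show ?thesis by (subst fps_dvd_iff) (auto simp: fps_X_power_subdegree)
qed auto

lemma conv_pderiv: "partial_y (conv p) = conv (pderiv p)"
  by (intro fps_ext) (simp add: partial_y_def coeff_pderiv fps_of_nat[symmetric] del: of_nat_Suc)

lemma map_poly_pderiv:
  assumes h: "is_rhom h" shows "map_poly h (pderiv p) = pderiv (map_poly h (p :: 'a::{comm_ring_1,semiring_no_zero_divisors} poly))"
proof -
  have "h (of_nat n) = of_nat n" for n by (induction n) (auto simp: rhomD[OF h])
  then show ?thesis by (intro poly_eqI) (simp add: coeff_map_poly coeff_pderiv rhomD[OF h] del: of_nat_Suc)
qed

lemma sum_sum_list_swap:
  "(\<Sum>a\<in>A. \<Sum>z\<leftarrow>zs. h a z) = (\<Sum>z\<leftarrow>zs. \<Sum>a\<in>A. (h a z :: nat))"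
  by (induction zs) (auto simp: sum.distrib)

lemma subdegree_prod_list:
  "(\<And>z. z \<in> set zs \<Longrightarrow> h z \<noteq> (0 :: 'a::field fps)) \<Longrightarrow> subdegree (\<Prod>z\<leftarrow>zs. h z) = (\<Sum>z\<leftarrow>zs. subdegree (h z))"
proof (induction zs)
  case (Cons z zs)
  moreover have "(\<Prod>z\<leftarrow>zs. h z) \<noteq> 0" using Cons.prems by (auto simp: prod_list_zero_iff)
  ultimately show ?case by simp
qed auto

section \<open>The roots of a curve and of its polar\<close>

text \<open>A single N serves f and its polar g, so that their roots are compared in the same
  K[[t]]. \<open>simple\<close> encodes that f is reduced, \<open>transversal\<close> that x = 0 is
  not tangent to it.\<close>

locale polar_pair = coord N \<zeta> T for N and \<zeta> :: "'k::{alg_closed_field,field_char_0}" and T +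
  fixes f g :: "'k fps fps" and ws vs :: "'k fps list"
  assumes f_nz: "f \<noteq> 0" and g_nz: "g \<noteq> 0" and splits_f: "splits f ws" and splits_g: "splits g vs"
    and T_g: "T g = partial_y (T f)" and mult_f: "multiplicity_of f \<ge> 2"
    and mult_g: "multiplicity_of g = multiplicity_of f - 1"
    and simple: "\<And>z. z $ 0 = 0 \<Longrightarrow> E z (T f) = 0 \<Longrightarrow> E z (T g) \<noteq> 0"
    and transversal: "\<And>\<alpha>. \<alpha> \<in> set ws \<Longrightarrow> \<alpha> = 0 \<or> N \<le> subdegree \<alpha>"
begin

abbreviation "m \<equiv> multiplicity_of f"

definition "S = set ws"

lemma S_zero: "\<alpha> \<in> S \<Longrightarrow> \<alpha> $ 0 = 0" and finite_S: "finite S"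
  using splits_f by (auto simp: splits_def S_def)

lemma vs_zero: "z \<in> set vs \<Longrightarrow> z $ 0 = 0"
  using splits_g by (auto simp: splits_def)

lemma length_splits: assumes "splits h as" shows "length as = multiplicity_of h"
proof -
  obtain W where "map_poly (xpow N) W = (\<Prod>a\<leftarrow>as. [:- a, 1:])" "degree W = multiplicity_of h"
    using assms by (auto simp: splits_def)
  moreover have "degree (\<Prod>a\<leftarrow>as. [:- a, 1:]) = length (as :: 'k fps list)"
  proof (induction as)
    case (Cons a as)
    have "(\<Prod>a\<leftarrow>as. [:- a, 1:]) \<noteq> 0" by (auto simp: prod_list_zero_iff)
    then have "degree ([:- a, 1:] * (\<Prod>a\<leftarrow>as. [:- a, 1:])) = 1 + length as"
      using Cons by (subst degree_mult_eq) auto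
    then show ?case by simp
  qed auto
  ultimately show ?thesis using degree_map_xpow[of W] by simp
qed

lemma E_unit: "z $ 0 = 0 \<Longrightarrow> U $ 0 $ 0 \<noteq> 0 \<Longrightarrow> E z U \<noteq> 0 \<and> subdegree (E z U) = 0"
  using ev_nth_0[of z U] by (metis fps_zero_nth subdegree_eq_0)

text \<open>A repeated root would be a common zero of the equation and its y-derivative, against
  \<open>simple\<close>. The list of roots may therefore be replaced by a set.\<close>

lemma distinct_ws: "distinct ws"
proof (rule ccontr)
  assume "\<not> distinct ws"
  then obtain xs ys zs y where ws: "ws = xs @ [y] @ ys @ [y] @ zs" using not_distinct_decomp by blast
  obtain U W where UW: "T f = U * conv W" "map_poly (xpow N) W = (\<Prod>a\<leftarrow>ws. [:- a, 1:])"
    using splits_f by (auto simp: splits_def)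
  have "y \<in> set ws" by (simp add: ws)
  then have "y \<in> S" by (simp add: S_def)
  then have y: "y $ 0 = 0" by (rule S_zero)
  define r where "r = (\<Prod>a\<leftarrow>xs @ ys @ zs. [:- a, 1:])"
  have W: "map_poly (xpow N) W = [:- y, 1:] * ([:- y, 1:] * r)"
    unfolding UW(2) ws r_def by (simp only: map_append prod_list.append list.map prod_list.Cons prod_list.Nil mult_1_right mult_1_left mult_ac)
  have 1: "poly (map_poly (xpow N) W) y = 0" unfolding W by simp
  have "poly (pderiv (map_poly (xpow N) W)) y = 0" unfolding W pderiv_mult[of "[:- y, 1:]"] by (simp del: mult_pCons_left)
  then have 2: "E y (conv (pderiv W)) = 0" by (simp add: E_conv[OF y] map_poly_pderiv[OF rhom_xpow[OF N]])
  have "E y (T f) = 0" using 1 by (simp add: UW(1) rhom_mult[OF rhom_E[OF y]] E_conv[OF y])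
  moreover have "E y (T g) = 0"
    unfolding T_g UW(1) partial_y_simps conv_pderiv rhom_add[OF rhom_E[OF y]] rhom_mult[OF rhom_E[OF y]]
    using 1 2 by (simp add: E_conv[OF y])
  ultimately show False using simple[OF y] by blast
qed

lemma card_S: "card S = m"
  using length_splits[OF splits_f] distinct_card[OF distinct_ws] by (simp add: S_def)

text \<open>The unit of the Weierstrass preparation also depends on y; its derivative gives the
  extra term with U', which vanishes at the roots of f.\<close>

lemma E_formulas:
  "\<exists>U U'. U $ 0 $ 0 \<noteq> 0 \<and> (\<forall>z. z $ 0 = 0 \<longrightarrow> E z (T f) = E z U * (\<Prod>\<alpha>\<in>S. z - \<alpha>) \<and>
     E z (T g) = E z U' * (\<Prod>\<alpha>\<in>S. z - \<alpha>) + E z U * (\<Sum>\<alpha>\<in>S. \<Prod>\<beta>\<in>S - {\<alpha>}. z - \<beta>))"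
proof -
  obtain U W where UW: "U $ 0 $ 0 \<noteq> 0" "T f = U * conv W" "map_poly (xpow N) W = (\<Prod>a\<leftarrow>ws. [:- a, 1:])"
    using splits_f by (auto simp: splits_def)
  have W: "map_poly (xpow N) W = gpoly S"
    unfolding UW(3) gpoly_def S_def using distinct_ws by (simp add: prod.distinct_set_conv_list)
  have pd: "poly (pderiv (gpoly S)) z = (\<Sum>\<alpha>\<in>S. \<Prod>\<beta>\<in>S - {\<alpha>}. z - \<beta>)" for z
    by (simp add: gpoly_def pderiv_prod poly_sum poly_prod pderiv_pCons)
  have "E z (T f) = E z U * (\<Prod>\<alpha>\<in>S. z - \<alpha>) \<and>
     E z (T g) = E z (partial_y U) * (\<Prod>\<alpha>\<in>S. z - \<alpha>) + E z U * (\<Sum>\<alpha>\<in>S. \<Prod>\<beta>\<in>S - {\<alpha>}. z - \<beta>)" if z: "z $ 0 = 0" for z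
    unfolding T_g UW(2) partial_y_simps conv_pderiv rhom_add[OF rhom_E[OF z]] rhom_mult[OF rhom_E[OF z]]
      E_conv[OF z] map_poly_pderiv[OF rhom_xpow[OF N]] W pd poly_gpoly[OF finite_S] by simp
  then show ?thesis using UW(1) by blast
qed

lemma E_f_scaled:
  assumes z: "z $ 0 = 0" and B: "\<And>\<alpha>. \<alpha> \<in> S \<Longrightarrow> z - \<alpha> = fps_X ^ \<rho> * B \<alpha>"
  shows "fps_X ^ (\<rho> * m) dvd E z (T f)"
    and "(\<And>\<alpha>. \<alpha> \<in> S \<Longrightarrow> B \<alpha> $ 0 \<noteq> 0) \<Longrightarrow> subdegree (E z (T f)) = \<rho> * m"
proof -
  obtain U where U: "U $ 0 $ 0 \<noteq> 0" "E z (T f) = E z U * (\<Prod>\<alpha>\<in>S. z - \<alpha>)" using E_formulas z by blast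
  have "(\<Prod>\<alpha>\<in>S. z - \<alpha>) = (\<Prod>\<alpha>\<in>S. fps_X ^ \<rho> * B \<alpha>)" using B by (intro prod.cong) auto
  also have "\<dots> = fps_X ^ (\<rho> * m) * (\<Prod>\<alpha>\<in>S. B \<alpha>)" by (simp add: prod.distrib card_S power_mult)
  finally have e: "E z (T f) = fps_X ^ (\<rho> * m) * (E z U * (\<Prod>\<alpha>\<in>S. B \<alpha>))" using U by (simp add: mult_ac)
  then show "fps_X ^ (\<rho> * m) dvd E z (T f)" by simp
  assume "\<And>\<alpha>. \<alpha> \<in> S \<Longrightarrow> B \<alpha> $ 0 \<noteq> 0"
  then have "(E z U * (\<Prod>\<alpha>\<in>S. B \<alpha>)) $ 0 \<noteq> 0"
    using U(1) ev_nth_0[OF z, of U] rhom_prod[OF rhom_nth0, of B S] finite_S by simp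
  then have "E z U * (\<Prod>\<alpha>\<in>S. B \<alpha>) \<noteq> 0" "subdegree (E z U * (\<Prod>\<alpha>\<in>S. B \<alpha>)) = 0" by (auto intro: subdegree_eq_0)
  then show "subdegree (E z (T f)) = \<rho> * m" unfolding e by (simp add: fps_X_power_subdegree)
qed

text \<open>Rescaling around z by t^\<rho>: up to a constant factor, the leading coefficient of the
  polar is the derivative of the product formed by the residues of the B \<alpha>. The term with U'
  carries an additional t^\<rho> and drops out at t = 0.\<close>

lemma E_g_scaled:
  assumes z: "z $ 0 = 0" and B: "\<And>\<alpha>. \<alpha> \<in> S \<Longrightarrow> z - \<alpha> = fps_X ^ \<rho> * B \<alpha>" and \<rho>: "\<rho> > 0"
  shows "\<exists>R u. u \<noteq> 0 \<and> E z (T g) = fps_X ^ (\<rho> * (m - 1)) * R \<and> R $ 0 = u * (\<Sum>\<alpha>\<in>S. \<Prod>\<beta>\<in>S - {\<alpha>}. B \<beta> $ 0)"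
proof -
  obtain U U' where U: "U $ 0 $ 0 \<noteq> 0"
    "E z (T g) = E z U' * (\<Prod>\<alpha>\<in>S. z - \<alpha>) + E z U * (\<Sum>\<alpha>\<in>S. \<Prod>\<beta>\<in>S - {\<alpha>}. z - \<beta>)" using E_formulas z by blast
  have 1: "(\<Prod>\<alpha>\<in>S. z - \<alpha>) = fps_X ^ (\<rho> * (m - 1)) * (fps_X ^ \<rho> * (\<Prod>\<alpha>\<in>S. B \<alpha>))"
  proof -
    have "(\<Prod>\<alpha>\<in>S. z - \<alpha>) = (\<Prod>\<alpha>\<in>S. fps_X ^ \<rho> * B \<alpha>)" using B by (intro prod.cong) auto
    also have "\<dots> = fps_X ^ (\<rho> * m) * (\<Prod>\<alpha>\<in>S. B \<alpha>)" by (simp add: prod.distrib card_S power_mult)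
    also have "\<rho> * m = \<rho> * (m - 1) + \<rho>" using mult_f by (cases m) auto
    finally show ?thesis by (simp only: power_add mult.assoc)
  qed
  have 2: "(\<Prod>\<beta>\<in>S - {\<alpha>}. z - \<beta>) = fps_X ^ (\<rho> * (m - 1)) * (\<Prod>\<beta>\<in>S - {\<alpha>}. B \<beta>)" if "\<alpha> \<in> S" for \<alpha>
  proof -
    have "(\<Prod>\<beta>\<in>S - {\<alpha>}. z - \<beta>) = (\<Prod>\<beta>\<in>S - {\<alpha>}. fps_X ^ \<rho> * B \<beta>)" using B by (intro prod.cong) auto
    then show ?thesis using that by (simp add: prod.distrib card_Diff_singleton card_S power_mult)
  qed
  define R where "R = E z U' * (fps_X ^ \<rho> * (\<Prod>\<alpha>\<in>S. B \<alpha>)) + E z U * (\<Sum>\<alpha>\<in>S. \<Prod>\<beta>\<in>S - {\<alpha>}. B \<beta>)"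
  have "E z (T g) = fps_X ^ (\<rho> * (m - 1)) * R"
    unfolding U(2) 1 R_def using 2 by (simp add: distrib_left sum_distrib_left mult.left_commute)
  moreover have "R $ 0 = U $ 0 $ 0 * (\<Sum>\<alpha>\<in>S. \<Prod>\<beta>\<in>S - {\<alpha>}. B \<beta> $ 0)"
    unfolding R_def using \<rho> ev_nth_0[OF z, of U] rhom_prod[OF rhom_nth0, of B] by (simp add: fps_sum_nth)
  ultimately show ?thesis using U(1) by blast
qed

section \<open>The minimal distance of two roots\<close>

definition "\<theta> = Min {subdegree (\<alpha> - \<beta>) | \<alpha> \<beta>. \<alpha> \<in> S \<and> \<beta> \<in> S \<and> \<alpha> \<noteq> \<beta>}"

lemma finite_diffs: "finite {subdegree (\<alpha> - \<beta>) | \<alpha> \<beta>. \<alpha> \<in> S \<and> \<beta> \<in> S \<and> \<alpha> \<noteq> \<beta>}"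
proof (rule finite_subset)
  show "{subdegree (\<alpha> - \<beta>) | \<alpha> \<beta>. \<alpha> \<in> S \<and> \<beta> \<in> S \<and> \<alpha> \<noteq> \<beta>} \<subseteq> (\<lambda>(\<alpha>, \<beta>). subdegree (\<alpha> - \<beta>)) ` (S \<times> S)" by auto
qed (use finite_S in auto)

lemma \<theta>_le: "\<alpha> \<in> S \<Longrightarrow> \<beta> \<in> S \<Longrightarrow> \<alpha> \<noteq> \<beta> \<Longrightarrow> \<theta> \<le> subdegree (\<alpha> - \<beta>)"
  unfolding \<theta>_def using finite_diffs by (intro Min_le) auto

lemma \<theta>_attained: "\<exists>\<alpha>\<in>S. \<exists>\<beta>\<in>S. \<alpha> \<noteq> \<beta> \<and> subdegree (\<alpha> - \<beta>) = \<theta>"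
proof -
  have "\<not> card S \<le> 1" using card_S mult_f by simp
  then obtain \<alpha> \<beta> where "\<alpha> \<in> S" "\<beta> \<in> S" "\<alpha> \<noteq> \<beta>" using finite_S by (metis card_le_Suc0_iff_eq One_nat_def)
  then have "{subdegree (\<alpha> - \<beta>) | \<alpha> \<beta>. \<alpha> \<in> S \<and> \<beta> \<in> S \<and> \<alpha> \<noteq> \<beta>} \<noteq> {}" by blast
  from Min_in[OF finite_diffs this] obtain \<alpha> \<beta>
    where "\<theta> = subdegree (\<alpha> - \<beta>)" "\<alpha> \<in> S" "\<beta> \<in> S" "\<alpha> \<noteq> \<beta>" unfolding \<theta>_def by blast
  then show ?thesis by metis
qed

lemma N_le_subdegree_diff: "\<alpha> \<in> S \<Longrightarrow> \<beta> \<in> S \<Longrightarrow> \<alpha> \<noteq> \<beta> \<Longrightarrow> N \<le> subdegree (\<alpha> - \<beta>)"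
proof -
  assume ab: "\<alpha> \<in> S" "\<beta> \<in> S" "\<alpha> \<noteq> \<beta>"
  then have "fps_X ^ N dvd \<alpha>" "fps_X ^ N dvd \<beta>" using transversal by (auto simp: X_power_dvd_iff S_def)
  then have "fps_X ^ N dvd \<alpha> - \<beta>" by simp
  then show ?thesis using ab(3) by (simp add: X_power_dvd_iff)
qed

lemma N_le_\<theta>: "N \<le> \<theta>" using \<theta>_attained N_le_subdegree_diff by metis

lemma \<theta>_pos: "\<theta> > 0" using N_le_\<theta> N by simp

definition "mean = fps_const (1 / of_nat m) * (\<Sum>\<alpha>\<in>S. \<alpha>)"

lemma mean_0: "mean $ 0 = 0"
  using S_zero by (simp add: mean_def fps_sum_nth)

text \<open>\<alpha> - mean is the average of the differences \<alpha> - \<beta>, each of which is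
  divisible by t^\<theta>.\<close>

lemma mean_dvd: assumes "\<alpha> \<in> S" shows "fps_X ^ \<theta> dvd \<alpha> - mean"
proof -
  have "(\<Sum>\<beta>\<in>S. \<alpha> - \<beta>) = of_nat m * \<alpha> - (\<Sum>\<beta>\<in>S. \<beta>)" by (simp add: sum_subtractf card_S)
  then have "fps_const (1 / of_nat m) * (\<Sum>\<beta>\<in>S. \<alpha> - \<beta>) = (fps_const (1 / of_nat m) * of_nat m) * \<alpha> - mean"
    by (simp only: mean_def right_diff_distrib mult.assoc)
  also have "fps_const (1 / of_nat m :: 'k) * of_nat m = 1" using mult_f by (simp flip: fps_of_nat)
  finally have e: "\<alpha> - mean = fps_const (1 / of_nat m) * (\<Sum>\<beta>\<in>S. \<alpha> - \<beta>)" by simp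
  have "fps_X ^ \<theta> dvd \<alpha> - \<beta>" if "\<beta> \<in> S" for \<beta>
    using \<theta>_le[OF assms that] by (auto simp: X_power_dvd_iff)
  then have "fps_X ^ \<theta> dvd (\<Sum>\<beta>\<in>S. \<alpha> - \<beta>)" by (rule dvd_sum)
  then show ?thesis unfolding e by (rule dvd_mult)
qed

text \<open>Seen from a point z with order \<rho> < \<theta> of z - mean, all roots of f have the
  same leading term, and the polar behaves like the derivative of an m-th power: its leading
  coefficient is a unit times m b^(m-1), so z cannot be a root of it.\<close>

lemma polar_root_dvd: assumes z: "z \<in> set vs" shows "fps_X ^ \<theta> dvd z - mean"
proof (rule ccontr)
  assume "\<not> fps_X ^ \<theta> dvd z - mean"
  then have nz: "z - mean \<noteq> 0" and lt: "subdegree (z - mean) < \<theta>" by (auto simp: X_power_dvd_iff)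
  define \<rho> where "\<rho> = subdegree (z - mean)"
  have z0: "z $ 0 = 0" by (rule vs_zero[OF z])
  have "(z - mean) $ 0 = 0" using z0 mean_0 by simp
  then have \<rho>: "\<rho> > 0" using nz by (simp add: \<rho>_def subdegree_eq_0_iff zero_less_iff_neq_zero)
  obtain b where b: "z - mean = fps_X ^ \<rho> * b" "b $ 0 \<noteq> 0"
  proof
    show "z - mean = fps_X ^ \<rho> * fps_shift \<rho> (z - mean)"
      using subdegree_decompose[of "z - mean"] by (simp add: \<rho>_def mult.commute)
    show "fps_shift \<rho> (z - mean) $ 0 \<noteq> 0" using nz nth_subdegree_nonzero[OF nz] by (simp add: \<rho>_def)
  qed
  obtain A where A: "\<And>\<alpha>. \<alpha> \<in> S \<Longrightarrow> \<alpha> - mean = fps_X ^ \<theta> * A \<alpha>"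
    using mean_dvd unfolding dvd_def by metis
  define B where "B \<alpha> = b - fps_X ^ (\<theta> - \<rho>) * A \<alpha>" for \<alpha>
  have B: "z - \<alpha> = fps_X ^ \<rho> * B \<alpha>" if "\<alpha> \<in> S" for \<alpha>
  proof -
    have "fps_X ^ \<theta> = (fps_X ^ \<rho> * fps_X ^ (\<theta> - \<rho>) :: 'k fps)" using lt by (simp add: \<rho>_def flip: power_add)
    then have "z - \<alpha> = fps_X ^ \<rho> * b - fps_X ^ \<rho> * fps_X ^ (\<theta> - \<rho>) * A \<alpha>"
      using b(1) A[OF that] by (metis diff_diff_eq2 diff_add_cancel diff_diff_add add_diff_cancel_right')
    then show ?thesis by (simp add: B_def algebra_simps)
  qed
  have B0: "B \<alpha> $ 0 = b $ 0" for \<alpha> using lt by (simp add: B_def \<rho>_def)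
  obtain R u where R: "u \<noteq> 0" "E z (T g) = fps_X ^ (\<rho> * (m - 1)) * R" "R $ 0 = u * (\<Sum>\<alpha>\<in>S. \<Prod>\<beta>\<in>S - {\<alpha>}. B \<beta> $ 0)"
    using E_g_scaled[OF z0 B \<rho>] by blast
  have "E z (T g) = 0" using splits_root_iff[OF splits_g z0] z by blast
  then have "R = 0" using R(2) by simp
  have "(\<Sum>\<alpha>\<in>S. \<Prod>\<beta>\<in>S - {\<alpha>}. B \<beta> $ 0) = (\<Sum>\<alpha>\<in>S. (b $ 0) ^ (m - 1))"
    unfolding B0 by (intro sum.cong refl) (simp add: card_Diff_singleton card_S)
  also have "\<dots> = of_nat m * (b $ 0) ^ (m - 1)" by (simp add: card_S)
  finally have "R $ 0 = u * (of_nat m * (b $ 0) ^ (m - 1))" using R(3) by simp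
  then show False using \<open>R = 0\<close> R(1) b(2) mult_f by simp
qed

lemma E_f_polar_root:
  assumes z: "z \<in> set vs" shows "E z (T f) \<noteq> 0" "m * \<theta> \<le> subdegree (E z (T f))"
proof -
  have z0: "z $ 0 = 0" by (rule vs_zero[OF z])
  show nz: "E z (T f) \<noteq> 0" using simple[OF z0] splits_root_iff[OF splits_g z0] z by blast
  have "fps_X ^ \<theta> dvd z - \<alpha>" if "\<alpha> \<in> S" for \<alpha>
    using dvd_diff[OF polar_root_dvd[OF z] mean_dvd[OF that]] by simp
  then obtain B where "\<And>\<alpha>. \<alpha> \<in> S \<Longrightarrow> z - \<alpha> = fps_X ^ \<theta> * B \<alpha>" unfolding dvd_def by metis
  from E_f_scaled(1)[OF z0 this] show "m * \<theta> \<le> subdegree (E z (T f))"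
    using nz by (simp add: X_power_dvd_iff mult.commute)
qed

text \<open>A critical point c of the polynomial of t^\<theta>-coefficients, off its zeros, has to
  be the t^\<theta>-coefficient of z - mean for some root z of the polar. Then no factor z -
  \<alpha> has order above \<theta>.\<close>

lemma E_f_polar_root_attained: "\<exists>z\<in>set vs. subdegree (E z (T f)) = m * \<theta>"
proof -
  obtain A where A: "\<And>\<alpha>. \<alpha> \<in> S \<Longrightarrow> \<alpha> - mean = fps_X ^ \<theta> * A \<alpha>"
    using mean_dvd unfolding dvd_def by metis
  obtain Z where Z: "\<And>z. z \<in> set vs \<Longrightarrow> z - mean = fps_X ^ \<theta> * Z z"
    using polar_root_dvd unfolding dvd_def by metis
  obtain \<alpha>0 \<beta>0 where ab: "\<alpha>0 \<in> S" "\<beta>0 \<in> S" "\<alpha>0 \<noteq> \<beta>0" "subdegree (\<alpha>0 - \<beta>0) = \<theta>"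
    using \<theta>_attained by blast
  have "\<alpha>0 - \<beta>0 = (\<alpha>0 - mean) - (\<beta>0 - mean)" by simp
  then have "\<alpha>0 - \<beta>0 = fps_X ^ \<theta> * (A \<alpha>0 - A \<beta>0)"
    unfolding A[OF ab(1)] A[OF ab(2)] by (simp only: right_diff_distrib)
  moreover from this have "A \<alpha>0 - A \<beta>0 \<noteq> 0" using ab(3) by auto
  ultimately have "subdegree (A \<alpha>0 - A \<beta>0) = 0" "A \<alpha>0 - A \<beta>0 \<noteq> 0" using ab(4) by (simp_all add: fps_X_power_subdegree)
  then have "A \<alpha>0 $ 0 \<noteq> A \<beta>0 $ 0" by (metis eq_iff_diff_eq_0 fps_sub_nth nth_subdegree_nonzero)
  then obtain c where c: "\<And>\<alpha>. \<alpha> \<in> S \<Longrightarrow> c \<noteq> A \<alpha> $ 0" "(\<Sum>\<alpha>\<in>S. \<Prod>\<beta>\<in>S - {\<alpha>}. c - A \<beta> $ 0) = 0"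
    using critical_point_off_roots[OF finite_S ab(1,2), of "\<lambda>\<alpha>. A \<alpha> $ 0"] by auto
  \<comment> \<open>A test point, in general not itself a root of the polar: the polar has order
    above (m - 1) \<theta> at y, so one of its m - 1 linear factors has order above \<theta> there,
    which identifies c.\<close>
  define y where "y = mean + fps_X ^ \<theta> * fps_const c"
  have y0: "y $ 0 = 0" using mean_0 \<theta>_pos by (simp add: y_def)
  have yd: "y - \<alpha> = fps_X ^ \<theta> * (fps_const c - A \<alpha>)" if "\<alpha> \<in> S" for \<alpha>
    using A[OF that] by (simp add: y_def algebra_simps)
  obtain R u where R: "u \<noteq> 0" "E y (T g) = fps_X ^ (\<theta> * (m - 1)) * R"
    "R $ 0 = u * (\<Sum>\<alpha>\<in>S. \<Prod>\<beta>\<in>S - {\<alpha>}. (fps_const c - A \<beta>) $ 0)"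
    using E_g_scaled[OF y0 yd \<theta>_pos] by blast
  have R0: "R $ 0 = 0" using R(3) c(2) by simp
  obtain V where V: "V $ 0 $ 0 \<noteq> 0" "E y (T g) = E y V * (\<Prod>z\<leftarrow>vs. y - z)" using splits_E[OF splits_g] y0 by blast
  have yz: "y - z = fps_X ^ \<theta> * (fps_const c - Z z)" if "z \<in> set vs" for z
    using Z[OF that] by (simp add: y_def algebra_simps)
  have "(\<Prod>z\<leftarrow>vs. y - z) = (\<Prod>z\<leftarrow>vs. fps_X ^ \<theta> * (fps_const c - Z z))"
    using yz by (intro arg_cong[where f = prod_list] map_cong) auto
  also have "\<dots> = fps_X ^ (\<theta> * length vs) * (\<Prod>z\<leftarrow>vs. fps_const c - Z z)"
    by (induction vs) (auto simp: power_add mult_ac)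
  also have "length vs = m - 1" using length_splits[OF splits_g] mult_g by simp
  finally have "fps_X ^ (\<theta> * (m - 1)) * R = fps_X ^ (\<theta> * (m - 1)) * (E y V * (\<Prod>z\<leftarrow>vs. fps_const c - Z z))"
    using R(2) V(2) by (simp add: mult_ac)
  then have "R = E y V * (\<Prod>z\<leftarrow>vs. fps_const c - Z z)" by simp
  then have "E y V $ 0 * (\<Prod>z\<leftarrow>vs. fps_const c - Z z) $ 0 = 0" using R0 by simp
  then have "(\<Prod>z\<leftarrow>vs. fps_const c - Z z) $ 0 = 0" using V(1) ev_nth_0[OF y0, of V] by simp
  moreover have "(\<Prod>z\<leftarrow>vs. fps_const c - Z z) $ 0 = (\<Prod>z\<leftarrow>vs. c - Z z $ 0)" by (induction vs) auto
  ultimately obtain z where z: "z \<in> set vs" "Z z $ 0 = c" by (auto simp: prod_list_zero_iff)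
  have "subdegree (E z (T f)) = \<theta> * m"
  proof (rule E_f_scaled(2)[OF vs_zero[OF z(1)], where B = "\<lambda>\<alpha>. Z z - A \<alpha>"])
    show "z - \<alpha> = fps_X ^ \<theta> * (Z z - A \<alpha>)" if "\<alpha> \<in> S" for \<alpha>
    proof -
      have "z - \<alpha> = (z - mean) - (\<alpha> - mean)" by simp
      then show ?thesis unfolding A[OF that] Z[OF z(1)] by (simp only: right_diff_distrib)
    qed
    show "(Z z - A \<alpha>) $ 0 \<noteq> 0" if "\<alpha> \<in> S" for \<alpha> using c(1)[OF that] z(2) by simp
  qed
  then show ?thesis using z(1) by (auto simp: mult.commute)
qed

text \<open>Both sides count the order of \<alpha> - z over all pairs of a root \<alpha> of f and a
  root z of the polar. At \<alpha> the polar takes the value \<open>Dif S \<alpha>\<close> up to a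
  unit.\<close>

lemma discriminant_sum: "(\<Sum>z\<leftarrow>vs. subdegree (E z (T f))) = (\<Sum>\<alpha>\<in>S. subdegree (Dif S \<alpha>))"
proof -
  obtain U U' where U: "U $ 0 $ 0 \<noteq> 0" "\<And>z. z $ 0 = 0 \<Longrightarrow> E z (T f) = E z U * (\<Prod>\<alpha>\<in>S. z - \<alpha>)"
    "\<And>z. z $ 0 = 0 \<Longrightarrow> E z (T g) = E z U' * (\<Prod>\<alpha>\<in>S. z - \<alpha>) + E z U * (\<Sum>\<alpha>\<in>S. \<Prod>\<beta>\<in>S - {\<alpha>}. z - \<beta>)"
    using E_formulas by blast
  obtain V where V: "V $ 0 $ 0 \<noteq> 0" "\<And>z. z $ 0 = 0 \<Longrightarrow> E z (T g) = E z V * (\<Prod>b\<leftarrow>vs. z - b)"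
    using splits_E[OF splits_g] by blast
  have S1: "subdegree (Dif S \<alpha>) = (\<Sum>z\<leftarrow>vs. subdegree (\<alpha> - z))" if \<alpha>: "\<alpha> \<in> S" for \<alpha>
  proof -
    note z0 = S_zero[OF \<alpha>]
    have p0: "(\<Prod>\<beta>\<in>S. \<alpha> - \<beta>) = 0" using finite_S \<alpha> by auto
    have "(\<Sum>\<gamma>\<in>S. \<Prod>\<beta>\<in>S - {\<gamma>}. \<alpha> - \<beta>) = (\<Sum>\<gamma>\<in>{\<alpha>}. \<Prod>\<beta>\<in>S - {\<gamma>}. \<alpha> - \<beta>)"
      using finite_S \<alpha> by (intro sum.mono_neutral_right) auto
    then have eg: "E \<alpha> (T g) = E \<alpha> U * Dif S \<alpha>" using U(3)[OF z0] p0 by (simp add: Dif_def)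
    have d: "Dif S \<alpha> \<noteq> 0" by (rule Dif_nonzero[OF finite_S])
    have nz: "E \<alpha> (T g) \<noteq> 0" using eg d E_unit[OF z0 U(1)] by simp
    have "\<alpha> - z \<noteq> 0" if "z \<in> set vs" for z using nz V(2)[OF z0] that by (auto simp: prod_list_zero_iff)
    then have "subdegree (\<Prod>b\<leftarrow>vs. \<alpha> - b) = (\<Sum>z\<leftarrow>vs. subdegree (\<alpha> - z))" "(\<Prod>b\<leftarrow>vs. \<alpha> - b) \<noteq> 0"
      by (auto simp: subdegree_prod_list prod_list_zero_iff)
    then have "subdegree (E \<alpha> (T g)) = (\<Sum>z\<leftarrow>vs. subdegree (\<alpha> - z))"
      using V(2)[OF z0] E_unit[OF z0 V(1)] by simp
    then show ?thesis using eg d E_unit[OF z0 U(1)] by simp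
  qed
  have S2: "subdegree (E z (T f)) = (\<Sum>\<alpha>\<in>S. subdegree (\<alpha> - z))" if z: "z \<in> set vs" for z
  proof -
    note z0 = vs_zero[OF z]
    have nz: "(\<Prod>\<alpha>\<in>S. z - \<alpha>) \<noteq> 0" using E_f_polar_root(1)[OF z] U(2)[OF z0] by auto
    have "subdegree (E z (T f)) = subdegree (\<Prod>\<alpha>\<in>S. z - \<alpha>)" using U(2)[OF z0] E_unit[OF z0 U(1)] nz by simp
    also have "\<dots> = (\<Sum>\<alpha>\<in>S. subdegree (z - \<alpha>))" using nz finite_S by (intro subdegree_prod) auto
    finally show ?thesis by (simp add: subdegree_minus_commute[of z])
  qed
  have "(\<Sum>z\<leftarrow>vs. subdegree (E z (T f))) = (\<Sum>z\<leftarrow>vs. \<Sum>\<alpha>\<in>S. subdegree (\<alpha> - z))"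
    using S2 by (intro arg_cong[where f = sum_list] map_cong) auto
  also have "\<dots> = (\<Sum>\<alpha>\<in>S. subdegree (Dif S \<alpha>))" using S1 by (simp flip: sum_sum_list_swap)
  finally show ?thesis .
qed

end

section \<open>Contact exponent and the main equivalence\<close>

context polar_pair begin

lemma stable_S: "stable S"
proof -
  have "\<sigma> \<alpha> \<in> S" if \<alpha>: "\<alpha> \<in> S" for \<alpha>
  proof -
    have z: "\<alpha> $ 0 = 0" "\<sigma> \<alpha> $ 0 = 0" using S_zero[OF \<alpha>] by auto
    have "E \<alpha> (T f) = 0" using splits_root_iff[OF splits_f z(1)] \<alpha> by (simp add: S_def)
    then have "E (\<sigma> \<alpha>) (T f) = 0" using \<sigma>_E[OF z(1), of "T f"] rhom_0[OF rhom_\<sigma>] by simp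
    then show ?thesis using splits_root_iff[OF splits_f z(2)] by (simp add: S_def)
  qed
  then show ?thesis using finite_S S_zero by (auto simp: stable_def)
qed

lemma S_nonempty: "S \<noteq> {}" using card_S mult_f by auto

lemma dvd_iff_roots: "f dvd h \<longleftrightarrow> (\<forall>\<alpha>\<in>S. E \<alpha> (T h) = 0)"
proof -
  obtain U W where UW: "U $ 0 $ 0 \<noteq> 0" "T f = U * conv W" "map_poly (xpow N) W = (\<Prod>a\<leftarrow>ws. [:- a, 1:])"
    using splits_f by (auto simp: splits_def)
  have "(\<Prod>a\<leftarrow>ws. [:- a, 1:]) = gpoly S"
    unfolding gpoly_def S_def using distinct_ws by (simp add: prod.distinct_set_conv_list)
  then have "map_poly (xpow N) W = map_poly (xpow N) (dpoly S)"
    unfolding map_xpow_dpoly[OF stable_S] UW(3) .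
  then have "xpow N (coeff W j) = xpow N (coeff (dpoly S) j)" for j
    by (metis (no_types) coeff_map_poly rhom_0[OF rhom_xpow[OF N]])
  then have "W = dpoly S" using inj_xpow[OF N, where 'a = 'k] by (intro poly_eqI) (metis injD)
  then have Tf: "T f = conv (dpoly S) * U" using UW(2) by (simp add: mult.commute)
  have "U dvd 1" using UW(1) by (simp add: fps_unit_iff)
  then show ?thesis
    unfolding T_dvd[symmetric, of f] Tf kernel_stable[OF stable_S] by (rule dvd_mult_unit)
qed

lemma N_le_Dif: assumes \<alpha>: "\<alpha> \<in> S" shows "N \<le> subdegree (Dif S \<alpha>)"
proof -
  have "S \<noteq> {\<alpha>}" using card_S mult_f by auto
  then obtain \<beta> where \<beta>: "\<beta> \<in> S" "\<beta> \<noteq> \<alpha>" using \<alpha> by blast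
  have "Dif S \<alpha> = (\<alpha> - \<beta>) * (\<Prod>\<gamma>\<in>S - {\<alpha>} - {\<beta>}. \<alpha> - \<gamma>)"
    unfolding Dif_def using finite_S \<beta> by (intro prod.remove) auto
  then have "subdegree (Dif S \<alpha>) \<ge> subdegree (\<alpha> - \<beta>)"
    using Dif_nonzero[OF finite_S, of \<alpha>] by auto
  then show ?thesis using N_le_subdegree_diff[OF \<alpha> \<beta>(1)] \<beta>(2) by simp
qed

lemma curve: "curve N \<zeta> S T f"
  by unfold_locales (use stable_S S_nonempty rhom_T bij_T T_cst dvd_iff_roots N_le_Dif in auto)

section \<open>Milnor number and contact exponent in terms of the roots\<close>

definition "D = (\<Sum>\<alpha>\<in>S. subdegree (Dif S \<alpha>))"

lemma milnor_number_eq: "milnor_number f = ereal (real D / real N - real m + 1)"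
proof -
  obtain c where c: "conductor_dim f = enat c" "N * c + N * card S = D + N * card (orb ` S)"
    using curve.conductor_dim_eq[OF curve] unfolding curve.Dtot_def[OF curve] curve.Ddeg_def[OF curve] D_def by blast
  have r: "num_branches f = card (orb ` S)" unfolding S_def by (rule num_branches_splits[OF splits_f f_nz])
  have "real N * real c + real N * real m = real D + real N * real (num_branches f)"
    using c(2) unfolding card_S r by (metis of_nat_add of_nat_mult)
  then have "real c - real (num_branches f) = real D / real N - real m"
    using N by (simp add: field_simps)
  then show ?thesis by (simp add: milnor_number_def c(1) one_ereal_def)
qed

lemma contact_value:
  assumes \<alpha>: "\<alpha> \<in> S" and u: "u dvd 1" and w: "w $ 0 $ 0 = 0" "multiplicity_of w = 1" "E \<alpha> (T w) \<noteq> 0"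
  shows "branch_contact (br \<alpha> * u) w = ereal (subdegree (E \<alpha> (T w)) / N)"
proof -
  have "multiplicity_of (br \<alpha> * u) = per \<alpha>"
    using multiplicity_br[OF splits_f f_nz _ u] \<alpha> by (simp add: S_def)
  then show ?thesis
    unfolding branch_contact_def intersection_number_commute[of "br \<alpha> * u"] w(2)
    using intersection_br[OF S_zero[OF \<alpha>] u w(1,3)] by simp
qed

text \<open>If w is a graph over x, then of two roots at distance exactly \<theta> one meets w to
  order at most \<theta>. Otherwise w is tangent to x = 0 and meets a root of f, by transversality,
  to order at most N, which is at most \<theta>.\<close>

lemma contact_upper:
  assumes w: "smooth_curve w" shows "contact f w \<le> ereal (\<theta> / N)"
proof -
  have w0: "w \<noteq> 0" "w $ 0 $ 0 = 0" "multiplicity_of w = 1"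
    using w by (auto simp: smooth_curve_def algebroid_curve_def)
  define h where "h = T w"
  have h00: "h $ 0 $ 0 = 0" using T_00 w0 by (simp add: h_def)
  have "\<not> ord_ge 2 h" unfolding h_def T_ord using ord_ge_iff_multiplicity[OF w0(1)] w0(3) by simp
  then have lin: "h $ 0 $ 1 \<noteq> 0 \<or> h $ 1 $ 0 \<noteq> 0"
  proof -
    assume "\<not> ord_ge 2 h"
    then obtain i j where ij: "i + j < 2" "h $ i $ j \<noteq> 0" by (auto simp: ord_ge_def)
    then consider "i = 0" "j = 0" | "i = 0" "j = 1" | "i = 1" "j = 0" by linarith
    then show ?thesis using ij h00 by cases auto
  qed
  obtain \<alpha>0 \<beta>0 where ab: "\<alpha>0 \<in> S" "\<beta>0 \<in> S" "\<alpha>0 \<noteq> \<beta>0" "subdegree (\<alpha>0 - \<beta>0) = \<theta>"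
    using \<theta>_attained by blast
  have "\<exists>\<alpha>\<in>S. E \<alpha> h \<noteq> 0 \<and> subdegree (E \<alpha> h) \<le> \<theta>"
  proof (cases "h $ 0 $ 1 = 0")
    case False
    then have h0: "h $ 0 \<noteq> 0" by auto
    have sd: "subdegree (h $ 0) = 1" using False h00 by (intro subdegreeI) auto
    obtain U W where UW: "U $ 0 $ 0 \<noteq> 0" "h = U * conv W" "wpoly W" "degree W = 1"
      using weierstrass_preparation[OF h0] sd by auto
    obtain b where W: "W = [:b, 1:]"
      using UW(3,4) by (metis wpoly_def degree1_coeffs lead_coeff_pCons coeff_pCons_Suc coeff_pCons_0 One_nat_def)
    have Eh: "E \<alpha> h = E \<alpha> U * (xpow N b + \<alpha>)" if "\<alpha> \<in> S" for \<alpha>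
      using S_zero[OF that] by (simp add: UW(2) rhom_mult[OF rhom_E] E_conv W map_poly_linear[OF rhom_xpow[OF N]])
    \<comment> \<open>If w met both roots to order above \<theta>, so would their
      difference.\<close>
    have "\<not> fps_X ^ Suc \<theta> dvd \<alpha>0 - \<beta>0" using ab(3,4) by (simp add: X_power_dvd_iff del: power_Suc)
    then have "\<not> (fps_X ^ Suc \<theta> dvd xpow N b + \<alpha>0 \<and> fps_X ^ Suc \<theta> dvd xpow N b + \<beta>0)"
      using dvd_diff[of "fps_X ^ Suc \<theta>" "xpow N b + \<alpha>0" "xpow N b + \<beta>0"] by (auto simp del: power_Suc)
    then obtain \<alpha> where \<alpha>: "\<alpha> \<in> S" "\<not> fps_X ^ Suc \<theta> dvd xpow N b + \<alpha>" using ab(1,2) by blast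
    then have "xpow N b + \<alpha> \<noteq> 0" "subdegree (xpow N b + \<alpha>) \<le> \<theta>"
      by (auto simp: X_power_dvd_iff simp del: power_Suc)
    then show ?thesis using Eh[OF \<alpha>(1)] E_unit[OF S_zero[OF \<alpha>(1)] UW(1)] \<alpha>(1) by (intro bexI[of _ \<alpha>]) auto
  next
    case True
    then have h10: "h $ 1 $ 0 \<noteq> 0" using lin by auto
    note z = S_zero[OF ab(1)]
    have "h = fps_const (h $ 0) + varX * fps_shift 1 h" by (auto simp: fps_eq_iff[of h])
    from arg_cong[OF this, of "E \<alpha>0"]
    have "E \<alpha>0 h = ((h $ 0) oo \<alpha>0) + fps_X ^ N * E \<alpha>0 (fps_shift 1 h)"
      unfolding rhom_add[OF rhom_E[OF z]] rhom_mult[OF rhom_E[OF z]] ev_fps_const[OF XN0 z] ev_varX[OF XN0 z] .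
    \<comment> \<open>Here \<open>h $ 0\<close> starts at y^2 and \<alpha>0 is divisible by t^N, so
      this part starts at t^(2N) and cannot cancel the term x.\<close>
    moreover have "((h $ 0) oo \<alpha>0) $ N = 0"
    proof -
      have lo: "h $ 0 $ n = 0" if "n < 2" for n using that True h00 by (auto simp: less_2_cases_iff)
      have "h $ 0 = fps_X ^ 2 * fps_shift 2 (h $ 0)"
      proof (rule fps_ext)
        fix n
        show "h $ 0 $ n = (fps_X ^ 2 * fps_shift 2 (h $ 0)) $ n"
        proof (cases "n < 2")
          case False
          then have "n - 2 + 2 = n" by simp
          then show ?thesis using False by (simp only: fps_X_power_mult_nth fps_shift_nth if_False)
        qed (simp add: lo fps_X_power_mult_nth)
      qed
      from arg_cong[OF this, of "\<lambda>b. b oo \<alpha>0"]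
      have "(h $ 0) oo \<alpha>0 = \<alpha>0 ^ 2 * (fps_shift 2 (h $ 0) oo \<alpha>0)"
        unfolding fps_compose_mult_distrib[OF z] fps_X_power_compose[OF z] .
      moreover have "fps_X ^ N dvd \<alpha>0" using transversal ab(1) by (auto simp: X_power_dvd_iff S_def)
      then have "(fps_X ^ N) ^ 2 dvd \<alpha>0 ^ 2" by (rule dvd_power_same)
      ultimately have "fps_X ^ (N * 2) dvd (h $ 0) oo \<alpha>0" by (simp add: power_mult)
      then obtain k where "(h $ 0) oo \<alpha>0 = fps_X ^ (N * 2) * k" by (auto simp: dvd_def)
      then show ?thesis using N by (simp add: fps_X_power_mult_nth)
    qed
    ultimately have "E \<alpha>0 h $ N = E \<alpha>0 (fps_shift 1 h) $ 0" by (simp add: fps_X_power_mult_nth)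
    also have "\<dots> = h $ 1 $ 0" using ev_nth_0[OF z] by simp
    finally have nz: "E \<alpha>0 h $ N \<noteq> 0" using h10 by simp
    then have "E \<alpha>0 h \<noteq> 0" "subdegree (E \<alpha>0 h) \<le> N" by (auto intro: subdegree_leI)
    then show ?thesis using N_le_\<theta> ab(1) by (meson le_trans)
  qed
  then obtain \<alpha> where \<alpha>: "\<alpha> \<in> S" "E \<alpha> h \<noteq> 0" "subdegree (E \<alpha> h) \<le> \<theta>" by blast
  have "br \<alpha> * 1 \<in> branches f" unfolding branches_splits[OF splits_f f_nz]
    using \<alpha>(1) by (intro CollectI exI[of _ \<alpha>] exI[of _ 1]) (simp add: S_def)
  moreover have "w \<in> branches w" using smooth_is_branch[OF w] by (simp add: branches_def)
  ultimately have "contact f w \<le> branch_contact (br \<alpha> * 1) w"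
    unfolding contact_def by (meson INF_lower INF_lower2 order_trans)
  also have "\<dots> = ereal (subdegree (E \<alpha> (T w)) / N)"
    by (rule contact_value[OF \<alpha>(1) one_dvd w0(2,3)]) (use \<alpha>(2) h_def in simp)
  also have "\<dots> \<le> ereal (\<theta> / N)" using \<alpha>(3) N by (simp add: h_def divide_right_mono)
  finally show ?thesis .
qed

text \<open>The curve y = mean, moved by a high power of x so that it contains no branch of f and
  all its contacts are finite. The mean is invariant under \<sigma> and so is a series in x.\<close>

lemma contact_lower: "\<exists>w. smooth_curve w \<and> ereal (\<theta> / N) \<le> contact f w"
proof -
  \<comment> \<open>Larger than \<theta>, to keep c within t^\<theta> of the roots, and larger than
    each order of \<alpha> - mean, to keep c different from every root.\<close>
  define e where "e = \<theta> + 1 + (\<Sum>\<alpha>\<in>S. subdegree (\<alpha> - mean))"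
  define c where "c = mean + fps_X ^ (N * e)"
  have "\<sigma> (\<Sum>\<alpha>\<in>S. \<alpha>) = (\<Sum>\<alpha>\<in>S. \<alpha>)"
    unfolding rhom_sum[OF rhom_\<sigma>] using sum.reindex_bij_betw[OF stable_bij[OF stable_S], of "\<lambda>x. x"] by simp
  then have "\<sigma> mean = mean" by (simp add: mean_def rhom_mult[OF rhom_\<sigma>])
  moreover have "\<sigma> (fps_X ^ (N * e)) = fps_X ^ (N * e)" by (auto simp: \<sigma>_fixed)
  ultimately have \<sigma>c: "\<sigma> c = c" by (simp add: c_def rhom_add[OF rhom_\<sigma>])
  have e0: "N * e > 0" using N by (simp add: e_def)
  have c0: "c $ 0 = 0" using mean_0 e0 by (simp add: c_def)
  obtain w where w: "T w = conv [:- unx c, 1:]" using T_surj by blast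
  have Ne: "e \<le> N * e" using N by simp
  have Ew: "E \<alpha> (T w) = \<alpha> - c" if "\<alpha> \<in> S" for \<alpha>
    using S_zero[OF that]
    by (simp add: w E_conv map_poly_linear[OF rhom_xpow[OF N]] rhom_minus[OF rhom_xpow[OF N]] xpow_unx[OF \<sigma>c])
  have val: "E \<alpha> (T w) \<noteq> 0 \<and> \<theta> \<le> subdegree (E \<alpha> (T w))" if \<alpha>: "\<alpha> \<in> S" for \<alpha>
  proof -
    have "subdegree (\<alpha> - mean) \<le> (\<Sum>\<alpha>\<in>S. subdegree (\<alpha> - mean))" using \<alpha> finite_S by (intro member_le_sum) auto
    then have "subdegree (\<alpha> - mean) < N * e" using Ne by (simp add: e_def)
    then have "\<alpha> - mean \<noteq> fps_X ^ (N * e)" using fps_X_power_subdegree by (metis less_irrefl)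
    then have nz: "\<alpha> - c \<noteq> 0" by (auto simp: c_def)
    have "\<theta> \<le> N * e" using Ne by (simp add: e_def)
    then have "fps_X ^ \<theta> dvd (fps_X ^ (N * e) :: 'k fps)" by (rule le_imp_power_dvd)
    then have "fps_X ^ \<theta> dvd (\<alpha> - mean) - fps_X ^ (N * e)" using mean_dvd[OF \<alpha>] by (rule dvd_diff[rotated])
    then have "fps_X ^ \<theta> dvd \<alpha> - c" by (simp add: c_def algebra_simps)
    then show ?thesis using nz unfolding Ew[OF \<alpha>] by (simp add: X_power_dvd_iff)
  qed
  have h: "T w $ 0 $ 0 = 0" "T w $ 0 $ 1 = 1" using c0 by (simp_all add: w unx_def)
  have w00: "w $ 0 $ 0 = 0" using h(1) by (simp only: T_00)
  have wnz: "w \<noteq> 0" using h(2) T_eq_0[of w] by auto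
  have "\<not> ord_ge 2 (T w)"
  proof
    assume "ord_ge 2 (T w)"
    then have "T w $ 0 $ 1 = 0" by (simp add: ord_ge_def)
    then show False using h(2) by simp
  qed
  then have "\<not> 2 \<le> multiplicity_of w" using ord_ge_iff_multiplicity[OF wnz] T_ord by blast
  moreover have "1 \<le> multiplicity_of w"
    using ord_ge_iff_multiplicity[OF wnz, of 1] w00 by (simp add: ord_ge_1_iff)
  ultimately have wm: "multiplicity_of w = 1" by simp
  have sm: "smooth_curve w" using wm w00 wnz by (simp add: smooth_curve_def algebroid_curve_def)
  have irr: "comm_semiring_1_class.irreducible w" using smooth_is_branch[OF sm] by (simp add: is_branch_def)
  have "ereal (\<theta> / N) \<le> branch_contact f' w'" if f': "f' \<in> branches f" and w': "w' \<in> branches w" for f' w'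
  proof -
    obtain \<alpha> u where f'u: "f' = br \<alpha> * u" "\<alpha> \<in> S" "u dvd 1"
      using f' unfolding branches_splits[OF splits_f f_nz] S_def by blast
    have b: "is_branch w'" "w' dvd w" using w' by (auto simp: branches_def)
    then obtain v where v: "w = w' * v" by (auto simp: dvd_def)
    have nu: "\<not> w' dvd 1" and w'0: "w' $ 0 $ 0 = 0" using b(1) by (auto simp: is_branch_def algebroid_curve_def fps_unit_iff)
    then have vu: "v dvd 1" using irr v Factorial_Ring.irreducibleD by blast
    have nz: "w' \<noteq> 0" "v \<noteq> 0" using wnz v by auto
    have m1: "multiplicity_of w' = 1" using multiplicity_mult[OF nz] wm v multiplicity_unit[OF vu] by simp
    note z = S_zero[OF f'u(2)]
    have "T v dvd 1" using vu by (simp add: T_unit)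
    then have "T v $ 0 $ 0 \<noteq> 0" by (simp add: fps_unit_iff)
    then have Ev: "E \<alpha> (T v) \<noteq> 0" "subdegree (E \<alpha> (T v)) = 0" using E_unit[OF z] by auto
    have "E \<alpha> (T w) = E \<alpha> (T w') * E \<alpha> (T v)" by (simp add: v T_simps rhom_mult[OF rhom_E[OF z]])
    then have Ew': "E \<alpha> (T w') \<noteq> 0" "\<theta> \<le> subdegree (E \<alpha> (T w'))" using val[OF f'u(2)] Ev by auto
    show ?thesis
      unfolding f'u(1) contact_value[OF f'u(2,3) w'0 m1 Ew'(1)] using Ew'(2) N by (simp add: divide_right_mono)
  qed
  then have "ereal (\<theta> / N) \<le> contact f w" unfolding contact_def by (intro INF_greatest)
  then show ?thesis using sm by blast
qed

lemma contact_exponent_eq: "contact_exponent f = ereal (\<theta> / N)"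
proof (rule antisym)
  show "contact_exponent f \<le> ereal (\<theta> / N)"
    unfolding contact_exponent_def by (rule SUP_least) (use contact_upper in auto)
  obtain w where w: "smooth_curve w" "ereal (\<theta> / N) \<le> contact f w" using contact_lower by blast
  then show "ereal (\<theta> / N) \<le> contact_exponent f"
    unfolding contact_exponent_def using smooth_is_branch by (intro SUP_upper2[of w]) auto
qed

section \<open>Polar quotients and the equivalence for one direction\<close>

lemma polar_quotients:
  "(\<lambda>h. ereal_of_enat (intersection_number f h) / ereal (real (multiplicity_of h))) ` branches g
    = (\<lambda>z. ereal (subdegree (E z (T f)) / N)) ` set vs"
proof -
  have f0: "f $ 0 $ 0 = 0" using multiplicity_0_iff[OF f_nz] mult_f by auto
  have val: "ereal_of_enat (intersection_number f (br z * u)) / ereal (real (multiplicity_of (br z * u))) = ereal (subdegree (E z (T f)) / N)"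
    if "z \<in> set vs" "u dvd 1" for z u
    unfolding multiplicity_br[OF splits_g g_nz that]
    by (rule intersection_br[OF vs_zero[OF that(1)] that(2) f0 E_f_polar_root(1)[OF that(1)]])
  show ?thesis
  proof (intro equalityI subsetI)
    fix q assume "q \<in> (\<lambda>h. ereal_of_enat (intersection_number f h) / ereal (real (multiplicity_of h))) ` branches g"
    then obtain z u where "z \<in> set vs" "u dvd 1"
      "q = ereal_of_enat (intersection_number f (br z * u)) / ereal (real (multiplicity_of (br z * u)))"
      unfolding branches_splits[OF splits_g g_nz] by blast
    then show "q \<in> (\<lambda>z. ereal (subdegree (E z (T f)) / N)) ` set vs" using val by blast
  next
    fix q assume "q \<in> (\<lambda>z. ereal (subdegree (E z (T f)) / N)) ` set vs"
    then obtain z where z: "z \<in> set vs" "q = ereal (subdegree (E z (T f)) / N)" by blast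
    have "br z * 1 \<in> branches g" unfolding branches_splits[OF splits_g g_nz]
      using z(1) by (intro CollectI exI[of _ z] exI[of _ 1]) simp
    moreover have "q = ereal_of_enat (intersection_number f (br z * 1)) / ereal (real (multiplicity_of (br z * 1)))"
      unfolding z(2) by (rule val[symmetric, OF z(1) one_dvd])
    ultimately show "q \<in> (\<lambda>h. ereal_of_enat (intersection_number f h) / ereal (real (multiplicity_of h))) ` branches g"
      by (rule rev_image_eqI)
  qed
qed

lemma sum_list_eq_bound:
  assumes "\<And>z. z \<in> set zs \<Longrightarrow> (k::nat) \<le> h z"
  shows "(\<Sum>z\<leftarrow>zs. h z) = length zs * k \<longleftrightarrow> (\<forall>z\<in>set zs. h z = k)"
proof -
  have "length zs * k \<le> (\<Sum>z\<leftarrow>zs. h z) \<and> ((\<Sum>z\<leftarrow>zs. h z) = length zs * k \<longleftrightarrow> (\<forall>z\<in>set zs. h z = k))"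
    using assms
  proof (induction zs)
    case (Cons a zs)
    then have "k \<le> h a" "length zs * k \<le> (\<Sum>z\<leftarrow>zs. h z)"
      "((\<Sum>z\<leftarrow>zs. h z) = length zs * k \<longleftrightarrow> (\<forall>z\<in>set zs. h z = k))" by auto
    then show ?case by auto
  qed auto
  then show ?thesis by blast
qed

theorem milnor_iff_single_polar_quotient:
  "milnor_number f = (contact_exponent f * ereal (real m) - 1) * (ereal (real m) - 1) \<longleftrightarrow>
   (\<exists>q. (\<lambda>h. ereal_of_enat (intersection_number f h) / ereal (real (multiplicity_of h))) ` branches g = {q})"
proof -
  have lvs: "length vs = m - 1" using length_splits[OF splits_g] mult_g by simp
  have "milnor_number f = (contact_exponent f * ereal (real m) - 1) * (ereal (real m) - 1) \<longleftrightarrow>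
    real D / real N - real m + 1 = (real \<theta> / real N * real m - 1) * (real m - 1)"
    by (simp add: milnor_number_eq contact_exponent_eq one_ereal_def)
  also have "\<dots> \<longleftrightarrow> real D / real N = (real \<theta> * real m * (real m - 1)) / real N"
    by (auto simp: algebra_simps add_divide_distrib diff_divide_distrib)
  also have "\<dots> \<longleftrightarrow> real D = real \<theta> * real m * (real m - 1)" using N by simp
  also have "\<dots> \<longleftrightarrow> real D = real ((m - 1) * (m * \<theta>))" using mult_f by (simp add: of_nat_diff mult_ac)
  also have "\<dots> \<longleftrightarrow> D = length vs * (m * \<theta>)" unfolding lvs by (rule of_nat_eq_iff)
  also have "\<dots> \<longleftrightarrow> (\<forall>z\<in>set vs. subdegree (E z (T f)) = m * \<theta>)"
    unfolding D_def discriminant_sum[symmetric] by (rule sum_list_eq_bound) (rule E_f_polar_root(2))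
  also have "\<dots> \<longleftrightarrow> (\<exists>q. (\<lambda>z. ereal (subdegree (E z (T f)) / N)) ` set vs = {q})"
  proof
    assume a: "\<forall>z\<in>set vs. subdegree (E z (T f)) = m * \<theta>"
    obtain z where "z \<in> set vs" using E_f_polar_root_attained by blast
    have "(\<lambda>z. ereal (subdegree (E z (T f)) / N)) ` set vs = (\<lambda>z. ereal (real (m * \<theta>) / N)) ` set vs"
      by (rule image_cong) (use a in auto)
    also have "\<dots> = {ereal (real (m * \<theta>) / N)}" by (rule image_constant[OF \<open>z \<in> set vs\<close>])
    finally show "\<exists>q. (\<lambda>z. ereal (subdegree (E z (T f)) / N)) ` set vs = {q}" by blast
  next
    assume "\<exists>q. (\<lambda>z. ereal (subdegree (E z (T f)) / N)) ` set vs = {q}"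
    then obtain q where q: "\<And>z. z \<in> set vs \<Longrightarrow> ereal (subdegree (E z (T f)) / N) = q" by blast
    \<comment> \<open>Attainment pins down the common value; the lower bound alone would allow all
      quotients to agree above it.\<close>
    obtain z0 where z0: "z0 \<in> set vs" "subdegree (E z0 (T f)) = m * \<theta>" using E_f_polar_root_attained by blast
    show "\<forall>z\<in>set vs. subdegree (E z (T f)) = m * \<theta>"
    proof
      fix z assume z: "z \<in> set vs"
      have "ereal (subdegree (E z (T f)) / N) = ereal (subdegree (E z0 (T f)) / N)" using q[OF z] q[OF z0(1)] by simp
      then have "real (subdegree (E z (T f))) = real (subdegree (E z0 (T f)))" using N by simp
      then show "subdegree (E z (T f)) = m * \<theta>" using z0(2) by (simp only: of_nat_eq_iff)
    qed
  qed
  finally show ?thesis unfolding polar_quotients .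
qed

end

section \<open>Existence of the parametrizations\<close>

text \<open>If a had order s < N, a term with j < n would have order at least N (n - j) + s j, which
  exceeds s n, so nothing could cancel a^n. The order condition on W places its Newton polygon on or
  above the line of slope -1.\<close>

lemma wpoly_root_order:
  fixes W :: "'a::field fps poly"
  assumes W: "wpoly W" "ord_ge (degree W) (conv W)" and N: "N > 0"
    and root: "poly (map_poly (xpow N) W) a = 0"
  shows "a = 0 \<or> N \<le> subdegree a"
proof (rule ccontr)
  assume "\<not> (a = 0 \<or> N \<le> subdegree a)"
  then have a: "a \<noteq> 0" "subdegree a < N" by auto
  define s n where "s = subdegree a" and "n = degree W"
  have "degree (map_poly (xpow N) W) \<le> n" using degree_map_poly_le[of "xpow N" W] by (simp add: n_def)
  then have "0 = (\<Sum>j\<le>n. xpow N (coeff W j) * a ^ j)"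
    using root by (simp add: poly_altdef_le coeff_map_poly)
  also have "\<dots> = xpow N (coeff W n) * a ^ n + (\<Sum>j<n. xpow N (coeff W j) * a ^ j)"
    by (simp add: lessThan_Suc_atMost[symmetric])
  also have "xpow N (coeff W n) = 1" using W(1) by (simp add: wpoly_def n_def)
  finally have e: "a ^ n = - (\<Sum>j<n. xpow N (coeff W j) * a ^ j)" by (simp add: eq_neg_iff_add_eq_0)
  have "fps_X ^ Suc (s * n) dvd xpow N (coeff W j) * a ^ j" if j: "j < n" for j
  proof (cases "coeff W j = 0")
    case False
    have "coeff W j $ i = 0" if "i < n - j" for i
      using W(2) that by (metis conv_nth n_def ord_ge_def less_diff_conv)
    then have "n - j \<le> subdegree (coeff W j)" using False by (intro subdegree_geI) auto
    then have "N * (n - j) \<le> subdegree (xpow N (coeff W j))" using N by (simp add: subdegree_xpow)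
    moreover have "s * (n - j) < N * (n - j)" using a(2) j by (simp add: s_def)
    moreover have "s * n = s * (n - j) + s * j" using j by (simp flip: distrib_left)
    ultimately have "Suc (s * n) \<le> subdegree (xpow N (coeff W j)) + s * j" by linarith
    moreover have "xpow N (coeff W j) \<noteq> 0"
      using False inj_xpow[OF N, where 'a = 'a] rhom_0[OF rhom_xpow[OF N, where 'a = 'a]] by (metis injD)
    ultimately show ?thesis using a by (simp add: X_power_dvd_iff s_def mult.commute del: power_Suc)
  qed simp
  then have "fps_X ^ Suc (s * n) dvd a ^ n" unfolding e dvd_minus_iff by (intro dvd_sum) simp
  then show False using a(1) by (simp add: X_power_dvd_iff s_def del: power_Suc)
qed

lemma coord_shear: "galois N \<zeta> \<Longrightarrow> coord N \<zeta> (shear a)"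
  by (intro coord.intro coord_axioms.intro) (simp_all add: rhom_shear bij_shear shear_cst ord_ge_shear_iff)

lemma map_xpow_split:
  assumes "n > 0" "map_poly (xpow k) W = (\<Prod>a\<leftarrow>as. [:- a, 1:])" "k > 0"
  shows "map_poly (xpow (n * k)) (W :: 'a::field fps poly) = (\<Prod>a\<leftarrow>map (xpow n) as. [:- a, 1:])"
proof -
  note h = rhom_xpow[OF assms(1), where 'a = 'a]
  have "map_poly (xpow (n * k)) W = map_poly (xpow n) (map_poly (xpow k) W)"
    using assms by (subst map_poly_map_poly) (auto simp: xpow_xpow o_def)
  also have "\<dots> = (\<Prod>a\<leftarrow>map (xpow n) as. [:- a, 1:])"
    unfolding assms(2)
  proof (induction as)
    case Nil
    then show ?case by (simp add: rhom_1[OF rhom_map_poly[OF h]])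
  next
    case (Cons a as)
    then show ?case
      unfolding list.map prod_list.Cons rhom_mult[OF rhom_map_poly[OF h]] map_poly_linear[OF h] rhom_minus[OF h] by simp
  qed
  finally show ?thesis .
qed

text \<open>The condition on a makes the sheared equation regular in y of order equal to its
  multiplicity. The polar inherits this with m - 1, and both sets of roots are written with one
  N.\<close>

lemma polar_pair_exists:
  fixes f :: "'k::{alg_closed_field,field_char_0} fps fps"
  assumes red: "reduced_curve f" and sing: "singular_curve f" and good: "shear a f $ 0 $ multiplicity_of f \<noteq> 0"
  shows "\<exists>N \<zeta> ws vs. polar_pair N \<zeta> (shear a) f (cst a * partial_x f + partial_y f) ws vs"
proof -
  let ?m = "multiplicity_of f" and ?g = "cst a * partial_x f + partial_y f"
  define F G where "F = shear a f" and "G = partial_y F"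
  have f: "f \<noteq> 0" "?m > 1" using sing by (auto simp: singular_curve_def algebroid_curve_def)
  have oF: "ord_ge ?m F" unfolding F_def ord_ge_shear_iff using ord_ge_iff_multiplicity[OF f(1)] by simp
  have F0: "F $ 0 \<noteq> 0" using good by (auto simp: F_def)
  have sF: "subdegree (F $ 0) = ?m"
    using good oF by (intro subdegreeI) (auto simp: F_def ord_ge_def)
  have Gn: "G $ i $ j = of_nat (Suc j) * F $ i $ Suc j" for i j by (simp add: G_def partial_y_def)
  have oG: "ord_ge (?m - 1) G" using oF by (auto simp: ord_ge_def Gn simp del: of_nat_Suc)
  \<comment> \<open>The factor m produced by differentiating y^m is nonzero in characteristic zero,
    so the polar is regular in y as well.\<close>
  have Gm: "G $ 0 $ (?m - 1) \<noteq> 0" using good f(2) by (simp add: Gn F_def del: of_nat_Suc)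
  then have G0: "G $ 0 \<noteq> 0" by auto
  have sG: "subdegree (G $ 0) = ?m - 1" using Gm oG by (intro subdegreeI) (auto simp: ord_ge_def)
  have Tg: "shear a ?g = G" by (simp add: G_def F_def partial_y_shear)
  have g: "?g \<noteq> 0" using Tg G0 rhom_0[OF rhom_shear, of a] by auto
  obtain U W where UW: "U $ 0 $ 0 \<noteq> 0" "F = U * conv W" "wpoly W" "degree W = ?m"
    using weierstrass_preparation[OF F0] sF by auto
  obtain U' V where UV: "U' $ 0 $ 0 \<noteq> 0" "G = U' * conv V" "wpoly V" "degree V = ?m - 1"
    using weierstrass_preparation[OF G0] sG by auto
  have ordW: "ord_ge k (conv Z)" if H: "ord_ge k H" "H = u * conv Z" "u $ 0 $ 0 \<noteq> 0" for k H u and Z :: "'k fps poly"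
  proof -
    obtain v where v: "1 = u * v" using H(3) fps_unit_iff[of u] by (auto simp: dvd_def)
    have "conv Z = (u * v) * conv Z" unfolding v[symmetric] by simp
    also have "\<dots> = v * H" unfolding H(2) by (simp only: mult_ac)
    finally show ?thesis using H(1) by (simp add: ord_ge_multr)
  qed
  obtain n1 as where n1: "n1 > 0" "map_poly (xpow n1) W = (\<Prod>a\<leftarrow>as. [:- a, 1:])"
    using puiseux_split[of W] UW(3) by (auto simp: wpoly_def)
  obtain n2 bs where n2: "n2 > 0" "map_poly (xpow n2) V = (\<Prod>a\<leftarrow>bs. [:- a, 1:])"
    using puiseux_split[of V] UV(3) by (auto simp: wpoly_def)
  \<comment> \<open>A common ramification exponent for the roots of both equations.\<close>
  define N where "N = n2 * n1"
  have N: "N > 0" using n1 n2 by (simp add: N_def)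
  obtain \<zeta> :: 'k where \<zeta>: "\<And>k. \<zeta> ^ k = 1 \<longleftrightarrow> N dvd k" using primitive_root_of_unity_exists[OF N] by blast
  define ws vs where "ws = map (xpow n2) as" and "vs = map (xpow n1) bs"
  have Wsplit: "map_poly (xpow N) W = (\<Prod>a\<leftarrow>ws. [:- a, 1:])"
    unfolding N_def ws_def by (rule map_xpow_split[OF n2(1) n1(2,1)])
  have Vsplit: "map_poly (xpow N) V = (\<Prod>a\<leftarrow>vs. [:- a, 1:])"
    unfolding N_def vs_def using map_xpow_split[OF n1(1) n2(2,1)] by (simp add: mult.commute)
  have rt: "poly (\<Prod>a\<leftarrow>xs. [:- a, 1:]) x = 0" if "x \<in> set xs" for x :: "'k fps" and xs
    using that by (induction xs) auto
  have wsN: "\<alpha> = 0 \<or> N \<le> subdegree \<alpha>" if "\<alpha> \<in> set ws" for \<alpha>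
    using wpoly_root_order[OF UW(3) _ N] ordW[OF oF UW(2,1)] UW(4) rt[OF that] Wsplit by simp
  have vsN: "\<alpha> = 0 \<or> N \<le> subdegree \<alpha>" if "\<alpha> \<in> set vs" for \<alpha>
    using wpoly_root_order[OF UV(3) _ N] ordW[OF oG UV(2,1)] UV(4) rt[OF that] Vsplit by simp
  have z0: "\<alpha> $ 0 = 0" if "\<alpha> = 0 \<or> N \<le> subdegree \<alpha>" for \<alpha> :: "'k fps"
    using that N by (metis fps_zero_nth nth_less_subdegree_zero order.strict_trans2)
  interpret galois N \<zeta> by (intro galois.intro N \<zeta>)
  interpret coord N \<zeta> "shear a" by (rule coord_shear[OF galois_axioms])
  have mg: "multiplicity_of ?g = ?m - 1"
  proof -
    have Gnz: "G \<noteq> 0" using G0 by auto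
    have "?m - 1 \<le> multiplicity_of G" using oG ord_ge_iff_multiplicity[OF Gnz] by simp
    moreover have "multiplicity_of G \<le> ?m - 1" using multiplicity_le_subdegree[OF G0] sG by simp
    ultimately show ?thesis using multiplicity_T[OF g] Tg by simp
  qed
  \<comment> \<open>At a common root z write f = br z * k. The polar at z is the y-derivative of the
    branch, which is \<open>Dif (orb z) z\<close> and nonzero, times k at z. So k vanishes at z and
    the square of \<open>br z\<close> divides f.\<close>
  have simple: "E z (shear a ?g) \<noteq> 0" if z: "z $ 0 = 0" and 0: "E z (shear a f) = 0" for z
  proof
    assume Eg: "E z (shear a ?g) = 0"
    have "br z dvd f" using br_dvd[OF z] 0 by simp
    then obtain k where k: "f = br z * k" by (auto simp: dvd_def)
    let ?P = "dpoly (orb z)"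
    note st = stable_orb[OF z]
    have F: "F = conv ?P * shear a k" by (simp add: F_def k T_simps T_br)
    have P0: "E z (conv ?P) = 0" by (rule bspec[OF iffD2[OF kernel_stable[OF st] dvd_refl] orb_self])
    have dP: "E z (conv (pderiv ?P)) = Dif (orb z) z"
    proof -
      have "E z (conv (pderiv ?P)) = poly (pderiv (gpoly (orb z))) z"
        by (simp add: E_conv[OF z] map_poly_pderiv[OF rhom_xpow[OF N]] map_xpow_dpoly[OF st])
      also have "\<dots> = (\<Sum>\<alpha>\<in>orb z. \<Prod>\<beta>\<in>orb z - {\<alpha>}. z - \<beta>)"
        by (simp add: gpoly_def pderiv_prod poly_sum poly_prod pderiv_pCons)
      also have "\<dots> = (\<Sum>\<alpha>\<in>{z}. \<Prod>\<beta>\<in>orb z - {\<alpha>}. z - \<beta>)"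
        using finite_orb orb_self by (intro sum.mono_neutral_right) auto
      finally show ?thesis by (simp add: Dif_def)
    qed
    have "E z G = Dif (orb z) z * E z (shear a k)"
      unfolding G_def F partial_y_simps conv_pderiv rhom_add[OF rhom_E[OF z]] rhom_mult[OF rhom_E[OF z]] P0 dP by simp
    then have "E z (shear a k) = 0" using Eg Tg Dif_nonzero[OF finite_orb] by simp
    then have "br z dvd k" using br_dvd[OF z] by simp
    then have "br z ^ 2 dvd f" unfolding k power2_eq_square by (rule mult_dvd_mono[OF dvd_refl])
    then have "br z dvd 1" using red by (auto simp: reduced_curve_def squarefree_def)
    then show False using br_0(2)[OF z] by (simp add: fps_unit_iff)
  qed
  have ws0: "\<forall>\<alpha>\<in>set ws. \<alpha> $ 0 = 0" by (intro ballI z0 wsN)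
  have vs0: "\<forall>\<alpha>\<in>set vs. \<alpha> $ 0 = 0" by (intro ballI z0 vsN)
  have "polar_pair N \<zeta> (shear a) f ?g ws vs"
  proof (unfold_locales)
    show "splits f ws" unfolding splits_def
      by (rule exI[of _ U], rule exI[of _ W]) (intro conjI UW(1,3,4) UW(2)[unfolded F_def] Wsplit ws0)
    show "splits ?g vs" unfolding splits_def mg Tg
      by (rule exI[of _ U'], rule exI[of _ V]) (intro conjI UV Vsplit vs0)
    show "shear a ?g = partial_y (shear a f)" using Tg by (simp add: G_def F_def)
  qed (use f g mg simple wsN in auto)
  then show ?thesis by blast
qed

section \<open>Generic directions\<close>

text \<open>The bad a are the zeros of the leading form of f at (a, 1), a nonzero polynomial in
  a.\<close>

lemma finite_bad_directions:
  fixes f :: "'k::{alg_closed_field,field_char_0} fps fps"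
  assumes "f \<noteq> 0" shows "finite {a. shear a f $ 0 $ multiplicity_of f = 0}"
proof -
  let ?m = "multiplicity_of f"
  define p where "p = (\<Sum>k\<le>?m. monom (f $ k $ (?m - k)) k)"
  obtain i j where ij: "i + j = ?m" "f $ i $ j \<noteq> 0" using multiplicity_witness[OF assms] by blast
  have "coeff p i = f $ i $ (?m - i)" using ij by (simp add: p_def coeff_sum)
  then have "coeff p i \<noteq> 0" using ij by (metis add_diff_cancel_left')
  then have "p \<noteq> 0" by auto
  moreover have "shear a f $ 0 $ ?m = poly p a" for a
    by (simp add: shear_nth_0 p_def poly_sum poly_monom mult.commute)
  ultimately show ?thesis using poly_roots_finite[of p] by simp
qed

lemma polar_invariants_scale:
  fixes f :: "'k::Fields.field fps fps"
  assumes "b \<noteq> 0"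
  shows "polar_invariants f a b = (\<lambda>h. ereal_of_enat (intersection_number f h) / ereal (real (multiplicity_of h)))
     ` branches (cst (a / b) * partial_x f + partial_y f)"
proof -
  let ?p = "cst (a / b) * partial_x f + partial_y f"
  have e: "polar f a b = cst b * ?p"
    using assms by (simp add: polar_def distrib_left mult.assoc[symmetric])
  have "?p = cst (1 / b) * polar f a b"
    unfolding e using assms by (simp add: mult.assoc[symmetric])
  then have "h dvd polar f a b \<longleftrightarrow> h dvd ?p" for h
    using e by (metis dvd_mult)
  then show ?thesis by (simp add: polar_invariants_def branches_def)
qed

theorem milnor_iff_eggers_direction:
  fixes f :: "'k::{alg_closed_field,field_char_0} fps fps"
  assumes "reduced_curve f" "singular_curve f" "shear a f $ 0 $ multiplicity_of f \<noteq> 0"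
  shows "milnor_number f = (contact_exponent f * ereal (real (multiplicity_of f)) - 1) *
           (ereal (real (multiplicity_of f)) - 1)
         \<longleftrightarrow> (\<exists>q. polar_invariants f a 1 = {q})"
proof -
  obtain N \<zeta> ws vs where "polar_pair N \<zeta> (shear a) f (cst a * partial_x f + partial_y f) ws vs"
    using polar_pair_exists[OF assms] by blast
  from polar_pair.milnor_iff_single_polar_quotient[OF this] show ?thesis
    using polar_invariants_scale[of 1 f a] by simp
qed

theorem proposition6p2:
  fixes f :: "'k::{alg_closed_field, field_char_0} fps fps"
  assumes "reduced_curve f" and "singular_curve f"
  shows "milnor_number f =
           (contact_exponent f * ereal (real (multiplicity_of f)) - 1) *
           (ereal (real (multiplicity_of f)) - 1)
         \<longleftrightarrow> eggers_singularity f"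
proof -
  let ?M = "milnor_number f = (contact_exponent f * ereal (real (multiplicity_of f)) - 1) *
           (ereal (real (multiplicity_of f)) - 1)"
  let ?bad = "{a. shear a f $ 0 $ multiplicity_of f = 0}"
  let ?line = "\<lambda>a b. range (\<lambda>t. (t * a, t * b)) :: ('k \<times> 'k) set"
  let ?L = "{?line a b | a b. (a, b) \<noteq> (0, 0) \<and> \<not> (\<exists>q. polar_invariants f a b = {q})}"
  have fin: "finite ?bad" using assms(2) by (intro finite_bad_directions) (auto simp: singular_curve_def algebroid_curve_def)
  have core: "?M \<longleftrightarrow> (\<exists>q. polar_invariants f a 1 = {q})" if "a \<notin> ?bad" for a
    using milnor_iff_eggers_direction[OF assms] that by blast
  show ?thesis
  proof
    assume M: ?M
    \<comment> \<open>The direction (1 : 0) is out of reach of the shears and is put among the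
      exceptions; the others come from tangents.\<close>
    have "?L \<subseteq> insert (?line 1 0) ((\<lambda>a. ?line a 1) ` ?bad)"
    proof
      fix l assume "l \<in> ?L"
      then obtain a b where l: "l = ?line a b" "(a, b) \<noteq> (0, 0)" "\<not> (\<exists>q. polar_invariants f a b = {q})" by blast
      have scale: "?line (c * a') (c * b') = ?line a' b'" if "c \<noteq> 0" for a' b' c
      proof (intro equalityI subsetI)
        fix x assume "x \<in> ?line (c * a') (c * b')"
        then obtain t where "x = (t * (c * a'), t * (c * b'))" by blast
        then show "x \<in> ?line a' b'" by (intro image_eqI[of _ _ "t * c"]) (auto simp: mult.assoc)
      next
        fix x assume "x \<in> ?line a' b'"
        then obtain t where "x = (t * a', t * b')" by blast
        then show "x \<in> ?line (c * a') (c * b')" using that by (intro image_eqI[of _ _ "t / c"]) auto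
      qed
      show "l \<in> insert (?line 1 0) ((\<lambda>a. ?line a 1) ` ?bad)"
      proof (cases "b = 0")
        case True
        then show ?thesis using l scale[of a 1 0] by simp
      next
        case False
        have "polar_invariants f a b = polar_invariants f (a / b) 1"
          using polar_invariants_scale[OF False, of f a] polar_invariants_scale[of 1 f "a / b"] by simp
        then have "a / b \<in> ?bad" using core[of "a / b"] M l(3) by auto
        moreover have "l = ?line (a / b) 1" using l(1) scale[OF False, of "a / b" 1] False by simp
        ultimately show ?thesis by blast
      qed
    qed
    then have "finite ?L" by (rule finite_subset) (use fin in simp)
    then show "eggers_singularity f" by (simp add: eggers_singularity_def generically_def)
  next
    assume "eggers_singularity f"
    then have finL: "finite ?L" by (simp add: eggers_singularity_def generically_def)
    have inj: "inj (\<lambda>a. ?line a 1)"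
    proof (rule injI)
      fix a a' assume "?line a 1 = ?line a' 1"
      moreover have "(1 * a, 1 * 1) \<in> ?line a 1" by blast
      ultimately show "a = a'" by auto
    qed
    \<comment> \<open>Only finitely many a fail to have a single polar quotient and finitely many
      are tangent, so the infinite field contains an a avoiding both.\<close>
    have "finite {a. ?line a 1 \<in> ?L}" using finite_vimageI[OF finL inj] by (simp add: vimage_def)
    then have "finite ({a. ?line a 1 \<in> ?L} \<union> ?bad)" using fin by simp
    then obtain a where a: "a \<notin> {a. ?line a 1 \<in> ?L} \<union> ?bad"
      using ex_new_if_finite[OF infinite_UNIV_char_0] by blast
    have "\<exists>q. polar_invariants f a 1 = {q}"
    proof (rule ccontr)
      assume "\<not> (\<exists>q. polar_invariants f a 1 = {q})"
      then have "?line a 1 \<in> ?L" by (intro CollectI exI[of _ a] exI[of _ 1]) auto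
      then show False using a by blast
    qed
    then show ?M using core a by blast
  qed
qed

end
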